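(* Let $q\ge 3$ be an integer. There is a constant $\mathbf{C}_q>0$ depending only on $q$ such that for all real $t\ge 10$, $$ \left|\mathcal{E}_q(t)\right| \le \mathbf{C}_q \begin{cases} t^{2q-2+\frac{994}{753}}, & q\ge 4,\\[1mm] t^{\frac{16}{3}}\log t, & q=3,\end{cases} $$ where $\mathcal{E}_q(t)=\#\left(\mathbb{Z}^{2q+1}\cap \mathcal{B}_t\right)-\operatorname{vol}(\mathcal{B}_1)\,t^{2q+2}$ is the error term of lattice point counting for the Cygan--Korányi ball $\mathcal{B}_t$ of radius $t$ in the Heisenberg group $\mathbb{H}^q$.
   Context: The Heisenberg group $\mathbb{H}^q$ is identified as a set with $\mathbb{R}^{2q}\times\mathbb{R}$, and its Haar measure $\operatorname{vol}$ is Lebesgue measure on $\mathbb{R}^{2q+1}$. Write points as $(v,w)$ with $v\in\mathbb{R}^{2q}$, $w\in\mathbb{R}$, and let $|v|$ be the Euclidean norm. The Cygan--Korányi norm is $\mathcal{N}(v,w)=(|v|^4+w^2)^{1/4}$. The anisotropic dilations are $\delta_r(v,w)=(rv,r^2w)$ for $r>0$. For $t>0$ the Cygan--Korányi ball is $$\mathcal{B}_t=\delta_t\mathcal{B}_1=\{(v,w)\in\mathbb{R}^{2q}\times\mathbb{R}:\ (|v|^4+w^2)^{1/4}\le t\}.$$ *)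

theory Defs
  imports "HOL-Analysis.Analysis"
begin

text \<open>
  The dimension \<open>2 q + 1\<close> depends on the variable \<open>q\<close>, so a point of the Heisenberg group is a
  pair \<open>(v, w)\<close> in which \<open>v\<close> is an extensional function on the index set \<open>{..<2 * q}\<close>:
  the value \<open>undefined\<close> outside the index set gives each point of \<open>\<real>\<^sup>2\<^sup>q \<times> \<real>\<close>
  exactly one representative, as needed for counting.
\<close>

definition heis_space :: "nat \<Rightarrow> ((nat \<Rightarrow> real) \<times> real) set" where
  "heis_space q = ({..<2 * q} \<rightarrow>\<^sub>E UNIV) \<times> UNIV"

definition heis_vol :: "nat \<Rightarrow> ((nat \<Rightarrow> real) \<times> real) measure" where
  "heis_vol q = (\<Pi>\<^sub>M i\<in>{..<2 * q}. lborel) \<Otimes>\<^sub>M lborel"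

definition heis_lattice :: "nat \<Rightarrow> ((nat \<Rightarrow> real) \<times> real) set" where
  "heis_lattice q = ({..<2 * q} \<rightarrow>\<^sub>E \<int>) \<times> \<int>"

definition ck_norm :: "nat \<Rightarrow> (nat \<Rightarrow> real) \<times> real \<Rightarrow> real" where
  "ck_norm q = (\<lambda>(v, w). ((L2_set v {..<2 * q}) ^ 4 + w\<^sup>2) powr (1 / 4))"

definition heis_dilation :: "nat \<Rightarrow> real \<Rightarrow> (nat \<Rightarrow> real) \<times> real \<Rightarrow> (nat \<Rightarrow> real) \<times> real" where
  "heis_dilation q r = (\<lambda>(v, w). (\<lambda>i\<in>{..<2 * q}. r * v i, r\<^sup>2 * w))"

definition ck_ball :: "nat \<Rightarrow> real \<Rightarrow> ((nat \<Rightarrow> real) \<times> real) set" where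
  "ck_ball q t = {p \<in> heis_space q. ck_norm q p \<le> t}"

definition ck_error :: "nat \<Rightarrow> real \<Rightarrow> real" where
  "ck_error q t =
     real (card (heis_lattice q \<inter> ck_ball q t))
       - measure (heis_vol q) (ck_ball q 1) * t ^ (2 * q + 2)"

lemma space_heis_vol: "space (heis_vol q) = heis_space q"
  by (simp add: heis_vol_def heis_space_def space_pair_measure space_PiM)

lemma ck_norm_dilation:
  assumes "0 < r"
  shows "ck_norm q (heis_dilation q r p) = r * ck_norm q p"
proof -
  obtain v w where p: "p = (v, w)" by force
  have "L2_set (\<lambda>i\<in>{..<2 * q}. r * v i) {..<2 * q} = L2_set (\<lambda>i. r * v i) {..<2 * q}"
    by (rule L2_set_cong) auto
  also have "\<dots> = r * L2_set v {..<2 * q}"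
    using assms by (simp add: L2_set_right_distrib)
  finally have "ck_norm q (heis_dilation q r p)
      = (r ^ 4 * ((L2_set v {..<2 * q}) ^ 4 + w\<^sup>2)) powr (1 / 4)"
    by (simp add: p ck_norm_def heis_dilation_def algebra_simps)
  also have "\<dots> = (r ^ 4) powr (1 / 4) * ck_norm q p"
    using assms by (simp add: p ck_norm_def powr_mult)
  also have "(r ^ 4) powr (1 / 4) = r"
    using assms by (simp add: powr_powr flip: powr_numeral)
  finally show ?thesis .
qed

lemma ck_ball_dilation:
  assumes "0 < t"
  shows "ck_ball q t = heis_dilation q t ` ck_ball q 1"
proof (intro equalityI subsetI)
  fix p assume p: "p \<in> ck_ball q t"
  have eq: "heis_dilation q t (heis_dilation q (1 / t) p) = p"
    using p assms
    by (auto simp: ck_ball_def heis_space_def heis_dilation_def PiE_def extensional_def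
        restrict_def fun_eq_iff field_simps)
  have "ck_norm q (heis_dilation q (1 / t) p) \<le> 1"
    using p assms by (simp add: ck_norm_dilation ck_ball_def)
  moreover have "heis_dilation q (1 / t) p \<in> heis_space q"
    by (auto simp: heis_space_def heis_dilation_def split: prod.splits)
  ultimately show "p \<in> heis_dilation q t ` ck_ball q 1"
    using eq by (auto simp: ck_ball_def intro!: rev_image_eqI[of "heis_dilation q (1 / t) p"])
next
  fix p assume "p \<in> heis_dilation q t ` ck_ball q 1"
  then obtain p' where p': "p = heis_dilation q t p'" "p' \<in> ck_ball q 1" by auto
  moreover have "p \<in> heis_space q"
    by (auto simp: p' heis_space_def heis_dilation_def split: prod.splits)
  ultimately show "p \<in> ck_ball q t"
    using assms by (simp add: ck_ball_def ck_norm_dilation)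
qed

end

theory Submission
  imports Defs
begin

text \<open>
  Put \<open>T = t^2\<close> and let \<open>r n m\<close> be the number of representations of \<open>m\<close> as a sum of \<open>n\<close> squares.
  Slicing the ball by the value \<open>m\<close> of \<open>|v|^2\<close> turns the count into the sum over \<open>m \<le> T\<close> of
  \<open>r (2 q) m * (2 \<lfloor>G m\<rfloor> + 1)\<close>, where \<open>G m = sqrt (T^2 - m^2)\<close>.

  The smooth part is read off from the Riesz means of \<open>r (2 q)\<close>. For six squares these come from the divisor
  formula for \<open>r 6\<close>, which Liouville's elementary method provides; each further square is
  added with the corrected trapezoidal rule. Tiling by small boxes shows that the leading constant is the volume.

  For the fractional part, \<open>r (2 q)\<close> is the convolution of \<open>r 6\<close> and \<open>r (2 q - 6)\<close>, so the divisor formula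
  and partial summation leave sawtooth sums of \<open>G\<close> along arithmetic progressions. Their Fourier series
  produce exponential sums along a circular arc. Poisson summation and stationary phase
  replace each of them by a shorter dual sum, and the derivative tests of order five and six for the dual sums
  give the exponent \<open>497/753\<close>.
\<close>

section \<open>Exponential sums and derivative tests\<close>

text \<open>Two demands shape the proof. The divisor formula for \<open>r 6\<close> produces
  progressions of every step \<open>e\<close> and, after convolution with the remaining squares,
  every shift \<open>s\<close>, so the arc estimate must be uniform in both. It loses only
  \<open>e powr (1/20)\<close>, while the weight \<open>d^2\<close> under
  \<open>d * e \<le> N\<close> contributes \<open>(N / e)^2\<close>, so the sum over
  \<open>e\<close> converges; six squares provide this margin. The phase of the dual sum is the
  hyperbola \<open>sqrt (1 + x^2)\<close>, whose fifth derivative vanishes at \<open>0\<close> and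
  at \<open>sqrt 3 / 2\<close>. Near these zeros the test of order six takes over, and its secondary
  term fixes the final exponent. The smooth part cannot come from the sharp count of
  \<open>r (2 * q)\<close>: its error, of relative order \<open>1 / T\<close>, integrated against
  the derivative of \<open>G\<close> would exceed the target. The Riesz mean keeps the absolute
  error up to a small power but is integrated against the second derivative of \<open>G\<close>,
  which costs only \<open>sqrt T\<close> once the last unit below \<open>T\<close> is cut
  off.\<close>

definition ee :: "real \<Rightarrow> complex" where "ee x = cis (2 * pi * x)"

lemma norm_ee [simp]: "norm (ee x) = 1" by (simp add: ee_def)
lemma ee_add: "ee (x + y) = ee x * ee y" by (simp add: ee_def cis_mult distrib_left)
lemma ee_minus: "ee (- x) = cnj (ee x)" by (simp add: ee_def cis_cnj)
lemma ee_diff: "ee (x - y) = ee x * cnj (ee y)" using ee_add[of x "- y"] by (simp add: ee_minus)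
lemma ee_of_int [simp]: "ee (of_int n) = 1"
  unfolding ee_def by (metis cis_multiple_2pi Ints_of_int)

text \<open>The Kusmin--Landau inequality. Its proof writes \<open>ee (a n)\<close> as
  \<open>(ee (a (n + 1)) - ee (a n)) * c n\<close> with \<open>c n = - 1/2 - (\<i>/2) cot (\<pi> d n)\<close>, and the
  total variation of \<open>c\<close> telescopes.\<close>

lemma inverse_ee_minus_one:
  assumes "sin (pi * d) \<noteq> 0"
  shows "1 / (ee d - 1) = - (1 / 2) - (\<i> / 2) * of_real (cot (pi * d))" (is "_ = ?c")
proof -
  have a: "ee d = cis (pi*d) * cis (pi*d)" by (simp add: ee_def cis_mult mult.assoc)
  have b: "cis (pi*d) * cis (-(pi*d)) = 1" by (simp add: cis_mult)
  have c: "cis (pi*d) - cis (-(pi*d)) = 2*\<i> * of_real (sin (pi*d))"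
    by (simp add: complex_eq_iff)
  have e1: "ee d - 1 = cis (pi*d) * (2*\<i> * of_real (sin (pi*d)))"
    unfolding c[symmetric] using a b by (simp add: algebra_simps)
  have e2: "?c = cis (-(pi*d)) * (-\<i>/2) / of_real (sin (pi*d))"
    using assms by (simp add: complex_eq_iff cot_def Re_divide_of_real Im_divide_of_real)
  have p: "cis (pi*d) \<noteq> 0" "cis (-(pi*d)) = 1 / cis (pi*d)"
    using b by (auto simp: field_simps)
  show ?thesis unfolding e1 e2 p(2) using p(1) assms by (simp add: field_simps)
qed

lemma cot_decreasing:
  assumes "0 < x" "x \<le> y" "y < pi" shows "cot y \<le> cot x"
proof -
  have "0 \<le> sin (y - x)" by (rule sin_ge_zero) (use assms in auto)
  hence "0 \<le> sin y * cos x - cos y * sin x" by (simp add: sin_diff)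
  moreover have "sin x > 0" "sin y > 0" using assms by (auto intro: sin_gt_zero)
  ultimately show ?thesis by (simp add: cot_def field_simps)
qed

lemma sin_ge_concave:
  assumes "0 \<le> d" "d \<le> 1/2" shows "sin (pi * d) \<ge> 2 * d"
proof -
  have c: "concave_on {0..pi/2} sin"
  proof (rule f''_le0_imp_concave)
    show "convex {0..pi/2}" by simp
    show "DERIV sin x :> cos x" for x :: real by (rule DERIV_sin)
    show "DERIV cos x :> - sin x" for x :: real by (rule DERIV_cos)
    show "- sin x \<le> 0" if "x \<in> {0..pi/2}" for x :: real using that by (auto intro!: sin_ge_zero)
  qed
  have "(1 - 2*d) * sin 0 + (2*d) * sin (pi/2) \<le> sin ((1 - 2*d) *\<^sub>R 0 + (2*d) *\<^sub>R (pi/2))"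
    using c assms by (intro concave_onD) auto
  thus ?thesis by (simp add: mult_ac)
qed

lemma sin_ge_dist:
  assumes "0 < r" "r \<le> d" "d \<le> 1 - r" shows "sin (pi * d) \<ge> 2 * r"
proof (cases "d \<le> 1/2")
  case True thus ?thesis using sin_ge_concave[of d] assms by linarith
next
  case False
  have "2 * r \<le> 2 * (1 - d)" using assms by simp
  also have "\<dots> \<le> sin (pi * (1 - d))" using assms False by (intro sin_ge_concave) auto
  also have "\<dots> = sin (pi * d)" by (simp add: right_diff_distrib)
  finally show ?thesis .
qed

lemma sum_by_parts_lessThan:
  fixes E c :: "nat \<Rightarrow> complex"
  shows "(\<Sum>n<Suc M. (E (Suc n) - E n) * c n)
    = E (Suc M) * c M - E 0 * c 0 - (\<Sum>n<M. E (Suc n) * (c (Suc n) - c n))"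
  by (induction M) (simp_all add: algebra_simps)

lemma kusmin_landau:
  fixes a :: "nat \<Rightarrow> real" and m :: int and r :: real
  assumes r: "0 < r" "r \<le> 1/2"
    and lo: "\<And>n. Suc n < N \<Longrightarrow> m + r \<le> a (Suc n) - a n"
    and up: "\<And>n. Suc n < N \<Longrightarrow> a (Suc n) - a n \<le> m + 1 - r"
    and mono: "\<And>n. Suc (Suc n) < N \<Longrightarrow> a (Suc n) - a n \<le> a (Suc (Suc n)) - a (Suc n)"
  shows "norm (\<Sum>n<N. ee (a n)) \<le> 2 / r"
proof -
  have one: "1 \<le> 1 / r" using r by simp
  consider "N = 0" | "N = 1" | M where "N = Suc (Suc M)" by (metis One_nat_def not0_implies_Suc)
  thus ?thesis
  proof cases
    case 1 thus ?thesis using r by simp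
  next
    case 2 thus ?thesis using one r by (simp add: field_simps)
  next
    case 3
    define d where "d n = a (Suc n) - a n - m" for n
    define c where "c n = 1 / (ee (d n) - 1)" for n
    have dr: "r \<le> d n" "d n \<le> 1 - r" if "n < Suc M" for n
      using lo[of n] up[of n] that 3 by (auto simp: d_def)
    have s: "sin (pi * d n) \<ge> 2 * r" if "n < Suc M" for n
      using sin_ge_dist[OF r(1) dr(1) dr(2)] that by blast
    have half_diff_le: "x \<le> b \<Longrightarrow> - y \<le> b \<Longrightarrow> (x - y) / 2 \<le> b" for x y b :: real by simp
    have ced: "c n = - (1 / 2) - (\<i> / 2) * of_real (cot (pi * d n))" if "n < Suc M" for n
      unfolding c_def by (rule inverse_ee_minus_one) (use s[OF that] r in auto)
    have cotb: "\<bar>cot (pi * d n)\<bar> \<le> 1 / (2 * r)" if "n < Suc M" for n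
    proof -
      have "\<bar>cot (pi * d n)\<bar> = \<bar>cos (pi * d n)\<bar> / sin (pi * d n)"
        using s[OF that] r by (simp add: cot_def)
      also have "\<dots> \<le> 1 / (2 * r)" using s[OF that] r by (intro frac_le) auto
      finally show ?thesis .
    qed
    have nc: "norm (c n) \<le> 1 / (2 * r)" if "n < Suc M" for n
    proof -
      have "norm (c n) \<le> norm (- (1 / 2) :: complex) + norm ((\<i> / 2) * of_real (cot (pi * d n)))"
        unfolding ced[OF that] by (rule norm_triangle_ineq4)
      also have "\<dots> = 1/2 + \<bar>cot (pi * d n)\<bar> / 2" by (simp add: norm_mult)
      also have "\<dots> \<le> 1/2 + (1 / (2 * r)) / 2" using cotb[OF that] by simp
      also have "\<dots> \<le> 1 / (2 * r)" using r by (simp add: field_simps)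
      finally show ?thesis .
    qed
    have cdiff: "norm (c (Suc n) - c n) = (cot (pi * d n) - cot (pi * d (Suc n))) / 2" if "n < M" for n
    proof -
      have "cot (pi * d (Suc n)) \<le> cot (pi * d n)"
      proof (rule cot_decreasing)
        show "0 < pi * d n" using dr[of n] that r by simp
        show "pi * d n \<le> pi * d (Suc n)" using mono[of n] that 3 by (simp add: d_def)
        show "pi * d (Suc n) < pi" using dr[of "Suc n"] that r by simp
      qed
      moreover have "c (Suc n) - c n = (\<i> / 2) * of_real (cot (pi * d n) - cot (pi * d (Suc n)))"
        using that by (simp add: ced right_diff_distrib)
      ultimately show ?thesis by (simp only: norm_mult norm_of_real) (simp)
    qed
    have eq: "ee (a n) = (ee (a (Suc n)) - ee (a n)) * c n" if "n < Suc M" for n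
    proof -
      have "ee (d n) \<noteq> 1"
      proof
        assume "ee (d n) = 1"
        hence "1 / (ee (d n) - 1) = 0" by simp
        thus False using ced[OF that] by (simp add: c_def complex_eq_iff)
      qed
      moreover have "ee (a (Suc n)) = ee (a n) * ee (d n)"
      proof -
        have "a (Suc n) = a n + (d n + of_int m)" by (simp add: d_def)
        thus ?thesis by (simp only: ee_add ee_of_int mult_1_right)
      qed
      ultimately show ?thesis by (simp add: c_def field_simps)
    qed
    have "(\<Sum>n<Suc M. ee (a n)) = (\<Sum>n<Suc M. (ee (a (Suc n)) - ee (a n)) * c n)"
      using eq by (intro sum.cong) auto
    also have "\<dots> = ee (a (Suc M)) * c M - ee (a 0) * c 0 - (\<Sum>n<M. ee (a (Suc n)) * (c (Suc n) - c n))"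
      by (rule sum_by_parts_lessThan)
    also have "norm \<dots> \<le> norm (c M) + norm (c 0) + (\<Sum>n<M. norm (c (Suc n) - c n))"
    proof -
      have "norm (\<Sum>n<M. ee (a (Suc n)) * (c (Suc n) - c n)) \<le> (\<Sum>n<M. norm (c (Suc n) - c n))"
        by (rule order.trans[OF norm_sum]) (simp add: norm_mult)
      moreover have "norm (ee (a (Suc M)) * c M - ee (a 0) * c 0) \<le> norm (c M) + norm (c 0)"
        by (rule order.trans[OF norm_triangle_ineq4]) (simp add: norm_mult)
      ultimately show ?thesis by (smt (verit) norm_triangle_ineq4)
    qed
    also have "(\<Sum>n<M. norm (c (Suc n) - c n)) = (\<Sum>n<M. (cot (pi * d n) - cot (pi * d (Suc n))) / 2)"
      by (intro sum.cong) (auto simp: cdiff)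
    also have "\<dots> = (cot (pi * d 0) - cot (pi * d M)) / 2"
      using sum_lessThan_telescope'[of "\<lambda>n. cot (pi * d n)" M]
      by (simp add: sum_divide_distrib[symmetric])
    also have "\<dots> \<le> 1 / (2 * r)"     by (rule half_diff_le[OF cotb[OF zero_less_Suc, THEN abs_le_D1] cotb[OF lessI, THEN abs_le_D2]])
    finally have "norm (\<Sum>n<Suc M. ee (a n)) \<le> 3 * (1 / (2 * r))"
      using nc[of M] nc[of 0] by simp
    \<comment> \<open>The last index has no successor and is bounded by 1; since
      \<open>r \<le> 1/2\<close>, this is at most \<open>1 / (2 * r)\<close>, which gives
      \<open>2 / r\<close> in all.\<close>
    moreover have "norm (\<Sum>n<N. ee (a n)) \<le> norm (\<Sum>n<Suc M. ee (a n)) + 1"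
      using norm_triangle_ineq[of "\<Sum>n<Suc M. ee (a n)" "ee (a (Suc M))"] 3 by simp
    ultimately have "norm (\<Sum>n<N. ee (a n)) \<le> 3 * (1 / (2 * r)) + 1" by simp
    also have "\<dots> \<le> 2 / r" using r by (simp add: field_simps)
    finally show ?thesis .
  qed
qed

lemma norm_sum_ee_le_card: "norm (\<Sum>n\<in>A. ee (a n)) \<le> card A"
  by (rule order.trans[OF norm_sum]) simp

lemma card_le_diameter:
  fixes A :: "nat set"
  assumes "finite A" "D \<ge> 0" "\<And>x y. x \<in> A \<Longrightarrow> y \<in> A \<Longrightarrow> x \<le> y \<Longrightarrow> real (y - x) \<le> D"
  shows "real (card A) \<le> D + 1"
proof (cases "A = {}")
  case True thus ?thesis using assms by simp
next
  case False
  have "A \<subseteq> {Min A..Max A}" using assms(1) by auto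
  hence "card A \<le> card {Min A..Max A}" by (intro card_mono) auto
  hence "real (card A) \<le> real (Max A - Min A) + 1"
    by (simp del: of_nat_diff)
  also have "real (Max A - Min A) \<le> D" using False assms(1) by (intro assms(3)) auto
  finally show ?thesis by simp
qed

lemma convex_nat_set_eq_atLeastLessThan:
  fixes A :: "nat set"
  assumes "finite A" "A \<noteq> {}" "\<And>x y z. x \<in> A \<Longrightarrow> z \<in> A \<Longrightarrow> x \<le> y \<Longrightarrow> y \<le> z \<Longrightarrow> y \<in> A"
  shows "A = {Min A..<Suc (Max A)}"
proof (intro set_eqI iffI)
  fix x assume "x \<in> {Min A..<Suc (Max A)}"
  thus "x \<in> A" using assms(3)[of "Min A" "Max A" x] assms(1,2) by auto
qed (use assms(1) in \<open>auto simp: less_Suc_eq_le\<close>)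

text \<open>Group the indices by the integer part of the first difference \<open>d\<close>. Within a
  group the differences grow by at least \<open>\<mu>\<close> per step, so few of them come near an
  integer, and those are counted trivially; the others form one interval, to which
  \<open>kusmin_landau\<close> applies. The total growth of \<open>d\<close>, at most
  \<open>\<alpha> * \<mu> * N\<close>, bounds the number of groups.\<close>

lemma second_difference_test:
  fixes a :: "nat \<Rightarrow> real"
  assumes "0 < \<mu>" "1 \<le> \<alpha>" "1 \<le> N"
    and lo: "\<And>n. n + 2 < N \<Longrightarrow> \<mu> \<le> a (n+2) - 2 * a (n+1) + a n"
    and up: "\<And>n. n + 2 < N \<Longrightarrow> a (n+2) - 2 * a (n+1) + a n \<le> \<alpha> * \<mu>"
  shows "norm (\<Sum>n<N. ee (a n)) \<le> 11 * \<alpha> * (N * sqrt \<mu> + 1 / sqrt \<mu>)"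
proof (cases "\<mu> \<le> 1/4")
  case False
  hence "sqrt \<mu> \<ge> sqrt (1/4)" by (intro real_sqrt_le_mono) auto
  hence s: "sqrt \<mu> \<ge> 1/2" by (simp add: real_sqrt_divide)
  have "norm (\<Sum>n<N. ee (a n)) \<le> N" using norm_sum_ee_le_card[of a "{..<N}"] by simp
  also have "real N \<le> 2 * (N * sqrt \<mu>)" using mult_left_mono[OF s, of "real N"] by simp
  also have "\<dots> \<le> (11 * \<alpha>) * (N * sqrt \<mu> + 1 / sqrt \<mu>)"
    using assms by (intro mult_mono) auto
  finally show ?thesis .
next
  case small: True
  \<comment> \<open>Width of the strips next to the integers: each holds about
    \<open>e / \<mu>\<close> indices and the rest of a group costs \<open>2 / e\<close>. Both agree
    for \<open>e = sqrt \<mu>\<close>, and \<open>\<mu> \<le> 1/4\<close> yields the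
    \<open>e \<le> 1/2\<close> that \<open>kusmin_landau\<close> asks for.\<close>
  define e where "e = sqrt \<mu>"
  have e: "0 < e" "e \<le> 1/2" "e * e = \<mu>"
    using assms(1) small real_sqrt_le_mono[OF small] by (auto simp: e_def real_sqrt_divide)
  define d where "d n = a (Suc n) - a n" for n
  define J where "J = {..<N - 1}"
  define F where "F m = {n\<in>J. \<lfloor>d n\<rfloor> = m}" for m
  have inc: "d n + \<mu> \<le> d (Suc n)" "d (Suc n) \<le> d n + \<alpha> * \<mu>" if "n + 2 < N" for n
    using lo[OF that] up[OF that] by (simp_all add: d_def)
  have grow: "d n + real (n' - n) * \<mu> \<le> d n' \<and> d n' \<le> d n + real (n' - n) * (\<alpha> * \<mu>)"
    if "n \<le> n'" "n' \<in> J" for n n'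
    using that
  proof (induction n' rule: dec_induct)
    case base thus ?case by simp
  next
    case (step k)
    hence "k \<in> J" "k + 2 < N" by (auto simp: J_def)
    thus ?case using step inc[of k] by (simp add: Suc_diff_le algebra_simps)
  qed
  have mono: "d n \<le> d n'" if "n \<le> n'" "n' \<in> J" for n n'
    using grow[OF that] assms(1) by (smt (verit) mult_nonneg_nonneg of_nat_0_le_iff)
  have near: "real (card {n\<in>J. l \<le> d n \<and> d n < l + e}) \<le> e / \<mu> + 1" for l
  proof (rule card_le_diameter)
    fix x y assume xy: "x \<in> {n\<in>J. l \<le> d n \<and> d n < l + e}" "y \<in> {n\<in>J. l \<le> d n \<and> d n < l + e}" "x \<le> y"
    hence "real (y - x) * \<mu> \<le> e" using grow[of x y] by auto
    thus "real (y - x) \<le> e / \<mu>" using assms(1) by (simp add: field_simps)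
  qed (use assms(1) e(1) in \<open>auto simp: J_def\<close>)
  have fib: "norm (\<Sum>n\<in>F m. ee (a n)) \<le> 2 * (e / \<mu> + 1) + 2 / e" for m
  proof -
    define L where "L = {n\<in>J. m \<le> d n \<and> d n < m + e}"
    define M where "M = {n\<in>J. m + e \<le> d n \<and> d n < m + 1 - e}"
    define U where "U = {n\<in>J. m + 1 - e \<le> d n \<and> d n < (m + 1 - e) + e}"
    have fin: "finite L" "finite M" "finite U" by (auto simp: L_def M_def U_def J_def)
    have FE: "F m = L \<union> (M \<union> U)" using e(1,2) by (auto simp: F_def L_def M_def U_def floor_eq_iff)
    have "L \<inter> (M \<union> U) = {}" "M \<inter> U = {}" using e(1,2) by (auto simp: L_def M_def U_def)
    hence S: "(\<Sum>n\<in>F m. ee (a n)) = (\<Sum>n\<in>L. ee (a n)) + ((\<Sum>n\<in>M. ee (a n)) + (\<Sum>n\<in>U. ee (a n)))"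
      unfolding FE using fin by (simp add: sum.union_disjoint)
    have L: "norm (\<Sum>n\<in>L. ee (a n)) \<le> e / \<mu> + 1"
      using order.trans[OF norm_sum_ee_le_card near[of m]] by (simp add: L_def)
    have U: "norm (\<Sum>n\<in>U. ee (a n)) \<le> e / \<mu> + 1"
      using order.trans[OF norm_sum_ee_le_card near[of "m + 1 - e"]] by (simp add: U_def)
    have M: "norm (\<Sum>n\<in>M. ee (a n)) \<le> 2 / e"
    proof (cases "M = {}")
      case True thus ?thesis using e(1) by simp
    next
      case False
      have cv: "y \<in> M" if "x \<in> M" "z \<in> M" "x \<le> y" "y \<le> z" for x y z
        using that mono[of x y] mono[of y z] by (force simp: M_def J_def)
      define u v where "u = Min M" and "v = Suc (Max M)"
      have ME: "M = {u..<v}"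
        unfolding u_def v_def by (rule convex_nat_set_eq_atLeastLessThan[OF fin(2) False cv])
      have uv: "u < v" using False ME by auto
      have "(\<Sum>n\<in>M. ee (a n)) = (\<Sum>n<v-u. ee (a (u + n)))"
        unfolding ME using uv by (intro sum.reindex_bij_witness[of _ "\<lambda>n. u + n" "\<lambda>n. n - u"]) auto
      also have "norm \<dots> \<le> 2 / e"
      proof (rule kusmin_landau[where m = m])
        fix n
        show "m + e \<le> a (u + Suc n) - a (u + n)" "a (u + Suc n) - a (u + n) \<le> m + 1 - e"
          if "Suc n < v - u"
        proof -
          have "u + n \<in> M" unfolding ME using that by auto
          thus "m + e \<le> a (u + Suc n) - a (u + n)" "a (u + Suc n) - a (u + n) \<le> m + 1 - e"
            by (auto simp: M_def d_def)
        qed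
        show "a (u + Suc n) - a (u + n) \<le> a (u + Suc (Suc n)) - a (u + Suc n)" if "Suc (Suc n) < v - u"
        proof -
          have "u + Suc n \<in> M" unfolding ME using that by auto
          thus ?thesis using mono[of "u + n" "u + Suc n"] by (auto simp: M_def d_def)
        qed
      qed (use e(1,2) in auto)
      finally show ?thesis .
    qed
    have "norm (\<Sum>n\<in>F m. ee (a n)) \<le> (e / \<mu> + 1) + (2 / e + (e / \<mu> + 1))"
      unfolding S by (intro norm_triangle_mono L M U)
    thus ?thesis by simp
  qed
  define I where "I = (\<lambda>n. \<lfloor>d n\<rfloor>) ` J"
  have finI: "finite I" by (simp add: I_def J_def)
  have cI: "real (card I) \<le> \<alpha> * \<mu> * N + 2"
  proof (cases "J = {}")
    case True thus ?thesis using assms by (simp add: I_def)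
  next
    case False
    hence N2: "N \<ge> 2" "N - 2 \<in> J" "0 \<in> J" by (auto simp: J_def)
    have "I \<subseteq> {\<lfloor>d 0\<rfloor>..\<lfloor>d (N - 2)\<rfloor>}"
      unfolding I_def using mono[of 0] mono[of _ "N - 2"] N2 by (auto simp: J_def intro!: floor_mono)
    hence "card I \<le> card {\<lfloor>d 0\<rfloor>..\<lfloor>d (N - 2)\<rfloor>}" by (intro card_mono) auto
    hence "real (card I) \<le> real_of_int (\<lfloor>d (N - 2)\<rfloor> - \<lfloor>d 0\<rfloor> + 1)"
      using floor_mono[OF mono[OF _ N2(2), of 0]] by simp
    also have "\<dots> \<le> d (N - 2) - d 0 + 2" by linarith
    also have "d (N - 2) \<le> d 0 + real (N - 2 - 0) * (\<alpha> * \<mu>)" using grow[OF _ N2(2), of 0] by simp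
    also have "real (N - 2 - 0) * (\<alpha> * \<mu>) \<le> N * (\<alpha> * \<mu>)"
      using assms by (intro mult_right_mono) auto
    finally show ?thesis by (simp add: mult_ac)
  qed
  have dm: "e / \<mu> = 1 / e" "2 \<le> 1 / e" using e assms(1) by (simp_all add: field_simps)
  have fb: "2 * (e / \<mu> + 1) + 2 / e \<le> 5 * (1 / e)"
    unfolding dm(1) using dm(2) by simp
  have "(\<Sum>n<N. ee (a n)) = (\<Sum>n\<in>J. ee (a n)) + ee (a (N - 1))"
    using assms(3) by (cases N) (auto simp: J_def)
  hence le: "norm (\<Sum>n<N. ee (a n)) \<le> norm (\<Sum>n\<in>J. ee (a n)) + 1"
    using norm_triangle_ineq[of "\<Sum>n\<in>J. ee (a n)" "ee (a (N - 1))"] by simp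
  have "(\<Sum>n\<in>J. ee (a n)) = (\<Sum>m\<in>I. \<Sum>n\<in>F m. ee (a n))"
    unfolding F_def I_def using sum.group[of J I "\<lambda>n. \<lfloor>d n\<rfloor>" "\<lambda>n. ee (a n)"] finI
    by (simp add: I_def J_def)
  also have "norm \<dots> \<le> (\<Sum>m\<in>I. 5 * (1 / e))"
    using fib fb by (intro sum_norm_le) (meson order.trans)
  also have "\<dots> = card I * (5 * (1 / e))" by simp
  also have "\<dots> \<le> (\<alpha> * \<mu> * N + 2) * (5 * (1 / e))" using cI e(1) by (intro mult_right_mono) auto
  finally have "norm (\<Sum>n\<in>J. ee (a n)) \<le> (\<alpha> * \<mu> * N + 2) * (5 * (1 / e))" .
  note order.trans[OF le add_right_mono[OF this, of 1]]
  also have "(\<alpha> * \<mu> * N + 2) * (5 * (1 / e)) + 1 \<le> 11 * \<alpha> * (N * e + 1 / e)"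
  proof -
    have m: "\<mu> * (1 / e) = e" using e(1,3) by (simp add: field_simps)
    have "(\<alpha> * \<mu> * N + 2) * (5 * i) = 5 * (\<alpha> * (N * (\<mu> * i))) + 10 * i" for i
      by (simp add: algebra_simps)
    hence "(\<alpha> * \<mu> * N + 2) * (5 * (1 / e)) = 5 * (\<alpha> * (N * e)) + 10 * (1 / e)"
      by (simp only: m)
    moreover have "1 / e \<le> \<alpha> * (1 / e)" "0 \<le> \<alpha> * (N * e)"
      using e(1) assms(1-3) by (auto simp: field_simps)
    ultimately have "(\<alpha> * \<mu> * N + 2) * (5 * (1 / e)) + 1 \<le> 11 * (\<alpha> * (N * e)) + 11 * (\<alpha> * (1 / e))"
      using dm(2) by linarith
    thus ?thesis by (simp only: distrib_left mult.assoc)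
  qed
  finally show ?thesis unfolding e_def .
qed

section \<open>Van der Corput differencing and the test of order k\<close>

text \<open>Each term lies in exactly \<open>H\<close> of the \<open>N + H\<close> windows of length
  \<open>H\<close>, so \<open>H\<close> times the sum equals the sum of the window sums
  \<open>W\<close>. Cauchy-Schwarz over the windows and expansion of the squares leave correlations
  \<open>C h h'\<close> that depend, up to conjugation, only on the distance of the shifts.\<close>

lemma van_der_corput_inequality:
  fixes z :: "nat \<Rightarrow> complex" and N H :: nat
  defines "\<gamma> \<equiv> \<lambda>k. norm (\<Sum>n<N - k. z (n + k) * cnj (z n))"
  shows "(real H)^2 * (norm (\<Sum>n<N. z n))^2
    \<le> real (N + H) * (real H * (\<gamma> 0 + 2 * (\<Sum>k=1..<H. \<gamma> k)))"
proof -
  define Z where "Z m h = (if h \<le> m \<and> m - h < N then z (m - h) else 0)" for m h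
  define W where "W m = (\<Sum>h<H. Z m h)" for m
  have Zs: "(\<Sum>m<N+H. Z m h) = (\<Sum>n<N. z n)" if "h < H" for h
  proof -
    have "(\<Sum>m<N+H. Z m h) = (\<Sum>m\<in>{h..<N+h}. Z m h)"
      using that by (intro sum.mono_neutral_right) (auto simp: Z_def)
    also have "\<dots> = (\<Sum>n<N. z n)"
      by (rule sum.reindex_bij_witness[of _ "\<lambda>n. n + h" "\<lambda>m. m - h"]) (auto simp: Z_def)
    finally show ?thesis .
  qed
  have "(\<Sum>m<N+H. W m) = (\<Sum>h<H. \<Sum>m<N+H. Z m h)" unfolding W_def by (rule sum.swap)
  also have "\<dots> = of_nat H * (\<Sum>n<N. z n)" using Zs by simp
  finally have "real H * norm (\<Sum>n<N. z n) = norm (\<Sum>m<N+H. W m)" by (simp add: norm_mult)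
  also have "\<dots> \<le> (\<Sum>m<N+H. norm (W m))" by (rule norm_sum)
  finally have "(real H * norm (\<Sum>n<N. z n))^2 \<le> (\<Sum>m<N+H. norm (W m))^2"
    by (intro power_mono) auto
  also have "\<dots> \<le> (\<Sum>m<N+H. (norm (W m))^2) * card {..<N+H}" by (rule sum_squared_le_sum_of_squares)
  finally have 1: "(real H)^2 * (norm (\<Sum>n<N. z n))^2 \<le> real (N + H) * (\<Sum>m<N+H. (norm (W m))^2)"
    by (simp add: power_mult_distrib mult.commute)
  define C where "C h h' = (\<Sum>m<N+H. Z m h * cnj (Z m h'))" for h h'
  have C1: "norm (C h h') = \<gamma> (h' - h)" if "h \<le> h'" "h' < H" for h h'
  proof -
    have "C h h' = (\<Sum>m\<in>{h'..<N+h}. Z m h * cnj (Z m h'))"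
      unfolding C_def using that by (intro sum.mono_neutral_right) (auto simp: Z_def)
    also have "\<dots> = (\<Sum>n<N - (h' - h). z (n + (h' - h)) * cnj (z n))"
      using that by (intro sum.reindex_bij_witness[of _ "\<lambda>n. n + h'" "\<lambda>m. m - h'"]) (auto simp: Z_def)
    finally show ?thesis by (simp add: \<gamma>_def)
  qed
  have C2: "C h h' = cnj (C h' h)" for h h' by (simp add: C_def mult.commute)
  have C: "norm (C h h') = \<gamma> (if h \<le> h' then h' - h else h - h')" if "h < H" "h' < H" for h h'
    using that C1[of h h'] C1[of h' h] C2[of h h'] by auto
  have "of_real (\<Sum>m<N+H. (norm (W m))^2) = (\<Sum>m<N+H. W m * cnj (W m))"
    by (simp add: complex_norm_square del: of_real_power)
  also have "\<dots> = (\<Sum>m<N+H. \<Sum>h<H. \<Sum>h'<H. Z m h * cnj (Z m h'))"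
    unfolding W_def by (simp add: sum_product)
  also have "\<dots> = (\<Sum>h<H. \<Sum>m<N+H. \<Sum>h'<H. Z m h * cnj (Z m h'))" by (rule sum.swap)
  also have "\<dots> = (\<Sum>h<H. \<Sum>h'<H. C h h')"
    unfolding C_def by (rule sum.cong[OF refl], rule sum.swap)
  finally have e: "complex_of_real (\<Sum>m<N+H. (norm (W m))^2) = (\<Sum>h<H. \<Sum>h'<H. C h h')" .
  have "(\<Sum>m<N+H. (norm (W m))^2) = norm (complex_of_real (\<Sum>m<N+H. (norm (W m))^2))"
    by (simp only: norm_of_real abs_of_nonneg sum_nonneg zero_le_power2)
  also have "\<dots> = norm (\<Sum>h<H. \<Sum>h'<H. C h h')" by (simp only: e)
  also have "\<dots> \<le> (\<Sum>h<H. \<gamma> 0 + 2 * (\<Sum>k=1..<H. \<gamma> k))"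
  proof (rule sum_norm_le)
    fix h assume h: "h \<in> {..<H}"
    have "norm (\<Sum>h'<H. C h h') \<le> (\<Sum>h'<H. norm (C h h'))" by (rule norm_sum)
    also have "\<dots> = (\<Sum>h'\<in>{..<h} \<union> ({h} \<union> {h<..<H}). norm (C h h'))"
      using h by (intro sum.cong) auto
    also have "\<dots> = (\<Sum>h'<h. norm (C h h')) + (norm (C h h) + (\<Sum>h'\<in>{h<..<H}. norm (C h h')))"
      by (subst sum.union_disjoint; force?)+
    also have "norm (C h h) = \<gamma> 0" using C[of h h] h by simp
    also have "(\<Sum>h'<h. norm (C h h')) = (\<Sum>k=1..<Suc h. \<gamma> k)"
      using h by (intro sum.reindex_bij_witness[of _ "\<lambda>k. h - k" "\<lambda>k. h - k"]) (auto simp: C)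
    also have "\<dots> \<le> (\<Sum>k=1..<H. \<gamma> k)" using h by (intro sum_mono2) (auto simp: \<gamma>_def)
    also have "(\<Sum>h'\<in>{h<..<H}. norm (C h h')) = (\<Sum>k=1..<H - h. \<gamma> k)"
      using h by (intro sum.reindex_bij_witness[of _ "\<lambda>k. h + k" "\<lambda>k. k - h"]) (auto simp: C)
    also have "\<dots> \<le> (\<Sum>k=1..<H. \<gamma> k)" using h by (intro sum_mono2) (auto simp: \<gamma>_def)
    finally show "norm (\<Sum>h'<H. C h h') \<le> \<gamma> 0 + 2 * (\<Sum>k=1..<H. \<gamma> k)" by simp
  qed
  also have "\<dots> = real H * (\<gamma> 0 + 2 * (\<Sum>k=1..<H. \<gamma> k))" by simp
  finally show ?thesis using 1 by (meson mult_left_mono of_nat_0_le_iff order.trans)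
qed

text \<open>Weighted AM-GM gives \<open>((j - 1) / j) powr p \<le> 1 - p / j\<close>; multiply by
  \<open>j powr p\<close>. The difference on the right telescopes in
  \<open>sum_powr_le\<close>.\<close>

lemma powr_diff_ge:
  fixes p j :: real
  assumes "0 < p" "p \<le> 1" "1 \<le> j"
  shows "p * j powr (p - 1) \<le> j powr p - (j - 1) powr p"
proof (cases "j = 1")
  case True thus ?thesis using assms by simp
next
  case False
  have "((j - 1) / j) powr p * 1 powr (1 - p) \<le> p * ((j - 1) / j) + (1 - p) * 1"
    using assms False by (intro Youngs_inequality_0) auto
  hence "j powr p * ((j - 1) / j) powr p \<le> j powr p * (1 - p / j)"
    using assms by (intro mult_left_mono) (auto simp: field_simps)
  moreover have "j powr p * ((j - 1) / j) powr p = (j - 1) powr p"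
    using assms by (simp add: powr_divide)
  moreover have "j powr p * (1 - p / j) = j powr p - p * j powr (p - 1)"
    using assms by (simp add: powr_diff right_diff_distrib)
  ultimately show ?thesis by simp
qed

lemma sum_powr_le:
  fixes p :: real
  assumes "0 < p" "p \<le> 1"
  shows "(\<Sum>j=1..n. real j powr (p - 1)) \<le> real n powr p / p"
proof (induction n)
  case (Suc n)
  have "p * real (Suc n) powr (p - 1) \<le> real (Suc n) powr p - real n powr p"
    using powr_diff_ge[of p "real (Suc n)"] assms by simp
  hence "real (Suc n) powr (p - 1) \<le> real (Suc n) powr p / p - real n powr p / p"
    using assms by (simp add: field_simps)
  thus ?case using Suc by simp
qed simp

text \<open>Iterated forward difference. The recursion differences the sequence and not the result,
  so inductions on the order run with the sequence arbitrary; \<open>fdiff_Suc_eq\<close> supplies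
  the other form.\<close>

primrec fdiff :: "nat \<Rightarrow> (nat \<Rightarrow> real) \<Rightarrow> nat \<Rightarrow> real" where
  "fdiff 0 a = a"
| "fdiff (Suc k) a = fdiff k (\<lambda>n. a (Suc n) - a n)"

lemma fdiff_diff: "fdiff k (\<lambda>n. a n - b n) n = fdiff k a n - fdiff k b n"
proof (induction k arbitrary: a b)
  case (Suc k)
  have "fdiff (Suc k) (\<lambda>n. a n - b n) n = fdiff k (\<lambda>n. (a (Suc n) - a n) - (b (Suc n) - b n)) n"
    by (simp add: algebra_simps)
  also have "\<dots> = fdiff (Suc k) a n - fdiff (Suc k) b n" by (subst Suc) simp
  finally show ?case .
qed simp

lemma fdiff_shift: "fdiff k (\<lambda>n. a (n + r)) n = fdiff k a (n + r)"
proof (induction k arbitrary: a)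
  case (Suc k)
  show ?case using Suc[of "\<lambda>n. a (Suc n) - a n"] by simp
qed simp

lemma fdiff_Suc_eq: "fdiff (Suc k) a n = fdiff k a (Suc n) - fdiff k a n"
  using fdiff_diff[of k "\<lambda>n. a (n + 1)" a n] fdiff_shift[of k a 1 n] by simp

text \<open>Differencing by \<open>h\<close> telescopes into \<open>h\<close> unit steps. Hence
  bounds for the differences of order \<open>Suc k\<close>, multiplied by \<open>h\<close>, hold for
  those of order \<open>k\<close> of the differenced phase.\<close>

lemma fdiff_step: "fdiff k (\<lambda>n. a (n + h) - a n) n = (\<Sum>i<h. fdiff (Suc k) a (n + i))"
proof -
  have "(\<Sum>i<h. fdiff (Suc k) a (n + i)) = (\<Sum>i<h. fdiff k a (n + Suc i) - fdiff k a (n + i))"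
    by (simp only: fdiff_Suc_eq add_Suc_right)
  also have "\<dots> = fdiff k a (n + h) - fdiff k a (n + 0)" by (rule sum_lessThan_telescope)
  finally show ?thesis by (simp add: fdiff_diff fdiff_shift)
qed

text \<open>One mean value theorem per order: passing from each \<open>F j\<close> to its unit
  difference \<open>G j\<close> shortens the chain by one, the new last function \<open>G k\<close>
  takes values of \<open>F (Suc k)\<close>, and the interval loses one unit.\<close>

lemma fdiff_mean_value:
  assumes "\<And>j x. j < k \<Longrightarrow> x \<in> {A..B} \<Longrightarrow> (F j has_real_derivative F (Suc j) x) (at x)"
    and "\<And>x. x \<in> {A..B} \<Longrightarrow> l \<le> F k x \<and> F k x \<le> u"
    and "A \<le> x" "x + real k \<le> B"
  shows "l \<le> fdiff k (\<lambda>n. F 0 (x + real n)) 0 \<and> fdiff k (\<lambda>n. F 0 (x + real n)) 0 \<le> u"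
  using assms
proof (induction k arbitrary: F B)
  case (Suc k)
  define G where "G j y = F j (y + 1) - F j y" for j y
  have "l \<le> fdiff k (\<lambda>n. G 0 (x + real n)) 0 \<and> fdiff k (\<lambda>n. G 0 (x + real n)) 0 \<le> u"
  proof (rule Suc.IH[of "B - 1"])
    fix j y assume jy: "j < k" "y \<in> {A..B - 1}"
    have "(F j has_real_derivative F (Suc j) (y + 1)) (at (y + 1))"
      using jy by (intro Suc.prems(1)) auto
    hence "((\<lambda>y. F j (y + 1)) has_real_derivative F (Suc j) (y + 1)) (at y)"
      by (simp add: DERIV_shift)
    moreover have "(F j has_real_derivative F (Suc j) y) (at y)"
      using jy by (intro Suc.prems(1)) auto
    ultimately show "(G j has_real_derivative G (Suc j) y) (at y)"
      unfolding G_def by (rule DERIV_diff)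
  next
    fix y assume y: "y \<in> {A..B - 1}"
    have "\<exists>\<xi>. y < \<xi> \<and> \<xi> < y + 1 \<and> F k (y + 1) - F k y = (y + 1 - y) * F (Suc k) \<xi>"
      by (rule MVT2) (use y in \<open>auto intro!: Suc.prems(1)\<close>)
    thus "l \<le> G k y \<and> G k y \<le> u"
      using y Suc.prems(2) by (auto simp: G_def)
  qed (use Suc.prems(3,4) in auto)
  thus ?case by (simp add: G_def add_ac)
qed auto

text \<open>Exponent of the derivative test of order \<open>k\<close>. It starts with
  \<open>kap 2 = 1 / 2\<close> and continues by \<open>kap_Suc\<close>, the balance equation of one
  differencing step.\<close>

definition kap :: "nat \<Rightarrow> real" where "kap k = 1 / (2 ^ k - 2)"

lemma pow2_ge4: "2 \<le> k \<Longrightarrow> (4::real) \<le> 2 ^ k"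
  using power_increasing[of 2 k "2::real"] by simp

lemma kap_bounds: "2 \<le> k \<Longrightarrow> 0 < kap k" "2 \<le> k \<Longrightarrow> kap k \<le> 1 / 2"
  using pow2_ge4[of k] by (auto simp: kap_def field_simps)

lemma kap_Suc: "2 \<le> k \<Longrightarrow> kap k = 2 * kap (Suc k) * (1 + kap k)"
proof -
  assume "2 \<le> k"
  hence "(2::real) ^ k - 2 > 0" "(2::real) * 2 ^ k - 2 > 0" using pow2_ge4[of k] by auto
  thus ?thesis by (simp add: kap_def field_simps)
qed

text \<open>One Weyl--van der Corput differencing step; \<open>p\<close> is the differencing range, chosen
  so that \<open>1 / p\<close> balances \<open>(p * \<mu>) powr K\<close>.\<close>

lemma weyl_step:
  fixes C \<alpha> \<mu> K \<sigma> :: real and a :: "nat \<Rightarrow> real"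
  assumes C: "1 \<le> C" and \<alpha>: "1 \<le> \<alpha>" and \<mu>: "0 < \<mu>" and K: "0 < K" "K \<le> 1 / 2" and K': "K = 2 * K' * (1 + K)"
    and \<sigma>: "0 \<le> \<sigma>" "\<sigma> \<le> 1" and N: "1 \<le> N"
    and IH: "\<And>h. 1 \<le> h \<Longrightarrow> h < N \<Longrightarrow> norm (\<Sum>n<N - h. ee (a (n + h) - a n))
        \<le> C * \<alpha> * (real N * (real h * \<mu>) powr K + real N powr (1 - \<sigma>) * (real h * \<mu>) powr (- K))"
  shows "norm (\<Sum>n<N. ee (a n)) \<le> 10 * C * \<alpha> * (real N * \<mu> powr K' + real N powr (1 - \<sigma> / 2) * \<mu> powr (- K'))"
proof -
  define S where "S = norm (\<Sum>n<N. ee (a n))"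
  define X where "X = real N * \<mu> powr K'"
  define Y where "Y = real N powr (1 - \<sigma> / 2) * \<mu> powr (- K')"
  have K'0: "0 < K'" using K K' by (smt (verit) zero_less_mult_iff)
  have XY: "0 \<le> X" "0 \<le> Y" by (auto simp: X_def Y_def)
  have Ca: "1 \<le> C * \<alpha>" using mult_mono[OF C \<alpha>] C by simp
  have triv: "S \<le> N" unfolding S_def by (rule order.trans[OF norm_sum]) simp
  have fin: "S \<le> 10 * C * \<alpha> * (X + Y)" if "S \<le> 2 * (X + Y)"
  proof -
    have "2 * (X + Y) \<le> (10 * (C * \<alpha>)) * (X + Y)" using Ca XY by (intro mult_right_mono) auto
    thus ?thesis using that by (simp add: mult.assoc)
  qed
  consider "\<mu> \<ge> 1" | "\<mu> < 1" by linarith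
  hence "S \<le> 10 * C * \<alpha> * (X + Y)"
  proof cases
    case 1
    hence "1 \<le> \<mu> powr K'" using K'0 by (simp add: ge_one_powr_ge_zero)
    hence "real N * 1 \<le> X" unfolding X_def by (intro mult_left_mono) auto
    thus ?thesis using triv XY by (intro fin) simp
  next
    case 2
    define p where "p = \<mu> powr (- 2 * K')"
    have p1: "1 \<le> p" using powr_mono'[of "- 2 * K'" 0 \<mu>] 2 \<mu> K'0 by (simp add: p_def)
    define H where "H = nat \<lceil>p\<rceil>"
    have H: "p \<le> H" "real H \<le> 2 * p" "1 \<le> H" unfolding H_def using p1 by linarith+
    show ?thesis
    proof (cases "N < H")
      \<comment> \<open>If the differencing range exceeds the sum, then \<open>sqrt N\<close> is at
        most \<open>2 * \<mu> powr (- K')\<close>, and the trivial bound \<open>N\<close> already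
        fits the second term.\<close>
      case True
      have "real N powr (\<sigma> / 2) \<le> real N powr (1/2)" using \<sigma> N by (intro powr_mono) auto
      also have "\<dots> \<le> (2 * p) powr (1/2)" using True H by (intro powr_mono2) auto
      also have "\<dots> = 2 powr (1/2) * \<mu> powr (- K')" using p1 \<mu> by (simp add: powr_mult p_def powr_powr)
      also have "\<dots> \<le> 2 * \<mu> powr (- K')" using powr_mono[of "1/2" 1 "2::real"] by (intro mult_right_mono) auto
      finally have "real N powr (1 - \<sigma> / 2) * real N powr (\<sigma> / 2) \<le> real N powr (1 - \<sigma> / 2) * (2 * \<mu> powr (- K'))"
        by (intro mult_left_mono) auto
      moreover have "real N powr (1 - \<sigma> / 2) * real N powr (\<sigma> / 2) = N"
        using N by (simp flip: powr_add)
      ultimately show ?thesis using triv XY by (intro fin) (simp add: Y_def)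
    next
      case False
      define \<gamma> where "\<gamma> k = norm (\<Sum>n<N - k. ee (a (n + k)) * cnj (ee (a n)))" for k
      have g0: "\<gamma> 0 = N" by (simp add: \<gamma>_def complex_norm_square[symmetric] norm_mult)
      have g: "\<gamma> h \<le> C * \<alpha> * (N * (H * \<mu>) powr K + (real N powr (1 - \<sigma>) * \<mu> powr (- K)) * real h powr ((1 - K) - 1))"
        if "h \<in> {1..<H}" for h
      proof -
        have h: "1 \<le> h" "h < N" using that False by auto
        have "\<gamma> h = norm (\<Sum>n<N - h. ee (a (n + h) - a n))" by (simp add: \<gamma>_def ee_diff)
        also have "\<dots> \<le> C * \<alpha> * (real N * (real h * \<mu>) powr K + real N powr (1 - \<sigma>) * (real h * \<mu>) powr (- K))"
          by (rule IH[OF h])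
        also have "\<dots> \<le> C * \<alpha> * (N * (H * \<mu>) powr K + (real N powr (1 - \<sigma>) * \<mu> powr (- K)) * real h powr ((1 - K) - 1))"
        proof (intro mult_left_mono add_mono)
          show "(real h * \<mu>) powr K \<le> (H * \<mu>) powr K"
            using that \<mu> K by (intro powr_mono2 mult_right_mono) auto
          show "real N powr (1 - \<sigma>) * (real h * \<mu>) powr (- K) \<le> (real N powr (1 - \<sigma>) * \<mu> powr (- K)) * real h powr ((1 - K) - 1)"
            using \<mu> by (simp add: powr_mult mult_ac)
        qed (use Ca in auto)
        finally show ?thesis .
      qed
      have "(\<Sum>h=1..<H. \<gamma> h) \<le> (\<Sum>h=1..<H. C * \<alpha> * (N * (H * \<mu>) powr K + (real N powr (1 - \<sigma>) * \<mu> powr (- K)) * real h powr ((1 - K) - 1)))"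
        by (intro sum_mono g)
      also have "\<dots> = C * \<alpha> * ((H - 1) * (N * (H * \<mu>) powr K) + (real N powr (1 - \<sigma>) * \<mu> powr (- K)) * (\<Sum>h=1..<H. real h powr ((1 - K) - 1)))"
        using H by (simp add: sum_distrib_left[symmetric] sum.distrib of_nat_diff)
      also have "\<dots> \<le> C * \<alpha> * (H * (N * (H * \<mu>) powr K) + (real N powr (1 - \<sigma>) * \<mu> powr (- K)) * (2 * real H powr (1 - K)))"
      proof (intro mult_left_mono add_mono mult_right_mono)
        have "(\<Sum>h=1..<H. real h powr ((1 - K) - 1)) \<le> (\<Sum>h=1..H. real h powr ((1 - K) - 1))"
          by (intro sum_mono2) auto
        also have "\<dots> \<le> real H powr (1 - K) / (1 - K)" using K by (intro sum_powr_le) auto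
        also have "\<dots> \<le> real H powr (1 - K) / (1 / 2)" using K by (intro divide_left_mono) auto
        finally show "(\<Sum>h=1..<H. real h powr ((1 - K) - 1)) \<le> 2 * real H powr (1 - K)" by simp
      qed (use Ca in auto)
      finally have gs: "(\<Sum>h=1..<H. \<gamma> h) \<le> C * \<alpha> * (H * (N * (H * \<mu>) powr K) + (real N powr (1 - \<sigma>) * \<mu> powr (- K)) * (2 * real H powr (1 - K)))" .
      define U where "U = N * (H * \<mu>) powr K + 2 * (real N powr (1 - \<sigma>) * (H * \<mu>) powr (- K))"
      have gs': "(\<Sum>h=1..<H. \<gamma> h) \<le> H * (C * \<alpha> * U)"
      proof -
        have "real H powr (1 - K) = real H * real H powr (- K)"
          using H powr_add[of "real H" 1 "- K"] by simp
        thus ?thesis using gs \<mu> by (simp add: U_def powr_mult algebra_simps)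
      qed
      have U0: "0 \<le> C * \<alpha> * U" using Ca by (simp add: U_def)
      have gs0: "0 \<le> (\<Sum>h=1..<H. \<gamma> h)" by (simp add: \<gamma>_def sum_nonneg)
      have "(real H)^2 * S^2 \<le> real (N + H) * (real H * (\<gamma> 0 + 2 * (\<Sum>k=1..<H. \<gamma> k)))"
        unfolding S_def \<gamma>_def by (rule van_der_corput_inequality)
      also have "\<dots> \<le> (2 * N) * (real H * (N + 2 * (H * (C * \<alpha> * U))))"
        using False gs' U0 g0 gs0 by (intro mult_mono add_mono mult_left_mono) auto
      finally have "real H * (real H * S^2) \<le> real H * (2 * N * (N + 2 * (H * (C * \<alpha> * U))))"
        by (simp add: power2_eq_square mult_ac)
      hence "real H * S^2 \<le> 2 * N * (N + 2 * (H * (C * \<alpha> * U)))" using H by simp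
      hence "S^2 \<le> 2 * N * (N / H + 2 * (C * \<alpha> * U))" using H by (simp add: field_simps)
      also have "\<dots> \<le> 2 * N * (N * \<mu> powr (2 * K') + 2 * (C * \<alpha> * (2 * (N * \<mu> powr (2 * K')) + 2 * (real N powr (1 - \<sigma>) * \<mu> powr (- 2 * K')))))"
      proof (intro mult_left_mono add_mono)
        have "real N / H \<le> real N / p" using H p1 by (intro divide_left_mono) auto
        thus "real N / H \<le> N * \<mu> powr (2 * K')" by (simp add: p_def powr_minus field_simps)
        \<comment> \<open>The relation between \<open>K\<close> and \<open>K'\<close> says exactly
          that \<open>(p * \<mu>) powr K = 1 / p\<close>, so the diagonal and the correlations have
          equal size.\<close>
        have ex: "(1 - 2 * K') * K = 2 * K'" using K' by (simp add: algebra_simps)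
        have pm: "p * \<mu> = \<mu> powr (1 - 2 * K')" using \<mu> powr_add[of \<mu> "- 2 * K'" 1] by (simp add: p_def)
        have "(H * \<mu>) powr K \<le> (2 * (p * \<mu>)) powr K" using H \<mu> K by (intro powr_mono2) auto
        also have "\<dots> = 2 powr K * \<mu> powr (2 * K')" using \<mu> by (simp add: powr_mult pm powr_powr ex)
        also have "\<dots> \<le> 2 * \<mu> powr (2 * K')" using K powr_mono[of K 1 "2::real"] by (intro mult_right_mono) auto
        finally have 1: "(H * \<mu>) powr K \<le> 2 * \<mu> powr (2 * K')" .
        have "(H * \<mu>) powr (- K) \<le> (p * \<mu>) powr (- K)"
          using H \<mu> K p1 by (intro powr_mono2') auto
        also have "\<dots> = \<mu> powr (- 2 * K')" using ex by (simp add: pm powr_powr)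
        finally have 2: "(H * \<mu>) powr (- K) \<le> \<mu> powr (- 2 * K')" .
        have "U \<le> N * (2 * \<mu> powr (2 * K')) + 2 * (real N powr (1 - \<sigma>) * \<mu> powr (- 2 * K'))"
          unfolding U_def by (intro add_mono mult_left_mono 1 2) auto
        thus "U \<le> 2 * (N * \<mu> powr (2 * K')) + 2 * (real N powr (1 - \<sigma>) * \<mu> powr (- 2 * K'))" by simp
      qed (use Ca in auto)
      also have "\<dots> = (2 + 8 * (C * \<alpha>)) * X^2 + 8 * (C * \<alpha>) * Y^2"
      proof -
        have "X^2 = N * N * \<mu> powr (2 * K')"
          by (simp add: X_def power2_eq_square powr_add[symmetric] mult_ac)
        moreover have "Y^2 = N * (real N powr (1 - \<sigma>) * \<mu> powr (- 2 * K'))"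
        proof -
          have "Y^2 = (real N powr (1 - \<sigma> / 2) * real N powr (1 - \<sigma> / 2)) * (\<mu> powr (- K') * \<mu> powr (- K'))"
            by (simp add: Y_def power2_eq_square mult_ac)
          also have "\<dots> = real N powr (1 + (1 - \<sigma>)) * \<mu> powr (- 2 * K')" by (simp flip: powr_add)
          also have "real N powr (1 + (1 - \<sigma>)) = N * real N powr (1 - \<sigma>)" using N by (subst powr_add) simp
          finally show ?thesis by simp
        qed
        ultimately show ?thesis by (simp add: algebra_simps)
      qed
      also have "\<dots> \<le> (10 * (C * \<alpha>)) * X^2 + (10 * (C * \<alpha>)) * Y^2"
        using Ca by (intro add_mono mult_right_mono) auto
      also have "\<dots> = (10 * (C * \<alpha>)) * (X^2 + Y^2)" by (simp add: distrib_left)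
      also have "\<dots> \<le> (10 * (C * \<alpha>))^2 * (X + Y)^2"
      proof (rule mult_mono)
        show "10 * (C * \<alpha>) \<le> (10 * (C * \<alpha>))^2" using self_le_power[of "10 * (C * \<alpha>)" 2] Ca by simp
        show "X^2 + Y^2 \<le> (X + Y)^2" using XY by (simp add: power2_sum)
      qed auto
      finally have "S^2 \<le> (10 * (C * \<alpha>) * (X + Y))^2" by (simp add: power_mult_distrib)
      hence "S \<le> 10 * (C * \<alpha>) * (X + Y)" by (rule power2_le_imp_le) (use XY Ca in auto)
      thus ?thesis by (simp add: mult.assoc)
    qed
  qed
  thus ?thesis by (simp add: S_def X_def Y_def)
qed

text \<open>Induction with \<open>weyl_step\<close> over the second difference test, where
  \<open>1 - 4 / 2 ^ 2 = 0\<close>. By \<open>fdiff_step\<close> the phase differenced by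
  \<open>h\<close> satisfies the hypothesis of order \<open>k\<close> with \<open>h * \<mu>\<close>.
  Each step multiplies the constant by 10 and halves the saving \<open>4 / 2 ^ k\<close> in the
  secondary term.\<close>

lemma kth_difference_test:
  assumes "2 \<le> k"
  shows "\<exists>C\<ge>1. \<forall>N \<mu> \<alpha> a. 1 \<le> N \<longrightarrow> 0 < \<mu> \<longrightarrow> 1 \<le> \<alpha> \<longrightarrow>
    (\<forall>n. n + k < N \<longrightarrow> \<mu> \<le> fdiff k a n \<and> fdiff k a n \<le> \<alpha> * \<mu>) \<longrightarrow>
    norm (\<Sum>n<N. ee (a n)) \<le> C * \<alpha> * (real N * \<mu> powr kap k + real N powr (1 - 4 / 2 ^ k) * \<mu> powr (- kap k))"
  using assms
proof (induction k rule: dec_induct)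
  case base
  show ?case
  proof (intro exI[of _ 11] conjI allI impI)
    fix N :: nat and \<mu> \<alpha> :: real and a :: "nat \<Rightarrow> real"
    assume *: "1 \<le> N" "0 < \<mu>" "1 \<le> \<alpha>" "\<forall>n. n + 2 < N \<longrightarrow> \<mu> \<le> fdiff 2 a n \<and> fdiff 2 a n \<le> \<alpha> * \<mu>"
    have fd: "fdiff 2 a n = a (n + 2) - 2 * a (n + 1) + a n" for n by (simp add: numeral_2_eq_2)
    have "norm (\<Sum>n<N. ee (a n)) \<le> 11 * \<alpha> * (N * sqrt \<mu> + 1 / sqrt \<mu>)"
      by (rule second_difference_test) (use * fd in auto)
    thus "norm (\<Sum>n<N. ee (a n)) \<le> 11 * \<alpha> * (real N * \<mu> powr kap 2 + real N powr (1 - 4 / 2 ^ 2) * \<mu> powr (- kap 2))"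
      using * by (simp add: kap_def powr_half_sqrt powr_minus field_simps)
  qed simp
next
  case (step k)
  then obtain C where C: "1 \<le> C" and IH: "\<And>N \<mu> \<alpha> a. 1 \<le> N \<Longrightarrow> 0 < \<mu> \<Longrightarrow> 1 \<le> \<alpha> \<Longrightarrow>
    (\<And>n. n + k < N \<Longrightarrow> \<mu> \<le> fdiff k a n \<and> fdiff k a n \<le> \<alpha> * \<mu>) \<Longrightarrow>
    norm (\<Sum>n<N. ee (a n)) \<le> C * \<alpha> * (real N * \<mu> powr kap k + real N powr (1 - 4 / 2 ^ k) * \<mu> powr (- kap k))"
    by blast
  note p4 = pow2_ge4[OF step.hyps(1)]
  show ?case
  proof (intro exI[of _ "10 * C"] conjI allI impI)
    fix N :: nat and \<mu> \<alpha> :: real and a :: "nat \<Rightarrow> real"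
    assume *: "1 \<le> N" "0 < \<mu>" "1 \<le> \<alpha>" and b: "\<forall>n. n + Suc k < N \<longrightarrow> \<mu> \<le> fdiff (Suc k) a n \<and> fdiff (Suc k) a n \<le> \<alpha> * \<mu>"
    have "norm (\<Sum>n<N. ee (a n)) \<le> 10 * C * \<alpha> * (real N * \<mu> powr kap (Suc k) + real N powr (1 - (4 / 2 ^ k) / 2) * \<mu> powr (- kap (Suc k)))"
    proof (rule weyl_step[OF C *(3,2) kap_bounds[OF step.hyps(1)] kap_Suc[OF step.hyps(1)] _ _ *(1)])
      fix h assume h: "1 \<le> h" "h < N"
      have "norm (\<Sum>n<N - h. ee (a (n + h) - a n)) \<le> C * \<alpha> * (real (N - h) * (real h * \<mu>) powr kap k
          + real (N - h) powr (1 - 4 / 2 ^ k) * (real h * \<mu>) powr (- kap k))"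
      proof (rule IH)
        fix n assume n: "n + k < N - h"
        have bb: "\<mu> \<le> fdiff (Suc k) a (n + i)" "fdiff (Suc k) a (n + i) \<le> \<alpha> * \<mu>" if "i < h" for i
          using b n that by auto
        have "of_nat h * \<mu> \<le> (\<Sum>i<h. fdiff (Suc k) a (n + i))"
          using bb(1) sum_bounded_below[of "{..<h}" \<mu> "\<lambda>i. fdiff (Suc k) a (n + i)"] by simp
        moreover have "(\<Sum>i<h. fdiff (Suc k) a (n + i)) \<le> of_nat h * (\<alpha> * \<mu>)"
          using bb(2) sum_bounded_above[of "{..<h}" "\<lambda>i. fdiff (Suc k) a (n + i)" "\<alpha> * \<mu>"] by simp
        ultimately show "h * \<mu> \<le> fdiff k (\<lambda>n. a (n + h) - a n) n \<and> fdiff k (\<lambda>n. a (n + h) - a n) n \<le> \<alpha> * (h * \<mu>)"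
          unfolding fdiff_step by (simp add: mult_ac)
      qed (use h * in auto)
      also have "\<dots> \<le> C * \<alpha> * (real N * (real h * \<mu>) powr kap k + real N powr (1 - 4 / 2 ^ k) * (real h * \<mu>) powr (- kap k))"
        using C *(3) p4 by (intro mult_left_mono add_mono mult_right_mono powr_mono2) (auto simp: field_simps)
      finally show "norm (\<Sum>n<N - h. ee (a (n + h) - a n)) \<le> \<dots>" .
    qed (use p4 in \<open>auto simp: field_simps\<close>)
    thus "norm (\<Sum>n<N. ee (a n)) \<le> 10 * C * \<alpha> * (real N * \<mu> powr kap (Suc k) + real N powr (1 - 4 / 2 ^ Suc k) * \<mu> powr (- kap (Suc k)))"
      by simp
  qed (use C in simp)
qed

definition deriv_chain :: "(nat \<Rightarrow> real \<Rightarrow> real) \<Rightarrow> nat \<Rightarrow> real set \<Rightarrow> bool" where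
  "deriv_chain F k A \<longleftrightarrow> (\<forall>j<k. \<forall>x\<in>A. (F j has_real_derivative F (Suc j) x) (at x))"

definition bounded_off_zero :: "(real \<Rightarrow> real) \<Rightarrow> real set \<Rightarrow> real \<Rightarrow> real \<Rightarrow> bool" where
  "bounded_off_zero f A \<mu> \<alpha> \<longleftrightarrow> (\<forall>x\<in>A. \<mu> \<le> f x \<and> f x \<le> \<alpha> * \<mu>) \<or> (\<forall>x\<in>A. \<mu> \<le> - f x \<and> - f x \<le> \<alpha> * \<mu>)"

text \<open>\<open>fdiff_mean_value\<close> transfers the bounds from derivatives to differences.
  The length \<open>L\<close> is only an upper bound for the number of terms, so that one estimate
  serves all subintervals; a negative derivative is reduced to a positive one by conjugating the
  sum.\<close>

lemma derivative_test:
  assumes "2 \<le> k"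
  shows "\<exists>C\<ge>1. \<forall>F (u::nat) (v::nat) (L::real) \<mu> \<alpha>. 0 < \<mu> \<longrightarrow> 1 \<le> \<alpha> \<longrightarrow> 1 \<le> L \<longrightarrow> real v - real u + 1 \<le> L \<longrightarrow>
    deriv_chain F k {real u..real v} \<longrightarrow> bounded_off_zero (F k) {real u..real v} \<mu> \<alpha> \<longrightarrow>
    norm (\<Sum>n=u..v. ee (F 0 (real n))) \<le> C * \<alpha> * (L * \<mu> powr kap k + L powr (1 - 4 / 2 ^ k) * \<mu> powr (- kap k))"
proof -
  obtain C where C: "1 \<le> C" and T: "\<And>N \<mu> \<alpha> a. 1 \<le> N \<Longrightarrow> 0 < \<mu> \<Longrightarrow> 1 \<le> \<alpha> \<Longrightarrow>
    (\<And>n. n + k < N \<Longrightarrow> \<mu> \<le> fdiff k a n \<and> fdiff k a n \<le> \<alpha> * \<mu>) \<Longrightarrow>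
    norm (\<Sum>n<N. ee (a n)) \<le> C * \<alpha> * (real N * \<mu> powr kap k + real N powr (1 - 4 / 2 ^ k) * \<mu> powr (- kap k))"
    using kth_difference_test[OF assms] by blast
  note p4 = pow2_ge4[OF assms]
  have pos: "norm (\<Sum>n=u..v. ee (F 0 (real n))) \<le> C * \<alpha> * (L * \<mu> powr kap k + L powr (1 - 4 / 2 ^ k) * \<mu> powr (- kap k))"
    if *: "0 < \<mu>" "1 \<le> \<alpha>" "1 \<le> L" "real v - real u + 1 \<le> L"
      and D: "\<And>j x. j < k \<Longrightarrow> x \<in> {real u..real v} \<Longrightarrow> (F j has_real_derivative F (Suc j) x) (at x)"
      and b: "\<And>x. x \<in> {real u..real v} \<Longrightarrow> \<mu> \<le> F k x \<and> F k x \<le> \<alpha> * \<mu>"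
    for F and u v :: nat and L \<mu> \<alpha> :: real
  proof (cases "u \<le> v")
    case False
    thus ?thesis using * C by simp
  next
    case True
    define N where "N = v - u + 1"
    have "(\<Sum>n=u..v. ee (F 0 (real n))) = (\<Sum>n<N. ee (F 0 (real (u + n))))"
      using True by (intro sum.reindex_bij_witness[of _ "\<lambda>n. u + n" "\<lambda>n. n - u"]) (auto simp: N_def)
    also have "norm \<dots> \<le> C * \<alpha> * (real N * \<mu> powr kap k + real N powr (1 - 4 / 2 ^ k) * \<mu> powr (- kap k))"
    proof (rule T)
      fix n assume n: "n + k < N"
      have "fdiff k (\<lambda>n. F 0 (real (u + n))) n = fdiff k (\<lambda>m. F 0 (real (u + n) + real m)) 0"
        using fdiff_shift[of k "\<lambda>n. F 0 (real (u + n))" n 0] by (simp add: add_ac)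
      moreover have "\<mu> \<le> fdiff k (\<lambda>m. F 0 (real (u + n) + real m)) 0
          \<and> fdiff k (\<lambda>m. F 0 (real (u + n) + real m)) 0 \<le> \<alpha> * \<mu>"
        by (rule fdiff_mean_value[OF D b]) (use n True in \<open>auto simp: N_def\<close>)
      ultimately show "\<mu> \<le> fdiff k (\<lambda>n. F 0 (real (u + n))) n \<and> fdiff k (\<lambda>n. F 0 (real (u + n))) n \<le> \<alpha> * \<mu>" by simp
    qed (use * in \<open>auto simp: N_def\<close>)
    also have "\<dots> \<le> C * \<alpha> * (L * \<mu> powr kap k + L powr (1 - 4 / 2 ^ k) * \<mu> powr (- kap k))"
      using C * p4 True by (intro mult_left_mono add_mono mult_right_mono powr_mono2) (auto simp: N_def field_simps)
    finally show ?thesis .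
  qed
  show ?thesis
  proof (intro exI[of _ C] conjI allI impI C)
    fix F :: "nat \<Rightarrow> real \<Rightarrow> real" and u v :: nat and L \<mu> \<alpha> :: real
    assume *: "0 < \<mu>" "1 \<le> \<alpha>" "1 \<le> L" "real v - real u + 1 \<le> L"
      and "deriv_chain F k {real u..real v}" and b: "bounded_off_zero (F k) {real u..real v} \<mu> \<alpha>"
    hence D: "\<forall>j<k. \<forall>x\<in>{real u..real v}. (F j has_real_derivative F (Suc j) x) (at x)"
      by (simp add: deriv_chain_def)
    from b show "norm (\<Sum>n=u..v. ee (F 0 (real n))) \<le> C * \<alpha> * (L * \<mu> powr kap k + L powr (1 - 4 / 2 ^ k) * \<mu> powr (- kap k))"
      unfolding bounded_off_zero_def
    proof
      assume "\<forall>x\<in>{real u..real v}. \<mu> \<le> F k x \<and> F k x \<le> \<alpha> * \<mu>"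
      thus ?thesis using * D by (intro pos) auto
    next
      assume b: "\<forall>x\<in>{real u..real v}. \<mu> \<le> - F k x \<and> - F k x \<le> \<alpha> * \<mu>"
      have "norm (\<Sum>n=u..v. ee (- F 0 (real n))) \<le> C * \<alpha> * (L * \<mu> powr kap k + L powr (1 - 4 / 2 ^ k) * \<mu> powr (- kap k))"
        using * D b by (intro pos[where F = "\<lambda>j x. - F j x"]) (auto intro!: DERIV_minus)
      moreover have "(\<Sum>n=u..v. ee (- F 0 (real n))) = cnj (\<Sum>n=u..v. ee (F 0 (real n)))"
        by (simp add: ee_minus)
      ultimately show ?thesis by (simp only: complex_mod_cnj)
    qed
  qed
qed

section \<open>The sawtooth function\<close>

definition psi :: "real \<Rightarrow> real" where "psi x = frac x - 1 / 2"
definition psi_part :: "nat \<Rightarrow> real \<Rightarrow> real" where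
  "psi_part K x = - (\<Sum>k=1..K. sin (2 * pi * real k * x) / (pi * real k))"

text \<open>Mean square over a period of the sawtooth minus its partial Fourier sum:
  \<open>1 / 12\<close> belongs to the sawtooth itself, and each harmonic removes its own
  share.\<close>

definition psi_def_sq :: "nat \<Rightarrow> real" where
  "psi_def_sq K = 1 / 12 - (\<Sum>k=1..K. 1 / (2 * pi^2 * (real k)^2))"

lemma has_real_derivative_sin_scaled:
  assumes "c \<noteq> (0::real)"
  shows "((\<lambda>x. sin (c * x) / c) has_real_derivative cos (c * x)) (at x within S)"
  using assms by (auto intro!: derivative_eq_intros)

lemma has_integral_sin_sin:
  fixes j k :: nat
  assumes "1 \<le> j" "j < k"
  shows "((\<lambda>x. sin (2 * pi * j * x) * sin (2 * pi * k * x)) has_integral 0) {0..1}"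
proof -
  define F where "F x = (sin (2 * pi * real (k - j) * x) / (2 * pi * real (k - j))) / 2
      - (sin (2 * pi * real (k + j) * x) / (2 * pi * real (k + j))) / 2" for x
  have "((\<lambda>x. sin (2 * pi * j * x) * sin (2 * pi * k * x)) has_integral F 1 - F 0) {0..1}"
  proof (rule fundamental_theorem_of_calculus)
    fix x :: real
    have "sin (2 * pi * j * x) * sin (2 * pi * k * x)
        = cos (2 * pi * real (k - j) * x) / 2 - cos (2 * pi * real (k + j) * x) / 2"
      using assms by (simp add: of_nat_diff distrib_left distrib_right left_diff_distrib right_diff_distrib
          cos_add cos_diff diff_divide_distrib add_divide_distrib)
    moreover have "(F has_real_derivative
      cos (2 * pi * real (k - j) * x) / 2 - cos (2 * pi * real (k + j) * x) / 2) (at x within {0..1})"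
      unfolding F_def using assms
      by (intro DERIV_diff DERIV_cdivide has_real_derivative_sin_scaled) auto
    ultimately show "(F has_vector_derivative sin (2 * pi * j * x) * sin (2 * pi * k * x)) (at x within {0..1})"
      by (simp add: has_real_derivative_iff_has_vector_derivative)
  qed auto
  moreover have "F 1 - F 0 = 0"
    using sin_integer_2pi[of "real (k - j)"] sin_integer_2pi[of "real (k + j)"] by (simp add: F_def)
  ultimately show ?thesis by simp
qed

lemma has_integral_sin_sq:
  fixes k :: nat
  assumes "1 \<le> k"
  shows "((\<lambda>x. sin (2 * pi * k * x) * sin (2 * pi * k * x)) has_integral 1 / 2) {0..1}"
proof -
  define F where "F x = x / 2 - (sin (2 * pi * real (2 * k) * x) / (2 * pi * real (2 * k))) / 2" for x
  have "((\<lambda>x. sin (2 * pi * k * x) * sin (2 * pi * k * x)) has_integral F 1 - F 0) {0..1}"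
  proof (rule fundamental_theorem_of_calculus)
    fix x :: real
    have "sin (2 * pi * k * x) * sin (2 * pi * k * x) = 1 / 2 - cos (2 * pi * real (2 * k) * x) / 2"
      by (simp add: sin_times_sin mult_ac)
    moreover have "(F has_real_derivative 1 / 2 - cos (2 * pi * real (2 * k) * x) / 2) (at x within {0..1})"
      unfolding F_def using assms
      by (intro DERIV_diff DERIV_cdivide has_real_derivative_sin_scaled DERIV_ident) auto
    ultimately show "(F has_vector_derivative sin (2 * pi * k * x) * sin (2 * pi * k * x)) (at x within {0..1})"
      by (simp add: has_real_derivative_iff_has_vector_derivative)
  qed auto
  moreover have "F 1 - F 0 = 1 / 2"
    using sin_integer_2pi[of "real (2 * k)"] by (simp add: F_def)
  ultimately show ?thesis by simp
qed

lemma has_integral_linear_sin: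
  fixes k :: nat
  assumes "1 \<le> k"
  shows "((\<lambda>x. (x - 1 / 2) * sin (2 * pi * k * x)) has_integral - (1 / (2 * pi * k))) {0..1}"
proof -
  define F where "F x = - (x - 1 / 2) * cos (2 * pi * k * x) / (2 * pi * k)
    + sin (2 * pi * k * x) / (2 * pi * k)^2" for x
  have "((\<lambda>x. (x - 1 / 2) * sin (2 * pi * k * x)) has_integral F 1 - F 0) {0..1}"
  proof (rule fundamental_theorem_of_calculus)
    fix x :: real
    have "(F has_real_derivative (x - 1 / 2) * sin (2 * pi * k * x)) (at x within {0..1})"
      unfolding F_def using assms by (auto intro!: derivative_eq_intros simp: field_simps power2_eq_square)
    thus "(F has_vector_derivative (x - 1 / 2) * sin (2 * pi * k * x)) (at x within {0..1})"
      by (simp add: has_real_derivative_iff_has_vector_derivative)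
  qed auto
  moreover have "F 1 - F 0 = - (1 / (2 * pi * k))"
    using sin_integer_2pi[of "real k"] cos_integer_2pi[of "real k"] by (simp add: F_def field_simps)
  ultimately show ?thesis by simp
qed

lemma has_integral_psi_def_sin:
  assumes "K < k"
  shows "((\<lambda>x. (x - 1 / 2 - psi_part K x) * sin (2 * pi * k * x)) has_integral - (1 / (2 * pi * k))) {0..1}"
proof -
  have "((\<lambda>x. (x - 1 / 2) * sin (2 * pi * k * x)
      + (\<Sum>j=1..K. 1 / (pi * j) * (sin (2 * pi * j * x) * sin (2 * pi * k * x))))
      has_integral - (1 / (2 * pi * k)) + (\<Sum>j=1..K. 1 / (pi * j) * 0)) {0..1}"
    using assms by (intro has_integral_add has_integral_linear_sin has_integral_sum
        has_integral_mult_right has_integral_sin_sin) auto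
  thus ?thesis by (simp add: psi_part_def algebra_simps sum_distrib_left sum_distrib_right)
qed

text \<open>Add one harmonic at a time. The cross term of the new sine with the old defect sees only
  the linear part, by orthogonality, and equals minus twice the new square; the net change is
  \<open>- 1 / (2 * pi^2 * k^2)\<close>.\<close>

lemma has_integral_psi_def_sq:
  "((\<lambda>x. (x - 1 / 2 - psi_part K x)^2) has_integral psi_def_sq K) {0..1}"
proof (induction K)
  case 0
  have "((\<lambda>x::real. (x - 1 / 2)^2) has_integral ((1 - 1/2) ^ 3 / 3 - (0 - 1/2) ^ 3 / 3)) {0..1}"
    by (rule fundamental_theorem_of_calculus)
      (auto intro!: derivative_eq_intros simp flip: has_real_derivative_iff_has_vector_derivative)
  thus ?case by (simp add: psi_part_def psi_def_sq_def power3_eq_cube)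
next
  case (Suc K)
  define k where "k = Suc K"
  define i where "i = 1 / (pi * real k)"
  have "((\<lambda>x. (x - 1 / 2 - psi_part K x)^2
      + (2 * i * ((x - 1 / 2 - psi_part K x) * sin (2 * pi * k * x))
         + i^2 * (sin (2 * pi * k * x) * sin (2 * pi * k * x))))
      has_integral psi_def_sq K + (2 * i * (- (1 / (2 * pi * k))) + i^2 * (1 / 2))) {0..1}"
    by (intro has_integral_add has_integral_mult_right Suc has_integral_psi_def_sin has_integral_sin_sq)
      (auto simp: k_def)
  moreover have "psi_def_sq K + (2 * i * (- (1 / (2 * pi * k))) + i^2 * (1 / 2)) = psi_def_sq (Suc K)"
  proof -
    have "psi_def_sq (Suc K) = psi_def_sq K - 1 / (2 * pi^2 * (real k)^2)"
      by (simp add: psi_def_sq_def k_def)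
    moreover have "2 * i * (- (1 / (2 * pi * k))) + i^2 * (1 / 2) = - (1 / (2 * pi^2 * (real k)^2))"
      by (simp add: i_def power2_eq_square field_simps)
    ultimately show ?thesis by simp
  qed
  moreover have "(x - 1 / 2 - psi_part K x)^2
      + (2 * i * ((x - 1 / 2 - psi_part K x) * sin (2 * pi * k * x))
         + i^2 * (sin (2 * pi * k * x) * sin (2 * pi * k * x))) = (x - 1 / 2 - psi_part (Suc K) x)^2" for x
  proof -
    have e: "x - 1 / 2 - psi_part (Suc K) x = (x - 1 / 2 - psi_part K x) + i * sin (2 * pi * k * x)"
      by (simp add: psi_part_def i_def k_def)
    show ?thesis unfolding e by (simp add: power2_eq_square algebra_simps)
  qed
  ultimately show ?case by simp
qed

lemma psi_def_sq_nonneg: "psi_def_sq K \<ge> 0"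
  using has_integral_nonneg[OF has_integral_psi_def_sq] by simp

text \<open>The sum \<open>pi^2 / 6\<close> of the inverse squares cancels \<open>1 / 12\<close>
  exactly; this is Parseval's identity for the sawtooth.\<close>

lemma psi_def_sq_tendsto: "psi_def_sq \<longlonglongrightarrow> 0"
proof -
  have "(\<lambda>n. \<Sum>k<n. 1 / (real k + 1)^2) \<longlonglongrightarrow> pi\<^sup>2 / 6"
    using inverse_squares_sums by (simp add: sums_def add.commute)
  moreover have "(\<Sum>k<n. 1 / (real k + 1)^2) = (\<Sum>k=1..n. 1 / (real k)^2)" for n
    by (rule sum.reindex_bij_witness[of _ "\<lambda>k. k - 1" Suc]) (auto simp: add.commute)
  ultimately have "(\<lambda>n. 1 / 12 - 1 / (2 * pi^2) * (\<Sum>k=1..n. 1 / (real k)^2)) \<longlonglongrightarrow> 1 / 12 - 1 / (2 * pi^2) * (pi^2 / 6)"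
    by (intro tendsto_intros) simp
  moreover have "1 / 12 - 1 / (2 * pi^2) * (\<Sum>k=1..n. 1 / (real k)^2) = psi_def_sq n" for n
    by (simp add: psi_def_sq_def sum_distrib_left)
  ultimately show ?thesis by simp
qed

text \<open>The bound \<open>2 \<bar>u\<bar> \<le> \<epsilon> + u^2 / \<epsilon>\<close> passes from mean square to mean convergence.\<close>

definition psi_l1 :: "nat \<Rightarrow> real" where
  "psi_l1 K = integral {0..1} (\<lambda>x. \<bar>x - 1 / 2 - psi_part K x\<bar>)"

lemma continuous_on_psi_part [continuous_intros]: "continuous_on A (psi_part K)"
  unfolding psi_part_def by (intro continuous_intros) auto

lemma psi_l1_tendsto: "psi_l1 \<longlonglongrightarrow> 0"
proof -
  \<comment> \<open>The summand \<open>1 / real (Suc K)\<close> keeps \<open>s K\<close> positive,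
    so that it may serve as the \<epsilon> one divides by.\<close>
  define s where "s K = sqrt (psi_def_sq K + 1 / real (Suc K))" for K
  have s: "s K > 0" "psi_def_sq K \<le> (s K)^2" for K
    using psi_def_sq_nonneg[of K] by (auto simp: s_def add_nonneg_pos)
  have "s \<longlonglongrightarrow> sqrt (0 + 0)" unfolding s_def
    by (intro tendsto_intros psi_def_sq_tendsto LIMSEQ_Suc[OF lim_1_over_n])
  hence lim: "s \<longlonglongrightarrow> 0" by simp
  have "psi_l1 K \<le> s K" for K
  proof -
    have f1: "((\<lambda>x. (s K + (x - 1 / 2 - psi_part K x)^2 / s K) / 2) has_integral (s K + psi_def_sq K / s K) / 2) {0..1}"
      using has_integral_divide[OF has_integral_add[OF has_integral_const_real[of "s K" 0 1]
            has_integral_divide[OF has_integral_psi_def_sq[of K], of "s K"]], of 2] by simp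
    have f2: "((\<lambda>x. \<bar>x - 1 / 2 - psi_part K x\<bar>) has_integral psi_l1 K) {0..1}"
      unfolding psi_l1_def by (intro integrable_integral integrable_continuous_interval continuous_intros)
    have pw: "\<bar>u\<bar> \<le> (s K + u^2 / s K) / 2" for u
    proof -
      have "0 \<le> (s K - \<bar>u\<bar>)^2 / s K" using s(1)[of K] by simp
      also have "\<dots> = s K - 2 * \<bar>u\<bar> + u^2 / s K"
        using s(1)[of K] by (simp add: power2_eq_square field_simps abs_mult_self_eq)
      finally show ?thesis by simp
    qed
    have "psi_l1 K \<le> (s K + psi_def_sq K / s K) / 2"
      by (rule has_integral_le[OF f2 f1 pw])
    also have "psi_def_sq K / s K \<le> s K" using s[of K] by (simp add: field_simps power2_eq_square)
    finally show ?thesis by simp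
  qed
  moreover have "psi_l1 K \<ge> 0" for K
    unfolding psi_l1_def by (intro integral_nonneg integrable_continuous_interval continuous_intros) auto
  ultimately show ?thesis
    by (intro tendsto_sandwich[OF _ _ tendsto_const lim]) auto
qed

text \<open>Periodic antiderivative of \<open>psi\<close>, up to a constant half of the second
  Bernoulli function. It is continuous, and its Fourier series converges absolutely.\<close>

definition beta :: "real \<Rightarrow> real" where "beta x = frac x * (frac x - 1) / 2"
definition beta_part :: "nat \<Rightarrow> real \<Rightarrow> real" where
  "beta_part K x = (\<Sum>k=1..K. cos (2 * pi * k * x) / (2 * pi^2 * (real k)^2))"

lemma beta_part_deriv: "(beta_part K has_real_derivative psi_part K x) (at x within A)"
  unfolding beta_part_def psi_part_def
  by (auto intro!: derivative_eq_intros simp: sum_negf[symmetric] power2_eq_square field_simps intro!: sum.cong)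

text \<open>Integrate the defect of the sawtooth from 0 to \<open>frac x\<close>; convergence in
  mean controls the integral. Subtracting the value at 0 removes the constant term of the
  series.\<close>

lemma beta_part_tendsto: "(\<lambda>K. beta_part K x - beta_part K 0) \<longlonglongrightarrow> beta x"
proof -
  define y where "y = frac x"
  have y: "0 \<le> y" "y \<le> 1" by (auto simp: y_def frac_lt_1 less_imp_le)
  have per: "beta_part K x = beta_part K y" for K
  proof -
    have "cos (2 * pi * k * x) = cos (2 * pi * k * y)" for k :: nat
    proof -
      have "2 * pi * k * x = 2 * pi * k * y + 2 * pi * of_int (int k * \<lfloor>x\<rfloor>)"
        by (simp add: y_def frac_def algebra_simps)
      thus ?thesis by (simp only: cos_add sin_int_2pin cos_int_2pin)
    qed
    thus ?thesis by (simp add: beta_part_def)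
  qed
  have "\<bar>beta x - (beta_part K x - beta_part K 0)\<bar> \<le> psi_l1 K" for K
  proof -
    have "((\<lambda>t. t - 1 / 2 - psi_part K t) has_integral
      (y * (y - 1) / 2 - beta_part K y) - (0 * (0 - 1) / 2 - beta_part K 0)) {0..y}"
    proof (rule fundamental_theorem_of_calculus)
      fix t assume "t \<in> {0..y}"
      show "((\<lambda>t. t * (t - 1) / 2 - beta_part K t) has_vector_derivative t - 1 / 2 - psi_part K t) (at t within {0..y})"
        unfolding has_real_derivative_iff_has_vector_derivative[symmetric]
        by (auto intro!: derivative_eq_intros beta_part_deriv simp: field_simps)
    qed (use y in auto)
    hence "beta x - (beta_part K x - beta_part K 0) = integral {0..y} (\<lambda>t. t - 1 / 2 - psi_part K t)"
      by (simp add: per beta_def y_def[symmetric] integral_unique)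
    also have "\<bar>\<dots>\<bar> \<le> integral {0..y} (\<lambda>t. \<bar>t - 1 / 2 - psi_part K t\<bar>)"
      using integral_norm_bound_integral[of "\<lambda>t. t - 1 / 2 - psi_part K t" "{0..y}" "\<lambda>t. \<bar>t - 1 / 2 - psi_part K t\<bar>"]
      by (simp add: integrable_continuous_interval continuous_intros)
    also have "\<dots> \<le> psi_l1 K" unfolding psi_l1_def
      using y by (intro integral_subset_le integrable_continuous_interval continuous_intros) auto
    finally show ?thesis .
  qed
  hence "(\<lambda>K. beta x - (beta_part K x - beta_part K 0)) \<longlonglongrightarrow> 0"
    by (intro Lim_null_comparison[OF _ psi_l1_tendsto]) auto
  from tendsto_diff[OF tendsto_const[of "beta x"] this] show ?thesis by simp
qed

lemma frac_sub_cases: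
  fixes x \<eta> :: real
  assumes "0 < \<eta>" "\<eta> < 1"
  shows "frac (x - \<eta>) = (if frac x \<ge> \<eta> then frac x - \<eta> else frac x - \<eta> + 1)"
    and "frac (x + \<eta>) = (if frac x + \<eta> < 1 then frac x + \<eta> else frac x + \<eta> - 1)"
proof -
  have f: "0 \<le> frac x" "frac x < 1" by (auto simp: frac_lt_1)
  have x: "x = of_int \<lfloor>x\<rfloor> + frac x" by (simp add: frac_def)
  have u: "frac y = c" if "y = of_int n + c" "0 \<le> c" "c < 1" for y c :: real and n :: int
    using that by (simp add: frac_unique_iff)
  have 1: "frac (x - \<eta>) = frac x - \<eta>" if "frac x \<ge> \<eta>"
    by (rule u[of _ "\<lfloor>x\<rfloor>"]) (use that f x assms in linarith)+
  have 2: "frac (x - \<eta>) = frac x - \<eta> + 1" if "\<not> frac x \<ge> \<eta>"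
    by (rule u[of _ "\<lfloor>x\<rfloor> - 1"]) (use that f x assms in \<open>simp; linarith\<close>)+
  have 3: "frac (x + \<eta>) = frac x + \<eta>" if "frac x + \<eta> < 1"
    by (rule u[of _ "\<lfloor>x\<rfloor>"]) (use that f x assms in linarith)+
  have 4: "frac (x + \<eta>) = frac x + \<eta> - 1" if "\<not> frac x + \<eta> < 1"
    by (rule u[of _ "\<lfloor>x\<rfloor> + 1"]) (use that f x assms in \<open>simp; linarith\<close>)+
  show "frac (x - \<eta>) = (if frac x \<ge> \<eta> then frac x - \<eta> else frac x - \<eta> + 1)"
    using 1 2 by simp
  show "frac (x + \<eta>) = (if frac x + \<eta> < 1 then frac x + \<eta> else frac x + \<eta> - 1)"
    using 3 4 by simp
qed

text \<open>\<open>psi\<close> has slope 1 and jumps only downwards, so it exceeds an earlier value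
  by at most the distance. Averaging over the window of length \<open>\<eta>\<close> before
  \<open>x\<close> bounds \<open>psi x\<close> from above; the window after \<open>x\<close> bounds
  it from below in \<open>psi_ge_beta_diff\<close>.\<close>

lemma psi_le_beta_diff:
  assumes "0 < \<eta>" "\<eta> < 1"
  shows "\<eta> * psi x \<le> (beta x - beta (x - \<eta>)) + \<eta>\<^sup>2 / 2"
  unfolding psi_def beta_def frac_sub_cases(1)[OF assms]
  by (auto simp: field_simps power2_eq_square)

lemma psi_ge_beta_diff:
  assumes "0 < \<eta>" "\<eta> < 1"
  shows "(beta (x + \<eta>) - beta x) - \<eta>\<^sup>2 / 2 \<le> \<eta> * psi x"
  unfolding psi_def beta_def frac_sub_cases(2)[OF assms]
  by (auto simp: field_simps power2_eq_square)


text \<open>Smoothing the sawtooth over a window of length \<open>\<eta>\<close> costs at most \<open>\<eta>\<close> per point and makes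
  its Fourier series absolutely convergent.\<close>

lemma norm_one_minus_ee_le: "norm (1 - ee t) \<le> 2 * pi * \<bar>t\<bar>"
proof -
  have "ee t - 1 = cis (pi * t) * (2 * \<i> * of_real (sin (pi * t)))"
  proof -
    have "ee t = cis (pi * t) * cis (pi * t)" "1 = cis (pi * t) * cis (- (pi * t))"
      by (simp_all add: ee_def cis_mult mult.assoc)
    hence "ee t - 1 = cis (pi * t) * (cis (pi * t) - cis (- (pi * t)))" by (simp add: right_diff_distrib)
    also have "cis (pi * t) - cis (- (pi * t)) = 2 * \<i> * of_real (sin (pi * t))" by (simp add: complex_eq_iff)
    finally show ?thesis .
  qed
  hence "norm (ee t - 1) = 2 * \<bar>sin (pi * t)\<bar>" by (simp add: norm_mult)
  hence "norm (1 - ee t) = 2 * \<bar>sin (pi * t)\<bar>" by (simp only: norm_minus_commute)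
  also have "\<dots> \<le> 2 * \<bar>pi * t\<bar>" using abs_sin_x_le_abs_x by simp
  finally show ?thesis by (simp add: abs_mult)
qed

abbreviation smooth_weight :: "real \<Rightarrow> nat \<Rightarrow> real" where
  "smooth_weight \<eta> k \<equiv> min (1 / real k) (1 / (\<eta> * (real k)^2))"

lemma psi_sum_bound:
  fixes x :: "'a \<Rightarrow> real" and \<eta> :: real
  assumes \<eta>: "0 < \<eta>" "\<eta> < 1"
    and B: "\<And>k. 1 \<le> k \<Longrightarrow> norm (\<Sum>n\<in>A. ee (real k * x n)) \<le> B k"
    and M: "\<And>K. (\<Sum>k=1..K. smooth_weight \<eta> k * B k) \<le> M"
  shows "\<bar>\<Sum>n\<in>A. psi (x n)\<bar> \<le> card A * \<eta> + M"
proof -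
  \<comment> \<open>\<open>u = 0\<close> describes the windows before the points, for the upper
    bound, and \<open>u = \<eta>\<close> those after them, for the lower bound.\<close>
  have key: "\<bar>\<Sum>n\<in>A. beta (x n + u) - beta (x n + u - \<eta>)\<bar> \<le> \<eta> * M" for u
  proof -
    have part: "\<bar>\<Sum>n\<in>A. beta_part K (x n + u) - beta_part K (x n + u - \<eta>)\<bar> \<le> \<eta> * M" for K
    proof -
      have trm: "\<bar>\<Sum>n\<in>A. cos (2 * pi * k * (x n + u)) - cos (2 * pi * k * (x n + u - \<eta>))\<bar>
          \<le> min 2 (2 * pi * k * \<eta>) * B k" if "1 \<le> k" for k :: nat
      proof -
        have "(\<Sum>n\<in>A. cos (2 * pi * k * (x n + u)) - cos (2 * pi * k * (x n + u - \<eta>)))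
          = Re (ee (k * u) * (1 - ee (- (k * \<eta>))) * (\<Sum>n\<in>A. ee (k * x n)))"
        proof -
          have "ee (k * u) * (1 - ee (- (k * \<eta>))) * ee (k * x n) = ee (k * (x n + u)) - ee (k * (x n + u - \<eta>))" for n
          proof -
            have "k * (x n + u) = k * u + k * x n" "k * (x n + u - \<eta>) = k * u + (- (k * \<eta>)) + k * x n"
              by (simp_all add: algebra_simps)
            thus ?thesis by (simp only: ee_add) (simp add: algebra_simps)
          qed
          hence "Re (ee (k * u) * (1 - ee (- (k * \<eta>))) * (\<Sum>n\<in>A. ee (k * x n)))
             = (\<Sum>n\<in>A. Re (ee (k * (x n + u)) - ee (k * (x n + u - \<eta>))))"
            by (simp only: sum_distrib_left Re_sum)
          thus ?thesis by (simp add: ee_def mult.assoc)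
        qed
        also have "\<bar>\<dots>\<bar> \<le> norm (ee (k * u) * (1 - ee (- (k * \<eta>))) * (\<Sum>n\<in>A. ee (k * x n)))"
          by (rule abs_Re_le_cmod)
        also have "\<dots> = norm (1 - ee (- (k * \<eta>))) * norm (\<Sum>n\<in>A. ee (k * x n))"
          by (simp add: norm_mult)
        also have "\<dots> \<le> min 2 (2 * pi * k * \<eta>) * B k"
        proof (rule mult_mono[OF _ B[OF that]])
          have "norm (1 - ee (- (k * \<eta>))) \<le> 2"
            using norm_triangle_ineq4[of 1 "ee (- (k * \<eta>))"] by simp
          moreover have "norm (1 - ee (- (k * \<eta>))) \<le> 2 * pi * k * \<eta>"
            using norm_one_minus_ee_le[of "- (k * \<eta>)"] \<eta> by (simp add: abs_mult mult_ac)
          ultimately show "norm (1 - ee (- (k * \<eta>))) \<le> min 2 (2 * pi * k * \<eta>)" by simp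
        qed (use \<eta> in auto)
        finally show ?thesis .
      qed
      have "(\<Sum>n\<in>A. beta_part K (x n + u) - beta_part K (x n + u - \<eta>))
        = (\<Sum>n\<in>A. \<Sum>k=1..K. (cos (2 * pi * k * (x n + u)) - cos (2 * pi * k * (x n + u - \<eta>))) / (2 * pi^2 * (real k)^2))"
        by (simp add: beta_part_def sum_subtractf diff_divide_distrib)
      also have "\<dots> = (\<Sum>k=1..K. \<Sum>n\<in>A. (cos (2 * pi * k * (x n + u)) - cos (2 * pi * k * (x n + u - \<eta>))) / (2 * pi^2 * (real k)^2))"
        by (rule sum.swap)
      finally have eq: "(\<Sum>n\<in>A. beta_part K (x n + u) - beta_part K (x n + u - \<eta>))
        = (\<Sum>k=1..K. \<Sum>n\<in>A. (cos (2 * pi * k * (x n + u)) - cos (2 * pi * k * (x n + u - \<eta>))) / (2 * pi^2 * (real k)^2))" .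
      have "\<bar>\<Sum>n\<in>A. beta_part K (x n + u) - beta_part K (x n + u - \<eta>)\<bar> \<le> (\<Sum>k=1..K. \<eta> * (smooth_weight \<eta> k * B k))"
      unfolding eq
      proof (rule order.trans[OF sum_abs sum_mono])
        fix k assume "k \<in> {1..K}"
        hence k: "1 \<le> k" by simp
        have B0: "B k \<ge> 0" using B[OF k] norm_ge_zero order.trans by blast
        have "\<bar>\<Sum>n\<in>A. (cos (2 * pi * k * (x n + u)) - cos (2 * pi * k * (x n + u - \<eta>))) / (2 * pi^2 * (real k)^2)\<bar>
          = \<bar>\<Sum>n\<in>A. cos (2 * pi * k * (x n + u)) - cos (2 * pi * k * (x n + u - \<eta>))\<bar> / (2 * pi^2 * (real k)^2)"
          by (simp add: sum_divide_distrib[symmetric] abs_mult)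
        also have "\<dots> \<le> (min 2 (2 * pi * k * \<eta>) * B k) / (2 * pi^2 * (real k)^2)"
          by (intro divide_right_mono trm k) auto
        also have "\<dots> = (min 2 (2 * pi * k * \<eta>) / (2 * pi^2 * (real k)^2)) * B k" by simp
        also have "\<dots> \<le> (\<eta> * smooth_weight \<eta> k) * B k"
        proof (rule mult_right_mono[OF _ B0])
          have p: "1 \<le> pi" "1 \<le> pi^2" using pi_ge_two by (auto intro: one_le_power)
          have "min 2 (2 * pi * k * \<eta>) / (2 * pi^2 * (real k)^2) \<le> (2 * pi * k * \<eta>) / (2 * pi^2 * (real k)^2)"
            by (intro divide_right_mono) auto
          also have "\<dots> = (\<eta> / k) / pi" using k by (simp add: power2_eq_square field_simps)
          also have "\<dots> \<le> (\<eta> / k) / 1" using p \<eta> k by (intro divide_left_mono) auto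
          finally have 1: "min 2 (2 * pi * k * \<eta>) / (2 * pi^2 * (real k)^2) \<le> \<eta> * (1 / k)" by simp
          have "min 2 (2 * pi * k * \<eta>) / (2 * pi^2 * (real k)^2) \<le> 2 / (2 * pi^2 * (real k)^2)"
            by (intro divide_right_mono) auto
          also have "\<dots> = (1 / (real k)^2) / pi^2" by simp
          also have "\<dots> \<le> (1 / (real k)^2) / 1" using p k by (intro divide_left_mono) auto
          finally have 2: "min 2 (2 * pi * k * \<eta>) / (2 * pi^2 * (real k)^2) \<le> \<eta> * (1 / (\<eta> * (real k)^2))"
            using \<eta> by simp
          show "min 2 (2 * pi * k * \<eta>) / (2 * pi^2 * (real k)^2) \<le> \<eta> * smooth_weight \<eta> k"
            using 1 2 \<eta> by (simp add: min_def)
        qed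
        finally show "\<bar>\<Sum>n\<in>A. (cos (2 * pi * k * (x n + u)) - cos (2 * pi * k * (x n + u - \<eta>))) / (2 * pi^2 * (real k)^2)\<bar>
          \<le> \<eta> * (smooth_weight \<eta> k * B k)" by (simp only: mult.assoc)
      qed
      also have "\<dots> = \<eta> * (\<Sum>k=1..K. smooth_weight \<eta> k * B k)"
        by (rule sum_distrib_left[symmetric])
      also have "\<dots> \<le> \<eta> * M" using \<eta>(1) by (intro mult_left_mono M) auto
      finally show ?thesis .
    qed
    have "(\<lambda>K. \<Sum>n\<in>A. (beta_part K (x n + u) - beta_part K 0) - (beta_part K (x n + u - \<eta>) - beta_part K 0))
       \<longlonglongrightarrow> (\<Sum>n\<in>A. beta (x n + u) - beta (x n + u - \<eta>))"
      by (intro tendsto_sum tendsto_diff beta_part_tendsto)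
    hence "(\<lambda>K. \<bar>\<Sum>n\<in>A. beta_part K (x n + u) - beta_part K (x n + u - \<eta>)\<bar>)
       \<longlonglongrightarrow> \<bar>\<Sum>n\<in>A. beta (x n + u) - beta (x n + u - \<eta>)\<bar>" by (intro tendsto_rabs) simp
    thus ?thesis by (rule LIMSEQ_le_const2) (use part in auto)
  qed
  have "\<eta> * (\<Sum>n\<in>A. psi (x n)) \<le> (\<Sum>n\<in>A. (beta (x n + 0) - beta (x n + 0 - \<eta>)) + \<eta>\<^sup>2 / 2)"
    unfolding sum_distrib_left using psi_le_beta_diff[OF \<eta>] by (intro sum_mono) simp
  also have "\<dots> \<le> \<eta> * M + card A * (\<eta>\<^sup>2 / 2)" using key[of 0] by (simp add: sum.distrib)
  finally have up: "\<eta> * (\<Sum>n\<in>A. psi (x n)) \<le> \<eta> * M + card A * (\<eta>\<^sup>2 / 2)" .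
  have "\<eta> * M + card A * (\<eta>\<^sup>2 / 2) \<ge> - (\<Sum>n\<in>A. (beta (x n + \<eta>) - beta (x n + \<eta> - \<eta>)) - \<eta>\<^sup>2 / 2)"
    using key[of \<eta>] by (simp add: sum_subtractf)
  moreover have "(\<Sum>n\<in>A. (beta (x n + \<eta>) - beta (x n + \<eta> - \<eta>)) - \<eta>\<^sup>2 / 2) \<le> \<eta> * (\<Sum>n\<in>A. psi (x n))"
    unfolding sum_distrib_left using psi_ge_beta_diff[OF \<eta>] by (intro sum_mono) simp
  ultimately have "\<bar>\<eta> * (\<Sum>n\<in>A. psi (x n))\<bar> \<le> \<eta> * M + card A * (\<eta>\<^sup>2 / 2)" using up by linarith
  also have "\<dots> = \<eta> * (M + card A * \<eta> / 2)" by (simp add: power2_eq_square algebra_simps)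
  finally have "\<bar>\<Sum>n\<in>A. psi (x n)\<bar> \<le> M + card A * \<eta> / 2" using \<eta> by (simp add: abs_mult)
  thus ?thesis using \<eta> by (smt (verit) mult_nonneg_nonneg of_nat_0_le_iff field_sum_of_halves)
qed

section \<open>Poisson summation\<close>

text \<open>Integrate by parts twice: the linear function \<open>x - n - 1/2\<close> against
  \<open>g'\<close> produces the trapezoid minus the integral, and the sines of its Fourier series
  against \<open>g'\<close> produce the cosine integrals. The difference is the defect of the
  sawtooth integrated against the bounded function \<open>g'\<close>, which tends to 0 by
  \<open>psi_l1_tendsto\<close>.\<close>

lemma poisson_unit:
  fixes g g' :: "real \<Rightarrow> complex" and n :: nat
  assumes d: "\<And>x. x \<in> {real n..real n + 1} \<Longrightarrow> (g has_vector_derivative g' x) (at x within {real n..real n + 1})"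
    and c: "continuous_on {real n..real n + 1} g'"
  shows "(\<lambda>K. \<Sum>k=1..K. integral {real n..real n + 1} (\<lambda>x. 2 * cos (2 * pi * real k * x) *\<^sub>R g x))
     \<longlonglongrightarrow> (g n + g (n + 1)) / 2 - integral {real n..real n + 1} g"
proof -
  let ?I = "{real n..real n + 1}"
  have cg: "continuous_on ?I g"
    using d by (intro continuous_on_vector_derivative) blast
  obtain M where M: "M > 0" "\<And>x. x \<in> ?I \<Longrightarrow> norm (g' x) \<le> M"
    using compact_imp_bounded[OF compact_continuous_image[OF c]] by (auto simp: bounded_pos)
  have lin: "integral ?I (\<lambda>x. (x - n - 1 / 2) *\<^sub>R g' x) = (g n + g (n + 1)) / 2 - integral ?I g"
  proof -
    define f where "f x = (x - n - 1 / 2) *\<^sub>R g x" for x :: real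
    have "((\<lambda>x. (x - n - 1 / 2) *\<^sub>R g' x + g x) has_integral f (real n + 1) - f n) ?I"
    proof (rule fundamental_theorem_of_calculus)
      fix x assume x: "x \<in> ?I"
      have "((\<lambda>x. x - real n - 1 / 2) has_real_derivative 1) (at x within ?I)"
        by (auto intro!: derivative_eq_intros)
      from has_vector_derivative_scaleR[OF this d[OF x]]
      show "(f has_vector_derivative (x - n - 1 / 2) *\<^sub>R g' x + g x) (at x within ?I)"
        by (simp add: f_def[abs_def])
    qed simp
    hence "integral ?I (\<lambda>x. (x - n - 1 / 2) *\<^sub>R g' x + g x) = (g n + g (n + 1)) / 2"
      by (simp add: integral_unique f_def scaleR_conv_of_real add_divide_distrib add.commute)
    moreover have "integral ?I (\<lambda>x. (x - n - 1 / 2) *\<^sub>R g' x + g x)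
      = integral ?I (\<lambda>x. (x - n - 1 / 2) *\<^sub>R g' x) + integral ?I g"
      by (intro integral_add integrable_continuous_interval continuous_intros c cg)
    ultimately show ?thesis by (simp add: algebra_simps)
  qed
  have trig: "integral ?I (\<lambda>x. (sin (2 * pi * k * x) / (pi * k)) *\<^sub>R g' x)
      = - integral ?I (\<lambda>x. 2 * cos (2 * pi * k * x) *\<^sub>R g x)" if "1 \<le> k" for k :: nat
  proof -
    define f where "f x = (sin (2 * pi * k * x) / (pi * k)) *\<^sub>R g x" for x :: real
    have "((\<lambda>x. (sin (2 * pi * k * x) / (pi * k)) *\<^sub>R g' x + (2 * cos (2 * pi * k * x)) *\<^sub>R g x)
        has_integral f (real n + 1) - f n) ?I"
    proof (rule fundamental_theorem_of_calculus)
      fix x assume x: "x \<in> ?I"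
      have "((\<lambda>x. sin (2 * pi * k * x) / (pi * k)) has_real_derivative 2 * cos (2 * pi * k * x)) (at x within ?I)"
        using that by (auto intro!: derivative_eq_intros)
      from has_vector_derivative_scaleR[OF this d[OF x]]
      show "(f has_vector_derivative
          (sin (2 * pi * k * x) / (pi * k)) *\<^sub>R g' x + (2 * cos (2 * pi * k * x)) *\<^sub>R g x) (at x within ?I)"
        by (simp add: f_def[abs_def])
    qed simp
    moreover have "f (real n + 1) = 0" "f n = 0"
      using sin_integer_2pi[of "real (k * (n + 1))"] sin_integer_2pi[of "real (k * n)"]
      by (simp_all add: mult.assoc f_def add.commute distrib_left)
    ultimately have "integral ?I (\<lambda>x. (sin (2 * pi * k * x) / (pi * k)) *\<^sub>R g' x + (2 * cos (2 * pi * k * x)) *\<^sub>R g x) = 0"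
      by (simp add: integral_unique)
    moreover have "integral ?I (\<lambda>x. (sin (2 * pi * k * x) / (pi * k)) *\<^sub>R g' x + (2 * cos (2 * pi * k * x)) *\<^sub>R g x)
      = integral ?I (\<lambda>x. (sin (2 * pi * k * x) / (pi * k)) *\<^sub>R g' x) + integral ?I (\<lambda>x. (2 * cos (2 * pi * k * x)) *\<^sub>R g x)"
      using that by (intro integral_add integrable_continuous_interval continuous_intros c cg) auto
    ultimately show ?thesis by (simp add: add_eq_0_iff scaleR_conv_of_real mult.assoc)
  qed
  have part: "(g n + g (n + 1)) / 2 - integral ?I g - (\<Sum>k=1..K. integral ?I (\<lambda>x. 2 * cos (2 * pi * real k * x) *\<^sub>R g x))
     = integral ?I (\<lambda>x. (x - n - 1 / 2 - psi_part K x) *\<^sub>R g' x)" for K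
  proof -
    have "integral ?I (\<lambda>x. (x - n - 1 / 2 - psi_part K x) *\<^sub>R g' x)
      = integral ?I (\<lambda>x. (x - n - 1 / 2) *\<^sub>R g' x + (\<Sum>k=1..K. (sin (2 * pi * k * x) / (pi * k)) *\<^sub>R g' x))"
      by (simp add: psi_part_def scaleR_sum_left algebra_simps scaleR_left.sum)
    also have "\<dots> = integral ?I (\<lambda>x. (x - n - 1 / 2) *\<^sub>R g' x) + (\<Sum>k=1..K. integral ?I (\<lambda>x. (sin (2 * pi * k * x) / (pi * k)) *\<^sub>R g' x))"
      by (subst integral_add; (subst integral_sum)?; auto intro!: integrable_continuous_interval continuous_intros c)
    finally show ?thesis using trig by (simp add: lin sum_negf)
  qed
  have "norm (integral ?I (\<lambda>x. (x - n - 1 / 2 - psi_part K x) *\<^sub>R g' x)) \<le> M * psi_l1 K" for K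
  proof -
    have "norm (integral ?I (\<lambda>x. (x - n - 1 / 2 - psi_part K x) *\<^sub>R g' x))
       \<le> integral ?I (\<lambda>x. M * \<bar>x - n - 1 / 2 - psi_part K x\<bar>)"
    proof (rule integral_norm_bound_integral)
      show "norm ((x - n - 1 / 2 - psi_part K x) *\<^sub>R g' x) \<le> M * \<bar>x - n - 1 / 2 - psi_part K x\<bar>" if "x \<in> ?I" for x
        using mult_left_mono[OF M(2)[OF that], of "\<bar>x - n - 1 / 2 - psi_part K x\<bar>"] by (simp add: mult.commute)
    qed (auto intro!: integrable_continuous_interval continuous_intros c)
    also have "\<dots> = M * integral ?I (\<lambda>x. \<bar>x - n - 1 / 2 - psi_part K x\<bar>)" by simp
    also have "integral ?I (\<lambda>x. \<bar>x - n - 1 / 2 - psi_part K x\<bar>) = psi_l1 K"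
    proof -
      have per: "psi_part K (x + n) = psi_part K x" for x :: real
      proof -
        have "sin (2 * pi * k * (x + n)) = sin (2 * pi * k * x)" for k :: nat
        proof -
          have "2 * pi * k * (x + n) = 2 * pi * k * x + 2 * pi * of_int (int (k * n))" by (simp add: algebra_simps)
          thus ?thesis by (simp only: sin_add sin_int_2pin cos_int_2pin)
        qed
        thus ?thesis by (simp add: psi_part_def)
      qed
      have "integral {0 + real n..1 + real n} (\<lambda>x. \<bar>x - n - 1 / 2 - psi_part K x\<bar>)
          = integral {0..1} ((\<lambda>x. \<bar>x - n - 1 / 2 - psi_part K x\<bar>) \<circ> ((+) (real n)))"
        by (rule integral_shift_Icc_real[symmetric])
      also have "\<dots> = psi_l1 K"
        unfolding psi_l1_def by (intro integral_cong) (simp add: per add.commute[of "real n"])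
      finally show ?thesis by (simp add: add.commute)
    qed
    finally show ?thesis .
  qed
  hence "(\<lambda>K. (g n + g (n + 1)) / 2 - integral ?I g - (\<Sum>k=1..K. integral ?I (\<lambda>x. 2 * cos (2 * pi * real k * x) *\<^sub>R g x))) \<longlonglongrightarrow> 0"
    unfolding part by (intro Lim_null_comparison[OF always_eventually tendsto_mult_right_zero[where c = M, OF psi_l1_tendsto]]) auto
  from tendsto_diff[OF tendsto_const[of "(g n + g (n + 1)) / 2 - integral ?I g"] this] show ?thesis by simp
qed

text \<open>The series in the limit is \<open>\<Sum>k\<noteq>0. \<integral> g x * ee (k * x)\<close>, summed symmetrically.\<close>

lemma truncated_poisson:
  fixes g g' :: "real \<Rightarrow> complex" and a b :: nat
  assumes "a \<le> b"
    and d: "\<And>x. x \<in> {real a..real b} \<Longrightarrow> (g has_vector_derivative g' x) (at x within {real a..real b})"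
    and c: "continuous_on {real a..real b} g'"
  shows "(\<lambda>K. \<Sum>k=1..K. integral {real a..real b} (\<lambda>x. 2 * cos (2 * pi * real k * x) *\<^sub>R g x))
     \<longlonglongrightarrow> (\<Sum>n\<in>{a<..b}. g n) + (g a - g b) / 2 - integral {real a..real b} g"
  using assms
proof (induction b rule: dec_induct)
  case base
  thus ?case by simp
next
  case (step b)
  have sub: "{real a..real b} \<subseteq> {real a..real (Suc b)}" "{real b..real b + 1} \<subseteq> {real a..real (Suc b)}"
    using step.hyps by auto
  have cc: "continuous_on {real a..real (Suc b)} g"
    using step.prems(1) by (intro continuous_on_vector_derivative) blast
  have comb: "integral {real a..real (Suc b)} f = integral {real a..real b} f + integral {real b..real b + 1} f"
    if "continuous_on {real a..real (Suc b)} f" for f :: "real \<Rightarrow> complex"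
    using Henstock_Kurzweil_Integration.integral_combine[of "real a" "real b" "real (Suc b)" f] that step.hyps
    by (auto simp: integrable_continuous_interval add.commute)
  have 1: "(\<lambda>K. \<Sum>k=1..K. integral {real a..real b} (\<lambda>x. 2 * cos (2 * pi * real k * x) *\<^sub>R g x))
     \<longlonglongrightarrow> (\<Sum>n\<in>{a<..b}. g n) + (g a - g b) / 2 - integral {real a..real b} g"
    using sub(1) by (intro step.IH)
      (auto intro: has_vector_derivative_within_subset[OF step.prems(1)] continuous_on_subset[OF step.prems(2)])
  have 2: "(\<lambda>K. \<Sum>k=1..K. integral {real b..real b + 1} (\<lambda>x. 2 * cos (2 * pi * real k * x) *\<^sub>R g x))
     \<longlonglongrightarrow> (g b + g (b + 1)) / 2 - integral {real b..real b + 1} g"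
    using sub(2) by (intro poisson_unit[where g' = g'])
      (auto intro: has_vector_derivative_within_subset[OF step.prems(1)] continuous_on_subset[OF step.prems(2)])
  have s: "{a<..Suc b} = insert (Suc b) {a<..b}" using step.hyps by auto
  have e: "(\<Sum>k=1..K. integral {real a..real (Suc b)} (\<lambda>x. 2 * cos (2 * pi * real k * x) *\<^sub>R g x))
     = (\<Sum>k=1..K. integral {real a..real b} (\<lambda>x. 2 * cos (2 * pi * real k * x) *\<^sub>R g x))
     + (\<Sum>k=1..K. integral {real b..real b + 1} (\<lambda>x. 2 * cos (2 * pi * real k * x) *\<^sub>R g x))" for K
    unfolding sum.distrib[symmetric] by (intro sum.cong refl comb continuous_intros cc)
  have v: "((\<Sum>n\<in>{a<..b}. g n) + (g a - g b) / 2 - integral {real a..real b} g)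
      + ((g b + g (b + 1)) / 2 - integral {real b..real b + 1} g)
    = (\<Sum>n\<in>{a<..Suc b}. g n) + (g a - g (Suc b)) / 2 - integral {real a..real (Suc b)} g"
    using comb[OF cc] by (simp add: s field_simps)
  show ?case unfolding e v[symmetric] by (rule tendsto_add[OF 1 2])
qed

section \<open>Stationary phase\<close>

lemma continuous_on_ee [continuous_intros]:
  "continuous_on A f \<Longrightarrow> continuous_on A (\<lambda>x. ee (f x))"
  unfolding ee_def by (intro continuous_intros)

lemma has_vector_derivative_ee:
  assumes "(f has_real_derivative f') (at x within A)"
  shows "((\<lambda>x. ee (f x)) has_vector_derivative (2 * pi * \<i> * f' * ee (f x))) (at x within A)"
proof -
  have e: "ee y = exp (2 * pi * \<i> * of_real y)" for y
    by (simp add: ee_def cis_conv_exp mult_ac)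
  have "((\<lambda>x. of_real (f x) :: complex) has_vector_derivative of_real f') (at x within A)"
    using assms by (rule has_vector_derivative_of_real)
  hence "((\<lambda>x. 2 * pi * \<i> * of_real (f x)) has_vector_derivative 2 * pi * \<i> * of_real f') (at x within A)"
    by (rule has_vector_derivative_mult_right)
  from field_vector_diff_chain_within[OF this DERIV_exp[THEN has_field_derivative_at_within]]
  show ?thesis by (simp add: e o_def)
qed

definition fresnel :: "real \<Rightarrow> complex" where
  "fresnel v = integral {0..v} (\<lambda>w. ee (- w\<^sup>2))"

lemma integrable_fresnel: "(\<lambda>w. ee (- w\<^sup>2)) integrable_on {a..b}"
  by (intro integrable_continuous_interval continuous_intros)

text \<open>Integration by parts: \<open>ee (- w^2)\<close> differs from the derivative of
  \<open>G\<close> by \<open>R\<close>, and both the boundary values and the integral of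
  \<open>R\<close> are of order \<open>1 / u\<close>.\<close>

lemma fresnel_diff_le:
  assumes "0 < u" "u \<le> v"
  shows "norm (fresnel v - fresnel u) \<le> 1 / u"
proof -
  have "fresnel v - fresnel u = integral {u..v} (\<lambda>w. ee (- w\<^sup>2))"
    using Henstock_Kurzweil_Integration.integral_combine[of 0 u v "\<lambda>w. ee (- w\<^sup>2)"] assms
    by (simp add: fresnel_def integrable_fresnel algebra_simps)
  define G where "G w = (\<i> / (4 * pi * w)) * ee (- w\<^sup>2)" for w :: real
  define R where "R w = (\<i> / (4 * pi * w^2)) * ee (- w\<^sup>2)" for w :: real
  have FT: "((\<lambda>w. ee (- w\<^sup>2) - R w) has_integral G v - G u) {u..v}"
  proof (rule fundamental_theorem_of_calculus[OF assms(2)])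
    fix w assume w: "w \<in> {u..v}"
    have w0: "w \<noteq> 0" using w assms by auto
    have "((\<lambda>w. - w\<^sup>2) has_real_derivative - (2 * w)) (at w within {u..v})"
      by (auto intro!: derivative_eq_intros)
    note 1 = has_vector_derivative_ee[OF this]
    have "((\<lambda>w. 1 / (4 * pi * w)) has_real_derivative - (1 / (4 * pi * w^2))) (at w within {u..v})"
      using w0 by (auto intro!: derivative_eq_intros simp: power2_eq_square field_simps)
    from has_vector_derivative_mult_right[OF has_vector_derivative_scaleR[OF this 1], of "\<i>"]
    have "((\<lambda>w. \<i> * ((1 / (4 * pi * w)) *\<^sub>R ee (- w\<^sup>2))) has_vector_derivative
       \<i> * ((1 / (4 * pi * w)) *\<^sub>R (2 * pi * \<i> * (- (2 * w)) * ee (- w\<^sup>2)) + (- (1 / (4 * pi * w^2))) *\<^sub>R ee (- w\<^sup>2))) (at w within {u..v})"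
      by simp
    moreover have "(\<lambda>w. \<i> * ((1 / (4 * pi * w)) *\<^sub>R ee (- w\<^sup>2))) = G"
      by (auto simp: G_def scaleR_conv_of_real)
    moreover have "\<i> * ((1 / (4 * pi * w)) *\<^sub>R (2 * pi * \<i> * (- (2 * w)) * ee (- w\<^sup>2)) + (- (1 / (4 * pi * w^2))) *\<^sub>R ee (- w\<^sup>2))
       = ee (- w\<^sup>2) - R w"
      using w0 by (simp add: R_def scaleR_conv_of_real field_simps)
    ultimately show "(G has_vector_derivative ee (- w\<^sup>2) - R w) (at w within {u..v})" by simp
  qed
  have R: "(R has_integral integral {u..v} R) {u..v}" unfolding R_def
    using assms by (intro integrable_integral integrable_continuous_interval continuous_intros) auto
  have "((\<lambda>w. ee (- w\<^sup>2)) has_integral G v - G u + integral {u..v} R) {u..v}"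
    using has_integral_add[OF FT R] by simp
  hence e: "fresnel v - fresnel u = G v - G u + integral {u..v} R"
    using \<open>fresnel v - fresnel u = _\<close> by (simp add: integral_unique)
  have I: "((\<lambda>w. 1 / (4 * pi * w^2)) has_integral (- (1 / (4 * pi * v)) - (- (1 / (4 * pi * u))))) {u..v}"
  proof (rule fundamental_theorem_of_calculus[OF assms(2)])
    fix w assume w: "w \<in> {u..v}"
    have w0: "w \<noteq> 0" using w assms by auto
    have "((\<lambda>w. - (1 / (4 * pi * w))) has_real_derivative 1 / (4 * pi * w^2)) (at w within {u..v})"
      using w0 by (auto intro!: derivative_eq_intros simp: power2_eq_square field_simps)
    thus "((\<lambda>w. - (1 / (4 * pi * w))) has_vector_derivative 1 / (4 * pi * w^2)) (at w within {u..v})"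
      by (simp add: has_real_derivative_iff_has_vector_derivative)
  qed
  have "norm (integral {u..v} R) \<le> integral {u..v} (\<lambda>w. 1 / (4 * pi * w^2))"
  proof (rule integral_norm_bound_integral)
    show "norm (R w) \<le> 1 / (4 * pi * w^2)" for w
      by (simp add: R_def norm_mult norm_divide norm_power)
  qed (use R I in \<open>auto intro: has_integral_integrable\<close>)
  hence "norm (integral {u..v} R) \<le> - (1 / (4 * pi * v)) - (- (1 / (4 * pi * u)))"
    using I by (simp add: integral_unique)
  moreover have "norm (G v) = 1 / (4 * pi * v)" "norm (G u) = 1 / (4 * pi * u)"
    using assms by (auto simp: G_def norm_mult norm_divide)
  ultimately have "norm (fresnel v - fresnel u) \<le> 2 * (1 / (4 * pi * u))"
    unfolding e using norm_triangle_ineq[of "G v - G u" "integral {u..v} R"] norm_triangle_ineq4[of "G v" "G u"]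
    by simp
  also have "\<dots> \<le> 1 / u" using assms pi_ge_two by (simp add: field_simps)
  finally show ?thesis .
qed

text \<open>The limit \<open>c\<close> exists by \<open>fresnel_diff_le\<close>. The form
  \<open>6 / (1 + v)\<close> joins the decay \<open>1 / v\<close> for \<open>v > 1\<close> with the
  bound 3 for \<open>v \<le> 1\<close>, so no case distinction is left for later.\<close>

lemma fresnel_limit: "\<exists>c. \<forall>v\<ge>0. norm (fresnel v - c) \<le> 6 / (1 + v)"
proof -
  have "Cauchy (\<lambda>n. fresnel (real (Suc n)))"
  proof (rule CauchyI')
    fix e :: real assume e: "0 < e"
    obtain M where M: "1 / e < real M" using reals_Archimedean2 by blast
    show "\<exists>M. \<forall>m\<ge>M. \<forall>n>m. dist (fresnel (real (Suc m))) (fresnel (real (Suc n))) < e"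
      unfolding dist_norm
    proof (intro exI allI impI)
      fix m n assume mn: "M \<le> m" "m < n"
      have "norm (fresnel (real (Suc m)) - fresnel (real (Suc n))) \<le> 1 / real (Suc m)"
        using fresnel_diff_le[of "real (Suc m)" "real (Suc n)"] mn by (simp add: norm_minus_commute)
      also have "\<dots> < e"
      proof -
        have "1 / e < real (Suc m)" using M mn by (simp add: less_trans)
        thus ?thesis using e by (simp add: field_simps)
      qed
      finally show "norm (fresnel (real (Suc m)) - fresnel (real (Suc n))) < e" .
    qed
  qed
  then obtain c where c: "(\<lambda>n. fresnel (real (Suc n))) \<longlonglongrightarrow> c"
    using Cauchy_convergent convergent_def by blast
  have big: "norm (fresnel v - c) \<le> 1 / v" if "0 < v" for v
  proof -
    have "(\<lambda>n. norm (fresnel v - fresnel (real (Suc n)))) \<longlonglongrightarrow> norm (fresnel v - c)"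
      by (intro tendsto_intros c)
    moreover obtain M where M: "v < real M" using reals_Archimedean2 by blast
    have "\<forall>n\<ge>M. norm (fresnel v - fresnel (real (Suc n))) \<le> 1 / v"
      using fresnel_diff_le[OF that] M by (subst norm_minus_commute) (auto intro!: fresnel_diff_le that)
    ultimately show ?thesis by (intro LIMSEQ_le_const2) auto
  qed
  have small: "norm (fresnel v) \<le> v" if "0 \<le> v" for v
  proof -
    have "norm (fresnel v) \<le> integral {0..v} (\<lambda>w. 1::real)" unfolding fresnel_def
      by (rule integral_norm_bound_integral) (auto simp: integrable_fresnel)
    thus ?thesis using that by simp
  qed
  have "norm c \<le> 2" using big[of 1] small[of 1] norm_triangle_ineq3[of "fresnel 1" c] by simp
  have "norm (fresnel v - c) \<le> 6 / (1 + v)" if "0 \<le> v" for v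
  proof (cases "v \<le> 1")
    case True
    have "norm (fresnel v - c) \<le> 3"
      using norm_triangle_ineq4[of "fresnel v" c] small[OF that] \<open>norm c \<le> 2\<close> True by linarith
    also have "3 \<le> 6 / (1 + v)" using that True by (simp add: field_simps)
    finally show ?thesis .
  next
    case False
    have "norm (fresnel v - c) \<le> 1 / v" using False by (intro big) auto
    also have "\<dots> \<le> 6 / (1 + v)" using False by (simp add: field_simps)
    finally show ?thesis .
  qed
  thus ?thesis by blast
qed

lemma fresnel_deriv:
  assumes "v \<in> {0..V}"
  shows "(fresnel has_vector_derivative ee (- v\<^sup>2)) (at v within {0..V})"
  unfolding fresnel_def by (rule integral_has_vector_derivative) (use assms in \<open>auto intro!: continuous_intros\<close>)

text \<open>Since \<open>cos t = 1 - 2 * (sin (t / 2))^2\<close>, the substitution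
  \<open>w = sqrt (2 * L) * sin (t / 2)\<close> makes the phase exactly quadratic, and
  \<open>cos (t / 2)\<close> is its Jacobian up to a constant. This weight therefore gives a Fresnel
  integral without error term.\<close>

lemma cos_half_integral:
  fixes L r :: real
  assumes L: "0 < L" and r: "0 \<le> r" "r \<le> pi"
  shows "((\<lambda>t. cos (t / 2) *\<^sub>R ee (L * cos t)) has_integral
     (2 / sqrt (2 * L)) *\<^sub>R (ee L * fresnel (sqrt (2 * L) * sin (r / 2)))) {0..r}"
proof -
  define s where "s = sqrt (2 * L)"
  have s: "s > 0" "s^2 = 2 * L" using L by (auto simp: s_def)
  define G where "G t = (2 / s) *\<^sub>R (ee L * fresnel (s * sin (t / 2)))" for t
  have "((\<lambda>t. cos (t / 2) *\<^sub>R ee (L * cos t)) has_integral G r - G 0) {0..r}"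
  proof (rule fundamental_theorem_of_calculus[OF r(1)])
    fix t assume t: "t \<in> {0..r}"
    have im: "(\<lambda>t. s * sin (t / 2)) ` {0..r} \<subseteq> {0..s}"
      using r s by (auto intro!: mult_nonneg_nonneg sin_ge_zero)
    have "((\<lambda>t. s * sin (t / 2)) has_real_derivative s * cos (t / 2) / 2) (at t within {0..r})"
      by (auto intro!: derivative_eq_intros)
    hence "((\<lambda>t. s * sin (t / 2)) has_vector_derivative s * cos (t / 2) / 2) (at t within {0..r})"
      by (simp add: has_real_derivative_iff_has_vector_derivative)
    moreover have "(fresnel has_vector_derivative ee (- (s * sin (t / 2))\<^sup>2)) (at (s * sin (t / 2)) within (\<lambda>t. s * sin (t / 2)) ` {0..r})"
      by (rule has_vector_derivative_within_subset[OF fresnel_deriv im]) (use im t in blast)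
    ultimately have "((fresnel \<circ> (\<lambda>t. s * sin (t / 2))) has_vector_derivative (s * cos (t / 2) / 2) *\<^sub>R ee (- (s * sin (t / 2))\<^sup>2)) (at t within {0..r})"
      by (rule vector_diff_chain_within)
    hence "(G has_vector_derivative (2 / s) *\<^sub>R (ee L * ((s * cos (t / 2) / 2) *\<^sub>R ee (- (s * sin (t / 2))\<^sup>2)))) (at t within {0..r})"
      unfolding G_def o_def
      by (intro has_vector_derivative_mult_right bounded_linear.has_vector_derivative[OF bounded_linear_scaleR_right])
    moreover have "L * cos t = L + (- (s * sin (t / 2))\<^sup>2)"
    proof -
      have "cos t = 1 - 2 * (sin (t / 2))^2" using cos_double_sin[of "t / 2"] by simp
      thus ?thesis by (simp only: power_mult_distrib s(2)) (simp add: algebra_simps)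
    qed
    hence "ee (L * cos t) = ee L * ee (- (s * sin (t / 2))\<^sup>2)" by (simp only: ee_add)
    hence "(2 / s) *\<^sub>R (ee L * ((s * cos (t / 2) / 2) *\<^sub>R ee (- (s * sin (t / 2))\<^sup>2))) = cos (t / 2) *\<^sub>R ee (L * cos t)"
      using s by simp
    ultimately show "(G has_vector_derivative cos (t / 2) *\<^sub>R ee (L * cos t)) (at t within {0..r})" by simp
  qed
  thus ?thesis by (simp add: G_def s_def fresnel_def)
qed

text \<open>Equal to \<open>(cos (t / 2) - cos t) / sin t\<close> after cancelling the common factor
  \<open>2 * sin (t / 4)\<close>, hence smooth at the stationary point \<open>t = 0\<close>.\<close>

definition rho :: "real \<Rightarrow> real" where
  "rho t = sin (3 * t / 4) / (2 * cos (t / 4) * cos (t / 2))"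

definition rho' :: "real \<Rightarrow> real" where
  "rho' t = ((3 / 4) * cos (3 * t / 4) * (2 * cos (t / 4) * cos (t / 2))
     - sin (3 * t / 4) * - (sin (t / 4) * cos (t / 2) / 2 + cos (t / 4) * sin (t / 2)))
     / ((2 * cos (t / 4) * cos (t / 2)) * (2 * cos (t / 4) * cos (t / 2)))"

lemma rho_denominator:
  assumes "0 \<le> t" "t \<le> pi / 2"
  shows "2 * cos (t / 4) * cos (t / 2) > 0"
  using assms pi_gt_zero by (intro mult_pos_pos cos_gt_zero_pi) linarith+

lemma rho_deriv:
  assumes "0 \<le> t" "t \<le> pi / 2"
  shows "(rho has_real_derivative rho' t) (at t within A)"
proof -
  have "((\<lambda>t. 2 * cos (t / 4) * cos (t / 2)) has_real_derivative
      - (sin (t / 4) * cos (t / 2) / 2 + cos (t / 4) * sin (t / 2))) (at t within A)"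
    by (auto intro!: derivative_eq_intros simp: algebra_simps)
  moreover have "((\<lambda>t. sin (3 * t / 4)) has_real_derivative (3 / 4) * cos (3 * t / 4)) (at t within A)"
    by (auto intro!: derivative_eq_intros)
  ultimately show ?thesis unfolding rho_def[abs_def] rho'_def
    using rho_denominator[OF assms] by (intro DERIV_divide) auto
qed

lemma cos_minus_cos_half:
  assumes "0 \<le> t" "t \<le> pi / 2"
  shows "cos t = cos (t / 2) - rho t * sin t"
proof -
  have pos: "2 * cos (t / 4) * cos (t / 2) > 0" by (rule rho_denominator[OF assms])
  have "sin t = 2 * sin (t / 2) * cos (t / 2)" using sin_double[of "t / 2"] by simp
  also have "sin (t / 2) = 2 * sin (t / 4) * cos (t / 4)" using sin_double[of "t / 4"] by simp
  finally have "sin t = (2 * cos (t / 4) * cos (t / 2)) * (2 * sin (t / 4))" by simp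
  moreover have "x / D * (D * y) = x * y" if "D > 0" for x y D :: real using that by simp
  ultimately have "rho t * sin t = sin (3 * t / 4) * (2 * sin (t / 4))"
    using pos by (simp only: rho_def)
  hence "rho t * sin t = 2 * sin (3 * t / 4) * sin (t / 4)" by simp
  also have "\<dots> = cos (t / 2) - cos t"
  proof -
    have "3 * t / 4 - t / 4 = t / 2" "3 * t / 4 + t / 4 = t" by simp_all
    thus ?thesis using sin_times_sin[of "3 * t / 4" "t / 4"] by simp
  qed
  finally show ?thesis by simp
qed


text \<open>Split \<open>cos t\<close> into \<open>cos (t / 2)\<close> minus
  \<open>rho t * sin t\<close>. The first weight gives a Fresnel integral exactly; in the second,
  \<open>sin t * ee (L * cos t)\<close> is a derivative up to the factor \<open>1 / L\<close>, and
  one integration by parts leaves \<open>O(1 / L)\<close>. The error is written as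
  \<open>1 / (sqrt L + L * r)\<close> to be valid also when the endpoint approaches the stationary
  point.\<close>

lemma cos_ee_integral_estimate:
  "\<exists>c C. 0 < C \<and> (\<forall>L\<ge>1. \<forall>r. 0 \<le> r \<longrightarrow> r \<le> pi / 2 \<longrightarrow>
     norm (integral {0..r} (\<lambda>t. cos t *\<^sub>R ee (L * cos t)) - c * ee L / sqrt L)
       \<le> C / (sqrt L + L * r))"
proof -
  obtain cf where cf: "\<And>v. 0 \<le> v \<Longrightarrow> norm (fresnel v - cf) \<le> 6 / (1 + v)" using fresnel_limit by blast
  have crho: "continuous_on {0..pi/2} rho'"
    unfolding rho'_def[abs_def] using rho_denominator by (intro continuous_intros) fastforce+
  obtain M where M: "0 < M" "\<And>t. t \<in> {0..pi/2} \<Longrightarrow> \<bar>rho' t\<bar> \<le> M"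
    using compact_imp_bounded[OF compact_continuous_image[OF crho]] by (auto simp: bounded_pos)
  have crho0: "continuous_on {0..pi/2} rho"
    unfolding rho_def[abs_def] using rho_denominator by (intro continuous_intros) fastforce+
  obtain M0 where M0: "0 < M0" "\<And>t. t \<in> {0..pi/2} \<Longrightarrow> \<bar>rho t\<bar> \<le> M0"
    using compact_imp_bounded[OF compact_continuous_image[OF crho0]] by (auto simp: bounded_pos)
  define C where "C = 24 + 3 * (2 * M0 + 2 * M)"
  have "norm (integral {0..r} (\<lambda>t. cos t *\<^sub>R ee (L * cos t)) - (sqrt 2 * cf) * ee L / sqrt L)
       \<le> C / (sqrt L + L * r)" if L: "1 \<le> L" and r: "0 \<le> r" "r \<le> pi / 2" for L r
  proof -
    define i where "i = \<i> / (2 * pi * L)"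
    define G where "G t = i * (rho t *\<^sub>R ee (L * cos t))" for t
    have sub: "{0..r} \<subseteq> {0..pi/2}" using r by auto
    have FTC: "((\<lambda>t. (rho t * sin t) *\<^sub>R ee (L * cos t) + i * (rho' t *\<^sub>R ee (L * cos t))) has_integral G r - G 0) {0..r}"
    proof (rule fundamental_theorem_of_calculus[OF r(1)])
      fix t assume t: "t \<in> {0..r}"
      have "((\<lambda>t. L * cos t) has_real_derivative L * - sin t) (at t within {0..r})"
        by (auto intro!: derivative_eq_intros)
      note 1 = has_vector_derivative_ee[OF this]
      have "(rho has_real_derivative rho' t) (at t within {0..r})" using t r by (intro rho_deriv) auto
      from has_vector_derivative_mult_right[OF has_vector_derivative_scaleR[OF this 1], of i]
      have "(G has_vector_derivative i * (rho t *\<^sub>R (2 * pi * \<i> * (L * - sin t) * ee (L * cos t)) + rho' t *\<^sub>R ee (L * cos t))) (at t within {0..r})"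
        by (simp add: G_def[abs_def])
      moreover have "i * (2 * pi * \<i> * (L * - sin t) * ee (L * cos t)) = sin t *\<^sub>R ee (L * cos t)"
        using L by (simp add: i_def scaleR_conv_of_real field_simps)
      hence "i * (rho t *\<^sub>R (2 * pi * \<i> * (L * - sin t) * ee (L * cos t)) + rho' t *\<^sub>R ee (L * cos t))
         = (rho t * sin t) *\<^sub>R ee (L * cos t) + i * (rho' t *\<^sub>R ee (L * cos t))"
        by (simp only: distrib_left mult_scaleR_right scaleR_scaleR)
      ultimately show "(G has_vector_derivative (rho t * sin t) *\<^sub>R ee (L * cos t) + i * (rho' t *\<^sub>R ee (L * cos t))) (at t within {0..r})"
        by simp
    qed
    define R where "R = integral {0..r} (\<lambda>t. i * (rho' t *\<^sub>R ee (L * cos t)))"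
    have intR: "((\<lambda>t. i * (rho' t *\<^sub>R ee (L * cos t))) has_integral R) {0..r}"
      unfolding R_def by (intro integrable_integral integrable_continuous_interval continuous_intros continuous_on_subset[OF crho sub])
    have ni: "norm i = 1 / (2 * pi * L)" using L by (simp add: i_def norm_divide norm_mult)
    have ni': "norm i \<le> 1 / L" unfolding ni using L pi_ge_two by (intro divide_left_mono) (auto intro: mult_right_mono[of 1 "2 * pi" L, simplified])
    have nR: "norm R \<le> (1 / L * M) * 2"
    proof -
      have "norm R \<le> integral {0..r} (\<lambda>t. 1 / L * M)" unfolding R_def
      proof (rule integral_norm_bound_integral)
        show "norm (i * (rho' t *\<^sub>R ee (L * cos t))) \<le> 1 / L * M" if "t \<in> {0..r}" for t
          unfolding norm_mult norm_scaleR norm_ee mult_1_right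
          using ni' M(2)[of t] that sub L by (intro mult_mono) auto
      qed (use intR in \<open>auto simp: has_integral_integrable\<close>)
      also have "\<dots> = (1 / L * M) * r" using r by simp
      also have "\<dots> \<le> (1 / L * M) * 2" using r pi_less_4 M L by (intro mult_left_mono) auto
      finally show ?thesis .
    qed
    have nG: "norm (G t) \<le> 1 / L * M0" if "t \<in> {0..r}" for t
      unfolding G_def norm_mult norm_scaleR norm_ee mult_1_right
      using ni' M0(2)[of t] that sub L by (intro mult_mono) auto
    define s where "s = sqrt (2 * L)"
    have s: "s > 0" using L by (simp add: s_def)
    have s2: "s = sqrt 2 * sqrt L" by (simp add: s_def real_sqrt_mult)
    define W where "W = s * sin (r / 2)"
    have I1: "((\<lambda>t. cos (t / 2) *\<^sub>R ee (L * cos t)) has_integral (2 / s) *\<^sub>R (ee L * fresnel W)) {0..r}"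
      unfolding s_def W_def using L r pi_gt_zero by (intro cos_half_integral) linarith+
    have I2: "((\<lambda>t. (rho t * sin t) *\<^sub>R ee (L * cos t)) has_integral (G r - G 0 - R)) {0..r}"
      using has_integral_diff[OF FTC intR] by simp
    have "((\<lambda>t. cos t *\<^sub>R ee (L * cos t)) has_integral ((2 / s) *\<^sub>R (ee L * fresnel W) - (G r - G 0 - R))) {0..r}"
    proof (rule has_integral_eq[OF _ has_integral_diff[OF I1 I2]])
      fix t assume "t \<in> {0..r}"
      hence "cos t = cos (t / 2) - rho t * sin t" using r by (intro cos_minus_cos_half) auto
      thus "cos (t / 2) *\<^sub>R ee (L * cos t) - (rho t * sin t) *\<^sub>R ee (L * cos t) = cos t *\<^sub>R ee (L * cos t)"
        by (simp only: scaleR_left_diff_distrib)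
    qed
    hence eq: "integral {0..r} (\<lambda>t. cos t *\<^sub>R ee (L * cos t)) = (2 / s) *\<^sub>R (ee L * fresnel W) - (G r - G 0 - R)"
      by (rule integral_unique)
    have "(sqrt 2 * cf) * ee L / sqrt L = (2 / s) *\<^sub>R (ee L * cf)"
    proof -
      have "sqrt 2 / sqrt L = 2 / s" using L by (simp add: s2 field_simps)
      moreover have "(sqrt 2 * cf) * ee L / sqrt L = of_real (sqrt 2 / sqrt L) * (ee L * cf)" by simp
      ultimately show ?thesis by (simp only: scaleR_conv_of_real)
    qed
    hence "integral {0..r} (\<lambda>t. cos t *\<^sub>R ee (L * cos t)) - (sqrt 2 * cf) * ee L / sqrt L
        = (2 / s) *\<^sub>R (ee L * (fresnel W - cf)) - (G r - G 0 - R)"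
      unfolding eq by (simp add: right_diff_distrib scaleR_right_diff_distrib)
    also have "norm \<dots> \<le> norm ((2 / s) *\<^sub>R (ee L * (fresnel W - cf))) + norm (G r - G 0 - R)"
      by (rule norm_triangle_ineq4)
    also have "norm (G r - G 0 - R) \<le> (1 / L * M0 + 1 / L * M0) + (1 / L * M) * 2"
      using nG[of r] nG[of 0] nR r by (intro order.trans[OF norm_triangle_ineq4] add_mono) auto
    also have "\<dots> = (2 * M0 + 2 * M) / L" by (simp add: add_divide_distrib)
    also have "\<dots> \<le> 3 * (2 * M0 + 2 * M) / (sqrt L + L * r)"
    proof -
      have "sqrt L \<le> L" using L real_sqrt_le_mono[of L "L * L"] by (simp add: mult_left_mono[of 1 L L, simplified])
      moreover have "L * r \<le> L * 2" using r pi_less_4 L by (intro mult_left_mono) auto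
      ultimately have d: "sqrt L + L * r \<le> 3 * L" by simp
      have p: "0 < sqrt L + L * r" using L r by (intro add_pos_nonneg) auto
      have "(2 * M0 + 2 * M) / L = 3 * (2 * M0 + 2 * M) / (3 * L)"
        by (subst mult_divide_mult_cancel_left) auto
      also have "\<dots> \<le> 3 * (2 * M0 + 2 * M) / (sqrt L + L * r)"
        using d p M M0 L by (intro divide_left_mono) auto
      finally show ?thesis .
    qed
    also have "norm ((2 / s) *\<^sub>R (ee L * (fresnel W - cf))) \<le> 24 / (sqrt L + L * r)"
    proof -
      have sinb: "r / 4 \<le> sin (r / 2)"
      proof -
        have "r / 4 \<le> r / pi" using r pi_less_4 divide_left_mono[of pi 4 r] by simp
        also have "\<dots> = 2 * (r / (2 * pi))" by simp
        also have "\<dots> \<le> sin (pi * (r / (2 * pi)))"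
          using r by (intro sin_ge_concave) (auto simp: field_simps)
        also have "pi * (r / (2 * pi)) = r / 2" by simp
        finally show ?thesis .
      qed
      hence W0: "0 \<le> W" using r s by (simp add: W_def)
      have "norm ((2 / s) *\<^sub>R (ee L * (fresnel W - cf))) = (2 / s) * norm (fresnel W - cf)"
        using s by (simp add: norm_mult)
      also have "\<dots> \<le> (2 / s) * (6 / (1 + W))" using s W0 by (intro mult_left_mono cf) auto
      also have "\<dots> = 12 / (s + s * W)" by (simp add: distrib_left)
      also have "\<dots> \<le> 12 / ((sqrt L + L * r) / 2)"
      proof (rule divide_left_mono)
        have "s * W = (s * s) * sin (r / 2)" by (simp add: W_def)
        also have "s * s = 2 * L" using L by (simp add: s_def)
        finally have "L * r / 2 \<le> s * W" using mult_left_mono[OF sinb, of "2 * L"] L by simp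
        moreover have "sqrt L / 2 \<le> s"
        proof -
          have "sqrt L \<le> s" "0 \<le> sqrt L" unfolding s_def using L by simp_all
          moreover have "x / 2 \<le> y" if "x \<le> y" "0 \<le> x" for x y :: real using that by simp
          ultimately show ?thesis by blast
        qed
        ultimately have "sqrt L / 2 + L * r / 2 \<le> s + s * W" by (rule add_mono[rotated])
        thus "(sqrt L + L * r) / 2 \<le> s + s * W" by (simp only: add_divide_distrib)
        have "0 < s + s * W" using s W0 by (simp add: add_pos_nonneg)
        moreover have "0 < sqrt L + L * r" using L r by (intro add_pos_nonneg) auto
        ultimately show "0 < (s + s * W) * ((sqrt L + L * r) / 2)" by simp
      qed simp
      finally show ?thesis by simp
    qed
    finally show ?thesis by (simp add: C_def add_divide_distrib)
  qed
  moreover have "0 < C" using M M0 by (simp add: C_def)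
  ultimately show ?thesis by blast
qed


lemma sin_ee_integral_le:
  assumes "0 < L" "a \<le> b"
  shows "norm (integral {a..b} (\<lambda>t. sin t *\<^sub>R ee (L * cos t))) \<le> 1 / L"
proof -
  define i where "i = \<i> / (2 * pi * L)"
  have "((\<lambda>t. sin t *\<^sub>R ee (L * cos t)) has_integral i * ee (L * cos b) - i * ee (L * cos a)) {a..b}"
  proof (rule fundamental_theorem_of_calculus[OF assms(2)])
    fix t assume "t \<in> {a..b}"
    have "((\<lambda>t. L * cos t) has_real_derivative L * - sin t) (at t within {a..b})"
      by (auto intro!: derivative_eq_intros)
    from has_vector_derivative_mult_right[OF has_vector_derivative_ee[OF this], of i]
    show "((\<lambda>t. i * ee (L * cos t)) has_vector_derivative sin t *\<^sub>R ee (L * cos t)) (at t within {a..b})"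
      using assms by (simp add: i_def scaleR_conv_of_real field_simps)
  qed
  hence "norm (integral {a..b} (\<lambda>t. sin t *\<^sub>R ee (L * cos t))) \<le> norm (i * ee (L * cos b)) + norm (i * ee (L * cos a))"
    using norm_triangle_ineq4 by (simp add: integral_unique)
  also have "\<dots> = 1 / (pi * L)" using assms by (simp add: i_def norm_mult norm_divide)
  also have "\<dots> \<le> 1 / L" using assms pi_ge_two
    by (intro divide_left_mono) (auto intro: mult_right_mono[of 1 pi L, simplified])
  finally show ?thesis .
qed

text \<open>Shift by \<open>\<alpha>\<close> and expand \<open>cos (t + \<alpha>)\<close>: the sine
  part integrates to \<open>O(1 / L)\<close> and the cosine part is even, so it is a sum or a
  difference of two integrals starting at the stationary point. Their main terms add if it lies
  between the ends and cancel otherwise.\<close>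

lemma arc_integral_estimate:
  "\<exists>c C. 0 < C \<and> (\<forall>L\<ge>1. \<forall>\<alpha> a b. 0 \<le> \<alpha> \<longrightarrow> \<alpha> \<le> pi / 2 \<longrightarrow> 0 \<le> a \<longrightarrow> a \<le> b \<longrightarrow> b \<le> pi / 2 \<longrightarrow>
     norm (integral {a..b} (\<lambda>t. cos t *\<^sub>R ee (L * cos (t - \<alpha>)))
         - (if a \<le> \<alpha> \<and> \<alpha> \<le> b then c * of_real (cos \<alpha>) * ee L / sqrt L else 0))
       \<le> C / (sqrt L + L * \<bar>a - \<alpha>\<bar>) + C / (sqrt L + L * \<bar>b - \<alpha>\<bar>))"
proof -
  obtain c C where C: "0 < C" and K: "\<And>L r. 1 \<le> L \<Longrightarrow> 0 \<le> r \<Longrightarrow> r \<le> pi / 2 \<Longrightarrow>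
     norm (integral {0..r} (\<lambda>t. cos t *\<^sub>R ee (L * cos t)) - c * ee L / sqrt L)
       \<le> C / (sqrt L + L * r)"
    using cos_ee_integral_estimate by blast
  define C' where "C' = C + 3"
  have "norm (integral {a..b} (\<lambda>t. cos t *\<^sub>R ee (L * cos (t - \<alpha>)))
         - (if a \<le> \<alpha> \<and> \<alpha> \<le> b then (2 * c) * of_real (cos \<alpha>) * ee L / sqrt L else 0))
       \<le> C' / (sqrt L + L * \<bar>a - \<alpha>\<bar>) + C' / (sqrt L + L * \<bar>b - \<alpha>\<bar>)"
    if L: "1 \<le> L" and \<alpha>: "0 \<le> \<alpha>" "\<alpha> \<le> pi / 2" and ab: "0 \<le> a" "a \<le> b" "b \<le> pi / 2" for L \<alpha> a b
  proof -
    define f where "f t = cos t *\<^sub>R ee (L * cos t)" for t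
    define S where "S = integral {a - \<alpha>..b - \<alpha>} (\<lambda>t. sin t *\<^sub>R ee (L * cos t))"
    define E where "E x = C / (sqrt L + L * \<bar>x\<bar>)" for x
    define P where "P = c * ee L / sqrt L"
    have int: "f integrable_on {x..y}" for x y
      unfolding f_def by (intro integrable_continuous_interval continuous_intros)
    have K': "norm (integral {0..r} f - P) \<le> E r" if "0 \<le> r" "r \<le> pi / 2" for r
      using K[OF L that] that by (simp add: f_def[abs_def] P_def E_def)
    have refl: "integral {x..y} f = integral {- y..- x} f" for x y
      using Henstock_Kurzweil_Integration.integral_reflect_real[where f = f and a = x and b = y]
      by (simp add: f_def[abs_def])
    have comb: "integral {x..y} f + integral {y..z} f = integral {x..z} f" if "x \<le> y" "y \<le> z" for x y z
      using that int by (intro Henstock_Kurzweil_Integration.integral_combine) auto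
    define x where "x = a - \<alpha>"
    define y where "y = b - \<alpha>"
    have xy: "x \<le> y" "- (pi / 2) \<le> x" "x \<le> pi / 2" "- (pi / 2) \<le> y" "y \<le> pi / 2" using \<alpha> ab by (auto simp: x_def y_def)
    have main: "norm (integral {x..y} f - (if x \<le> 0 \<and> 0 \<le> y then 2 * P else 0)) \<le> E x + E y"
    proof -
      consider "x \<le> 0" "0 \<le> y" | "0 < x" | "y < 0" by linarith
      thus ?thesis
      proof cases
        case 1
        have "integral {x..y} f = integral {0..- x} f + integral {0..y} f"
          using comb[of x 0 y] refl[of x 0] 1 by simp
        hence "integral {x..y} f - 2 * P = (integral {0..- x} f - P) + (integral {0..y} f - P)" by simp
        also have "norm \<dots> \<le> E (- x) + E y" by (intro norm_triangle_mono K') (use 1 xy in auto)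
        finally show ?thesis using 1 by (simp add: E_def)
      next
        case 2
        have "integral {x..y} f = (integral {0..y} f - P) - (integral {0..x} f - P)"
          using comb[of 0 x y] 2 xy by (simp add: algebra_simps)
        also have "norm \<dots> \<le> E y + E x"
          by (rule order.trans[OF norm_triangle_ineq4 add_mono]; rule K') (use 2 xy in auto)
        finally show ?thesis using 2 by simp
      next
        case 3
        have "integral {x..y} f = (integral {0..- x} f - P) - (integral {0..- y} f - P)"
          using comb[of 0 "- y" "- x"] refl[of x y] 3 xy by (simp add: algebra_simps)
        also have "norm \<dots> \<le> E (- x) + E (- y)"
          by (rule order.trans[OF norm_triangle_ineq4 add_mono]; rule K') (use 3 xy in auto)
        finally show ?thesis using 3 by (simp add: E_def)
      qed
    qed
    have "integral {a..b} (\<lambda>t. cos t *\<^sub>R ee (L * cos (t - \<alpha>)))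
        = integral {x..y} ((\<lambda>t. cos t *\<^sub>R ee (L * cos (t - \<alpha>))) \<circ> ((+) \<alpha>))"
      using integral_shift_Icc_real[of x y "\<lambda>t. cos t *\<^sub>R ee (L * cos (t - \<alpha>))" \<alpha>] by (simp add: x_def y_def)
    also have "\<dots> = integral {x..y} (\<lambda>t. cos \<alpha> *\<^sub>R f t - sin \<alpha> *\<^sub>R (sin t *\<^sub>R ee (L * cos t)))"
      by (intro integral_cong) (simp add: f_def cos_add scaleR_left_diff_distrib)
    also have "\<dots> = integral {x..y} (\<lambda>t. cos \<alpha> *\<^sub>R f t) - integral {x..y} (\<lambda>t. sin \<alpha> *\<^sub>R (sin t *\<^sub>R ee (L * cos t)))"
      by (intro integral_diff integrable_cmul int) (intro integrable_continuous_interval continuous_intros)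
    also have "\<dots> = cos \<alpha> *\<^sub>R integral {x..y} f - sin \<alpha> *\<^sub>R S"
      by (simp only: integral_cmul S_def x_def y_def)
    finally have "integral {a..b} (\<lambda>t. cos t *\<^sub>R ee (L * cos (t - \<alpha>)))
         - (if a \<le> \<alpha> \<and> \<alpha> \<le> b then (2 * c) * of_real (cos \<alpha>) * ee L / sqrt L else 0)
       = cos \<alpha> *\<^sub>R (integral {x..y} f - (if x \<le> 0 \<and> 0 \<le> y then 2 * P else 0)) - sin \<alpha> *\<^sub>R S"
      by (auto simp: x_def y_def P_def scaleR_conv_of_real right_diff_distrib mult_ac)
    also have "norm \<dots> \<le> norm (cos \<alpha> *\<^sub>R (integral {x..y} f - (if x \<le> 0 \<and> 0 \<le> y then 2 * P else 0))) + norm (sin \<alpha> *\<^sub>R S)"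
      by (rule norm_triangle_ineq4)
    also have "\<dots> \<le> 1 * (E x + E y) + 1 * (1 / L)"
      unfolding norm_scaleR
    proof (intro add_mono mult_mono main)
      show "norm S \<le> 1 / L" unfolding S_def using L ab by (intro sin_ee_integral_le) auto
    qed (use C L in \<open>auto simp: E_def\<close>)
    also have "1 / L \<le> 3 / (sqrt L + L * \<bar>y\<bar>)"
    proof -
      have "sqrt L \<le> L" using L real_sqrt_le_mono[of L "L * L"] by (simp add: mult_left_mono[of 1 L L, simplified])
      moreover have "\<bar>y\<bar> \<le> 2" using xy pi_less_4 by linarith
      hence "L * \<bar>y\<bar> \<le> L * 2" using L by (intro mult_left_mono) auto
      ultimately have d: "sqrt L + L * \<bar>y\<bar> \<le> 3 * L" by simp
      have p: "0 < sqrt L + L * \<bar>y\<bar>" using L by (intro add_pos_nonneg) auto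
      have "1 / L = 3 / (3 * L)" by simp
      also have "\<dots> \<le> 3 / (sqrt L + L * \<bar>y\<bar>)" using d p L by (intro divide_left_mono) auto
      finally show ?thesis .
    qed
    also have "1 * (E x + E y) + 1 * (3 / (sqrt L + L * \<bar>y\<bar>)) \<le> C' / (sqrt L + L * \<bar>a - \<alpha>\<bar>) + C' / (sqrt L + L * \<bar>b - \<alpha>\<bar>)"
    proof -
      have "E x \<le> C' / (sqrt L + L * \<bar>a - \<alpha>\<bar>)" unfolding E_def x_def C'_def using L
        by (intro divide_right_mono) auto
      moreover have "E y + 3 / (sqrt L + L * \<bar>y\<bar>) = C' / (sqrt L + L * \<bar>b - \<alpha>\<bar>)"
        by (simp only: E_def y_def C'_def add_divide_distrib)
      ultimately show ?thesis by simp
    qed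
    finally show ?thesis by simp
  qed
  note main = this
  show ?thesis
    by (rule exI[of _ "2 * c"], rule exI[of _ C'], intro conjI allI impI, use C in \<open>simp add: C'_def\<close>, rule main)
qed

section \<open>The dual sum\<close>

text \<open>From \<open>j = 1\<close> on, each numerator \<open>P\<close> yields the next as
  \<open>P' * (1 + x^2) + (1 - 2 * j) * x * P\<close>, the rule for differentiating \<open>P\<close>
  times the power \<open>1/2 - j\<close> of \<open>1 + x^2\<close>.\<close>

definition hyp_num :: "nat \<Rightarrow> real \<Rightarrow> real" where
  "hyp_num j x = [1 + x^2, x, 1, - 3 * x, 12 * x^2 - 3, 45 * x - 60 * x ^ 3,
     45 - 540 * x^2 + 360 * x ^ 4] ! j"

definition hyp_deriv :: "nat \<Rightarrow> real \<Rightarrow> real" where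
  "hyp_deriv j x = hyp_num j x * (1 + x^2) powr (1 / 2 - (if j = 0 then 1 else real j))"

text \<open>\<open>hyp_deriv j\<close> is the \<open>j\<close>-th derivative of \<open>\<lambda>x. sqrt (1 + x^2)\<close> for \<open>j \<le> 6\<close>.\<close>

lemma hyp_deriv_0: "hyp_deriv 0 x = sqrt (1 + x^2)"
proof -
  have p: "1 + x^2 > 0" by (simp add: add_pos_nonneg)
  have "(1 + x^2) * (1 + x^2) powr (- (1 / 2)) = (1 + x^2) powr (1 / 2)"
    using p powr_add[of "1 + x^2" 1 "- (1/2)"] by simp
  thus ?thesis using p by (simp add: hyp_deriv_def hyp_num_def powr_half_sqrt)
qed

lemma has_real_derivative_powr_quotient:
  assumes "(P has_real_derivative P') (at x)"
  shows "((\<lambda>x. P x * (1 + x^2) powr m) has_real_derivative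
    (P' * (1 + x^2) + 2 * m * x * P x) * (1 + x^2) powr (m - 1)) (at x)"
proof -
  have p: "1 + x^2 > 0" by (simp add: add_pos_nonneg)
  have "((\<lambda>x. 1 + x^2) has_real_derivative 2 * x) (at x)" by (auto intro!: derivative_eq_intros)
  from DERIV_fun_powr[OF this p, of m]
  have "((\<lambda>x. (1 + x^2) powr m) has_real_derivative m * (1 + x^2) powr (m - 1) * (2 * x)) (at x)" by simp
  from DERIV_mult[OF assms this]
  have "((\<lambda>x. P x * (1 + x^2) powr m) has_real_derivative
     P' * (1 + x^2) powr m + m * (1 + x^2) powr (m - 1) * (2 * x) * P x) (at x)" by (simp add: mult_ac)
  moreover have "(1 + x^2) powr m = (1 + x^2) * (1 + x^2) powr (m - 1)"
    using p powr_add[of "1 + x^2" 1 "m - 1"] by simp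
  ultimately show ?thesis by (simp add: algebra_simps)
qed

lemma hyp_deriv_step:
  assumes "j < 6"
  shows "(hyp_deriv j has_real_derivative hyp_deriv (Suc j) x) (at x)"
proof -
  have p: "1 + x^2 > 0" by (simp add: add_pos_nonneg)
  have cases: "j = 0 \<or> j = 1 \<or> j = 2 \<or> j = 3 \<or> j = 4 \<or> j = 5" using assms by linarith
  define P' where "P' = [2 * x, 1, 0, - 3, 24 * x, 45 - 180 * x^2] ! j"
  have P: "(hyp_num j has_real_derivative P') (at x)"
    using cases unfolding hyp_num_def[abs_def] P'_def
    by (elim disjE) (auto intro!: derivative_eq_intros simp: power3_eq_cube power2_eq_square)
  show ?thesis
  proof (cases "j = 0")
    case True
    have "(hyp_deriv 0 has_real_derivative (P' * (1 + x^2) + 2 * (1/2 - 1) * x * hyp_num 0 x) * (1 + x^2) powr (1/2 - 1 - 1)) (at x)"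
      using has_real_derivative_powr_quotient[OF P, of "1/2 - 1"] True by (simp add: hyp_deriv_def[abs_def])
    also have "(P' * (1 + x^2) + 2 * (1/2 - 1) * x * hyp_num 0 x) * (1 + x^2) powr (1/2 - 1 - 1) = hyp_deriv 1 x"
    proof -
      have a: "P' * (1 + x^2) + 2 * (1/2 - 1) * x * hyp_num 0 x = x * (1 + x^2)"
        using True by (simp add: P'_def hyp_num_def algebra_simps)
      have b: "(1 + x^2) * (1 + x^2) powr (1/2 - 1 - 1) = (1 + x^2) powr (1/2 - 1)"
        using p powr_add[of "1 + x^2" 1 "1/2 - 1 - 1"] by simp
      have "hyp_deriv 1 x = x * (1 + x^2) powr (1/2 - 1)" by (simp add: hyp_deriv_def hyp_num_def)
      thus ?thesis unfolding a by (simp only: mult.assoc b)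
    qed
    finally show ?thesis using True by simp
  next
    case False
    have "(hyp_deriv j has_real_derivative (P' * (1 + x^2) + 2 * (1/2 - real j) * x * hyp_num j x) * (1 + x^2) powr (1/2 - real j - 1)) (at x)"
      using has_real_derivative_powr_quotient[OF P, of "1/2 - real j"] False by (simp add: hyp_deriv_def[abs_def])
    moreover have "P' * (1 + x^2) + 2 * (1/2 - real j) * x * hyp_num j x = hyp_num (Suc j) x"
      using cases False unfolding hyp_num_def P'_def
      by (elim disjE) (auto simp: algebra_simps power2_eq_square power3_eq_cube power4_eq_xxxx)
    moreover have "1/2 - real j - 1 = 1/2 - real (Suc j)" by simp
    ultimately show ?thesis by (simp only: hyp_deriv_def) simp
  qed
qed

lemma powr_ge_const:
  assumes "1 \<le> (y::real)" "y \<le> 2" "m \<ge> 0"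
  shows "2 powr (- m) \<le> y powr (- m)" "y powr (- m) \<le> 1"
  using assms powr_mono2'[of "- m" y 2] powr_mono2'[of "- m" 1 y] by auto

abbreviation zone_bound :: "nat \<Rightarrow> real \<Rightarrow> real \<Rightarrow> real \<Rightarrow> real \<Rightarrow> bool" where
  "zone_bound j \<rho> \<alpha> x1 x2 \<equiv> bounded_off_zero (hyp_deriv j) {x1..x2} \<rho> \<alpha>"

text \<open>On \<open>[0, 1]\<close> the power of \<open>1 + x^2\<close> lies between
  \<open>1 / 64\<close> and \<open>1\<close>, and the numerators are at most
  \<open>45 + 540 + 360 = 945\<close>; the ratio \<open>64 * 945\<close> stays below 100000.\<close>

lemma zone_bound_small:
  assumes "j = 5 \<or> j = 6" "0 \<le> x1" "x2 \<le> 1"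
    and "(\<forall>x\<in>{x1..x2}. 1 \<le> hyp_num j x) \<or> (\<forall>x\<in>{x1..x2}. 1 \<le> - hyp_num j x)"
  shows "zone_bound j (1 / 64) 100000 x1 x2"
proof -
  have *: "1 / 64 \<le> y * (1 + x^2) powr (1/2 - real j)" "y * (1 + x^2) powr (1/2 - real j) \<le> 100000 * (1 / 64)"
    if "1 \<le> y" "y \<le> 945" "x \<in> {x1..x2}" for x y
  proof -
    have x: "0 \<le> x" "x \<le> 1" using that assms by auto
    hence "x^2 \<le> 1" by (simp add: power_le_one)
    hence w: "1 \<le> 1 + x^2" "1 + x^2 \<le> 2" by auto
    have "(2::real) powr (- 6) \<le> 2 powr (- (real j - 1/2))" using assms(1) by (intro powr_mono) auto
    hence "1 / 64 \<le> (1 + x^2) powr (- (real j - 1/2))"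
      using powr_ge_const(1)[OF w, of "real j - 1/2"] assms(1) by (simp add: powr_minus powr_numeral) linarith
    moreover have "(1 + x^2) powr (- (real j - 1/2)) \<le> 1"
      by (rule powr_ge_const(2)[OF w]) (use assms(1) in auto)
    moreover have "- (real j - 1/2) = 1/2 - real j" by simp
    ultimately have b: "1 / 64 \<le> (1 + x^2) powr (1/2 - real j)" "(1 + x^2) powr (1/2 - real j) \<le> 1" by simp_all
    show "1 / 64 \<le> y * (1 + x^2) powr (1/2 - real j)"
      using mult_mono[OF that(1) b(1)] that(1) by simp
    have "y * (1 + x^2) powr (1/2 - real j) \<le> 945 * 1" using that b by (intro mult_mono) auto
    thus "y * (1 + x^2) powr (1/2 - real j) \<le> 100000 * (1 / 64)" by simp
  qed
  have up: "\<bar>hyp_num j x\<bar> \<le> 945" if "x \<in> {x1..x2}" for x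
  proof -
    have x: "0 \<le> x" "x \<le> 1" using that assms by auto
    have "0 \<le> x^2" "x^2 \<le> 1" "0 \<le> x ^ 3" "x ^ 3 \<le> 1" "0 \<le> x ^ 4" "x ^ 4 \<le> 1"
      using x by (auto intro: power_le_one)
    hence "\<bar>45 * x - 60 * x ^ 3\<bar> \<le> 945" "\<bar>45 - 540 * x^2 + 360 * x ^ 4\<bar> \<le> 945" using x by linarith+
    thus ?thesis using assms(1) by (auto simp: hyp_num_def)
  qed
  show ?thesis using assms(4)
  proof
    assume "\<forall>x\<in>{x1..x2}. 1 \<le> hyp_num j x"
    thus ?thesis unfolding bounded_off_zero_def hyp_deriv_def using assms(1) * up by (auto simp: abs_le_iff)
  next
    assume "\<forall>x\<in>{x1..x2}. 1 \<le> - hyp_num j x"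
    hence "1 / 64 \<le> (- hyp_num j x) * (1 + x^2) powr (1/2 - real j) \<and> (- hyp_num j x) * (1 + x^2) powr (1/2 - real j) \<le> 100000 * (1 / 64)"
      if "x \<in> {x1..x2}" for x
      using that *[OF _ abs_le_D2[OF up[OF that]] that] by blast
    thus ?thesis unfolding bounded_off_zero_def hyp_deriv_def using assms(1) by auto
  qed
qed

text \<open>For \<open>x \<ge> 0\<close> the fifth derivative vanishes at \<open>0\<close> and at
  \<open>sqrt 3 / 2\<close>, about 0.87, the sixth only near 0.30 and 1.19. So order six is used on
  \<open>[0, 1/4]\<close> and \<open>[3/4, 1]\<close>, order five in between and beyond 1.\<close>

lemma zone_1: "zone_bound 6 (1 / 64) 100000 0 (1 / 4)"
proof (rule zone_bound_small)
  have "1 \<le> 45 - 540 * x^2 + 360 * x ^ 4" if "0 \<le> x" "x \<le> 1 / 4" for x :: real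
  proof -
    have "x^2 \<le> (1 / 4)^2" using that by (intro power_mono) auto
    hence "540 * x^2 \<le> 34" by (simp add: power2_eq_square)
    moreover have "0 \<le> x ^ 4" by simp
    ultimately show ?thesis by linarith
  qed
  thus "(\<forall>x\<in>{0..1/4}. 1 \<le> hyp_num 6 x) \<or> (\<forall>x\<in>{0..1/4}. 1 \<le> - hyp_num 6 x)" by (simp add: hyp_num_def)
qed auto

lemma zone_2: "zone_bound 5 (1 / 64) 100000 (1 / 4) (3 / 4)"
proof (rule zone_bound_small)
  have "1 \<le> 45 * x - 60 * x ^ 3" if "1 / 4 \<le> x" "x \<le> 3 / 4" for x :: real
  proof -
    have "x^2 \<le> (3 / 4)^2" using that by (intro power_mono) auto
    hence "45 / 4 \<le> 45 - 60 * x^2" by (simp add: power2_eq_square)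
    hence "(1 / 4) * (45 / 4) \<le> x * (45 - 60 * x^2)" using that by (intro mult_mono) auto
    thus ?thesis by (simp add: power2_eq_square power3_eq_cube algebra_simps)
  qed
  thus "(\<forall>x\<in>{1/4..3/4}. 1 \<le> hyp_num 5 x) \<or> (\<forall>x\<in>{1/4..3/4}. 1 \<le> - hyp_num 5 x)" by (simp add: hyp_num_def)
qed auto

lemma zone_3: "zone_bound 6 (1 / 64) 100000 (3 / 4) 1"
proof (rule zone_bound_small)
  have "1 \<le> - (45 - 540 * x^2 + 360 * x ^ 4)" if "3 / 4 \<le> x" "x \<le> 1" for x :: real
  proof -
    have "(3 / 4)^2 \<le> x^2" using that by (intro power_mono) auto
    moreover have "x^2 \<le> 1" using that by (simp add: power_le_one)
    ultimately have "(9 / 16) * 180 \<le> x^2 * (540 - 360 * x^2)" by (intro mult_mono) (auto simp: power2_eq_square)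
    thus ?thesis by (simp add: power2_eq_square power4_eq_xxxx algebra_simps)
  qed
  thus "(\<forall>x\<in>{3/4..1}. 1 \<le> hyp_num 6 x) \<or> (\<forall>x\<in>{3/4..1}. 1 \<le> - hyp_num 6 x)" by (simp add: hyp_num_def)
qed auto

text \<open>For \<open>x \<ge> 1\<close> the cubic numerator over a ninth power makes the fifth
  derivative of size \<open>x powr (- 6)\<close>, which varies by at most 64 over a dyadic interval.
  The lower constant \<open>15 / (32 * 64)\<close> is rounded down to
  \<open>1 / 1000\<close>.\<close>

lemma zone_dyadic:
  assumes "1 \<le> X"
  shows "zone_bound 5 (X powr (- 6) / 1000) 60000 X (2 * X)"
proof -
  have "X powr (- 6) / 1000 \<le> - hyp_deriv 5 x \<and> - hyp_deriv 5 x \<le> 60000 * (X powr (- 6) / 1000)"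
    if x: "x \<in> {X..2 * X}" for x
  proof -
    have x1: "1 \<le> x" "X \<le> x" "x \<le> 2 * X" using x assms by auto
    have n: "- hyp_num 5 x = x * (60 * x^2 - 45)"
      by (simp add: hyp_num_def power2_eq_square power3_eq_cube algebra_simps)
    have x2: "1 \<le> x^2" using x1 by (simp add: one_le_power)
    have lo: "15 * x ^ 3 \<le> - hyp_num 5 x"
    proof -
      have "x * (15 * x^2) \<le> x * (60 * x^2 - 45)" using x1 x2 by (intro mult_left_mono) auto
      thus ?thesis unfolding n by (simp add: power2_eq_square power3_eq_cube)
    qed
    have hi: "- hyp_num 5 x \<le> 60 * x ^ 3" using x1 by (simp add: hyp_num_def)
    have px: "x powr (- 9) = (x^2) powr (- (9 / 2))" using x1 by (simp add: powr_powr flip: powr_numeral)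
    have x3: "x ^ 3 * x powr (- 9) = x powr (- 6)"
      using x1 powr_add[of x 3 "- 9"] by (simp flip: powr_numeral)
    have whi: "(1 + x^2) powr (- (9 / 2)) \<le> x powr (- 9)"
      unfolding px using x1 by (intro powr_mono2') auto
    have wlo: "x powr (- 9) / 32 \<le> (1 + x^2) powr (- (9 / 2))"
    proof -
      have "(2 * x^2) powr (- (9 / 2)) \<le> (1 + x^2) powr (- (9 / 2))"
        using x2 by (intro powr_mono2') auto
      moreover have "(2 * x^2) powr (- (9 / 2)) = 2 powr (- (9 / 2)) * x powr (- 9)"
        by (simp add: powr_mult px)
      moreover have "(1 / 32) * x powr (- 9) \<le> 2 powr (- (9 / 2)) * x powr (- 9)"
      proof (rule mult_right_mono)
        have "(2::real) powr (- 5) \<le> 2 powr (- (9 / 2))" by (intro powr_mono) auto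
        thus "1 / 32 \<le> (2::real) powr (- (9 / 2))" by (simp add: powr_minus powr_numeral)
      qed simp
      ultimately show ?thesis by simp
    qed
    have X6: "X powr (- 6) / 64 \<le> x powr (- 6)" "x powr (- 6) \<le> X powr (- 6)"
    proof -
      have "(2 * X) powr (- 6) \<le> x powr (- 6)" using x1 by (intro powr_mono2') auto
      thus "X powr (- 6) / 64 \<le> x powr (- 6)" by (simp add: powr_mult powr_minus powr_numeral)
      show "x powr (- 6) \<le> X powr (- 6)" using x1 assms by (intro powr_mono2') auto
    qed
    have e: "- hyp_deriv 5 x = (- hyp_num 5 x) * (1 + x^2) powr (- (9 / 2))" by (simp add: hyp_deriv_def)
    have "(15 * x ^ 3) * (x powr (- 9) / 32) \<le> - hyp_deriv 5 x"
      unfolding e using x1 order.trans[OF _ lo, of 0] by (intro mult_mono lo wlo) auto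
    hence "(15 / 32) * x powr (- 6) \<le> - hyp_deriv 5 x" by (simp flip: x3)
    moreover have "- hyp_deriv 5 x \<le> (60 * x ^ 3) * x powr (- 9)"
      unfolding e using hi whi x1 by (intro mult_mono) auto
    hence "- hyp_deriv 5 x \<le> 60 * x powr (- 6)" by (simp flip: x3)
    ultimately show ?thesis using X6 by auto
  qed
  thus ?thesis by (simp add: bounded_off_zero_def)
qed

text \<open>Abel summation: the total variation of decreasing weights telescopes, so only the first
  weight survives.\<close>

lemma norm_sum_decreasing_weights:
  fixes w :: "nat \<Rightarrow> real" and z :: "nat \<Rightarrow> complex"
  assumes dec: "\<And>k. k \<in> {u..<v} \<Longrightarrow> w (Suc k) \<le> w k" and pos: "\<And>k. k \<in> {u..v} \<Longrightarrow> 0 \<le> w k"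
    and B: "\<And>n. n \<in> {u..v} \<Longrightarrow> norm (\<Sum>k=u..n. z k) \<le> B" and "0 \<le> B" "u \<le> v"
  shows "norm (\<Sum>k=u..v. w k *\<^sub>R z k) \<le> w u * B"
proof -
  define Z where "Z n = (\<Sum>k=u..n. z k)" for n
  have "(\<Sum>k=u..n. w k *\<^sub>R z k) = w n *\<^sub>R Z n + (\<Sum>k\<in>{u..<n}. (w k - w (Suc k)) *\<^sub>R Z k)" if "u \<le> n" for n
    using that
  proof (induction n rule: dec_induct)
    case base thus ?case by (simp add: Z_def)
  next
    case (step n)
    have "Z (Suc n) = Z n + z (Suc n)" using step.hyps by (simp add: Z_def)
    moreover have "{u..<Suc n} = insert n {u..<n}" using step.hyps by auto
    ultimately show ?case using step by (simp add: algebra_simps)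
  qed
  note eq = this[OF assms(5)]
  have "norm (\<Sum>k=u..v. w k *\<^sub>R z k) \<le> norm (w v *\<^sub>R Z v) + norm (\<Sum>k\<in>{u..<v}. (w k - w (Suc k)) *\<^sub>R Z k)"
    unfolding eq by (rule norm_triangle_ineq)
  also have "norm (w v *\<^sub>R Z v) \<le> w v * B"
    using B[of v] pos[of v] assms(5) by (simp add: Z_def mult_left_mono)
  also have "norm (\<Sum>k\<in>{u..<v}. (w k - w (Suc k)) *\<^sub>R Z k) \<le> (\<Sum>k\<in>{u..<v}. (w k - w (Suc k)) * B)"
    using dec B by (intro sum_norm_le) (auto simp: Z_def intro!: mult_mono)
  also have "\<dots> = (w u - w v) * B"
    using assms(5) sum_Suc_diff'[of u v "\<lambda>k. - w k"] by (simp add: sum_distrib_right[symmetric])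
  finally show ?thesis by (simp add: algebra_simps)
qed


text \<open>Length of the frequency vector \<open>(h, k / e)\<close>. The extreme value of this
  linear form on the circle of radius \<open>T\<close> is \<open>T\<close> times the length, hence
  the phase of \<open>dual_term\<close>.\<close>

definition dual_radius :: "real \<Rightarrow> real \<Rightarrow> nat \<Rightarrow> real" where
  "dual_radius h e k = h * sqrt (1 + (real k / (e * h))^2)"

text \<open>In the variable \<open>x = k / (e * h)\<close> the phase is
  \<open>T * h * sqrt (1 + x^2)\<close> minus a linear term. Its derivative of order
  \<open>j\<close> is \<open>T * h * (e * h) powr (- j) * hyp_deriv j x\<close>, and
  \<open>s\<close> enters only the linear term, which makes the bound uniform in \<open>s\<close>.
  The amplitudes decrease in \<open>k\<close> and come out by partial summation with their value at
  the lower end \<open>x1\<close>.\<close>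

lemma dual_zone:
  assumes "j = 5 \<or> j = 6"
  shows "\<exists>C\<ge>1. \<forall>T h e s x1 x2 \<rho> \<alpha> L. \<forall>u v :: nat. 0 < T \<longrightarrow> 1 \<le> h \<longrightarrow> 1 \<le> e \<longrightarrow> 0 \<le> x1 \<longrightarrow> 0 < \<rho> \<longrightarrow> 1 \<le> \<alpha> \<longrightarrow>
     1 \<le> L \<longrightarrow> zone_bound j \<rho> \<alpha> x1 x2 \<longrightarrow> x1 * (e * h) \<le> real u \<longrightarrow> real v \<le> x2 * (e * h) \<longrightarrow> real v - real u + 1 \<le> L \<longrightarrow>
     norm (\<Sum>k=u..v. (dual_radius h e k powr (-3/2)) *\<^sub>R ee (T * dual_radius h e k - real k * s / e))
      \<le> (h * sqrt (1 + x1^2)) powr (-3/2) * (C * \<alpha> * (L * (T * h * (e * h) powr (- real j) * \<rho>) powr kap j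
           + L powr (1 - 4 / 2 ^ j) * (T * h * (e * h) powr (- real j) * \<rho>) powr (- kap j)))"
proof -
  have j2: "2 \<le> j" "j \<le> 6" using assms by auto
  obtain C where C: "1 \<le> C" and T: "\<And>F u v L \<mu> \<alpha>. 0 < \<mu> \<Longrightarrow> 1 \<le> \<alpha> \<Longrightarrow> 1 \<le> L \<Longrightarrow> real v - real u + 1 \<le> L \<Longrightarrow>
    deriv_chain F j {real u..real v} \<Longrightarrow> bounded_off_zero (F j) {real u..real v} \<mu> \<alpha> \<Longrightarrow>
    norm (\<Sum>n=u..v. ee (F 0 (real n))) \<le> C * \<alpha> * (L * \<mu> powr kap j + L powr (1 - 4 / 2 ^ j) * \<mu> powr (- kap j))"
    using derivative_test[OF j2(1)] by blast
  show ?thesis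
  proof (intro exI[of _ C] conjI allI impI C)
    fix T h e s x1 x2 \<rho> \<alpha> L :: real and u v :: nat
    assume *: "0 < T" "1 \<le> h" "1 \<le> e" "0 \<le> x1" "0 < \<rho>" "1 \<le> \<alpha>" "1 \<le> L"
      and z: "zone_bound j \<rho> \<alpha> x1 x2" and uv: "x1 * (e * h) \<le> real u" "real v \<le> x2 * (e * h)" "real v - real u + 1 \<le> L"
    define \<nu> where "\<nu> = 1 / (e * h)"
    have \<nu>: "0 < \<nu>" using * by (simp add: \<nu>_def)
    define \<mu> where "\<mu> = T * h * (e * h) powr (- real j) * \<rho>"
    have \<nu>j: "\<nu> ^ j = (e * h) powr (- real j)" using * by (simp add: \<nu>_def powr_minus powr_realpow power_one_over field_simps)
    have \<mu>: "0 < \<mu>" using * by (simp add: \<mu>_def)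
    define F where "F i x = T * h * \<nu> ^ i * hyp_deriv i (x * \<nu>) - (if i = 0 then x * s / e else if i = 1 then s / e else 0)" for i x
    have D: "(F i has_real_derivative F (Suc i) x) (at x)" if "i < j" for i x
    proof -
      have a: "(hyp_deriv i has_real_derivative hyp_deriv (Suc i) (x * \<nu>)) (at (x * \<nu>))"
        using that j2 by (intro hyp_deriv_step) auto
      have b: "((\<lambda>x. x * \<nu>) has_real_derivative \<nu>) (at x)" by (auto intro!: derivative_eq_intros)
      have "((\<lambda>x. hyp_deriv i (x * \<nu>)) has_real_derivative hyp_deriv (Suc i) (x * \<nu>) * \<nu>) (at x)"
        by (rule DERIV_chain2[where g = "\<lambda>x. x * \<nu>", OF a b])
      hence 1: "((\<lambda>x. T * h * \<nu> ^ i * hyp_deriv i (x * \<nu>)) has_real_derivative T * h * \<nu> ^ i * (hyp_deriv (Suc i) (x * \<nu>) * \<nu>)) (at x)"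
        by (rule DERIV_cmult)
      have 2: "((\<lambda>x. if i = 0 then x * s / e else if i = 1 then s / e else 0) has_real_derivative (if i = 0 then s / e else 0)) (at x)"
        using *(3) by (cases "i = 0") (auto intro!: derivative_eq_intros)
      show ?thesis using DERIV_diff[OF 1 2] by (simp add: F_def[abs_def] mult_ac)
    qed
    have zz: "(\<forall>x\<in>{real u..real v}. \<mu> \<le> F j x \<and> F j x \<le> \<alpha> * \<mu>) \<or> (\<forall>x\<in>{real u..real v}. \<mu> \<le> - F j x \<and> - F j x \<le> \<alpha> * \<mu>)"
    proof -
      have Fj: "F j x = (T * h * \<nu> ^ j) * hyp_deriv j (x * \<nu>)" for x using assms by (auto simp: F_def)
      have M: "\<mu> = (T * h * \<nu> ^ j) * \<rho>" by (simp add: \<mu>_def \<nu>j)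
      have P: "0 \<le> T * h * \<nu> ^ j" using * \<nu> by simp
      have in_zone: "x * \<nu> \<in> {x1..x2}" if "x \<in> {real u..real v}" for x
        using that uv * by (auto simp: \<nu>_def field_simps)
      from z show ?thesis unfolding bounded_off_zero_def
      proof
        assume a: "\<forall>x\<in>{x1..x2}. \<rho> \<le> hyp_deriv j x \<and> hyp_deriv j x \<le> \<alpha> * \<rho>"
        have "\<mu> \<le> F j x \<and> F j x \<le> \<alpha> * \<mu>" if "x \<in> {real u..real v}" for x
          using mult_left_mono[OF _ P, of \<rho> "hyp_deriv j (x * \<nu>)"] mult_left_mono[OF _ P, of "hyp_deriv j (x * \<nu>)" "\<alpha> * \<rho>"]
            bspec[OF a in_zone[OF that]] unfolding Fj M by (simp add: mult.left_commute)
        thus ?thesis by blast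
      next
        assume a: "\<forall>x\<in>{x1..x2}. \<rho> \<le> - hyp_deriv j x \<and> - hyp_deriv j x \<le> \<alpha> * \<rho>"
        have "\<mu> \<le> - F j x \<and> - F j x \<le> \<alpha> * \<mu>" if "x \<in> {real u..real v}" for x
          using mult_left_mono[OF _ P, of \<rho> "- hyp_deriv j (x * \<nu>)"] mult_left_mono[OF _ P, of "- hyp_deriv j (x * \<nu>)" "\<alpha> * \<rho>"]
            bspec[OF a in_zone[OF that]] unfolding Fj M by (simp add: mult.left_commute)
        thus ?thesis by blast
      qed
    qed
    have F0: "F 0 (real k) = T * dual_radius h e k - real k * s / e" for k
      by (simp add: F_def hyp_deriv_0 dual_radius_def \<nu>_def)
    define B where "B = C * \<alpha> * (L * \<mu> powr kap j + L powr (1 - 4 / 2 ^ j) * \<mu> powr (- kap j))"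
    have B0: "0 \<le> B" using C * by (simp add: B_def)
    show "norm (\<Sum>k=u..v. (dual_radius h e k powr (-3/2)) *\<^sub>R ee (T * dual_radius h e k - real k * s / e))
      \<le> (h * sqrt (1 + x1^2)) powr (-3/2) * (C * \<alpha> * (L * (T * h * (e * h) powr (- real j) * \<rho>) powr kap j
           + L powr (1 - 4 / 2 ^ j) * (T * h * (e * h) powr (- real j) * \<rho>) powr (- kap j)))"
    proof (cases "u \<le> v")
      case False thus ?thesis using B0 by (simp add: B_def \<mu>_def)
    next
      case True
      have r1: "dual_radius h e k \<le> dual_radius h e k'" if "k \<le> k'" for k k'
        using that * by (auto simp: dual_radius_def intro!: mult_left_mono divide_right_mono power_mono)
      have r0: "0 < dual_radius h e k" for k using * by (simp add: dual_radius_def add_pos_nonneg)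
      have "norm (\<Sum>k=u..v. (dual_radius h e k powr (-3/2)) *\<^sub>R ee (T * dual_radius h e k - real k * s / e))
         \<le> dual_radius h e u powr (-3/2) * B"
      proof (rule norm_sum_decreasing_weights)
        fix n assume n: "n \<in> {u..v}"
        show "norm (\<Sum>k=u..n. ee (T * dual_radius h e k - real k * s / e)) \<le> B"
          unfolding F0[symmetric] B_def
          by (rule T) (use \<mu> * uv n D zz in \<open>auto simp: deriv_chain_def bounded_off_zero_def\<close>)
      qed (use r0 r1 B0 True in \<open>auto intro!: powr_mono2'\<close>)
      also have "\<dots> \<le> (h * sqrt (1 + x1^2)) powr (-3/2) * B"
      proof (rule mult_right_mono[OF _ B0])
        have "x1 \<le> real u / (e * h)" using uv * by (simp add: field_simps)
        hence "h * sqrt (1 + x1^2) \<le> dual_radius h e u" unfolding dual_radius_def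
          using * by (intro mult_left_mono real_sqrt_le_mono add_left_mono power_mono) auto
        moreover have "0 < h * sqrt (1 + x1^2)" using * by (simp add: add_pos_nonneg)
        ultimately show "dual_radius h e u powr (-3/2) \<le> (h * sqrt (1 + x1^2)) powr (-3/2)"
          by (intro powr_mono2') auto
      qed
      finally show ?thesis by (simp only: B_def \<mu>_def)
    qed
  qed
qed


text \<open>Exponent bookkeeping is done on logarithms: \<open>T = exp t\<close>, \<open>h = exp y\<close>, \<open>e = exp z\<close>, \<open>X = exp w\<close>.\<close>

lemma exp_powr: "exp a powr b = exp (a * b :: real)"
  by (simp add: powr_def mult.commute)

text \<open>Here \<open>1/30 = kap 5\<close>, \<open>7/8 = 1 - 4 / 2 ^ 5\<close>, and
  \<open>2 * X * (e * h)\<close> bounds the length of the zone. The first term decays like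
  \<open>X powr (- (7/10))\<close>, the second like \<open>X powr (- (17/40))\<close>; the exponents
  of \<open>e\<close> are \<open>- 1/6\<close> and \<open>1/24\<close>. The larger exponent of
  \<open>X\<close> and the round \<open>e powr (1/20)\<close> cover both.\<close>

lemma fifth_derivative_terms:
  fixes T h e X r :: real
  assumes "1 \<le> T" "1 \<le> h" "1 \<le> e" "1 \<le> X" "1 / 1000 \<le> r" "r \<le> 1"
  defines "\<mu> \<equiv> T * h * (e * h) powr (- 5) * (X powr (- 6) * r)"
  shows "(T powr (1/2) * h / e) * ((h * X) powr (-3/2) * ((2 * X * (e * h)) * \<mu> powr (1/30) + (2 * X * (e * h)) powr (7/8) * \<mu> powr (- (1/30))))
    \<le> 6 * X powr (- (17/40)) * e powr (1/20) * (T powr (16/30) * h powr (11/30) + T powr (14/30) * h powr (61/120))"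
proof -
  define t y z w q where "t = ln T" and "y = ln h" and "z = ln e" and "w = ln X" and "q = ln r"
  have ex: "T = exp t" "h = exp y" "e = exp z" "X = exp w" "r = exp q"
    using assms by (auto simp: t_def y_def z_def w_def q_def)
  have nn: "0 \<le> y" "0 \<le> z" "0 \<le> w" "q \<le> 0" using assms by (auto simp: y_def z_def w_def q_def)
  \<comment> \<open>The power \<open>- 1/30\<close> of \<open>r\<close> then costs less than the
    factor \<open>exp 1\<close> granted below.\<close>
  have "- 10 \<le> q"
  proof -
    have "(2::real) ^ 10 \<le> exp 1 ^ 10" using exp_ge_add_one_self[of 1] by (intro power_mono) auto
    hence "1000 \<le> exp (10::real)" by (simp flip: exp_of_nat_mult)
    hence "(1 / 1000) * 1000 \<le> r * exp 10" using assms(5) by (intro mult_mono) auto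
    hence "exp (- 10) \<le> r" by (simp add: exp_minus field_simps)
    thus ?thesis using ex(5) by simp
  qed
  have \<mu>: "\<mu> = exp (t + y - 5 * (z + y) - 6 * w + q)"
    unfolding \<mu>_def ex by (simp add: exp_powr flip: exp_add)
  have "(T powr (1/2) * h / e) * ((h * X) powr (-3/2) * ((2 * X * (e * h)) * \<mu> powr (1/30)))
      = 2 * ((T powr (1/2) * h / e) * ((h * X) powr (-3/2) * ((X * (e * h)) * \<mu> powr (1/30))))" by simp
  also have "\<dots> = 2 * exp (t / 2 + y - z - 3/2 * (y + w) + (w + z + y) + (t + y - 5 * (z + y) - 6 * w + q) / 30)"
    unfolding \<mu> ex by (simp only: exp_powr mult_exp_exp exp_diff[symmetric]; simp add: field_simps)
  also have "\<dots> \<le> 2 * exp (- (17/40) * w + z / 20 + (16/30 * t + 11/30 * y))"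
    using nn by (intro mult_left_mono) (auto simp: field_simps)
  also have "\<dots> = 2 * (X powr (- (17/40)) * e powr (1/20) * (T powr (16/30) * h powr (11/30)))"
    unfolding ex by (simp add: exp_powr mult_ac flip: exp_add)
  finally have 1: "(T powr (1/2) * h / e) * ((h * X) powr (-3/2) * ((2 * X * (e * h)) * \<mu> powr (1/30)))
      \<le> 2 * (X powr (- (17/40)) * e powr (1/20) * (T powr (16/30) * h powr (11/30)))" .
  have "(T powr (1/2) * h / e) * ((h * X) powr (-3/2) * ((2 * X * (e * h)) powr (7/8) * \<mu> powr (- (1/30))))
      = 2 powr (7/8) * ((T powr (1/2) * h / e) * ((h * X) powr (-3/2) * ((X * (e * h)) powr (7/8) * \<mu> powr (- (1/30)))))"
    using assms by (simp add: powr_mult)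
  also have "\<dots> = 2 powr (7/8) * exp (t / 2 + y - z - 3/2 * (y + w) + 7/8 * (w + z + y) - (t + y - 5 * (z + y) - 6 * w + q) / 30)"
    unfolding \<mu> ex by (simp only: exp_powr mult_exp_exp exp_diff[symmetric]; simp add: field_simps)
  also have "\<dots> \<le> 2 * exp (1 + (- (17/40) * w + z / 20 + (14/30 * t + 61/120 * y)))"
  proof (rule mult_mono)
    show "2 powr (7/8) \<le> (2::real)" using powr_mono[of "7/8" 1 "2::real"] by simp
  qed (use nn \<open>- 10 \<le> q\<close> in \<open>auto simp: field_simps\<close>)
  also have "\<dots> = 2 * exp 1 * (X powr (- (17/40)) * e powr (1/20) * (T powr (14/30) * h powr (61/120)))"
    unfolding ex by (simp add: exp_powr mult_ac exp_add flip: exp_add)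
  also have "\<dots> \<le> 6 * (X powr (- (17/40)) * e powr (1/20) * (T powr (14/30) * h powr (61/120)))"
    using exp_le by (intro mult_right_mono) auto
  finally have 2: "(T powr (1/2) * h / e) * ((h * X) powr (-3/2) * ((2 * X * (e * h)) powr (7/8) * \<mu> powr (- (1/30))))
      \<le> 6 * (X powr (- (17/40)) * e powr (1/20) * (T powr (14/30) * h powr (61/120)))" .
  have "0 \<le> X powr (- (17/40)) * e powr (1/20) * (T powr (16/30) * h powr (11/30))" by simp
  thus ?thesis using add_mono[OF 1 2] by (simp only: distrib_left mult.assoc; linarith?)
qed

text \<open>The same bookkeeping with \<open>kap 6 = 1/62\<close> and
  \<open>15/16 = 1 - 4 / 2 ^ 6\<close>. The last term, with exponents \<open>30/62\<close> and
  \<open>257/496\<close>, is the one that determines \<open>\<theta>\<close>.\<close>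

lemma sixth_derivative_terms:
  fixes T h e :: real
  assumes "1 \<le> T" "1 \<le> h" "1 \<le> e"
  defines "\<mu> \<equiv> T * h * (e * h) powr (- 6) * (1 / 64)"
  shows "(T powr (1/2) * h / e) * (h powr (-3/2) * ((2 * (e * h)) * \<mu> powr (1/62) + (2 * (e * h)) powr (15/16) * \<mu> powr (- (1/62))))
    \<le> 6 * e powr (1/20) * (T powr (32/62) * h powr (26/62) + T powr (30/62) * h powr (257/496))"
proof -
  define t y z q where "t = ln T" and "y = ln h" and "z = ln e" and "q = ln (1 / 64 :: real)"
  have ex: "T = exp t" "h = exp y" "e = exp z" "1 / 64 = exp q"
    using assms by (auto simp: t_def y_def z_def q_def)
  have nn: "0 \<le> y" "0 \<le> z" "q \<le> 0" using assms by (auto simp: y_def z_def q_def)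
  have "- 10 \<le> q"
  proof -
    have "(2::real) ^ 10 \<le> exp 1 ^ 10" using exp_ge_add_one_self[of 1] by (intro power_mono) auto
    hence "1000 \<le> exp (10::real)" by (simp flip: exp_of_nat_mult)
    hence "exp (- 10) \<le> (1 / 64 :: real)" by (simp add: exp_minus field_simps)
    thus ?thesis using ex(4) by simp
  qed
  have \<mu>: "\<mu> = exp (t + y - 6 * (z + y) + q)"
    unfolding \<mu>_def ex by (simp add: exp_powr flip: exp_add)
  have "(T powr (1/2) * h / e) * (h powr (-3/2) * ((2 * (e * h)) * \<mu> powr (1/62)))
      = 2 * ((T powr (1/2) * h / e) * (h powr (-3/2) * ((e * h) * \<mu> powr (1/62))))" by simp
  also have "\<dots> = 2 * exp (t / 2 + y - z - 3/2 * y + (z + y) + (t + y - 6 * (z + y) + q) / 62)"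
    unfolding \<mu> ex by (simp only: exp_powr mult_exp_exp exp_diff[symmetric]; simp add: field_simps)
  also have "\<dots> \<le> 2 * exp (z / 20 + (32/62 * t + 26/62 * y))"
    using nn by (intro mult_left_mono) (auto simp: field_simps)
  also have "\<dots> = 2 * (e powr (1/20) * (T powr (32/62) * h powr (26/62)))"
    unfolding ex by (simp add: exp_powr mult_ac flip: exp_add)
  finally have 1: "(T powr (1/2) * h / e) * (h powr (-3/2) * ((2 * (e * h)) * \<mu> powr (1/62)))
      \<le> 2 * (e powr (1/20) * (T powr (32/62) * h powr (26/62)))" .
  have "(T powr (1/2) * h / e) * (h powr (-3/2) * ((2 * (e * h)) powr (15/16) * \<mu> powr (- (1/62))))
      = 2 powr (15/16) * ((T powr (1/2) * h / e) * (h powr (-3/2) * ((e * h) powr (15/16) * \<mu> powr (- (1/62)))))"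
    using assms by (simp add: powr_mult)
  also have "\<dots> = 2 powr (15/16) * exp (t / 2 + y - z - 3/2 * y + 15/16 * (z + y) - (t + y - 6 * (z + y) + q) / 62)"
    unfolding \<mu> ex by (simp only: exp_powr mult_exp_exp exp_diff[symmetric]; simp add: field_simps)
  also have "\<dots> \<le> 2 * exp (1 + (z / 20 + (30/62 * t + 257/496 * y)))"
  proof (rule mult_mono)
    show "2 powr (15/16) \<le> (2::real)" using powr_mono[of "15/16" 1 "2::real"] by simp
  qed (use nn \<open>- 10 \<le> q\<close> in \<open>auto simp: field_simps\<close>)
  also have "\<dots> = 2 * exp 1 * (e powr (1/20) * (T powr (30/62) * h powr (257/496)))"
    unfolding ex by (simp add: exp_powr mult_ac exp_add flip: exp_add)
  also have "\<dots> \<le> 6 * (e powr (1/20) * (T powr (30/62) * h powr (257/496)))"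
    using exp_le by (intro mult_right_mono) auto
  finally have 2: "(T powr (1/2) * h / e) * (h powr (-3/2) * ((2 * (e * h)) powr (15/16) * \<mu> powr (- (1/62))))
      \<le> 6 * (e powr (1/20) * (T powr (30/62) * h powr (257/496)))" .
  have "0 \<le> e powr (1/20) * (T powr (32/62) * h powr (26/62))" by simp
  thus ?thesis using add_mono[OF 1 2] by (simp only: distrib_left mult.assoc; linarith?)
qed


definition dual_bound :: "real \<Rightarrow> real \<Rightarrow> real \<Rightarrow> real" where
  "dual_bound T h e = e powr (1/20) * (T powr (16/30) * h powr (11/30) + T powr (14/30) * h powr (61/120)
     + (T powr (32/62) * h powr (26/62) + T powr (30/62) * h powr (257/496)))"

definition dual_term :: "real \<Rightarrow> real \<Rightarrow> real \<Rightarrow> real \<Rightarrow> nat \<Rightarrow> complex" where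
  "dual_term T h e s k = (dual_radius h e k powr (-3/2)) *\<^sub>R ee (T * dual_radius h e k - real k * s / e)"

text \<open>Cut the range of \<open>k / (e * h)\<close> at \<open>1/4\<close>, \<open>3/4\<close>
  and \<open>1\<close>, then dyadically, and use on each piece the order whose derivative is bounded
  away from zero. The dyadic pieces form a geometric series, so no logarithm appears and the range
  \<open>u..v\<close> may be arbitrary.\<close>

lemma dual_sum_estimate:
  "\<exists>C>0. \<forall>T h e s. \<forall>u v :: nat. 1 \<le> T \<longrightarrow> 1 \<le> h \<longrightarrow> 1 \<le> e \<longrightarrow>
     (T powr (1/2) * h / e) * norm (\<Sum>k=u..v. dual_term T h e s k) \<le> C * dual_bound T h e"
proof -
  obtain C5 where C5: "1 \<le> C5" and Z5: "\<And>T h e s x1 x2 \<rho> \<alpha> L u v. 0 < T \<Longrightarrow> 1 \<le> h \<Longrightarrow> 1 \<le> e \<Longrightarrow> 0 \<le> x1 \<Longrightarrow> 0 < \<rho> \<Longrightarrow> 1 \<le> \<alpha> \<Longrightarrow>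
     1 \<le> L \<Longrightarrow> zone_bound 5 \<rho> \<alpha> x1 x2 \<Longrightarrow> x1 * (e * h) \<le> real u \<Longrightarrow> real v \<le> x2 * (e * h) \<Longrightarrow> real v - real u + 1 \<le> L \<Longrightarrow>
     norm (\<Sum>k=u..v. (dual_radius h e k powr (-3/2)) *\<^sub>R ee (T * dual_radius h e k - real k * s / e))
      \<le> (h * sqrt (1 + x1^2)) powr (-3/2) * (C5 * \<alpha> * (L * (T * h * (e * h) powr (- real 5) * \<rho>) powr kap 5
           + L powr (1 - 4 / 2 ^ 5) * (T * h * (e * h) powr (- real 5) * \<rho>) powr (- kap 5)))"
    using dual_zone[of 5] by blast
  obtain C6 where C6: "1 \<le> C6" and Z6: "\<And>T h e s x1 x2 \<rho> \<alpha> L u v. 0 < T \<Longrightarrow> 1 \<le> h \<Longrightarrow> 1 \<le> e \<Longrightarrow> 0 \<le> x1 \<Longrightarrow> 0 < \<rho> \<Longrightarrow> 1 \<le> \<alpha> \<Longrightarrow>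
     1 \<le> L \<Longrightarrow> zone_bound 6 \<rho> \<alpha> x1 x2 \<Longrightarrow> x1 * (e * h) \<le> real u \<Longrightarrow> real v \<le> x2 * (e * h) \<Longrightarrow> real v - real u + 1 \<le> L \<Longrightarrow>
     norm (\<Sum>k=u..v. (dual_radius h e k powr (-3/2)) *\<^sub>R ee (T * dual_radius h e k - real k * s / e))
      \<le> (h * sqrt (1 + x1^2)) powr (-3/2) * (C6 * \<alpha> * (L * (T * h * (e * h) powr (- real 6) * \<rho>) powr kap 6
           + L powr (1 - 4 / 2 ^ 6) * (T * h * (e * h) powr (- real 6) * \<rho>) powr (- kap 6)))"
    using dual_zone[of 6] by blast
  \<comment> \<open>Decay from one dyadic zone to the next, given by the factor
    \<open>X powr (- (17/40))\<close> of \<open>fifth_derivative_terms\<close>.\<close>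
  define r where "r = (2::real) powr (- (17/40))"
  have r: "0 < r" "r < 1" by (auto simp: r_def powr_less_one)
  define C where "C = 100000 * 6 * (C5 + C5 / (1 - r) + 2 * C6)"
  have Cpos: "0 < C" using C5 C6 r by (simp add: C_def add_pos_nonneg)
  define Q where "Q = C5 + C5 / (1 - r) + 2 * C6"
  have "0 \<le> C5 / (1 - r)" using C5 r by simp
  hence Q: "2 * C6 \<le> Q" "C5 + C5 / (1 - r) \<le> Q" using C5 C6 by (simp_all add: Q_def)
  have "(T powr (1/2) * h / e) * norm (\<Sum>k=u..v. dual_term T h e s k) \<le> C * dual_bound T h e"
    if *: "1 \<le> T" "1 \<le> h" "1 \<le> e" for T h e s u v
  proof -
    define f where "f = dual_term T h e s"
    define c where "c = e * h"
    have c1: "1 \<le> c" using mult_mono[of 1 e 1 h] * by (simp add: c_def)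
    define A where "A x1 x2 = {k\<in>{u..v}. x1 * c \<le> real k \<and> real k < x2 * c}" for x1 x2
    define W where "W = T powr (1/2) * h / e"
    have W0: "0 \<le> W" using * by (simp add: W_def)
    define B5 where "B5 = e powr (1/20) * (T powr (16/30) * h powr (11/30) + T powr (14/30) * h powr (61/120))"
    define B6 where "B6 = e powr (1/20) * (T powr (32/62) * h powr (26/62) + T powr (30/62) * h powr (257/496))"
    have B0: "0 \<le> B5" "0 \<le> B6" by (auto simp: B5_def B6_def)
    have finA: "finite (A x1 x2)" for x1 x2 by (simp add: A_def)
    have interval: "\<exists>u' v'. A x1 x2 = {u'..v'} \<and> x1 * c \<le> real u' \<and> real v' \<le> x2 * c \<and> real v' - real u' + 1 \<le> (x2 - x1) * c + 1"
      if "A x1 x2 \<noteq> {}" for x1 x2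
    proof -
      have cv: "y \<in> A x1 x2" if "x \<in> A x1 x2" "z \<in> A x1 x2" "x \<le> y" "y \<le> z" for x y z
        using that by (auto simp: A_def)
      have "A x1 x2 = {Min (A x1 x2)..<Suc (Max (A x1 x2))}"
        by (rule convex_nat_set_eq_atLeastLessThan[OF finA that cv])
      hence e: "A x1 x2 = {Min (A x1 x2)..Max (A x1 x2)}" by (simp add: atLeastLessThanSuc_atLeastAtMost)
      have "Min (A x1 x2) \<in> A x1 x2" "Max (A x1 x2) \<in> A x1 x2" using finA that by auto
      hence m: "x1 * c \<le> real (Min (A x1 x2))" "real (Max (A x1 x2)) \<le> x2 * c" by (auto simp: A_def)
      show ?thesis by (intro exI conjI, rule e) (use m in \<open>simp_all add: left_diff_distrib\<close>)
    qed
    have zone5: "W * norm (\<Sum>k\<in>A x1 x2. f k) \<le> 100000 * C5 * (6 * X powr (- (17/40)) * B5)"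
      if z: "zone_bound 5 (X powr (- 6) * \<rho>) \<alpha> x1 x2" and X: "1 \<le> X" "1/1000 \<le> \<rho>" "\<rho> \<le> 1" and \<alpha>: "1 \<le> \<alpha>" "\<alpha> \<le> 100000"
        and x: "0 \<le> x1" "X^2 \<le> 1 + x1^2" "x2 - x1 \<le> X" for X \<rho> \<alpha> x1 x2
    proof (cases "A x1 x2 = {}")
      case True thus ?thesis using B0 C5 by simp
    next
      case False
      then obtain u' v' where uv: "A x1 x2 = {u'..v'}" "x1 * c \<le> real u'" "real v' \<le> x2 * c" "real v' - real u' + 1 \<le> (x2 - x1) * c + 1"
        using interval by blast
      define \<mu> where "\<mu> = T * h * (e * h) powr (- 5) * (X powr (- 6) * \<rho>)"
      define V where "V = (2 * X * (e * h)) * \<mu> powr (1/30) + (2 * X * (e * h)) powr (7/8) * \<mu> powr (- (1/30))"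
      have Xc: "1 \<le> X * c" using mult_mono[OF X(1) c1] X by simp
      have "(x2 - x1) * c \<le> X * c" using x c1 by (intro mult_right_mono) auto
      hence L: "real v' - real u' + 1 \<le> 2 * X * (e * h)" "1 \<le> 2 * X * (e * h)"
        using uv(4) Xc by (simp_all add: c_def[symmetric] mult.assoc)
      have "norm (\<Sum>k\<in>A x1 x2. f k) \<le> (h * sqrt (1 + x1^2)) powr (-3/2) * (C5 * \<alpha> * V)"
        unfolding uv(1) f_def dual_term_def
        using Z5[OF _ *(2,3) x(1) _ \<alpha>(1) L(2) z, of T u' v' s] * X uv(2,3) L(1)
        by (simp add: V_def \<mu>_def kap_def c_def[symmetric])
      also have "\<dots> \<le> (h * X) powr (-3/2) * (C5 * 100000 * V)"
      proof (rule mult_mono)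
        have "X \<le> sqrt (1 + x1^2)" using x(2) by (intro real_le_rsqrt)
        hence "h * X \<le> h * sqrt (1 + x1^2)" using * by (intro mult_left_mono) auto
        thus "(h * sqrt (1 + x1^2)) powr (-3/2) \<le> (h * X) powr (-3/2)"
          using * X by (intro powr_mono2') auto
        have "0 \<le> V" using * X by (simp add: V_def)
        thus "C5 * \<alpha> * V \<le> C5 * 100000 * V" "0 \<le> C5 * \<alpha> * V"
          using C5 \<alpha> by (auto intro!: mult_right_mono mult_left_mono)
      qed simp
      finally have "W * norm (\<Sum>k\<in>A x1 x2. f k) \<le> W * ((h * X) powr (-3/2) * (C5 * 100000 * V))"
        using W0 by (rule mult_left_mono)
      also have "\<dots> = 100000 * C5 * (W * ((h * X) powr (-3/2) * V))" by (simp add: mult_ac)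
      also have "\<dots> \<le> 100000 * C5 * (6 * X powr (- (17/40)) * B5)"
        using fifth_derivative_terms[OF *(1,2,3) X] C5
        by (intro mult_left_mono) (auto simp: W_def V_def \<mu>_def B5_def mult.assoc)
      finally show ?thesis .
    qed
    have zone6: "W * norm (\<Sum>k\<in>A x1 x2. f k) \<le> 100000 * C6 * (6 * B6)"
      if z: "zone_bound 6 (1 / 64) 100000 x1 x2" and x: "0 \<le> x1" "x2 - x1 \<le> 1" for x1 x2
    proof (cases "A x1 x2 = {}")
      case True thus ?thesis using B0 C6 by simp
    next
      case False
      then obtain u' v' where uv: "A x1 x2 = {u'..v'}" "x1 * c \<le> real u'" "real v' \<le> x2 * c" "real v' - real u' + 1 \<le> (x2 - x1) * c + 1"
        using interval by blast
      define \<mu> where "\<mu> = T * h * (e * h) powr (- 6) * (1 / 64)"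
      define V where "V = (2 * (e * h)) * \<mu> powr (1/62) + (2 * (e * h)) powr (15/16) * \<mu> powr (- (1/62))"
      have "(x2 - x1) * c \<le> 1 * c" using x c1 by (intro mult_right_mono) auto
      hence L: "real v' - real u' + 1 \<le> 2 * (e * h)" "1 \<le> 2 * (e * h)"
        unfolding c_def[symmetric] using uv(4) c1 by linarith+
      have "norm (\<Sum>k\<in>A x1 x2. f k) \<le> (h * sqrt (1 + x1^2)) powr (-3/2) * (C6 * 100000 * V)"
        unfolding uv(1) f_def dual_term_def
        using Z6[OF _ *(2,3) x(1) _ _ L(2) z, of T u' v' s] * uv(2,3) L(1)
        by (simp add: V_def \<mu>_def kap_def c_def[symmetric])
      also have "\<dots> \<le> h powr (-3/2) * (C6 * 100000 * V)"
      proof (rule mult_right_mono)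
        have "h \<le> h * sqrt (1 + x1^2)" using * by (simp add: mult_le_cancel_left1)
        thus "(h * sqrt (1 + x1^2)) powr (-3/2) \<le> h powr (-3/2)"
          using * by (intro powr_mono2') auto
        show "0 \<le> C6 * 100000 * V" using * C6 by (simp add: V_def)
      qed
      finally have "W * norm (\<Sum>k\<in>A x1 x2. f k) \<le> W * (h powr (-3/2) * (C6 * 100000 * V))"
        using W0 by (rule mult_left_mono)
      also have "\<dots> = 100000 * C6 * (W * (h powr (-3/2) * V))" by (simp add: mult_ac)
      also have "\<dots> \<le> 100000 * C6 * (6 * B6)"
        using sixth_derivative_terms[OF *(1,2,3)] C6
        by (intro mult_left_mono) (auto simp: W_def V_def \<mu>_def B6_def mult.assoc)
      finally show ?thesis .
    qed
    have dyadic: "W * norm (\<Sum>k\<in>A (2 ^ i) (2 ^ Suc i). f k) \<le> 100000 * C5 * (6 * r ^ i * B5)" for i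
    proof -
      have "(2 ^ i) powr (- (17/40)) = r ^ i"
      proof -
        have "(2 ^ i :: real) powr (- (17/40)) = (2 powr real i) powr (- (17/40))" by (simp add: powr_realpow)
        also have "\<dots> = r powr real i" by (simp add: r_def powr_powr mult.commute)
        finally show ?thesis using r by (simp add: powr_realpow)
      qed
      moreover have "W * norm (\<Sum>k\<in>A (2 ^ i) (2 ^ Suc i). f k) \<le> 100000 * C5 * (6 * (2 ^ i) powr (- (17/40)) * B5)"
        using zone5[where X = "2 ^ i" and \<rho> = "1/1000" and \<alpha> = 60000 and ?x1.0 = "2 ^ i" and ?x2.0 = "2 ^ Suc i"]
          zone_dyadic[of "2 ^ i"] by simp
      ultimately show ?thesis by simp
    qed
    have union_dyadic: "(\<Sum>k\<in>A 1 (2 ^ I). f k) = (\<Sum>i<I. \<Sum>k\<in>A (2 ^ i) (2 ^ Suc i). f k)" for I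
    proof (induction I)
      case 0
      have "A 1 (2 ^ 0) = {}" by (auto simp: A_def)
      thus ?case by (simp only: sum.empty lessThan_0)
    next
      case (Suc I)
      have "2 ^ I * c \<le> 2 ^ Suc I * c" "1 * c \<le> 2 ^ I * c" using c1 by (intro mult_right_mono; simp)+
      hence "A 1 (2 ^ Suc I) = A 1 (2 ^ I) \<union> A (2 ^ I) (2 ^ Suc I)" "A 1 (2 ^ I) \<inter> A (2 ^ I) (2 ^ Suc I) = {}"
        by (auto simp: A_def)
      thus ?case using Suc by (simp add: sum.union_disjoint finA)
    qed
    obtain I where I: "real v < 2 ^ I" using real_arch_pow[of 2 "real v"] by auto
    have le: "2 ^ I * 1 \<le> 2 ^ I * c" using c1 by (intro mult_left_mono) auto
    have I': "real k < 2 ^ I * c" if "k \<le> v" for k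
    proof -
      have "real k \<le> real v" using that by simp
      thus ?thesis using I le by linarith
    qed
    have split: "{u..v} = A 0 (1/4) \<union> (A (1/4) (3/4) \<union> (A (3/4) 1 \<union> A 1 (2 ^ I)))"
      using I' by (auto simp: A_def)
    have "(\<Sum>k=u..v. f k) = (\<Sum>k\<in>A 0 (1/4). f k) + ((\<Sum>k\<in>A (1/4) (3/4). f k) + ((\<Sum>k\<in>A (3/4) 1. f k) + (\<Sum>k\<in>A 1 (2 ^ I). f k)))"
      unfolding split using c1 finA
      by (subst sum.union_disjoint; (simp add: finA; fail)?; (force simp: A_def; fail)?)+
    hence "norm (\<Sum>k=u..v. f k) \<le> norm (\<Sum>k\<in>A 0 (1/4). f k) + (norm (\<Sum>k\<in>A (1/4) (3/4). f k) + (norm (\<Sum>k\<in>A (3/4) 1. f k) + (\<Sum>i<I. norm (\<Sum>k\<in>A (2 ^ i) (2 ^ Suc i). f k))))"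
      unfolding union_dyadic by (simp only:) (intro norm_triangle_mono order.refl norm_sum)
    hence "W * norm (\<Sum>k=u..v. f k) \<le> W * (norm (\<Sum>k\<in>A 0 (1/4). f k) + (norm (\<Sum>k\<in>A (1/4) (3/4). f k) + (norm (\<Sum>k\<in>A (3/4) 1. f k) + (\<Sum>i<I. norm (\<Sum>k\<in>A (2 ^ i) (2 ^ Suc i). f k)))))"
      using W0 by (rule mult_left_mono)
    also have "\<dots> = W * norm (\<Sum>k\<in>A 0 (1/4). f k) + (W * norm (\<Sum>k\<in>A (1/4) (3/4). f k) + (W * norm (\<Sum>k\<in>A (3/4) 1. f k) + (\<Sum>i<I. W * norm (\<Sum>k\<in>A (2 ^ i) (2 ^ Suc i). f k))))"
      by (simp only: distrib_left sum_distrib_left)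
    also have "\<dots> \<le> 100000 * C6 * (6 * B6) + (100000 * C5 * (6 * 1 powr (- (17/40)) * B5) + (100000 * C6 * (6 * B6) + (\<Sum>i<I. 100000 * C5 * (6 * r ^ i * B5))))"
    proof (intro add_mono sum_mono dyadic zone6 zone_1 zone_3)
      show "W * norm (\<Sum>k\<in>A (1/4) (3/4). f k) \<le> 100000 * C5 * (6 * 1 powr (- (17/40)) * B5)"
        using zone5[where X = 1 and \<rho> = "1/64" and \<alpha> = 100000 and ?x1.0 = "1/4" and ?x2.0 = "3/4"]
          zone_2 by simp
    qed auto
    also have "(\<Sum>i<I. 100000 * C5 * (6 * r ^ i * B5)) = 600000 * C5 * B5 * (\<Sum>i<I. r ^ i)"
    proof -
      have "100000 * C5 * (6 * r ^ i * B5) = 600000 * C5 * B5 * r ^ i" for i by simp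
      thus ?thesis by (simp only: sum_distrib_left)
    qed
    also have "\<dots> \<le> 600000 * C5 * B5 * (1 / (1 - r))"
    proof (rule mult_left_mono)
      have "(\<Sum>i<I. r ^ i) = (1 - r ^ I) / (1 - r)" using r sum_gp_strict[of r I] by simp
      also have "\<dots> \<le> 1 / (1 - r)" using r by (intro divide_right_mono) auto
      finally show "(\<Sum>i<I. r ^ i) \<le> 1 / (1 - r)" .
    qed (use C5 B0 in auto)
    also have "100000 * C6 * (6 * B6) + (100000 * C5 * (6 * 1 powr (- (17/40)) * B5) + (100000 * C6 * (6 * B6) + 600000 * C5 * B5 * (1 / (1 - r))))
       = 600000 * ((2 * C6) * B6 + (C5 + C5 / (1 - r)) * B5)" by (simp add: algebra_simps)
    also have "\<dots> \<le> 600000 * (Q * B6 + Q * B5)"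
      by (intro mult_left_mono add_mono mult_right_mono Q B0) auto
    also have "\<dots> = C * dual_bound T h e" by (simp add: C_def Q_def dual_bound_def B5_def B6_def algebra_simps)
    finally show ?thesis by (simp add: W_def f_def)
  qed
  note main = this
  show ?thesis by (rule exI[of _ C]) (use main Cpos in simp)
qed

section \<open>Power sums with smoothed Fourier weights\<close>

lemma powr_neg_diff_ge:
  fixes a k :: real
  assumes "0 < a" "a \<le> 1" "1 < k"
  shows "a * k powr (- a - 1) \<le> (k - 1) powr (- a) - k powr (- a)"
proof -
  have k: "0 < k powr a" "0 < (k - 1) powr a" "(k - 1) powr a \<le> k powr a" using assms by (auto intro: powr_mono2)
  have "a * k powr (- a - 1) = a * k powr (a - 1) / (k powr a * k powr a)"
    using assms by (simp add: powr_diff powr_minus field_simps)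
  also have "\<dots> \<le> (k powr a - (k - 1) powr a) / (k powr a * k powr a)"
    using assms k by (intro divide_right_mono powr_diff_ge) auto
  also have "\<dots> \<le> (k powr a - (k - 1) powr a) / (k powr a * (k - 1) powr a)"
    using k by (intro divide_left_mono mult_left_mono mult_pos_pos) auto
  also have "\<dots> = (k - 1) powr (- a) - k powr (- a)"
    using k by (simp add: powr_minus field_simps)
  finally show ?thesis .
qed

text \<open>The two bounds in the weight cross at \<open>k = 1 / \<eta>\<close>. Below, the terms
  are at most \<open>k powr (p - 1)\<close> and grow in sum; above, they are at most
  \<open>k powr (p - 2) / \<eta>\<close> and form a convergent tail. Both parts have size
  \<open>\<eta> powr (- p)\<close>.\<close>

lemma smoothed_power_sum:
  fixes p \<eta> :: real
  assumes p: "0 < p" "p < 1" and \<eta>: "0 < \<eta>" "\<eta> < 1"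
  shows "(\<Sum>k=1..K. smooth_weight \<eta> k * real k powr p) \<le> (1 / p + 2 / (1 - p)) * \<eta> powr (- p)"
proof -
  define f where "f k = smooth_weight \<eta> k * real k powr p" for k :: nat
  have f0: "0 \<le> f k" for k using \<eta> by (simp add: f_def)
  define M where "M = nat \<lfloor>1 / \<eta>\<rfloor>"
  have e1: "1 < 1 / \<eta>" using \<eta> by simp
  have M: "1 \<le> M" "real M \<le> 1 / \<eta>" "1 / \<eta> \<le> 2 * real M" 
  proof -
    have "1 \<le> nat \<lfloor>x\<rfloor> \<and> real (nat \<lfloor>x\<rfloor>) \<le> x \<and> x \<le> 2 * real (nat \<lfloor>x\<rfloor>)" if "1 < x" for x :: real
    proof -
      have f: "1 \<le> \<lfloor>x\<rfloor>" using that by (simp add: le_floor_iff)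
      have "1 \<le> nat \<lfloor>x\<rfloor>" using f by linarith
      moreover have "real (nat \<lfloor>x\<rfloor>) = real_of_int \<lfloor>x\<rfloor>" using f by simp
      moreover have "real_of_int \<lfloor>x\<rfloor> \<le> x" "x < real_of_int \<lfloor>x\<rfloor> + 1" "1 \<le> real_of_int \<lfloor>x\<rfloor>" using f by simp_all
      ultimately show ?thesis by (intro conjI; linarith)
    qed
    from this[OF e1] show "1 \<le> M" "real M \<le> 1 / \<eta>" "1 / \<eta> \<le> 2 * real M" by (simp_all only: M_def)
  qed
  have 1: "(\<Sum>k=1..M. f k) \<le> 1 / p * \<eta> powr (- p)"
  proof -
    have "(\<Sum>k=1..M. f k) \<le> (\<Sum>k=1..M. real k powr (p - 1))"
    proof (rule sum_mono)
      fix k assume k: "k \<in> {1..M}"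
      have "f k \<le> (1 / real k) * real k powr p" unfolding f_def by (intro mult_right_mono) auto
      also have "\<dots> = real k powr (p - 1)" using k by (simp add: powr_diff)
      finally show "f k \<le> real k powr (p - 1)" .
    qed
    also have "\<dots> \<le> real M powr p / p" using p by (intro sum_powr_le) auto
    also have "\<dots> \<le> (1 / \<eta>) powr p / p" using p M by (intro divide_right_mono powr_mono2) auto
    finally show ?thesis using \<eta> by (simp add: powr_divide powr_minus inverse_eq_divide mult.commute)
  qed
  have 2: "(\<Sum>k\<in>{M<..N}. f k) \<le> 2 / (1 - p) * \<eta> powr (- p)" if "M \<le> N" for N
  proof -
    have tele: "(\<Sum>k\<in>{M<..N}. (1 - p) * real k powr (p - 2)) \<le> real M powr (p - 1) - real N powr (p - 1)"
      using that
    proof (induction N rule: dec_induct)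
      case (step n)
      have "{M<..Suc n} = insert (Suc n) {M<..n}" using step.hyps by auto
      moreover have "(1 - p) * real (Suc n) powr (- (1 - p) - 1) \<le> (real (Suc n) - 1) powr (- (1 - p)) - real (Suc n) powr (- (1 - p))"
        using p M step.hyps by (intro powr_neg_diff_ge) auto
      ultimately show ?case using step.IH by (simp add: algebra_simps)
    qed simp
    have "(\<Sum>k\<in>{M<..N}. f k) \<le> (\<Sum>k\<in>{M<..N}. 1 / (\<eta> * (1 - p)) * ((1 - p) * real k powr (p - 2)))"
    proof (rule sum_mono)
      fix k assume k: "k \<in> {M<..N}"
      have "f k \<le> (1 / (\<eta> * (real k)^2)) * real k powr p" unfolding f_def by (intro mult_right_mono) auto
      also have "\<dots> = 1 / \<eta> * real k powr (p - 2)" using k by (simp add: powr_diff powr_numeral)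
      also have "\<dots> = 1 / (\<eta> * (1 - p)) * ((1 - p) * real k powr (p - 2))" using p by simp
      finally show "f k \<le> 1 / (\<eta> * (1 - p)) * ((1 - p) * real k powr (p - 2))" .
    qed
    also have "\<dots> = 1 / (\<eta> * (1 - p)) * (\<Sum>k\<in>{M<..N}. (1 - p) * real k powr (p - 2))" by (simp only: sum_distrib_left)
    also have "\<dots> \<le> 1 / (\<eta> * (1 - p)) * real M powr (p - 1)"
      using tele p \<eta> by (intro mult_left_mono) (auto intro: order.trans)
    also have "\<dots> \<le> 1 / (\<eta> * (1 - p)) * (2 * \<eta> powr (1 - p))"
    proof (rule mult_left_mono)
      have "real M powr (p - 1) \<le> (1 / (2 * \<eta>)) powr (p - 1)" using p \<eta> M by (intro powr_mono2') (auto simp: field_simps)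
      also have "\<dots> = (2 * \<eta>) powr (1 - p)" using \<eta> by (simp add: powr_divide powr_diff powr_mult field_simps)
      also have "\<dots> = 2 powr (1 - p) * \<eta> powr (1 - p)" using \<eta> by (simp add: powr_mult)
      also have "\<dots> \<le> 2 powr 1 * \<eta> powr (1 - p)" using p by (intro mult_right_mono powr_mono) auto
      finally show "real M powr (p - 1) \<le> 2 * \<eta> powr (1 - p)" by simp
    qed (use p \<eta> in auto)
    also have "\<dots> = 2 / (1 - p) * \<eta> powr (- p)" using \<eta> p by (simp add: powr_diff powr_minus field_simps)
    finally show ?thesis .
  qed
  have "(\<Sum>k=1..K. f k) \<le> (\<Sum>k=1..max M K. f k)" by (intro sum_mono2) (auto simp: f0)
  also have "\<dots> = (\<Sum>k=1..M. f k) + (\<Sum>k\<in>{M<..max M K}. f k)"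
  proof -
    have "{1..max M K} = {1..M} \<union> {M<..max M K}" by auto
    thus ?thesis by (simp add: sum.union_disjoint[symmetric] ivl_disj_int)
  qed
  also have "\<dots> \<le> 1 / p * \<eta> powr (- p) + 2 / (1 - p) * \<eta> powr (- p)" by (intro add_mono 1 2) auto
  finally show ?thesis by (simp add: f_def distrib_right)
qed

section \<open>Exponential sums along a circular arc\<close>

text \<open>Integrate by parts, using that \<open>g1 * ee (g x)\<close> is a derivative up to a
  constant. As \<open>q\<close> is monotone, its variation is the difference of its end values;
  boundary and remainder give \<open>4 * M / (2 * pi)\<close>, below \<open>M\<close>. The first
  derivative test is the case where \<open>q\<close> is the reciprocal of \<open>g1\<close>.\<close>

lemma first_derivative_weighted:
  fixes g g1 q q1 :: "real \<Rightarrow> real"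
  assumes ab: "a \<le> b"
    and g: "\<And>x. x \<in> {a..b} \<Longrightarrow> (g has_real_derivative g1 x) (at x within {a..b})"
    and q: "\<And>x. x \<in> {a..b} \<Longrightarrow> (q has_real_derivative q1 x) (at x within {a..b})"
    and sgn: "(\<forall>x\<in>{a..b}. 0 \<le> q1 x) \<or> (\<forall>x\<in>{a..b}. q1 x \<le> 0)"
    and c: "continuous_on {a..b} q1"
    and M: "\<And>x. x \<in> {a..b} \<Longrightarrow> \<bar>q x\<bar> \<le> M"
  shows "norm (integral {a..b} (\<lambda>x. (q x * g1 x) *\<^sub>R ee (g x))) \<le> M"
proof -
  define i where "i = - \<i> / (2 * pi)"
  have ni: "norm i = 1 / (2 * pi)" by (simp add: i_def norm_divide norm_mult)
  define G where "G x = i * (q x *\<^sub>R ee (g x))" for x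
  have M0: "0 \<le> M" using M[of a] ab by force
  have cg: "continuous_on {a..b} g" using g by (rule DERIV_continuous_on)
  have FT: "((\<lambda>x. (q x * g1 x) *\<^sub>R ee (g x) + i * (q1 x *\<^sub>R ee (g x))) has_integral G b - G a) {a..b}"
  proof (rule fundamental_theorem_of_calculus[OF ab])
    fix x assume x: "x \<in> {a..b}"
    from has_vector_derivative_mult_right[OF has_vector_derivative_scaleR[OF q[OF x] has_vector_derivative_ee[OF g[OF x]]], of i]
    have "(G has_vector_derivative i * (q x *\<^sub>R (2 * pi * \<i> * g1 x * ee (g x)) + q1 x *\<^sub>R ee (g x))) (at x within {a..b})"
      by (simp add: G_def[abs_def])
    moreover have "i * (2 * pi * \<i> * g1 x * ee (g x)) = g1 x *\<^sub>R ee (g x)"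
      by (simp add: i_def scaleR_conv_of_real)
    hence "i * (q x *\<^sub>R (2 * pi * \<i> * g1 x * ee (g x)) + q1 x *\<^sub>R ee (g x))
       = (q x * g1 x) *\<^sub>R ee (g x) + i * (q1 x *\<^sub>R ee (g x))"
      by (simp only: distrib_left mult_scaleR_right scaleR_scaleR)
    ultimately show "(G has_vector_derivative (q x * g1 x) *\<^sub>R ee (g x) + i * (q1 x *\<^sub>R ee (g x))) (at x within {a..b})"
      by simp
  qed
  define R where "R = integral {a..b} (\<lambda>x. i * (q1 x *\<^sub>R ee (g x)))"
  have intR: "((\<lambda>x. i * (q1 x *\<^sub>R ee (g x))) has_integral R) {a..b}"
    unfolding R_def by (intro integrable_integral integrable_continuous_interval continuous_intros c cg)
  have eq: "integral {a..b} (\<lambda>x. (q x * g1 x) *\<^sub>R ee (g x)) = G b - G a - R"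
    using has_integral_diff[OF FT intR] by (simp add: integral_unique)
  have Q: "(q1 has_integral q b - q a) {a..b}"
    using ab q by (intro fundamental_theorem_of_calculus) (auto simp flip: has_real_derivative_iff_has_vector_derivative)
  have "norm R \<le> (1 / (2 * pi)) * (2 * M)"
  proof -
    obtain \<sigma> :: real where \<sigma>: "\<bar>\<sigma>\<bar> = 1" "\<And>x. x \<in> {a..b} \<Longrightarrow> \<bar>q1 x\<bar> = \<sigma> * q1 x"
      using sgn
    proof
      assume "\<forall>x\<in>{a..b}. 0 \<le> q1 x" thus ?thesis by (intro that[of 1]) auto
    next
      assume "\<forall>x\<in>{a..b}. q1 x \<le> 0" thus ?thesis by (intro that[of "-1"]) auto
    qed
    have I: "((\<lambda>x. (1 / (2 * pi)) * (\<sigma> * q1 x)) has_integral (1 / (2 * pi)) * (\<sigma> * (q b - q a))) {a..b}"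
      by (intro has_integral_mult_right Q)
    have "norm R \<le> integral {a..b} (\<lambda>x. (1 / (2 * pi)) * (\<sigma> * q1 x))" unfolding R_def
    proof (rule integral_norm_bound_integral)
      show "norm (i * (q1 x *\<^sub>R ee (g x))) \<le> (1 / (2 * pi)) * (\<sigma> * q1 x)" if "x \<in> {a..b}" for x
        using \<sigma>(2)[OF that] by (simp add: norm_mult ni)
    qed (use intR I in \<open>auto simp: has_integral_integrable\<close>)
    also have "\<dots> = (1 / (2 * pi)) * (\<sigma> * (q b - q a))" using I by (rule integral_unique)
    also have "\<sigma> * (q b - q a) \<le> 2 * M"
    proof -
      have "\<sigma> * (q b - q a) \<le> \<bar>\<sigma>\<bar> * \<bar>q b - q a\<bar>" by (metis abs_ge_self abs_mult)
      also have "\<dots> \<le> 2 * M" using \<sigma>(1) M[of a] M[of b] ab by auto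
      finally show ?thesis .
    qed
    finally show ?thesis by (simp add: mult_left_mono divide_right_mono)
  qed
  note hR = this
  have "norm (G x) \<le> (1 / (2 * pi)) * M" if "x \<in> {a..b}" for x
    unfolding G_def norm_mult ni norm_scaleR norm_ee using M[OF that] by (intro mult_left_mono) auto
  hence hG: "norm (G b - G a) \<le> (1 / (2 * pi)) * M + (1 / (2 * pi)) * M"
    using ab by (intro order.trans[OF norm_triangle_ineq4] add_mono) auto
  have "norm (G b - G a - R) \<le> ((1 / (2 * pi)) * M + (1 / (2 * pi)) * M) + (1 / (2 * pi)) * (2 * M)"
    by (rule order.trans[OF norm_triangle_ineq4 add_mono[OF hG hR]])
  also have "\<dots> = (2 / pi) * M" by (simp add: field_simps)
  also have "\<dots> \<le> 1 * M" using pi_ge_two M0 by (intro mult_right_mono) auto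
  finally show ?thesis by (simp add: eq)
qed

text \<open>On either side of \<open>x\<close>, the j-th integer counted from the nearest one has
  distance at least \<open>j\<close>, starting with \<open>j = 0\<close>, which yields two harmonic
  sums. The power \<open>1/20\<close> stands in for the logarithm.\<close>

lemma sum_inverse_distance:
  fixes A B x :: real
  assumes "0 < A" "0 < B" "1 \<le> K"
  shows "(\<Sum>k=0..K. 1 / (A + B * \<bar>real k - x\<bar>)) \<le> 2 / A + 40 * real K powr (1/20) / B"
proof -
  have harm: "(\<Sum>j=0..K. 1 / (A + B * real j)) \<le> 1 / A + 20 * real K powr (1/20) / B"
  proof -
    have "(\<Sum>j=0..K. 1 / (A + B * real j)) = 1 / A + (\<Sum>j=1..K. 1 / (A + B * real j))"
      by (simp add: sum.atLeast_Suc_atMost)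
    also have "(\<Sum>j=1..K. 1 / (A + B * real j)) \<le> (\<Sum>j=1..K. real j powr (1/20 - 1) / B)"
    proof (rule sum_mono)
      fix j assume j: "j \<in> {1..K}"
      have "1 / (A + B * real j) \<le> 1 / (B * real j)" using assms j by (intro divide_left_mono) (auto intro!: mult_pos_pos add_pos_nonneg)
      also have "\<dots> = real j powr (- 1) / B" using j by (simp add: powr_minus field_simps)
      also have "\<dots> \<le> real j powr (1/20 - 1) / B" using assms j by (intro divide_right_mono powr_mono) auto
      finally show "1 / (A + B * real j) \<le> real j powr (1/20 - 1) / B" .
    qed
    also have "\<dots> = (\<Sum>j=1..K. real j powr (1/20 - 1)) / B" by (simp add: sum_divide_distrib)
    also have "\<dots> \<le> (real K powr (1/20) / (1/20)) / B" using assms by (intro divide_right_mono sum_powr_le) auto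
    also have "(real K powr (1/20) / (1/20)) / B = 20 * real K powr (1/20) / B" by (simp add: mult.commute)
    finally show ?thesis by simp
  qed
  define m where "m = \<lfloor>x\<rfloor>"
  define P where "P = {k\<in>{0..K}. int k \<le> m}"
  define Q where "Q = {k\<in>{0..K}. m < int k}"
  have un: "{0..K} = P \<union> Q" and dj: "P \<inter> Q = {}" and fin: "finite P" "finite Q"
    by (auto simp: P_def Q_def)
  have "(\<Sum>k=0..K. 1 / (A + B * \<bar>real k - x\<bar>)) = (\<Sum>k\<in>P. 1 / (A + B * \<bar>real k - x\<bar>)) + (\<Sum>k\<in>Q. 1 / (A + B * \<bar>real k - x\<bar>))"
    unfolding un by (rule sum.union_disjoint[OF fin dj])
  also have "(\<Sum>k\<in>P. 1 / (A + B * \<bar>real k - x\<bar>)) \<le> (\<Sum>j=0..K. 1 / (A + B * real j))"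
  proof -
    define t where "t = min m (int K)"
    have "(\<Sum>k\<in>P. 1 / (A + B * \<bar>real k - x\<bar>)) \<le> (\<Sum>k\<in>P. 1 / (A + B * real (nat (t - int k))))"
    proof (rule sum_mono)
      fix k assume k: "k \<in> P"
      have "real (nat (t - int k)) \<le> \<bar>real k - x\<bar>" using k by (auto simp: P_def t_def m_def) linarith+
      thus "1 / (A + B * \<bar>real k - x\<bar>) \<le> 1 / (A + B * real (nat (t - int k)))"
        using assms by (intro divide_left_mono add_left_mono mult_left_mono mult_pos_pos add_pos_nonneg) auto
    qed
    also have "\<dots> = (\<Sum>j\<in>(\<lambda>k. nat (t - int k)) ` P. 1 / (A + B * real j))"
      by (rule sum.reindex_cong[symmetric, of "\<lambda>k. nat (t - int k)"]) (auto simp: inj_on_def P_def t_def)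
    also have "\<dots> \<le> (\<Sum>j=0..K. 1 / (A + B * real j))"
      using assms by (intro sum_mono2) (auto simp: P_def t_def intro!: divide_nonneg_pos add_pos_nonneg)
    finally show ?thesis .
  qed
  also have "(\<Sum>k\<in>Q. 1 / (A + B * \<bar>real k - x\<bar>)) \<le> (\<Sum>j=0..K. 1 / (A + B * real j))"
  proof -
    define t where "t = max (m + 1) 0"
    have "(\<Sum>k\<in>Q. 1 / (A + B * \<bar>real k - x\<bar>)) \<le> (\<Sum>k\<in>Q. 1 / (A + B * real (nat (int k - t))))"
    proof (rule sum_mono)
      fix k assume k: "k \<in> Q"
      have "real (nat (int k - t)) \<le> \<bar>real k - x\<bar>" using k by (auto simp: Q_def t_def m_def) linarith+
      thus "1 / (A + B * \<bar>real k - x\<bar>) \<le> 1 / (A + B * real (nat (int k - t)))"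
        using assms by (intro divide_left_mono add_left_mono mult_left_mono mult_pos_pos add_pos_nonneg) auto
    qed
    also have "\<dots> = (\<Sum>j\<in>(\<lambda>k. nat (int k - t)) ` Q. 1 / (A + B * real j))"
      by (rule sum.reindex_cong[symmetric, of "\<lambda>k. nat (int k - t)"]) (auto simp: inj_on_def Q_def t_def)
    also have "\<dots> \<le> (\<Sum>j=0..K. 1 / (A + B * real j))"
      using assms by (intro sum_mono2) (auto simp: Q_def t_def intro!: divide_nonneg_pos add_pos_nonneg)
    finally show ?thesis .
  qed
  finally show ?thesis using harm by simp
qed

text \<open>Data of one exponential sum along the circle of radius \<open>T\<close>: frequency
  \<open>h\<close>, progression with step \<open>e\<close> and shift \<open>s\<close>. The height of
  the arc stays above \<open>\<gamma> * T\<close>, which bounds the slope of the phase by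
  \<open>\<beta>\<close>; the vertical end of the semicircle, where the slope is infinite, is kept
  out.\<close>

locale arc =
  fixes T h e s \<gamma> :: real and X :: nat
  assumes T: "1 \<le> T" and h: "1 \<le> h" and e: "1 \<le> e" and s: "0 \<le> s" and \<gamma>: "0 < \<gamma>" "\<gamma> \<le> 1"
    and X: "e * real X + s < T" "\<gamma> * T \<le> sqrt (T^2 - (e * real X + s)^2)"
begin

definition d :: "real \<Rightarrow> real" where "d x = T^2 - (e * x + s)^2"
definition g :: "real \<Rightarrow> real" where "g x = h * sqrt (d x)"
definition g1 :: "real \<Rightarrow> real" where "g1 x = - (h * e * (e * x + s) / sqrt (d x))"
definition g2 :: "real \<Rightarrow> real" where "g2 x = - (h * e^2 * T^2 / (d x * sqrt (d x)))"
definition \<beta> :: real where "\<beta> = h * e / \<gamma>"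

lemma ybound: "x \<in> {0..real X} \<Longrightarrow> 0 \<le> e * x + s \<and> e * x + s \<le> e * real X + s"
  using e s by (auto intro!: add_nonneg_nonneg mult_left_mono)

lemma sqrt_d: "x \<in> {0..real X} \<Longrightarrow> \<gamma> * T \<le> sqrt (d x)"
proof -
  assume x: "x \<in> {0..real X}"
  have "(e * x + s)^2 \<le> (e * real X + s)^2" using ybound[OF x] by (intro power_mono) auto
  hence "sqrt (T^2 - (e * real X + s)^2) \<le> sqrt (d x)" by (simp add: d_def)
  thus ?thesis using X(2) by linarith
qed

lemma d_pos: "x \<in> {0..real X} \<Longrightarrow> 0 < d x"
proof -
  assume "x \<in> {0..real X}"
  hence "0 < sqrt (d x)" using sqrt_d mult_pos_pos[of \<gamma> T] \<gamma> T by (meson less_le_trans zero_less_one)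
  thus ?thesis by simp
qed

lemma g_deriv: "x \<in> {0..real X} \<Longrightarrow> (g has_real_derivative g1 x) (at x within A)"
  and g1_deriv: "x \<in> {0..real X} \<Longrightarrow> (g1 has_real_derivative g2 x) (at x within A)"
proof -
  assume x: "x \<in> {0..real X}"
  have dd: "(d has_real_derivative - (2 * e * (e * x + s))) (at x within A)"
    unfolding d_def[abs_def] by (auto intro!: derivative_eq_intros simp: algebra_simps)
  have p: "0 < d x" "0 < sqrt (d x)" using d_pos[OF x] by auto
  have sd: "((\<lambda>x. sqrt (d x)) has_real_derivative - (e * (e * x + s) / sqrt (d x))) (at x within A)"
    by (rule DERIV_cong[OF DERIV_chain2[OF DERIV_real_sqrt[OF p(1)] dd]]) (use p in \<open>simp add: field_simps\<close>)
  show "(g has_real_derivative g1 x) (at x within A)"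
    unfolding g_def[abs_def] g1_def by (rule DERIV_cong[OF DERIV_cmult[OF sd]]) simp
  have "((\<lambda>x. (e * x + s) / sqrt (d x)) has_real_derivative (e * sqrt (d x) - (e * x + s) * - (e * (e * x + s) / sqrt (d x))) / (sqrt (d x) * sqrt (d x))) (at x within A)"
    by (rule DERIV_divide[OF _ sd]) (use p in \<open>auto intro!: derivative_eq_intros\<close>)
  hence "((\<lambda>x. - (h * e) * ((e * x + s) / sqrt (d x))) has_real_derivative - (h * e) * ((e * sqrt (d x) - (e * x + s) * - (e * (e * x + s) / sqrt (d x))) / (sqrt (d x) * sqrt (d x)))) (at x within A)"
    by (rule DERIV_cmult)
  moreover have "- (h * e) * ((e * sqrt (d x) - (e * x + s) * - (e * (e * x + s) / sqrt (d x))) / (sqrt (d x) * sqrt (d x))) = g2 x"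
  proof -
    define S where "S = sqrt (d x)"
    have S: "S \<noteq> 0" "S * S = d x" using p by (auto simp: S_def)
    have "e * S - (e * x + s) * - (e * (e * x + s) / S) = e * (S * S + (e * x + s)^2) / S"
      using S(1) by (simp add: field_simps power2_eq_square)
    also have "S * S + (e * x + s)^2 = T^2" unfolding S(2) d_def by simp
    finally show ?thesis unfolding g2_def S_def[symmetric]
      by (simp only: S(2)[symmetric]) (use S(1) in \<open>simp add: field_simps power2_eq_square\<close>)
  qed
  ultimately show "(g1 has_real_derivative g2 x) (at x within A)"
    by (simp add: g1_def[abs_def] mult.assoc)
qed

lemma g1_bounds: "x \<in> {0..real X} \<Longrightarrow> - \<beta> \<le> g1 x \<and> g1 x \<le> 0"
proof -
  assume x: "x \<in> {0..real X}"
  have p: "0 < sqrt (d x)" using d_pos[OF x] by auto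
  have y: "0 \<le> e * x + s" "e * x + s \<le> T" using ybound[OF x] X(1) by auto
  have "h * e * (e * x + s) / sqrt (d x) \<le> h * e * T / (\<gamma> * T)"
    using y h e T \<gamma> sqrt_d[OF x] by (intro frac_le mult_left_mono mult_pos_pos) auto
  also have "\<dots> = \<beta>" using T by (simp add: \<beta>_def)
  finally show ?thesis using y h e p by (simp add: g1_def)
qed

lemma g2_neg: "x \<in> {0..real X} \<Longrightarrow> g2 x \<le> 0"
  using d_pos[of x] h by (auto simp: g2_def intro!: divide_nonneg_nonneg mult_nonneg_nonneg)

lemma continuous_g: "continuous_on {0..real X} g" "continuous_on {0..real X} g1" "continuous_on {0..real X} g2"
proof -
  have nz: "d x \<noteq> 0" if "x \<in> {0..real X}" for x using d_pos[OF that] by simp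
  have cd: "continuous_on {0..real X} d" unfolding d_def[abs_def] by (intro continuous_intros)
  show "continuous_on {0..real X} g" unfolding g_def[abs_def] by (intro continuous_intros cd)
  show "continuous_on {0..real X} g1" unfolding g1_def[abs_def]
    by (intro continuous_on_minus continuous_on_divide continuous_on_real_sqrt cd continuous_intros ballI) (simp add: nz)
  show "continuous_on {0..real X} g2" unfolding g2_def[abs_def]
    by (intro continuous_on_minus continuous_on_divide continuous_on_mult continuous_on_real_sqrt cd continuous_on_const ballI) (simp add: nz)
qed

text \<open>The phase decreases, so subtracting \<open>k * x\<close> leaves a derivative of at most
  \<open>- k\<close>: there is no stationary point. The reciprocal of that derivative is monotone
  because \<open>g2\<close> has one sign.\<close>

lemma negative_frequency:
  assumes "1 \<le> (k::nat)"
  shows "norm (integral {0..real X} (\<lambda>x. ee (g x - k * x))) \<le> 1 / k"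
proof -
  have nz: "g1 x - k \<le> - k" "g1 x - k \<noteq> 0" if "x \<in> {0..real X}" for x using g1_bounds[OF that] assms by auto
  have "norm (integral {0..real X} (\<lambda>x. ((1 / (g1 x - k)) * (g1 x - k)) *\<^sub>R ee (g x - k * x))) \<le> 1 / k"
  proof (rule first_derivative_weighted[where g = "\<lambda>x. g x - k * x" and ?g1.0 = "\<lambda>x. g1 x - k"
        and ?q1.0 = "\<lambda>x. - (g2 x / (g1 x - k)^2)"])
    fix x assume x: "x \<in> {0..real X}"
    show "((\<lambda>x. g x - k * x) has_real_derivative g1 x - k) (at x within {0..real X})"
      by (auto intro!: derivative_eq_intros g_deriv[OF x])
    show "((\<lambda>x. 1 / (g1 x - k)) has_real_derivative - (g2 x / (g1 x - k)^2)) (at x within {0..real X})"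
      using nz[OF x] by (auto intro!: derivative_eq_intros g1_deriv[OF x] simp: power2_eq_square)
    show "\<bar>1 / (g1 x - k)\<bar> \<le> 1 / k" using nz[OF x] assms by (auto simp: abs_divide intro!: divide_left_mono)
  next
    show "continuous_on {0..real X} (\<lambda>x. - (g2 x / (g1 x - k)^2))"
      using nz by (intro continuous_intros continuous_g) auto
    show "(\<forall>x\<in>{0..real X}. 0 \<le> - (g2 x / (g1 x - k)^2)) \<or> (\<forall>x\<in>{0..real X}. - (g2 x / (g1 x - k)^2) \<le> 0)"
      using g2_neg by (auto intro!: divide_nonpos_nonneg)
  qed auto
  also have "integral {0..real X} (\<lambda>x. ((1 / (g1 x - k)) * (g1 x - k)) *\<^sub>R ee (g x - k * x)) = integral {0..real X} (\<lambda>x. ee (g x - k * x))"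
    using nz by (intro integral_cong) simp
  finally show ?thesis .
qed

text \<open>With \<open>\<bar>\<kappa>\<bar>\<close> at least twice the largest slope,
  \<open>g1 + \<kappa>\<close> is bounded away from zero, and \<open>g1 / (g1 + \<kappa>)\<close> is
  monotone because its derivative is \<open>\<kappa> * g2\<close> over a square.\<close>

lemma weighted_frequency:
  assumes "2 * \<beta> \<le> \<bar>\<kappa>\<bar>" "0 < \<bar>\<kappa>\<bar>"
  shows "norm (integral {0..real X} (\<lambda>x. g1 x *\<^sub>R ee (g x + \<kappa> * x))) \<le> 2 * \<beta> / \<bar>\<kappa>\<bar>"
proof -
  have nz: "\<bar>\<kappa>\<bar> / 2 \<le> \<bar>g1 x + \<kappa>\<bar>" "g1 x + \<kappa> \<noteq> 0" if "x \<in> {0..real X}" for x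
    using g1_bounds[OF that] assms by linarith+
  have "norm (integral {0..real X} (\<lambda>x. ((g1 x / (g1 x + \<kappa>)) * (g1 x + \<kappa>)) *\<^sub>R ee (g x + \<kappa> * x))) \<le> 2 * \<beta> / \<bar>\<kappa>\<bar>"
  proof (rule first_derivative_weighted[where g = "\<lambda>x. g x + \<kappa> * x" and ?g1.0 = "\<lambda>x. g1 x + \<kappa>"
        and ?q1.0 = "\<lambda>x. \<kappa> * g2 x / (g1 x + \<kappa>)^2"])
    fix x assume x: "x \<in> {0..real X}"
    show "((\<lambda>x. g x + \<kappa> * x) has_real_derivative g1 x + \<kappa>) (at x within {0..real X})"
      by (auto intro!: derivative_eq_intros g_deriv[OF x])
    show "((\<lambda>x. g1 x / (g1 x + \<kappa>)) has_real_derivative \<kappa> * g2 x / (g1 x + \<kappa>)^2) (at x within {0..real X})"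
      using nz[OF x] by (auto intro!: derivative_eq_intros g1_deriv[OF x] simp: power2_eq_square algebra_simps)
    have "\<bar>g1 x\<bar> / \<bar>g1 x + \<kappa>\<bar> \<le> \<beta> / (\<bar>\<kappa>\<bar> / 2)"
      using nz[OF x] g1_bounds[OF x] assms by (intro frac_le) auto
    thus "\<bar>g1 x / (g1 x + \<kappa>)\<bar> \<le> 2 * \<beta> / \<bar>\<kappa>\<bar>" by (simp add: abs_divide mult.commute)
  next
    show "continuous_on {0..real X} (\<lambda>x. \<kappa> * g2 x / (g1 x + \<kappa>)^2)"
      using nz by (intro continuous_intros continuous_g) auto
    show "(\<forall>x\<in>{0..real X}. 0 \<le> \<kappa> * g2 x / (g1 x + \<kappa>)^2) \<or> (\<forall>x\<in>{0..real X}. \<kappa> * g2 x / (g1 x + \<kappa>)^2 \<le> 0)"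
    proof (cases "0 \<le> \<kappa>")
      case True
      thus ?thesis using g2_neg by (intro disjI2 ballI divide_nonpos_nonneg mult_nonneg_nonpos) auto
    next
      case False
      thus ?thesis using g2_neg by (intro disjI1 ballI divide_nonneg_nonneg mult_nonpos_nonpos) auto
    qed
  qed auto
  also have "integral {0..real X} (\<lambda>x. ((g1 x / (g1 x + \<kappa>)) * (g1 x + \<kappa>)) *\<^sub>R ee (g x + \<kappa> * x)) = integral {0..real X} (\<lambda>x. g1 x *\<^sub>R ee (g x + \<kappa> * x))"
    using nz by (intro integral_cong) simp
  finally show ?thesis .
qed

text \<open>Two savings of \<open>1 / k\<close>, as needed to sum over all \<open>k\<close>.
  Integrating the cosine gives the first, its boundary terms being sines at multiples of
  \<open>2 * pi\<close> since \<open>X\<close> is an integer; the remaining integrals contain the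
  factor \<open>g1\<close> and gain the second by \<open>weighted_frequency\<close>.\<close>

lemma high_frequency:
  assumes "1 \<le> (k::nat)" "2 * \<beta> \<le> k"
  shows "norm (integral {0..real X} (\<lambda>x. (2 * cos (2 * pi * k * x)) *\<^sub>R ee (g x))) \<le> 4 * \<beta> / k^2"
proof -
  define F where "F x = (sin (2 * pi * k * x) / (pi * k)) *\<^sub>R ee (g x)" for x
  have FT: "((\<lambda>x. (sin (2 * pi * k * x) / (pi * k)) *\<^sub>R (2 * pi * \<i> * g1 x * ee (g x)) + (2 * cos (2 * pi * k * x)) *\<^sub>R ee (g x))
      has_integral F X - F 0) {0..real X}"
  proof (rule fundamental_theorem_of_calculus)
    fix x assume x: "x \<in> {0..real X}"
    have "((\<lambda>x. sin (2 * pi * k * x) / (pi * k)) has_real_derivative 2 * cos (2 * pi * k * x)) (at x within {0..real X})"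
      using assms by (auto intro!: derivative_eq_intros)
    from has_vector_derivative_scaleR[OF this has_vector_derivative_ee[OF g_deriv[OF x]]]
    show "(F has_vector_derivative (sin (2 * pi * k * x) / (pi * k)) *\<^sub>R (2 * pi * \<i> * g1 x * ee (g x)) + (2 * cos (2 * pi * k * x)) *\<^sub>R ee (g x)) (at x within {0..real X})"
      by (simp add: F_def[abs_def])
  qed simp
  have "F X = 0" "F 0 = 0" using sin_integer_2pi[of "real (k * X)"] by (simp_all add: F_def mult.assoc)
  define J where "J \<kappa> = integral {0..real X} (\<lambda>x. g1 x *\<^sub>R ee (g x + \<kappa> * x))" for \<kappa>
  have intJ: "((\<lambda>x. g1 x *\<^sub>R ee (g x + \<kappa> * x)) has_integral J \<kappa>) {0..real X}" for \<kappa>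
    unfolding J_def by (intro integrable_integral integrable_continuous_interval continuous_intros continuous_g)
  have t: "(sin (2 * pi * k * x) / (pi * k)) *\<^sub>R (2 * pi * \<i> * g1 x * ee (g x))
      = (1 / k) *\<^sub>R (g1 x *\<^sub>R ee (g x + k * x) - g1 x *\<^sub>R ee (g x + (- real k) * x))" for x :: real
  proof -
    have "ee (k * x) - ee (- (k * x)) = 2 * \<i> * of_real (sin (2 * pi * k * x))"
      by (simp add: ee_def complex_eq_iff mult.assoc)
    moreover have "ee (g x + k * x) - ee (g x + (- real k) * x) = ee (g x) * (ee (k * x) - ee (- (k * x)))"
    proof -
      have "g x + (- real k) * x = g x + - (k * x)" by simp
      thus ?thesis by (simp only: ee_add right_diff_distrib)
    qed
    ultimately have "ee (g x + k * x) - ee (g x + (- real k) * x) = ee (g x) * (2 * \<i> * of_real (sin (2 * pi * k * x)))" by simp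
    hence "(1 / k) *\<^sub>R (g1 x *\<^sub>R (ee (g x + k * x) - ee (g x + (- real k) * x))) = (sin (2 * pi * k * x) / (pi * k)) *\<^sub>R (2 * pi * \<i> * g1 x * ee (g x))"
      using assms by (simp add: scaleR_conv_of_real field_simps)
    thus ?thesis by (simp add: scaleR_right_diff_distrib)
  qed
  have P: "((\<lambda>x. (sin (2 * pi * k * x) / (pi * k)) *\<^sub>R (2 * pi * \<i> * g1 x * ee (g x))) has_integral (1 / k) *\<^sub>R (J k - J (- real k))) {0..real X}"
    unfolding t by (intro has_integral_cmul has_integral_diff intJ)
  have "((\<lambda>x. (2 * cos (2 * pi * k * x)) *\<^sub>R ee (g x)) has_integral (F X - F 0) - (1 / k) *\<^sub>R (J k - J (- real k))) {0..real X}"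
    using has_integral_diff[OF FT P] by simp
  hence "norm (integral {0..real X} (\<lambda>x. (2 * cos (2 * pi * k * x)) *\<^sub>R ee (g x))) = (1 / k) * norm (J k - J (- real k))"
    using \<open>F X = 0\<close> \<open>F 0 = 0\<close> by (simp add: integral_unique)
  also have "\<dots> \<le> (1 / k) * (2 * \<beta> / k + 2 * \<beta> / k)"
    using weighted_frequency[of k] weighted_frequency[of "- real k"] assms
    by (intro mult_left_mono order.trans[OF norm_triangle_ineq4] add_mono) (auto simp: J_def)
  also have "\<dots> = 4 * \<beta> / k^2" by (simp add: power2_eq_square)
  finally show ?thesis .
qed

text \<open>Parametrise the arc by its angle, \<open>e * x + s = T * sin t\<close>. With polar
  coordinates \<open>R\<close>, \<open>\<alpha>\<close> for the vector \<open>(h, k / e)\<close>,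
  the phase becomes \<open>T * R * cos (t - \<alpha>)\<close> up to a constant, and
  \<open>cos t\<close> is the Jacobian.\<close>

lemma stationary_substitution:
  fixes k :: nat
  defines "R \<equiv> dual_radius h e k"
  shows "integral {0..real X} (\<lambda>x. ee (g x + k * x))
    = (T / e) *\<^sub>R (ee (- (k * s / e)) * integral {arcsin (s / T)..arcsin ((e * X + s) / T)}
        (\<lambda>t. cos t *\<^sub>R ee (T * R * cos (t - arctan (k / (e * h))))))"
proof -
  define a where "a = arcsin (s / T)"
  define b where "b = arcsin ((e * X + s) / T)"
  have sX: "s \<le> e * X + s" using e by simp
  have r: "0 \<le> s / T" "s / T \<le> (e * X + s) / T" "(e * X + s) / T < 1"
    using s T e X(1) by (auto simp: divide_right_mono add_nonneg_nonneg)
  have ab: "0 \<le> a" "a \<le> b" "b < pi / 2" "- (pi / 2) \<le> b"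
  proof -
    show "0 \<le> a" unfolding a_def using r by (intro arcsin_nonneg) auto
    show "a \<le> b" unfolding a_def b_def using r by (intro arcsin_le_arcsin) auto
    have "b < arcsin 1" unfolding b_def using r by (intro arcsin_less_arcsin) auto
    thus "b < pi / 2" by simp
    show "- (pi / 2) \<le> b" using \<open>0 \<le> a\<close> \<open>a \<le> b\<close> pi_gt_zero by linarith
  qed
  define u where "u t = (T * sin t - s) / e" for t
  define \<alpha> where "\<alpha> = arctan (k / (e * h))"
  have u: "u a = 0" "u b = X"
  proof -
    have "sin a = s / T" "sin b = (e * X + s) / T" unfolding a_def b_def using r by (intro sin_arcsin; linarith)+
    thus "u a = 0" "u b = X" using e T by (simp_all add: u_def)
  qed
  have mono: "u t \<in> {0..real X}" if "t \<in> {a..b}" for t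
  proof -
    have "sin a \<le> sin t" "sin t \<le> sin b" using that ab pi_gt_zero by (auto intro!: sin_monotone_2pi_le)
    hence "u a \<le> u t" "u t \<le> u b" unfolding u_def using T e by (auto intro!: divide_right_mono)
    thus ?thesis by (simp add: u)
  qed
  have Rc: "R * cos \<alpha> = h" "R * sin \<alpha> = k / e"
  proof -
    have "0 < sqrt (1 + (k / (e * h))^2)" by (simp add: add_pos_nonneg)
    thus "R * cos \<alpha> = h" "R * sin \<alpha> = k / e"
      using h e by (auto simp: R_def dual_radius_def \<alpha>_def cos_arctan sin_arctan)
  qed
  have phase: "g (u t) + k * u t = - (k * s / e) + T * R * cos (t - \<alpha>)" if "t \<in> {a..b}" for t
  proof -
    have c0: "0 \<le> cos t" using that ab by (intro cos_ge_zero) auto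
    have "e * u t + s = T * sin t" using e by (simp add: u_def)
    hence "d (u t) = (T * cos t)^2" by (simp add: d_def power_mult_distrib cos_squared_eq algebra_simps)
    hence "sqrt (d (u t)) = T * cos t" using c0 T by (simp add: real_sqrt_abs abs_mult)
    hence "g (u t) = T * (R * cos \<alpha>) * cos t" unfolding Rc by (simp add: g_def)
    moreover have "k * u t = T * (R * sin \<alpha>) * sin t - k * s / e" unfolding Rc using e by (simp add: u_def field_simps)
    moreover have "T * R * cos (t - \<alpha>) = T * (R * cos \<alpha>) * cos t + T * (R * sin \<alpha>) * sin t"
      by (simp add: cos_diff algebra_simps)
    ultimately show ?thesis by simp
  qed
  have du: "(u has_real_derivative (T / e) * cos t) (at t within {a..b})" for t
    unfolding u_def[abs_def] using e by (auto intro!: derivative_eq_intros simp: field_simps)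
  have "((\<lambda>t. ((T / e) * cos t) *\<^sub>R ee (g (u t) + k * u t)) has_integral
      (integral {u a..u b} (\<lambda>x. ee (g x + k * x)) - integral {u b..u a} (\<lambda>x. ee (g x + k * x)))) {a..b}"
  proof (rule has_integral_substitution_general[of "{}" a b u 0 "real X" "\<lambda>x. ee (g x + k * x)" "\<lambda>t. (T / e) * cos t"])
    show "continuous_on {a..b} u" unfolding u_def[abs_def] using e by (intro continuous_intros) auto
    show "continuous_on {0..real X} (\<lambda>x. ee (g x + k * x))" by (intro continuous_intros continuous_g)
  qed (use ab mono u du in auto)
  moreover have "integral {u b..u a} (\<lambda>x. ee (g x + k * x)) = 0"
    unfolding u by (cases "X = 0") auto
  ultimately have 1: "((\<lambda>t. ((T / e) * cos t) *\<^sub>R ee (g (u t) + k * u t)) has_integral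
      integral {0..real X} (\<lambda>x. ee (g x + k * x))) {a..b}" by (simp add: u)
  have "((\<lambda>t. (T / e) *\<^sub>R (ee (- (k * s / e)) * (cos t *\<^sub>R ee (T * R * cos (t - \<alpha>))))) has_integral
      integral {0..real X} (\<lambda>x. ee (g x + k * x))) {a..b}"
    by (rule has_integral_eq[OF _ 1]) (simp only: phase ee_add mult_scaleR_right scaleR_scaleR)
  hence "integral {0..real X} (\<lambda>x. ee (g x + k * x))
     = integral {a..b} (\<lambda>t. (T / e) *\<^sub>R (ee (- (k * s / e)) * (cos t *\<^sub>R ee (T * R * cos (t - \<alpha>)))))"
    by (simp add: integral_unique)
  thus ?thesis by (simp only: a_def b_def \<alpha>_def integral_cmul integral_mult_right)
qed

text \<open>From \<open>R * sin (\<phi> - \<alpha>) = (cos \<phi> / e) * (e * h * tan \<phi> -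
  k)\<close>. It turns the angular distance between an end of the arc and the stationary point into
  a distance of \<open>k\<close> from a fixed number, over which \<open>sum_inverse_distance\<close>
  can sum.\<close>

lemma angle_distance:
  fixes k :: nat and x y :: real
  assumes "0 \<le> y" "y \<le> e * real X + s"
  shows "(\<gamma> / e) * \<bar>real k - e * h * tan (arcsin (y / T))\<bar> \<le> dual_radius h e k * \<bar>arcsin (y / T) - arctan (k / (e * h))\<bar>"
proof -
  define \<phi> where "\<phi> = arcsin (y / T)"
  define \<alpha> where "\<alpha> = arctan (k / (e * h))"
  define R where "R = dual_radius h e k"
  have yT: "0 \<le> y / T" "y / T < 1" using assms X(1) T by auto
  have sphi: "sin \<phi> = y / T" unfolding \<phi>_def using yT by (intro sin_arcsin) auto
  have cphi: "cos \<phi> = sqrt (1 - (y / T)^2)" unfolding \<phi>_def using yT by (intro cos_arcsin) auto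
  have "1 - (y / T)^2 = (T^2 - y\<^sup>2) / T^2" using T by (simp add: power_divide field_simps)
  hence "cos \<phi> = sqrt (T^2 - y\<^sup>2) / T" using cphi T by (simp add: real_sqrt_divide)
  moreover have "\<gamma> * T \<le> sqrt (T^2 - y\<^sup>2)"
  proof -
    have "y^2 \<le> (e * real X + s)^2" using assms by (intro power_mono) auto
    thus ?thesis using X(2) by (meson order.trans real_sqrt_le_mono diff_left_mono)
  qed
  ultimately have "T * \<gamma> \<le> T * cos \<phi>" using T by (simp add: mult.commute)
  hence c\<gamma>: "\<gamma> \<le> cos \<phi>" using T by simp
  hence c0: "0 < cos \<phi>" using \<gamma> by linarith
  have Rc: "R * cos \<alpha> = h" "R * sin \<alpha> = k / e"
  proof -
    have "0 < sqrt (1 + (k / (e * h))^2)" by (simp add: add_pos_nonneg)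
    thus "R * cos \<alpha> = h" "R * sin \<alpha> = k / e"
      using h e by (auto simp: R_def dual_radius_def \<alpha>_def cos_arctan sin_arctan)
  qed
  have R0: "0 \<le> R" using h by (simp add: R_def dual_radius_def)
  have "R * sin (\<phi> - \<alpha>) = (R * cos \<alpha>) * sin \<phi> - (R * sin \<alpha>) * cos \<phi>" by (simp add: sin_diff algebra_simps)
  also have "\<dots> = (cos \<phi> / e) * (e * h * tan \<phi> - k)" unfolding Rc using c0 e by (simp add: tan_def field_simps)
  finally have eq: "R * sin (\<phi> - \<alpha>) = (cos \<phi> / e) * (e * h * tan \<phi> - k)" .
  have "R * \<bar>sin (\<phi> - \<alpha>)\<bar> = \<bar>R * sin (\<phi> - \<alpha>)\<bar>" using R0 by (simp add: abs_mult)
  also have "\<dots> = (cos \<phi> / e) * \<bar>real k - e * h * tan \<phi>\<bar>"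
    unfolding eq using c0 e by (simp add: abs_mult abs_minus_commute)
  finally have "R * \<bar>sin (\<phi> - \<alpha>)\<bar> = (cos \<phi> / e) * \<bar>real k - e * h * tan \<phi>\<bar>" .
  moreover have "R * \<bar>sin (\<phi> - \<alpha>)\<bar> \<le> R * \<bar>\<phi> - \<alpha>\<bar>" using R0 by (intro mult_left_mono abs_sin_x_le_abs_x)
  moreover have "(\<gamma> / e) * \<bar>real k - e * h * tan \<phi>\<bar> \<le> (cos \<phi> / e) * \<bar>real k - e * h * tan \<phi>\<bar>"
    using c\<gamma> e by (intro mult_right_mono divide_right_mono) auto
  ultimately show ?thesis by (simp add: \<phi>_def \<alpha>_def R_def)
qed

end

lemma sum_inverse_squares_tail:
  assumes "1 \<le> K" "0 \<le> b"
  shows "(\<Sum>k\<in>{K<..K'}. b / (real k)^2) \<le> b / real K"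
proof -
  have "(\<Sum>k\<in>{K<..K'}. b / (real k)^2) \<le> b / real K - b / real K'" if "K \<le> K'" for K'
    using that
  proof (induction K' rule: dec_induct)
    case (step n)
    have n: "1 \<le> n" using step.hyps assms by simp
    have "{K<..Suc n} = insert (Suc n) {K<..n}" using step.hyps by auto
    hence "(\<Sum>k\<in>{K<..Suc n}. b / (real k)^2) = b / (real (Suc n))^2 + (\<Sum>k\<in>{K<..n}. b / (real k)^2)" by simp
    also have "b / (real (Suc n))^2 \<le> b / (real n * real (Suc n))"
      using n assms by (intro divide_left_mono) (auto simp: power2_eq_square)
    also have "\<dots> = b / real n - b / real (Suc n)" using n by (simp add: field_simps)
    finally show ?case using step.IH by simp
  qed simp
  note main = this
  show ?thesis
  proof (cases "K \<le> K'")
    case True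
    have "0 \<le> b / real K'" using assms by simp
    thus ?thesis using main[OF True] by linarith
  qed (use assms in simp)
qed

text \<open>Poisson summation turns the sum into integrals over frequencies. Stationary phase treats
  \<open>0 \<le> k \<le> K\<close>, with main terms forming the dual sum;
  \<open>negative_frequency\<close> treats the mirror frequencies, and \<open>high_frequency\<close>
  makes all \<open>k > K\<close> contribute at most 2. The stationary phase errors near the two ends
  of the arc add up to \<open>sqrt T\<close> and the term with \<open>\<gamma>\<close>.\<close>

lemma arc_sum_estimate:
  "\<exists>C>0. \<forall>T h e s \<gamma> X. arc T h e s \<gamma> X \<longrightarrow>
     norm (\<Sum>n\<in>{0<..X}. ee (h * sqrt (T^2 - (e * real n + s)^2)))
       \<le> C * (sqrt T + (h * e / \<gamma>) powr (1/20) / \<gamma> + dual_bound T h e)"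
proof -
  obtain c C where C: "0 < C" and AI: "\<And>\<Lambda> \<alpha> a b. 1 \<le> \<Lambda> \<Longrightarrow> 0 \<le> \<alpha> \<Longrightarrow> \<alpha> \<le> pi / 2 \<Longrightarrow> 0 \<le> a \<Longrightarrow> a \<le> b \<Longrightarrow> b \<le> pi / 2 \<Longrightarrow>
     norm (integral {a..b} (\<lambda>t. cos t *\<^sub>R ee (\<Lambda> * cos (t - \<alpha>)))
         - (if a \<le> \<alpha> \<and> \<alpha> \<le> b then c * of_real (cos \<alpha>) * ee \<Lambda> / sqrt \<Lambda> else 0))
       \<le> C / (sqrt \<Lambda> + \<Lambda> * \<bar>a - \<alpha>\<bar>) + C / (sqrt \<Lambda> + \<Lambda> * \<bar>b - \<alpha>\<bar>)"
    using arc_integral_estimate by blast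
  obtain C2 where C2: "0 < C2" and DS: "\<And>T h e s u v. 1 \<le> T \<Longrightarrow> 1 \<le> h \<Longrightarrow> 1 \<le> e \<Longrightarrow>
     (T powr (1/2) * h / e) * norm (\<Sum>k=u..v. dual_term T h e s k) \<le> C2 * dual_bound T h e"
    using dual_sum_estimate by blast
  define CF where "CF = 83 + norm c * C2 + 400 * C"
  have "norm (\<Sum>n\<in>{0<..X}. ee (h * sqrt (T^2 - (e * real n + s)^2)))
       \<le> CF * (sqrt T + (h * e / \<gamma>) powr (1/20) / \<gamma> + dual_bound T h e)"
    if arc: "arc T h e s \<gamma> X" for T h e s \<gamma> X
  proof -
    interpret arc T h e s \<gamma> X by (rule arc)
    define a where "a = arcsin (s / T)"
    define b where "b = arcsin ((e * X + s) / T)"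
    define \<alpha> where "\<alpha> k = arctan (real k / (e * h))" for k :: nat
    define R where "R k = dual_radius h e k" for k
    have r: "0 \<le> s / T" "s / T \<le> (e * X + s) / T" "(e * X + s) / T < 1"
      using s T e X(1) by (auto simp: divide_right_mono add_nonneg_nonneg)
    have ab: "0 \<le> a" "a \<le> b" "b \<le> pi / 2"
    proof -
      show "0 \<le> a" unfolding a_def using r by (intro arcsin_nonneg) auto
      show "a \<le> b" unfolding a_def b_def using r by (intro arcsin_le_arcsin) auto
      show "b \<le> pi / 2" unfolding b_def using r by (intro arcsin_ubound) auto
    qed
    have al: "0 \<le> \<alpha> k" "\<alpha> k \<le> pi / 2" for k
      using e h arctan_ubound[of "real k / (e * h)"] by (auto simp: \<alpha>_def)
    have Rh: "h \<le> R k" for k using h by (simp add: R_def dual_radius_def mult_le_cancel_left1)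
    define \<Lambda> where "\<Lambda> k = T * R k" for k
    have L1: "T \<le> \<Lambda> k" "1 \<le> \<Lambda> k" for k
    proof -
      have "T * 1 \<le> T * R k" using T h Rh[of k] by (intro mult_left_mono) auto
      thus "T \<le> \<Lambda> k" by (simp only: \<Lambda>_def mult_1_right)
      thus "1 \<le> \<Lambda> k" using T by linarith
    qed
    define P where "P k \<longleftrightarrow> a \<le> \<alpha> k \<and> \<alpha> k \<le> b" for k
    define I where "I k = integral {0..real X} (\<lambda>x. ee (g x + real k * x))" for k :: nat
    define cc where "cc = c * of_real (T powr (1/2) * h / e)"
    \<comment> \<open>\<open>k0\<close> and \<open>k1\<close> are the real frequencies whose
      stationary point is the left or the right end of the arc.\<close>
    define k0 where "k0 = e * h * tan (arcsin (s / T))"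
    define k1 where "k1 = e * h * tan (arcsin ((e * X + s) / T))"
    define A where "A = 1 / sqrt T"
    have A0: "0 < A" using T by (simp add: A_def)
    have I_est: "norm (I k - (if P k then cc * dual_term T h e s k else 0)) \<le> C / (A + \<gamma> * \<bar>real k - k0\<bar>) + C / (A + \<gamma> * \<bar>real k - k1\<bar>)" for k
    proof -
      define J where "J = integral {a..b} (\<lambda>t. cos t *\<^sub>R ee (\<Lambda> k * cos (t - \<alpha> k)))"
      have eqI: "I k = (T / e) *\<^sub>R (ee (- (k * s / e)) * J)"
        unfolding I_def J_def using stationary_substitution[of k] by (simp add: a_def b_def \<alpha>_def \<Lambda>_def R_def)
      have Rpos: "0 < R k" using Rh[of k] h by linarith
      have cosA: "cos (\<alpha> k) = h / R k"
      proof -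
        have "0 < sqrt (1 + (k / (e * h))^2)" by (simp add: add_pos_nonneg)
        thus ?thesis using h e by (auto simp: R_def dual_radius_def \<alpha>_def cos_arctan)
      qed
      \<comment> \<open>The cosine of the stationary angle is \<open>h / R k\<close>, and the square
        root of \<open>\<Lambda> k\<close> contributes another \<open>R k powr (- 1/2)\<close>;
        together they are the amplitude \<open>R k powr (- 3/2)\<close> of the dual sum.\<close>
      have M: "(T / e) *\<^sub>R (ee (- (k * s / e)) * (c * of_real (cos (\<alpha> k)) * ee (\<Lambda> k) / sqrt (\<Lambda> k))) = cc * dual_term T h e s k"
      proof -
        have "T / e * cos (\<alpha> k) / sqrt (\<Lambda> k) = T powr (1/2) * h / e * R k powr (-3/2)"
        proof -
          have rp: "R k powr (-3/2) = 1 / (R k * sqrt (R k))"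
          proof -
            have "R k powr (-3/2) = R k powr (-1) * R k powr (-1/2)"
              by (simp only: powr_add[symmetric]) simp
            also have "R k powr (-1/2) = 1 / sqrt (R k)" using Rpos powr_minus[of "R k" "1/2"] by (simp add: powr_half_sqrt inverse_eq_divide)
            also have "R k powr (-1) = 1 / R k" using Rpos by (simp add: powr_minus inverse_eq_divide)
            finally show ?thesis by simp
          qed
          have eq1: "T / e * (h / R k) / sqrt (\<Lambda> k) = (sqrt T * sqrt T) / e * (h / R k) / (sqrt T * sqrt (R k))"
            using T by (simp add: \<Lambda>_def real_sqrt_mult)
          have "(x * x) / e * (h / R k) / (x * y) = x * h / e * (1 / (R k * y))" if "x \<noteq> 0" for x y
            using that by simp
          from this[of "sqrt T" "sqrt (R k)"]
          have eq2: "(sqrt T * sqrt T) / e * (h / R k) / (sqrt T * sqrt (R k)) = sqrt T * h / e * (1 / (R k * sqrt (R k)))"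
            using T by fastforce
          have "T powr (1/2) = sqrt T" using T by (simp add: powr_half_sqrt)
          thus ?thesis by (simp only: cosA eq1 eq2 rp)
        qed
        hence "of_real (T / e) * of_real (cos (\<alpha> k)) / of_real (sqrt (\<Lambda> k)) = (of_real (T powr (1/2) * h / e) * of_real (R k powr (-3/2)) :: complex)"
          by (simp only: of_real_mult[symmetric] of_real_divide[symmetric])
        moreover have "ee (T * R k - k * s / e) = ee (- (k * s / e)) * ee (\<Lambda> k)"
        proof -
          have "T * R k - k * s / e = - (k * s / e) + \<Lambda> k" by (simp add: \<Lambda>_def)
          thus ?thesis by (simp only: ee_add)
        qed
        moreover have "(T / e) *\<^sub>R (ee (- (k * s / e)) * (c * of_real (cos (\<alpha> k)) * ee (\<Lambda> k) / sqrt (\<Lambda> k)))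
           = c * (of_real (T / e) * of_real (cos (\<alpha> k)) / of_real (sqrt (\<Lambda> k))) * (ee (- (k * s / e)) * ee (\<Lambda> k))"
          by (simp add: scaleR_conv_of_real mult_ac)
        ultimately show ?thesis
          by (simp only: cc_def dual_term_def R_def scaleR_conv_of_real mult.assoc)
      qed
      have "I k - (if P k then cc * dual_term T h e s k else 0)
         = (T / e) *\<^sub>R (ee (- (k * s / e)) * (J - (if P k then c * of_real (cos (\<alpha> k)) * ee (\<Lambda> k) / sqrt (\<Lambda> k) else 0)))"
        unfolding eqI M[symmetric] by (simp add: right_diff_distrib scaleR_right_diff_distrib)
      also have "norm \<dots> = (T / e) * norm (J - (if P k then c * of_real (cos (\<alpha> k)) * ee (\<Lambda> k) / sqrt (\<Lambda> k) else 0))"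
        using T e by (simp add: norm_mult)
      also have "\<dots> \<le> (T / e) * (C / (sqrt (\<Lambda> k) + \<Lambda> k * \<bar>a - \<alpha> k\<bar>) + C / (sqrt (\<Lambda> k) + \<Lambda> k * \<bar>b - \<alpha> k\<bar>))"
        unfolding J_def P_def using T e by (intro mult_left_mono AI L1 al ab) auto
      also have "\<dots> \<le> C / (A + \<gamma> * \<bar>real k - k0\<bar>) + C / (A + \<gamma> * \<bar>real k - k1\<bar>)"
      proof -
        have gen: "(T / e) * (C / (sqrt (\<Lambda> k) + \<Lambda> k * \<delta>)) \<le> C / (A + \<gamma> * \<Delta>)"
          if d: "(\<gamma> / e) * \<Delta> \<le> R k * \<delta>" "0 \<le> \<Delta>" for \<delta> \<Delta>
        proof -
          have "(T / e) * A \<le> sqrt (\<Lambda> k)"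
          proof -
            have "(T / e) * A = (T / sqrt T) / e" by (simp add: A_def)
            also have "T / sqrt T = sqrt T" using T by (intro real_div_sqrt) auto
            also have "sqrt T / e \<le> sqrt T / 1" using T e by (intro divide_left_mono) auto
            also have "\<dots> \<le> sqrt (\<Lambda> k)" using L1[of k] by simp
            finally show ?thesis .
          qed
          moreover have "(T / e) * (\<gamma> * \<Delta>) \<le> \<Lambda> k * \<delta>"
            using mult_left_mono[OF d(1), of T] T by (simp add: \<Lambda>_def mult_ac)
          ultimately have le: "(T / e) * (A + \<gamma> * \<Delta>) \<le> sqrt (\<Lambda> k) + \<Lambda> k * \<delta>" by (simp add: distrib_left)
          have p: "0 < A + \<gamma> * \<Delta>" using A0 \<gamma> d by (intro add_pos_nonneg) auto
          have Te: "0 < T / e" using T e by simp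
          have "(T / e) * (C / (sqrt (\<Lambda> k) + \<Lambda> k * \<delta>)) \<le> (T / e) * (C / ((T / e) * (A + \<gamma> * \<Delta>)))"
            using le p C Te mult_pos_pos[OF Te p] by (intro mult_left_mono divide_left_mono mult_pos_pos) auto
          also have "\<dots> = C / (A + \<gamma> * \<Delta>)" using T e by simp
          finally show ?thesis .
        qed
        show ?thesis unfolding distrib_left
        proof (intro add_mono gen)
          show "(\<gamma> / e) * \<bar>real k - k0\<bar> \<le> R k * \<bar>a - \<alpha> k\<bar>"
            unfolding k0_def a_def \<alpha>_def R_def using s e by (intro angle_distance) auto
          show "(\<gamma> / e) * \<bar>real k - k1\<bar> \<le> R k * \<bar>b - \<alpha> k\<bar>"
            unfolding k1_def b_def \<alpha>_def R_def using s e by (intro angle_distance) (auto intro: add_nonneg_nonneg)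
        qed auto
      qed
      finally show ?thesis .
    qed
    have b1: "1 \<le> \<beta>"
    proof -
      have "1 * 1 \<le> h * e" using h e by (intro mult_mono) auto
      hence "1 / 1 \<le> h * e / \<gamma>" using \<gamma> by (intro frac_le) auto
      thus ?thesis by (simp add: \<beta>_def)
    qed
    \<comment> \<open>Beyond twice the largest slope \<open>high_frequency\<close> applies, and its
      tail \<open>4 * \<beta> / K\<close> is at most 2.\<close>
    define K where "K = nat \<lceil>2 * \<beta>\<rceil>"
    have K: "2 * \<beta> \<le> real K" "real K \<le> 4 * \<beta>" "1 \<le> K" unfolding K_def using b1 by linarith+
    define L where "L = \<beta> powr (1/20) / \<gamma>"
    have KL: "real K powr (1/20) \<le> 4 * \<beta> powr (1/20)"
    proof -
      have "real K powr (1/20) \<le> (4 * \<beta>) powr (1/20)" using K by (intro powr_mono2) auto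
      also have "\<dots> = 4 powr (1/20) * \<beta> powr (1/20)" using b1 by (simp add: powr_mult)
      also have "\<dots> \<le> 4 powr 1 * \<beta> powr (1/20)" by (intro mult_right_mono powr_mono) auto
      finally show ?thesis by simp
    qed
    have KL2: "\<beta> powr (1/20) \<le> L" unfolding L_def using \<gamma> divide_left_mono[of \<gamma> 1 "\<beta> powr (1/20)"] by simp
    have sumI: "norm (\<Sum>k=0..K. I k) \<le> norm c * C2 * dual_bound T h e + C * (4 * sqrt T + 320 * L)"
    proof -
      define S where "S = {k\<in>{0..K}. P k}"
      have m1: "(\<Sum>k=0..K. if P k then cc * dual_term T h e s k else 0) = cc * (\<Sum>k\<in>S. dual_term T h e s k)"
        unfolding S_def sum_distrib_left by (rule sum.inter_filter[symmetric]) simp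
      have m2: "norm (cc * (\<Sum>k\<in>S. dual_term T h e s k)) \<le> norm c * C2 * dual_bound T h e"
      proof -
        have "\<exists>u v. S = {u..v}"
        proof (cases "S = {}")
          case True thus ?thesis by (intro exI[of _ 1] exI[of _ 0]) simp
        next
          case False
          \<comment> \<open>The angle \<open>\<alpha> k\<close> increases with \<open>k\<close>, so
            the frequencies with stationary point on the arc are consecutive, as
            \<open>dual_sum_estimate\<close> asks.\<close>
          have cv: "y \<in> S" if "x \<in> S" "z \<in> S" "x \<le> y" "y \<le> z" for x y z
          proof -
            have "\<alpha> x \<le> \<alpha> y" "\<alpha> y \<le> \<alpha> z" unfolding \<alpha>_def using that e h by (auto intro!: arctan_monotone' divide_right_mono)
            thus ?thesis using that by (auto simp: S_def P_def)
          qed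
          have "S = {Min S..<Suc (Max S)}"
            by (rule convex_nat_set_eq_atLeastLessThan[OF _ False cv]) (simp add: S_def)
          hence "S = {Min S..Max S}" by (simp only: atLeastLessThanSuc_atLeastAtMost)
          thus ?thesis by (intro exI)
        qed
        then obtain u v where uv: "S = {u..v}" by blast
        have "norm (cc * (\<Sum>k\<in>S. dual_term T h e s k)) = norm c * ((T powr (1/2) * h / e) * norm (\<Sum>k=u..v. dual_term T h e s k))"
        proof -
          have n: "norm (c * of_real w * z) = norm c * (w * norm z)" if "0 \<le> w" for w :: real and z :: complex
            using that by (simp add: norm_mult)
          show ?thesis unfolding cc_def uv by (rule n) (use T h e in simp)
        qed
        also have "\<dots> \<le> norm c * (C2 * dual_bound T h e)" using T h e by (intro mult_left_mono DS) auto
        finally show ?thesis by (simp add: mult.assoc)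
      qed
      have m3: "norm (\<Sum>k=0..K. I k - (if P k then cc * dual_term T h e s k else 0)) \<le> C * (4 * sqrt T + 320 * L)"
      proof -
        have "norm (\<Sum>k=0..K. I k - (if P k then cc * dual_term T h e s k else 0)) \<le> (\<Sum>k=0..K. C / (A + \<gamma> * \<bar>real k - k0\<bar>) + C / (A + \<gamma> * \<bar>real k - k1\<bar>))"
          by (intro sum_norm_le I_est)
        also have "\<dots> = C * ((\<Sum>k=0..K. 1 / (A + \<gamma> * \<bar>real k - k0\<bar>)) + (\<Sum>k=0..K. 1 / (A + \<gamma> * \<bar>real k - k1\<bar>)))"
          by (simp add: sum.distrib sum_distrib_left distrib_left)
        also have "\<dots> \<le> C * ((2 / A + 40 * real K powr (1/20) / \<gamma>) + (2 / A + 40 * real K powr (1/20) / \<gamma>))"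
          using C by (intro mult_left_mono add_mono sum_inverse_distance A0 \<gamma> K) auto
        also have "\<dots> \<le> C * (4 * sqrt T + 320 * L)"
        proof (rule mult_left_mono)
          have "real K powr (1/20) / \<gamma> \<le> 4 * \<beta> powr (1/20) / \<gamma>" using KL \<gamma> by (intro divide_right_mono) auto
          also have "\<dots> = 4 * L" by (simp add: L_def)
          finally have "real K powr (1/20) / \<gamma> \<le> 4 * L" .
          moreover have "2 / A = 2 * sqrt T" by (simp add: A_def)
          moreover have "40 * real K powr (1/20) / \<gamma> = 40 * (real K powr (1/20) / \<gamma>)" by simp
          ultimately show "(2 / A + 40 * real K powr (1/20) / \<gamma>) + (2 / A + 40 * real K powr (1/20) / \<gamma>) \<le> 4 * sqrt T + 320 * L"
            by linarith
        qed (use C in simp)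
        finally show ?thesis .
      qed
      have m4: "(\<Sum>k=0..K. I k) = (\<Sum>k=0..K. if P k then cc * dual_term T h e s k else 0)
         + (\<Sum>k=0..K. I k - (if P k then cc * dual_term T h e s k else 0))"
        by (simp add: sum_subtractf)
      show ?thesis unfolding m4 by (rule norm_triangle_mono[OF _ m3]) (use m1 m2 in simp)
    qed
    define N where "N k = integral {0..real X} (\<lambda>x. ee (g x - real k * x))" for k :: nat
    define J where "J k = integral {0..real X} (\<lambda>x. (2 * cos (2 * pi * real k * x)) *\<^sub>R ee (g x))" for k :: nat
    have JIN: "J k = I k + N k" for k
    proof -
      have "(2 * cos (2 * pi * real k * x)) *\<^sub>R ee (g x) = ee (g x + real k * x) + ee (g x - real k * x)" for x
      proof -
        have "ee (real k * x) + ee (- (real k * x)) = of_real (2 * cos (2 * pi * real k * x))"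
          by (simp add: ee_def complex_eq_iff mult.assoc)
        moreover have "ee (g x + real k * x) + ee (g x - real k * x) = ee (g x) * (ee (real k * x) + ee (- (real k * x)))"
        proof -
          have "g x - real k * x = g x + - (real k * x)" by simp
          thus ?thesis by (simp only: ee_add distrib_left)
        qed
        ultimately show ?thesis by (simp add: scaleR_conv_of_real mult.commute)
      qed
      thus ?thesis unfolding J_def I_def N_def
        by (simp only:) (intro integral_add integrable_continuous_interval continuous_intros continuous_g)
    qed
    have sumN: "norm (\<Sum>k=1..K. N k) \<le> 80 * L"
    proof -
      have "norm (\<Sum>k=1..K. N k) \<le> (\<Sum>k=1..K. real k powr (1/20 - 1))"
      proof (rule sum_norm_le)
        fix k assume k: "k \<in> {1..K}"
        have "norm (N k) \<le> 1 / real k" unfolding N_def using k by (intro negative_frequency) auto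
        also have "\<dots> = real k powr (- 1)" using k by (simp add: powr_minus inverse_eq_divide)
        also have "\<dots> \<le> real k powr (1/20 - 1)" using k by (intro powr_mono) auto
        finally show "norm (N k) \<le> real k powr (1/20 - 1)" .
      qed
      also have "\<dots> \<le> real K powr (1/20) / (1/20)" by (intro sum_powr_le) auto
      also have "\<dots> = 20 * real K powr (1/20)" by simp
      finally show ?thesis using KL KL2 by linarith
    qed
    define S where "S = (\<Sum>n\<in>{0<..X}. ee (g (real n)))"
    define D where "D = S + (ee (g 0) - ee (g X)) / 2 - I 0"
    have lim: "(\<lambda>K. \<Sum>k=1..K. J k) \<longlonglongrightarrow> D"
    proof -
      have "(\<lambda>K. \<Sum>k=1..K. integral {real 0..real X} (\<lambda>x. 2 * cos (2 * pi * real k * x) *\<^sub>R ee (g x)))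
         \<longlonglongrightarrow> (\<Sum>n\<in>{0<..X}. ee (g n)) + (ee (g (real 0)) - ee (g X)) / 2 - integral {real 0..real X} (\<lambda>x. ee (g x))"
      proof (rule truncated_poisson)
        show "((\<lambda>x. ee (g x)) has_vector_derivative 2 * pi * \<i> * g1 x * ee (g x)) (at x within {real 0..real X})"
          if "x \<in> {real 0..real X}" for x using that by (intro has_vector_derivative_ee g_deriv) auto
        show "continuous_on {real 0..real X} (\<lambda>x. 2 * pi * \<i> * g1 x * ee (g x))"
          using continuous_g by (intro continuous_intros) auto
      qed simp
      moreover have "(2 * cos (2 * pi * real k * x)) *\<^sub>R z = 2 * cos (2 * pi * real k * x) *\<^sub>R z" for k :: nat and x :: real and z :: complex
        by (simp add: scaleR_conv_of_real mult.assoc)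
      ultimately show ?thesis unfolding J_def D_def S_def I_def by simp
    qed
    have n1: "norm (D - (\<Sum>k=1..K. J k)) \<le> 2"
    proof -
      have "norm ((\<Sum>k=1..K'. J k) - (\<Sum>k=1..K. J k)) \<le> 2" if "K \<le> K'" for K'
      proof -
        have "{1..K'} = {1..K} \<union> {K<..K'}" "{1..K} \<inter> {K<..K'} = {}" using that by auto
        hence "(\<Sum>k=1..K'. J k) - (\<Sum>k=1..K. J k) = (\<Sum>k\<in>{K<..K'}. J k)" by (simp add: sum.union_disjoint)
        also have "norm \<dots> \<le> (\<Sum>k\<in>{K<..K'}. 4 * \<beta> / (real k)^2)"
        proof (rule sum_norm_le)
          fix k assume "k \<in> {K<..K'}"
          hence "1 \<le> k" "2 * \<beta> \<le> real k" using K by auto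
          from high_frequency[OF this] show "norm (J k) \<le> 4 * \<beta> / (real k)^2" by (simp add: J_def)
        qed
        also have "\<dots> \<le> 4 * \<beta> / real K" using b1 K by (intro sum_inverse_squares_tail) auto
        also have "\<dots> \<le> 2" using K b1 by (simp add: field_simps)
        finally show ?thesis .
      qed
      moreover have "(\<lambda>K'. norm ((\<Sum>k=1..K'. J k) - (\<Sum>k=1..K. J k))) \<longlonglongrightarrow> norm (D - (\<Sum>k=1..K. J k))"
        by (intro tendsto_intros lim)
      ultimately show ?thesis by (intro LIMSEQ_le_const2) auto
    qed
    have n2: "norm ((ee (g 0) - ee (g X)) / 2) \<le> 1"
      using norm_triangle_ineq4[of "ee (g 0)" "ee (g X)"] by (simp add: norm_divide)
    \<comment> \<open>\<open>D\<close> has the zero frequency subtracted; adding it back lets the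
      sum of the \<open>I k\<close> start at 0.\<close>
    have n3: "S = (D - (\<Sum>k=1..K. J k)) + ((\<Sum>k=0..K. I k) + ((\<Sum>k=1..K. N k) - (ee (g 0) - ee (g X)) / 2))"
      by (simp add: D_def JIN sum.distrib sum.atLeast_Suc_atMost)
    have "norm S \<le> 2 + ((norm c * C2 * dual_bound T h e + C * (4 * sqrt T + 320 * L)) + (80 * L + 1))"
      unfolding n3
      by (intro norm_triangle_mono n1 sumI order.trans[OF norm_triangle_ineq4 add_mono[OF sumN n2]])
    also have "\<dots> \<le> CF * (sqrt T + L + dual_bound T h e)"
    proof -
      have db: "0 \<le> dual_bound T h e" by (simp add: dual_bound_def)
      have L0: "0 \<le> L" using \<gamma> by (simp add: L_def)
      have sT: "1 \<le> sqrt T" using T by simp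
      have "norm c * C2 * dual_bound T h e \<le> CF * dual_bound T h e" "(83 + 400 * C) * sqrt T \<le> CF * sqrt T" "(83 + 400 * C) * L \<le> CF * L"
        using db L0 sT C C2 by (auto simp: CF_def intro!: mult_right_mono)
      moreover have "0 \<le> C * L" "0 \<le> C * sqrt T" using C L0 sT by auto
      moreover have "2 + ((a + (C * (4 * r + 320 * L))) + (80 * L + 1)) \<le> b + c + d"
        if "a \<le> d" "(83 + 400 * C) * r \<le> b" "(83 + 400 * C) * L \<le> c" "0 \<le> C * L" "0 \<le> C * r" "1 \<le> r" for a b c d r :: real
        using that L0 by (simp add: distrib_left distrib_right)
      ultimately show ?thesis using sT unfolding distrib_left by blast
    qed
    finally show ?thesis by (simp add: S_def g_def d_def L_def \<beta>_def)
  qed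
  note main = this
  have "0 < CF" using C C2 by (simp add: CF_def add_pos_nonneg)
  thus ?thesis by (intro exI[of _ CF] conjI allI impI main)
qed

section \<open>Sawtooth sums along an arc\<close>

lemma abs_psi_le: "\<bar>psi x\<bar> \<le> 1 / 2"
  unfolding psi_def using frac_ge_0[of x] frac_lt_1[of x] by arith

lemma abs_sum_psi_le: "\<bar>\<Sum>n\<in>A. psi (f n)\<bar> \<le> real (card A)"
proof -
  have "\<bar>\<Sum>n\<in>A. psi (f n)\<bar> \<le> (\<Sum>n\<in>A. 1)"
  proof (rule order.trans[OF sum_abs sum_mono])
    fix n show "\<bar>psi (f n)\<bar> \<le> 1" using abs_psi_le[of "f n"] by linarith
  qed
  thus ?thesis by simp
qed

text \<open>Smoothing with \<open>\<eta> = T powr (\<theta> - 1)\<close> costs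
  \<open>T powr \<theta>\<close>. The last term of \<open>dual_bound\<close> costs
  \<open>T powr (30/62) * \<eta> powr (- (257/496))\<close>. Equality,
  \<open>\<theta> = 30/62 + (1 - \<theta>) * 257/496\<close>, gives \<open>497/753\<close>, and
  \<open>256/753 = 1 - \<theta>\<close>.\<close>

definition \<theta> :: real where "\<theta> = 497 / 753"

lemma smoothed_power_term:
  fixes T p a :: real
  assumes T: "1 \<le> T" and p: "1 / 20 \<le> p" "p \<le> 3 / 5" and ap: "a + 256 / 753 * p \<le> \<theta>"
  defines "\<eta> \<equiv> T powr (- (256 / 753)) / 2"
  shows "T powr a * (\<Sum>k=1..K. smooth_weight \<eta> k * real k powr p) \<le> 50 * T powr \<theta>"
proof -
  have T1: "T powr (- (256 / 753)) \<le> T powr 0" by (rule powr_mono) (use T in auto)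
  have \<eta>: "0 < \<eta>" "\<eta> < 1" using T T1 by (auto simp: \<eta>_def)
  have c: "1 / p \<le> 20" "2 / (1 - p) \<le> 5" using p by (auto simp: field_simps)
  have c: "1 / p + 2 / (1 - p) \<le> 25" using add_mono[OF c] by simp
  have "\<eta> powr (- p) = (T powr (- (256 / 753))) powr (- p) / 2 powr (- p)"
    unfolding \<eta>_def by (rule powr_divide)
  also have "(T powr (- (256 / 753))) powr (- p) = T powr (256 / 753 * p)" unfolding powr_powr by (rule arg_cong[of _ _ "\<lambda>z. T powr z"]) simp
  also have "T powr (256 / 753 * p) / 2 powr (- p) = 2 powr p * T powr (256 / 753 * p)" by (simp add: powr_minus_divide)
  also have "\<dots> \<le> 2 powr 1 * T powr (256 / 753 * p)" using p by (intro mult_right_mono powr_mono) auto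
  finally have e: "\<eta> powr (- p) \<le> 2 * T powr (256 / 753 * p)" by simp
  have "(\<Sum>k=1..K. smooth_weight \<eta> k * real k powr p) \<le> (1 / p + 2 / (1 - p)) * \<eta> powr (- p)"
    using p \<eta> by (intro smoothed_power_sum) auto
  also have "\<dots> \<le> 25 * (2 * T powr (256 / 753 * p))" using c e by (intro mult_mono) auto
  finally have "T powr a * (\<Sum>k=1..K. smooth_weight \<eta> k * real k powr p)
     \<le> T powr a * (25 * (2 * T powr (256 / 753 * p)))" by (rule mult_left_mono) simp
  also have "\<dots> = 50 * T powr (a + 256 / 753 * p)" by (simp add: powr_add)
  also have "\<dots> \<le> 50 * T powr \<theta>" using T ap by (intro mult_left_mono powr_mono) auto
  finally show ?thesis .
qed

lemma sum_dual_weights: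
  fixes T e C1 :: real
  assumes T: "1 \<le> T" and e: "1 \<le> e" and C1: "0 \<le> C1"
  defines "\<eta> \<equiv> T powr (- (256 / 753)) / 2"
  shows "(\<Sum>k=1..K. smooth_weight \<eta> k * (C1 * (2 * e powr (1/20) * T powr (1/2) * real k powr (1/20) + dual_bound T k e)))
     \<le> 300 * C1 * e powr (1/20) * T powr \<theta>"
proof -
  define w where "w k = smooth_weight \<eta> k" for k :: nat
  define S where "S p = (\<Sum>k=1..K. w k * real k powr p)" for p
  have b: "T powr a * S p \<le> 50 * T powr \<theta>" if "1 / 20 \<le> p" "p \<le> 3 / 5" "a + 256 / 753 * p \<le> \<theta>" for a p
    unfolding S_def w_def \<eta>_def using smoothed_power_term[OF T that] .
  have "(\<Sum>k=1..K. w k * (C1 * (2 * e powr (1/20) * T powr (1/2) * real k powr (1/20) + dual_bound T k e)))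
     = (C1 * e powr (1/20)) * (2 * (T powr (1/2) * S (1/20)) + (T powr (16/30) * S (11/30) + T powr (14/30) * S (61/120)
     + (T powr (32/62) * S (26/62) + T powr (30/62) * S (257/496))))"
    by (simp add: S_def dual_bound_def sum_distrib_left sum_distrib_right distrib_left distrib_right sum.distrib mult_ac)
  also have "\<dots> \<le> (C1 * e powr (1/20)) * (2 * (50 * T powr \<theta>) + (50 * T powr \<theta> + 50 * T powr \<theta> + (50 * T powr \<theta> + 50 * T powr \<theta>)))"
    \<comment> \<open>Each use of \<open>b\<close> leaves an inequality
      \<open>a + 256/753 * p \<le> \<theta>\<close>; for \<open>p = 257/496\<close> it is an
      equality.\<close>
    using C1 by (intro mult_left_mono add_mono b) (auto simp: \<theta>_def)
  also have "\<dots> = 300 * C1 * e powr (1/20) * T powr \<theta>" by simp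
  finally show ?thesis by (simp only: w_def)
qed

text \<open>At distance \<open>T powr (3/5)\<close> from the end, \<open>T^2 - Y^2\<close> is at
  least \<open>T powr (8/5)\<close>, so the height is at least \<open>T powr (4/5)\<close>.\<close>

lemma arc_away_from_endpoint:
  fixes T e s :: real and X :: nat
  assumes T: "1 \<le> T" and h: "1 \<le> h" and e: "1 \<le> e" and s: "0 \<le> s" and X: "0 < X" "e * X + s \<le> T - T powr (3/5)"
  shows "arc T h e s (T powr (- (1/5))) X"
proof
  define Y where "Y = e * real X + s"
  have Y: "0 < Y" "Y \<le> T - T powr (3/5)" using X s e by (auto simp: Y_def intro!: add_pos_nonneg)
  have "0 < T powr (3/5)" using T by simp
  thus "e * real X + s < T" using X by linarith
  have "T powr (3/5) * T \<le> (T - Y) * (T + Y)" using Y T powr_ge_zero[of T "3/5"] by (intro mult_mono) linarith+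
  hence "(T powr (-(1/5)) * T)^2 \<le> T^2 - Y\<^sup>2"
    using T by (simp add: power2_eq_square algebra_simps powr_mult_base flip: powr_add)
  thus "T powr (- (1/5)) * T \<le> sqrt (T^2 - (e * real X + s)^2)" unfolding Y_def by (rule real_le_rsqrt)
  have "T powr (-(1/5)) \<le> T powr 0" using T by (intro powr_mono) auto
  thus "T powr (-(1/5)) \<le> 1" using T by simp
qed (use assms in auto)

text \<open>Points within \<open>T powr (3/5)\<close> of the vertical end are bounded trivially,
  which is allowed since \<open>3/5 < \<theta>\<close>. On the rest
  \<open>\<gamma> = T powr (- (1/5))\<close>, so the end terms of \<open>arc_sum_estimate\<close>
  carry only \<open>T powr (21/100)\<close> and disappear in \<open>sqrt T\<close>.\<close>

theorem arc_psi_sum: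
  "\<exists>C>0. \<forall>T e s X. 1 \<le> T \<longrightarrow> 1 \<le> e \<longrightarrow> 0 \<le> s \<longrightarrow> e * real X + s \<le> T \<longrightarrow>
     \<bar>\<Sum>n\<in>{0<..X}. psi (sqrt (T^2 - (e * real n + s)^2))\<bar> \<le> C * T powr \<theta> * e powr (1/20)"
proof -
  obtain C1 where C1: "0 < C1" and est: "\<And>T h e s \<gamma> X. arc T h e s \<gamma> X \<Longrightarrow>
     norm (\<Sum>n\<in>{0<..X}. ee (h * sqrt (T^2 - (e * real n + s)^2)))
       \<le> C1 * (sqrt T + (h * e / \<gamma>) powr (1/20) / \<gamma> + dual_bound T h e)"
    using arc_sum_estimate by auto
  have "\<bar>\<Sum>n\<in>{0<..X}. psi (sqrt (T^2 - (e * real n + s)^2))\<bar> \<le> (3 + 300 * C1) * T powr \<theta> * e powr (1/20)"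
    if T: "1 \<le> T" and e: "1 \<le> e" and s: "0 \<le> s" and X: "e * real X + s \<le> T" for T e s X
  proof -
    define f where "f n = sqrt (T^2 - (e * real n + s)^2)" for n :: nat
    define Y where "Y = T - T powr (3/5)"
    define X' where "X' = min X (nat \<lfloor>(Y - s) / e\<rfloor>)"
    define Q where "Q = T powr \<theta> * e powr (1/20)"
    have e1: "1 \<le> e powr (1/20)" using e by (simp add: ge_one_powr_ge_zero)
    have TQ: "T powr \<theta> \<le> Q" unfolding Q_def using mult_left_mono[OF e1, of "T powr \<theta>"] by simp
    have T35: "T powr (3/5) \<le> T powr \<theta>" "1 \<le> T powr \<theta>"
      using T by (auto intro!: powr_mono ge_one_powr_ge_zero simp: \<theta>_def)
    have tail: "\<bar>\<Sum>n\<in>{X'<..X}. psi (f n)\<bar> \<le> 2 * Q"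
    proof -
      have Yn: "Y < e * real n + s" if "n \<in> {X'<..X}" for n
      proof -
        have "nat \<lfloor>(Y - s) / e\<rfloor> < n" using that by (auto simp: X'_def)
        hence "(Y - s) / e < real n" by linarith
        thus ?thesis using e by (simp add: field_simps)
      qed
      have "real (card {X'<..X}) \<le> T powr (3/5) + 1"
      proof (rule card_le_diameter)
        fix x y assume xy: "x \<in> {X'<..X}" "y \<in> {X'<..X}" "x \<le> y"
        have "e * real y \<le> e * real X" using xy e by (intro mult_left_mono) auto
        hence "e * (real y - real x) \<le> T powr (3/5)" using Yn[OF xy(1)] X by (simp add: Y_def right_diff_distrib)
        moreover have "1 * (real y - real x) \<le> e * (real y - real x)" using e xy by (intro mult_right_mono) auto
        ultimately show "real (y - x) \<le> T powr (3/5)" using xy by (simp add: of_nat_diff)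
      qed auto
      thus ?thesis using abs_sum_psi_le[of f "{X'<..X}"] T35 TQ by linarith
    qed
    have main: "\<bar>\<Sum>n\<in>{0<..X'}. psi (f n)\<bar> \<le> (1 + 300 * C1) * Q"
    proof (cases "X' = 0")
      case True
      have "0 \<le> (1 + 300 * C1) * Q" using C1 by (auto simp: Q_def)
      thus ?thesis using True by simp
    next
      case False
      hence nz: "0 < nat \<lfloor>(Y - s) / e\<rfloor>" by (simp add: X'_def)
      hence "real (nat \<lfloor>(Y - s) / e\<rfloor>) \<le> (Y - s) / e" by linarith
      moreover have "real X' \<le> real (nat \<lfloor>(Y - s) / e\<rfloor>)" by (simp add: X'_def)
      ultimately have "real X' \<le> (Y - s) / e" by linarith
      hence XY: "e * real X' + s \<le> T - T powr (3/5)" using e by (simp add: field_simps Y_def)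
      define \<eta> where "\<eta> = T powr (- (256 / 753)) / 2"
      have "T powr (- (256 / 753)) \<le> T powr 0" using T by (intro powr_mono) auto
      hence \<eta>: "0 < \<eta>" "\<eta> < 1" using T by (auto simp: \<eta>_def)
      have "\<bar>\<Sum>n\<in>{0<..X'}. psi (f n)\<bar> \<le> card {0<..X'} * \<eta> + 300 * C1 * e powr (1/20) * T powr \<theta>"
      proof (rule psi_sum_bound[OF \<eta>])
        fix k :: nat assume k: "1 \<le> k"
        have "arc T k e s (T powr (- (1/5))) X'" using False k by (intro arc_away_from_endpoint T e s XY) auto
        from est[OF this] have "norm (\<Sum>n\<in>{0<..X'}. ee (real k * f n))
          \<le> C1 * (sqrt T + (real k * e / T powr (- (1/5))) powr (1/20) / T powr (- (1/5)) + dual_bound T k e)"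
          by (simp add: f_def)
        also have "\<dots> \<le> C1 * (2 * e powr (1/20) * T powr (1/2) * real k powr (1/20) + dual_bound T k e)"
        proof (intro mult_left_mono add_right_mono)
          have k1: "1 \<le> real k powr (1/20)" using k by (intro ge_one_powr_ge_zero) auto
          have ek: "1 * 1 \<le> e powr (1/20) * real k powr (1/20)" by (rule mult_mono[OF e1 k1]) auto
          have "(real k * e / T powr (- (1/5))) powr (1/20) / T powr (- (1/5))
             = e powr (1/20) * real k powr (1/20) * (T powr (1/100) * T powr (1/5))"
            using T e by (simp add: powr_divide powr_mult powr_powr powr_minus field_simps)
          also have "T powr (1/100) * T powr (1/5) \<le> T powr (1/2)" unfolding powr_add[symmetric] using T by (intro powr_mono) auto
          finally have 1: "(real k * e / T powr (- (1/5))) powr (1/20) / T powr (- (1/5)) \<le> e powr (1/20) * real k powr (1/20) * T powr (1/2)"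
            by (simp add: mult_left_mono)
          have "1 * sqrt T \<le> (e powr (1/20) * real k powr (1/20)) * T powr (1/2)"
            using ek T by (intro mult_mono) (auto simp: powr_half_sqrt)
          with 1 show "sqrt T + (real k * e / T powr (- (1/5))) powr (1/20) / T powr (- (1/5))
              \<le> 2 * e powr (1/20) * T powr (1/2) * real k powr (1/20)" by (simp add: mult_ac)
        qed (use C1 in simp)
        finally show "norm (\<Sum>n\<in>{0<..X'}. ee (real k * f n)) \<le> \<dots>" .
      next
        fix K
        show "(\<Sum>k=1..K. smooth_weight \<eta> k * (C1 * (2 * e powr (1/20) * T powr (1/2) * real k powr (1/20) + dual_bound T k e)))
           \<le> 300 * C1 * e powr (1/20) * T powr \<theta>"
          unfolding \<eta>_def using C1 by (intro sum_dual_weights T e) auto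
      qed
      also have "card {0<..X'} * \<eta> \<le> T powr \<theta>"
      proof -
        have "1 * real X' \<le> e * real X'" using e by (intro mult_right_mono) auto
        also have "\<dots> \<le> T" using XY s powr_ge_zero[of T "3/5"] by linarith
        finally have "real X' * \<eta> \<le> T * T powr (- (256 / 753))" using T unfolding \<eta>_def by (intro mult_mono) auto
        also have "\<dots> = T powr \<theta>" using T by (simp add: powr_mult_base \<theta>_def)
        finally show ?thesis by simp
      qed
      finally show ?thesis using TQ by (simp add: Q_def algebra_simps)
    qed
    have "X' \<le> X" by (simp add: X'_def)
    hence "{0<..X} = {0<..X'} \<union> {X'<..X}" by auto
    hence "(\<Sum>n\<in>{0<..X}. psi (f n)) = (\<Sum>n\<in>{0<..X'}. psi (f n)) + (\<Sum>n\<in>{X'<..X}. psi (f n))"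
      by (simp add: sum.union_disjoint ivl_disj_int)
    hence "\<bar>\<Sum>n\<in>{0<..X}. psi (f n)\<bar> \<le> (1 + 300 * C1) * Q + 2 * Q" using main tail by linarith
    also have "\<dots> = (3 + 300 * C1) * T powr \<theta> * e powr (1/20)" by (simp add: Q_def algebra_simps)
    finally show ?thesis by (simp add: f_def)
  qed
  note main = this
  show ?thesis using C1 by (intro exI[of _ "3 + 300 * C1"] conjI allI impI main) auto
qed

section \<open>Sums of six squares\<close>

definition theta :: "real fps" where
  "theta = Abs_fps (\<lambda>n. real (card {i::int. i\<^sup>2 = int n}))"

abbreviation sq_reps :: "nat \<Rightarrow> nat \<Rightarrow> real" where "sq_reps n \<equiv> fps_nth (theta ^ n)"

definition sq_ints :: "nat \<Rightarrow> int set" where "sq_ints n = {i. i\<^sup>2 \<le> int n}"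

lemma abs_le_of_sq_le: "(i::int)^2 \<le> int n \<Longrightarrow> \<bar>i\<bar> \<le> int n"
proof -
  assume "i^2 \<le> int n"
  moreover have "\<bar>i\<bar> \<le> i^2"
  proof (cases "i = 0")
    case False
    hence "\<bar>i\<bar> * 1 \<le> \<bar>i\<bar> * \<bar>i\<bar>" by (intro mult_left_mono) auto
    thus ?thesis by (simp add: power2_eq_square abs_mult_self_eq)
  qed simp
  ultimately show ?thesis by linarith
qed

lemma finite_sq_ints [simp]: "finite (sq_ints n)"
proof (rule finite_subset)
  show "sq_ints n \<subseteq> {- int n..int n}"
  proof
    fix i assume "i \<in> sq_ints n"
    hence "\<bar>i\<bar> \<le> int n" by (intro abs_le_of_sq_le) (simp add: sq_ints_def)
    thus "i \<in> {- int n..int n}" by (simp only: atLeastAtMost_iff) linarith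
  qed
qed simp

lemma theta_sum:
  fixes g :: "nat \<Rightarrow> real"
  shows "(\<Sum>j=0..n. fps_nth theta j * g j) = (\<Sum>i\<in>sq_ints n. g (nat (i^2)))"
proof -
  have "(\<Sum>i\<in>sq_ints n. g (nat (i^2))) = (\<Sum>j\<in>{0..n}. \<Sum>i\<in>{i\<in>sq_ints n. nat (i^2) = j}. g (nat (i^2)))"
    by (rule sum.group[symmetric]) (simp, simp, force simp: sq_ints_def nat_le_iff)
  also have "\<dots> = (\<Sum>j\<in>{0..n}. fps_nth theta j * g j)"
  proof (rule sum.cong[OF refl])
    fix j assume j: "j \<in> {0..n}"
    have "{i\<in>sq_ints n. nat (i^2) = j} = {i. i\<^sup>2 = int j}"
      using j by (auto simp: sq_ints_def)
    thus "(\<Sum>i\<in>{i\<in>sq_ints n. nat (i^2) = j}. g (nat (i^2))) = fps_nth theta j * g j"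
      by (simp add: theta_def)
  qed
  finally show ?thesis by simp
qed

lemma fps_nth_theta_mult: "fps_nth (theta * F) n = (\<Sum>i\<in>sq_ints n. fps_nth F (n - nat (i^2)))"
  by (simp add: fps_mult_nth theta_sum)

text \<open>Compare coefficients in \<open>theta * D (theta ^ k) = k * D theta * theta ^ k\<close>,
  where \<open>D\<close> multiplies the coefficient of index \<open>n\<close> by \<open>n\<close>.
  The term \<open>i = 0\<close> carries the factor \<open>n\<close>, so for \<open>n \<ge> 1\<close>
  the recursion determines \<open>sq_reps k n\<close> from smaller arguments.\<close>

lemma theta_power_recursion:
  "(\<Sum>i\<in>sq_ints n. (real n - (real k + 1) * real_of_int (i^2)) * sq_reps k (n - nat (i^2))) = 0"
proof -
  let ?D = "\<lambda>f::real fps. fps_X * fps_deriv f"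
  have eq: "theta * ?D (theta ^ k) = fps_const (real k) * (?D theta * theta ^ k)"
  proof (cases k)
    case (Suc m)
    have "fps_deriv (theta ^ k) = fps_const (real k) * fps_deriv theta * theta ^ m"
      using fps_deriv_power[of theta k] Suc by simp
    thus ?thesis by (simp only: Suc power_Suc) (simp add: mult_ac)
  qed simp
  have "fps_nth (theta * ?D (theta ^ k)) n = real k * fps_nth (?D theta * theta ^ k) n"
    by (simp only: eq fps_mult_left_const_nth)
  moreover have D: "fps_nth (?D f) m = real m * fps_nth f m" for f m by (cases m) auto
  ultimately have "(\<Sum>i\<in>sq_ints n. real (n - nat (i^2)) * sq_reps k (n - nat (i^2)))
      = real k * (\<Sum>j=0..n. fps_nth theta j * (real j * sq_reps k (n - j)))"
    unfolding fps_nth_theta_mult fps_mult_nth[of "?D theta"] D by (simp only: mult_ac)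
  also have "\<dots> = real k * (\<Sum>i\<in>sq_ints n. real (nat (i^2)) * sq_reps k (n - nat (i^2)))"
    by (subst theta_sum) simp
  finally have "(\<Sum>i\<in>sq_ints n. real (n - nat (i^2)) * sq_reps k (n - nat (i^2))
      - real k * (real (nat (i^2)) * sq_reps k (n - nat (i^2)))) = 0"
    by (simp add: sum_subtractf sum_distrib_left)
  moreover have "real (n - nat (i^2)) * c - real k * (real (nat (i^2)) * c) = (real n - (real k + 1) * real_of_int (i^2)) * c"
    if "i \<in> sq_ints n" for i c
  proof -
    have "nat (i^2) \<le> n" "real (nat (i^2)) = real_of_int (i^2)" using that by (auto simp: sq_ints_def nat_le_iff)
    thus ?thesis by (simp add: of_nat_diff algebra_simps)
  qed
  ultimately show ?thesis by simp
qed

section \<open>Liouville's identity and the divisor formula for six squares\<close>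

definition chi :: "int \<Rightarrow> int" where
  "chi n = (if n mod 4 = 1 then 1 else if n mod 4 = 3 then -1 else 0)"

lemma chi_even: "even n \<Longrightarrow> chi n = 0" unfolding chi_def by presburger
lemma chi_minus: "chi (- n) = - chi n" unfolding chi_def by presburger
lemma chi_shift: "chi (2 * y - z) = (if even y then - chi z else chi z)" unfolding chi_def by presburger

definition quad_pairs :: "nat \<Rightarrow> (int \<times> int \<times> int) set" where
  "quad_pairs N = {(i, d, e). 1 \<le> d \<and> 1 \<le> e \<and> i^2 + d * e = int N}"

lemma finite_quad_pairs [simp]: "finite (quad_pairs N)"
proof (rule finite_subset)
  show "quad_pairs N \<subseteq> {- int N..int N} \<times> {1..int N} \<times> {1..int N}"
  proof
    fix p assume "p \<in> quad_pairs N"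
    moreover obtain i d e where p: "p = (i, d, e)" by (cases p)
    ultimately have *: "1 \<le> d" "1 \<le> e" "i^2 + d * e = int N" by (auto simp: quad_pairs_def)
    have "0 \<le> d * e" using * by simp
    hence "d * e \<le> int N" "i^2 \<le> int N" using *(3) zero_le_power2[of i] by linarith+
    have "d \<le> d * e" "e \<le> d * e" using * mult_left_mono[of 1 e d] mult_right_mono[of 1 d e] by simp_all
    hence "d \<le> int N" "e \<le> int N" using \<open>d * e \<le> int N\<close> by (auto intro: order.trans)
    moreover have "\<bar>i\<bar> \<le> int N" using \<open>i\<^sup>2 \<le> int N\<close> by (rule abs_le_of_sq_le)
    ultimately show "p \<in> {- int N..int N} \<times> {1..int N} \<times> {1..int N}"
      using *(1,2) by (auto simp: abs_le_iff p)
  qed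
qed simp

lemma sum_neg_involution:
  fixes f :: "'a \<Rightarrow> int"
  assumes "\<And>x. x \<in> A \<Longrightarrow> g x \<in> A" "\<And>x. x \<in> A \<Longrightarrow> g (g x) = x" "\<And>x. x \<in> A \<Longrightarrow> f (g x) = - f x"
  shows "sum f A = 0"
proof -
  have "sum f A = (\<Sum>x\<in>A. f (g x))"
    by (rule sum.reindex_bij_witness[of _ g g]) (use assms in auto)
  also have "\<dots> = - sum f A" using assms(3) by (simp add: sum_negf)
  finally show ?thesis by simp
qed

text \<open>The substitution \<open>x = e - 2 i\<close>, \<open>y = d + i\<close>, \<open>z = 2 d + 2 i - e\<close> turns \<open>i\<^sup>2 + d e = N\<close> into
  \<open>4 y\<^sup>2 + x^2 - z\<^sup>2 = 4 N\<close>, whose sign changes are the source of Liouville's identities.\<close>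

definition hyp_triples :: "nat \<Rightarrow> (int \<times> int \<times> int) set" where
  "hyp_triples N = {(x, y, z). odd x \<and> odd z \<and> 4 * y^2 + x^2 - z\<^sup>2 = 4 * int N}"

text \<open>Odd under a sign change of each of \<open>x\<close>, \<open>y\<close> and
  \<open>z\<close>, the last because \<open>chi\<close> is odd. The polynomial comes from the
  identity wanted for \<open>quad_pairs\<close>, rewritten in the new variables.\<close>

definition liou :: "int \<times> int \<times> int \<Rightarrow> int" where
  "liou = (\<lambda>(x, y, z). (if even y then 1 else -1) * chi z * (x * y * (4 * y^2 - x\<^sup>2)))"

text \<open>In the new variables \<open>x + z = 2 * d\<close> and \<open>2 * y - z = e\<close>, so
  positivity of \<open>d\<close> and \<open>e\<close> becomes the two inequalities. Even
  \<open>e\<close> contribute nothing, and \<open>chi_shift\<close> trades \<open>chi e\<close> for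
  \<open>chi z\<close> at the price of a sign given by the parity of \<open>y\<close>.\<close>

lemma sum_quad_pairs_eq_liou:
  "(\<Sum>(i, d, e)\<in>quad_pairs N. chi e * ((e - 2 * i) * (d + i) * (4 * (d + i)^2 - (e - 2 * i)^2)))
    = - (\<Sum>p\<in>{(x, y, z)\<in>hyp_triples N. x + z > 0 \<and> 2 * y - z > 0}. liou p)"
proof -
  let ?f = "\<lambda>(i, d, e). chi e * ((e - 2 * i) * (d + i) * (4 * (d + i)^2 - (e - 2 * i)^2))"
  have "sum ?f (quad_pairs N) = sum ?f {(i, d, e)\<in>quad_pairs N. odd e}"
    by (intro sum.mono_neutral_right) (auto simp: chi_even)
  also have "\<dots> = (\<Sum>p\<in>{(x, y, z)\<in>hyp_triples N. x + z > 0 \<and> 2 * y - z > 0}. - liou p)"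
  proof (rule sum.reindex_bij_witness[of _ "\<lambda>(x, y, z). (y - (x + z) div 2, (x + z) div 2, 2 * y - z)"
        "\<lambda>(i, d, e). (e - 2 * i, d + i, 2 * d + 2 * i - e)"], goal_cases)
    case (1 a) thus ?case by auto
  next
    case (2 a)
    thus ?case by (auto simp: quad_pairs_def hyp_triples_def power2_eq_square algebra_simps)
  next
    case (3 b) thus ?case by (auto simp: hyp_triples_def)
  next
    case (4 b)
    obtain x y z where b: "b = (x, y, z)" by (cases b)
    with 4 have *: "odd x" "odd z" "4 * y^2 + x^2 - z\<^sup>2 = 4 * int N" "x + z > 0" "2 * y - z > 0"
      by (auto simp: hyp_triples_def)
    then obtain d where d: "x + z = 2 * d" by (metis dvd_def odd_even_add)
    hence x: "x = 2 * d - z" by simp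
    have "(y - d)^2 + d * (2 * y - z) = int N"
      using *(3) by (simp add: x power2_eq_square algebra_simps)
    thus ?case using * by (auto simp: b d quad_pairs_def)
  next
    case (5 a)
    obtain i d e where a: "a = (i, d, e)" by (cases a)
    have "e = 2 * (d + i) - (2 * d + 2 * i - e)" by simp
    hence "chi e = (if even (d + i) then - chi (2 * d + 2 * i - e) else chi (2 * d + 2 * i - e))"
      using chi_shift[of "d + i" "2 * d + 2 * i - e"] by simp
    thus ?case by (simp add: a liou_def)
  qed
  finally show ?thesis by (simp add: sum_negf)
qed

text \<open>On this cone \<open>x^2 - z^2\<close> is a product of two positive factors, so the
  indefinite form bounds all three variables.\<close>

lemma finite_hyp_triples_cone: "finite {(x, y, z)\<in>hyp_triples N. \<bar>z\<bar> < x}"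
proof (rule finite_subset)
  show "{(x, y, z)\<in>hyp_triples N. \<bar>z\<bar> < x} \<subseteq> {0..4 * int N} \<times> {- int N..int N} \<times> {- (4 * int N)..4 * int N}"
  proof
    fix p assume "p \<in> {(x, y, z)\<in>hyp_triples N. \<bar>z\<bar> < x}"
    moreover obtain x y z where p: "p = (x, y, z)" by (cases p)
    ultimately have *: "(x, y, z) \<in> hyp_triples N" "\<bar>z\<bar> < x" by auto
    hence eq: "4 * y^2 + (x - \<bar>z\<bar>) * (x + \<bar>z\<bar>) = 4 * int N"
      by (simp add: hyp_triples_def power2_eq_square algebra_simps)
    define P where "P = (x - \<bar>z\<bar>) * (x + \<bar>z\<bar>)"
    have "1 * (x + \<bar>z\<bar>) \<le> P" unfolding P_def using * by (intro mult_right_mono) auto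
    moreover have "0 \<le> y^2" "0 \<le> x + \<bar>z\<bar>" using * by auto
    moreover have "4 * y^2 + P = 4 * int N" using eq by (simp only: P_def)
    ultimately have "x + \<bar>z\<bar> \<le> P" "0 \<le> P" "4 * y^2 = 4 * int N - P" by simp_all
    moreover from this have "P \<le> 4 * int N" using zero_le_power2[of y] by linarith
    ultimately have 1: "x + \<bar>z\<bar> \<le> 4 * int N" "y^2 \<le> int N" by simp_all
    show "p \<in> {0..4 * int N} \<times> {- int N..int N} \<times> {- (4 * int N)..4 * int N}"
      using 1(1) * abs_le_of_sq_le[OF 1(2)] by (auto simp: p abs_le_iff)
  qed
qed simp

text \<open>Split \<open>x + z > 0\<close> by comparing \<open>x\<close> and \<open>z\<close>. Where
  \<open>\<bar>x\<bar> < z\<close>, the change \<open>x\<close> to \<open>- x\<close> cancels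
  everything. Where \<open>\<bar>z\<bar> < x\<close>, the change of both \<open>y\<close> and
  \<open>z\<close> maps the half \<open>2 * y > z\<close> to the other half with the same weights,
  and \<open>2 * y = z\<close> is excluded by parity; the two halves together cancel under
  \<open>y\<close> to \<open>- y\<close>. Only \<open>x = z\<close> remains.\<close>

lemma liou_sum_reduce:
  "(\<Sum>p\<in>{(x, y, z)\<in>hyp_triples N. x + z > 0 \<and> 2 * y - z > 0}. liou p)
    = (\<Sum>p\<in>{(x, y, z)\<in>hyp_triples N. x = z \<and> x > 0 \<and> 2 * y - z > 0}. liou p)"
proof -
  let ?T = "{(x, y, z)\<in>hyp_triples N. x + z > 0 \<and> 2 * y - z > 0}"
  let ?A = "{(x, y, z)\<in>hyp_triples N. \<bar>x\<bar> < z \<and> 2 * y - z > 0}"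
  let ?B = "{(x, y, z)\<in>hyp_triples N. \<bar>z\<bar> < x \<and> 2 * y - z > 0}"
  let ?B' = "{(x, y, z)\<in>hyp_triples N. \<bar>z\<bar> < x \<and> 2 * y - z < 0}"
  let ?U = "{(x, y, z)\<in>hyp_triples N. \<bar>z\<bar> < x}"
  let ?Z = "{(x, y, z)\<in>hyp_triples N. x = z \<and> x > 0 \<and> 2 * y - z > 0}"
  have fin: "finite ?T"
  proof (rule finite_subset)
    show "?T \<subseteq> (\<lambda>(i, d, e). (e - 2 * i, d + i, 2 * d + 2 * i - e)) ` quad_pairs N"
    proof
      fix b assume 4: "b \<in> ?T"
      obtain x y z where b: "b = (x, y, z)" by (cases b)
      with 4 have *: "odd x" "odd z" "4 * y^2 + x^2 - z\<^sup>2 = 4 * int N" "x + z > 0" "2 * y - z > 0"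
        by (auto simp: hyp_triples_def)
      then obtain d where d: "x + z = 2 * d" by (metis dvd_def odd_even_add)
      hence x: "x = 2 * d - z" by simp
      have "(y - d)^2 + d * (2 * y - z) = int N"
        using *(3) by (simp add: x power2_eq_square algebra_simps)
      hence "(y - d, d, 2 * y - z) \<in> quad_pairs N" using * d by (auto simp: quad_pairs_def)
      thus "b \<in> (\<lambda>(i, d, e). (e - 2 * i, d + i, 2 * d + 2 * i - e)) ` quad_pairs N"
        by (rule rev_image_eqI) (simp add: b x)
    qed
  qed simp
  have "?T = ?A \<union> (?B \<union> ?Z)" by auto
  moreover have "?A \<inter> (?B \<union> ?Z) = {}" "?B \<inter> ?Z = {}" by auto
  moreover have "finite ?A" "finite ?B" "finite ?Z" by (rule finite_subset[OF _ fin]; auto)+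
  ultimately have split: "sum liou ?T = sum liou ?A + (sum liou ?B + sum liou ?Z)"
    by (simp add: sum.union_disjoint)
  have A: "sum liou ?A = 0"
    by (rule sum_neg_involution[of _ "\<lambda>(x, y, z). (- x, y, z)"])
      (auto simp: hyp_triples_def liou_def)
  have BB: "sum liou ?B = sum liou ?B'"
    by (rule sum.reindex_bij_witness[of _ "\<lambda>(x, y, z). (x, - y, - z)" "\<lambda>(x, y, z). (x, - y, - z)"])
      (auto simp: hyp_triples_def liou_def chi_minus)
  have U: "?U = ?B \<union> ?B'"
  proof -
    have "2 * y - z \<noteq> 0" if "(x, y, z) \<in> hyp_triples N" for x y z
      using that by (auto simp: hyp_triples_def)
    thus ?thesis by force
  qed
  have "sum liou ?U = 0"
    by (rule sum_neg_involution[of _ "\<lambda>(x, y, z). (x, - y, z)"])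
      (auto simp: hyp_triples_def liou_def)
  moreover have "sum liou ?U = sum liou ?B + sum liou ?B'"
    unfolding U by (rule sum.union_disjoint) (auto intro: finite_subset[OF _ finite_hyp_triples_cone[of N]])
  ultimately have "sum liou ?B = 0" using BB by linarith
  thus ?thesis using split A by simp
qed

lemma alternating_odd_sums:
  "(\<Sum>j<m. (-1) ^ j * (2 * int j + 1)) = - ((-1) ^ m * int m)"
  "(\<Sum>j<m. (-1) ^ j * (2 * int j + 1) ^ 3) = - ((-1) ^ m * (4 * int m ^ 3 - 3 * int m))"
  by (induction m) (auto simp: algebra_simps power3_eq_cube)

lemma chi_odd: "chi (2 * int j + 1) = (-1) ^ j"
proof (induction j)
  case (Suc j)
  have "chi (2 * int (Suc j) + 1) = - chi (2 * int j + 1)" unfolding chi_def by presburger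
  thus ?case using Suc by simp
qed (simp add: chi_def)

text \<open>\<open>x = z\<close> forces \<open>y^2 = N\<close>, so there is nothing unless
  \<open>N = m^2\<close>; then \<open>y = m\<close> and \<open>x\<close> runs through the odd
  numbers below \<open>2 * m\<close>. The alternating sums of these numbers and of their cubes
  combine to \<open>- 3 * m^2\<close>.\<close>

lemma liou_boundary:
  assumes "1 \<le> N"
  shows "(\<Sum>p\<in>{(x, y, z)\<in>hyp_triples N. x = z \<and> x > 0 \<and> 2 * y - z > 0}. liou p)
    = (if \<exists>m. N = m^2 then - (3 * int N) else 0)" (is "sum liou ?Z = _")
proof (cases "\<exists>m. N = m^2")
  case False
  have "?Z = {}"
  proof (rule ccontr)
    assume "?Z \<noteq> {}"
    then obtain y :: int where "y^2 = int N" by (auto simp: hyp_triples_def)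
    hence "int ((nat \<bar>y\<bar>)^2) = int N" by simp
    hence "N = (nat \<bar>y\<bar>)^2" by (simp only: of_nat_eq_iff)
    thus False using False by blast
  qed
  thus ?thesis using False by (simp only: sum.empty if_False)
next
  case True
  then obtain m where m: "N = m^2" by blast
  have m1: "1 \<le> m" using assms m by (cases m) auto
  have y: "y = int m" if "4 * y^2 = 4 * int N" "2 * y - x > 0" "x > 0" for x y
  proof -
    have "y^2 = (int m)^2" using that m by simp
    thus ?thesis using that by (simp add: power2_eq_iff) 
  qed
  have "sum liou ?Z = (\<Sum>j<m. (-1) ^ m * int m * (4 * int m ^ 2 * ((-1) ^ j * (2 * int j + 1)) - (-1) ^ j * (2 * int j + 1) ^ 3))"
  proof (rule sum.reindex_bij_witness[of _ "\<lambda>j. (2 * int j + 1, int m, 2 * int j + 1)" "\<lambda>(x, y, z). nat (x div 2)"], goal_cases)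
    case (1 a)
    obtain x yy z where a: "a = (x, yy, z)" by (cases a)
    from 1 have *: "odd x" "x = z" "x > 0" "2 * yy - x > 0" "4 * yy^2 = 4 * int N" by (auto simp: a hyp_triples_def)
    have "2 * (x div 2) + 1 = x" "x div 2 \<ge> 0" using *(1,3) by auto
    thus ?case using * y[OF *(5,4,3)] by (simp add: a)
  next
    case (2 a)
    obtain x yy z where a: "a = (x, yy, z)" by (cases a)
    from 2 have *: "odd x" "x = z" "x > 0" "2 * yy - x > 0" "4 * yy^2 = 4 * int N" by (auto simp: a hyp_triples_def)
    have "2 * (x div 2) + 1 = x" "x div 2 \<ge> 0" using *(1,3) by auto
    moreover have "yy = int m" by (rule y[OF *(5,4,3)])
    ultimately have "x div 2 < int m" using *(4) by linarith
    thus ?case using * by (simp add: a nat_less_iff)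
  next
    case (3 j) thus ?case by simp
  next
    case (4 j) thus ?case by (simp add: hyp_triples_def m)
  next
    case (5 a)
    obtain x yy z where a: "a = (x, yy, z)" by (cases a)
    from 5 have *: "odd x" "x = z" "x > 0" "2 * yy - x > 0" "4 * yy^2 = 4 * int N" by (auto simp: a hyp_triples_def)
    have ym: "yy = int m" by (rule y[OF *(5,4,3)])
    define j where "j = nat (x div 2)"
    have x: "x = 2 * int j + 1" using *(1,3) by (simp add: j_def)
    have "nat ((2 * int j + 1) div 2) = j" by simp
    moreover have "(if even (int m) then 1 else - 1) = (-1::int) ^ m" by simp
    moreover have "a = (2 * int j + 1, int m, 2 * int j + 1)" using *(2) by (simp add: a x ym)
    ultimately show ?case
      by (simp only: liou_def prod.case chi_odd) (simp add: power3_eq_cube power2_eq_square algebra_simps)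
  qed
  also have "\<dots> = (-1) ^ m * int m * (4 * int m ^ 2 * (\<Sum>j<m. (-1) ^ j * (2 * int j + 1)) - (\<Sum>j<m. (-1) ^ j * (2 * int j + 1) ^ 3))"
    by (simp only: sum_distrib_left sum_subtractf right_diff_distrib)
  also have "\<dots> = - (((-1) ^ m * (-1) ^ m) * (3 * int m ^ 2))"
  proof -
    have "s * x * (4 * x ^ 2 * (- (s * x)) - (- (s * (4 * x ^ 3 - 3 * x)))) = - ((s * s) * (3 * x ^ 2))" for s x :: int
      by (simp add: algebra_simps power3_eq_cube power2_eq_square)
    thus ?thesis unfolding alternating_odd_sums .
  qed
  also have "(-1::int) ^ m * (-1) ^ m = 1" by (simp flip: power_mult_distrib)
  finally show ?thesis using True m by simp
qed

lemma liouville_six_squares: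
  assumes "1 \<le> N"
  shows "(\<Sum>(i, d, e)\<in>quad_pairs N. chi e * ((d * e - 6 * i^2) * (4 * d^2 - e\<^sup>2)))
    = (if \<exists>m. N = m^2 then 3 * int N else 0)"
proof -
  let ?f = "\<lambda>i d e. chi e * ((e - 2 * i) * (d + i) * (4 * (d + i)^2 - (e - 2 * i)^2))"
  \<comment> \<open>Averaging over \<open>i\<close> and \<open>- i\<close> removes the odd powers of
    \<open>i\<close>; the even part of the polynomial is
    \<open>(d * e - 6 * i^2) * (4 * d^2 - e^2)\<close>.\<close>
  have a: "(\<Sum>(i, d, e)\<in>quad_pairs N. ?f i d e) = (\<Sum>(i, d, e)\<in>quad_pairs N. ?f (- i) d e)"
    by (rule sum.reindex_bij_witness[of _ "\<lambda>(i, d, e). (- i, d, e)" "\<lambda>(i, d, e). (- i, d, e)"])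
      (auto simp: quad_pairs_def)
  have "2 * (\<Sum>(i, d, e)\<in>quad_pairs N. chi e * ((d * e - 6 * i^2) * (4 * d^2 - e\<^sup>2)))
     = (\<Sum>(i, d, e)\<in>quad_pairs N. ?f i d e + ?f (- i) d e)"
    unfolding sum_distrib_left
    by (rule sum.cong) (auto simp: algebra_simps power2_eq_square)
  also have "\<dots> = 2 * (\<Sum>(i, d, e)\<in>quad_pairs N. ?f i d e)"
    using a by (simp add: case_prod_unfold sum.distrib)
  finally show ?thesis
    using sum_quad_pairs_eq_liou[of N] liou_sum_reduce[of N] liou_boundary[OF assms] by simp
qed

text \<open>The classical divisor sum for six squares, in which \<open>e\<close> is the codivisor of
  \<open>d\<close>; \<open>six_squares\<close> proves the identity.\<close>

definition six_coeff :: "nat \<Rightarrow> int" where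
  "six_coeff m = (\<Sum>(d, e)\<in>{(d, e). d * e = m}. (16 * chi (int e) - 4 * chi (int d)) * (int d)^2)"

lemma finite_divisor_pairs: "1 \<le> m \<Longrightarrow> finite {(d, e). d * e = (m::nat)}"
proof (rule finite_subset)
  assume m: "1 \<le> m"
  show "{(d, e). d * e = m} \<subseteq> {..m} \<times> {..m}"
    using m by (auto intro: dvd_imp_le)
qed simp

text \<open>Sum over \<open>i\<close> first: the pairs \<open>(d, e)\<close> are the factorisations
  of \<open>N - i^2\<close>, on which \<open>N - 7 * i^2 = d * e - 6 * i^2\<close>.\<close>

lemma sum_quad_pairs_fibre:
  assumes "1 \<le> N"
  shows "(\<Sum>i\<in>{i. i\<^sup>2 < int N}. (int N - 7 * i^2) * six_coeff (N - nat (i^2)))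
    = (\<Sum>(i, d, e)\<in>quad_pairs N. (d * e - 6 * i^2) * ((16 * chi e - 4 * chi d) * d^2))"
proof -
  let ?I = "{i::int. i\<^sup>2 < int N}"
  let ?P = "\<lambda>i::int. {(d, e). d * e = N - nat (i^2)}"
  have fI: "finite ?I" by (rule finite_subset[OF _ finite_sq_ints[of N]]) (auto simp: sq_ints_def)
  have pos: "1 \<le> N - nat (i^2)" "int (N - nat (i^2)) = int N - i\<^sup>2" if "i \<in> ?I" for i
  proof -
    have "nat (i^2) < N" using that by (simp add: nat_less_iff)
    thus "1 \<le> N - nat (i^2)" "int (N - nat (i^2)) = int N - i\<^sup>2" by (auto simp: of_nat_diff)
  qed
  have "(\<Sum>i\<in>?I. (int N - 7 * i^2) * six_coeff (N - nat (i^2)))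
     = (\<Sum>i\<in>?I. \<Sum>p\<in>?P i. (int N - 7 * i^2) * ((16 * chi (int (snd p)) - 4 * chi (int (fst p))) * (int (fst p))^2))"
    by (simp add: six_coeff_def sum_distrib_left case_prod_unfold)
  also have "\<dots> = (\<Sum>(i, p)\<in>Sigma ?I ?P. (int N - 7 * i^2) * ((16 * chi (int (snd p)) - 4 * chi (int (fst p))) * (int (fst p))^2))"
    by (rule sum.Sigma) (use fI finite_divisor_pairs[OF pos(1)] in auto)
  also have "\<dots> = (\<Sum>(i, d, e)\<in>quad_pairs N. (d * e - 6 * i^2) * ((16 * chi e - 4 * chi d) * d^2))"
  proof (rule sum.reindex_bij_witness[of _ "\<lambda>(i, d, e). (i, nat d, nat e)" "\<lambda>(i, d, e). (i, int d, int e)"], goal_cases)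
    case (2 a)
    obtain i d e where a: "a = (i, d, e)" by (cases a)
    from 2 have i: "i \<in> ?I" and de: "d * e = N - nat (i^2)" by (auto simp: a)
    have "d * e \<noteq> 0" using de pos(1)[OF i] by simp
    moreover have "int d * int e = int N - i\<^sup>2" using pos(2)[OF i] de by (metis of_nat_mult)
    ultimately show ?case by (auto simp: a quad_pairs_def)
  next
    case (4 b)
    obtain i d e where b: "b = (i, d, e)" by (cases b)
    from 4 have *: "1 \<le> d" "1 \<le> e" "i^2 + d * e = int N" by (auto simp: b quad_pairs_def)
    have "0 < d * e" using * by simp
    hence "i^2 < int N" using *(3) by linarith
    hence i: "i \<in> ?I" by simp
    have "int (nat d * nat e) = int (N - nat (i^2))" unfolding pos(2)[OF i] using * by simp
    thus ?case using i unfolding b by (simp only: of_nat_eq_iff) simp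
  next
    case (5 a)
    obtain i d e where a: "a = (i, d, e)" by (cases a)
    from 5 have i: "i \<in> ?I" and de: "d * e = N - nat (i^2)" by (auto simp: a)
    have "int d * int e = int N - i\<^sup>2" using pos(2)[OF i] de by (metis of_nat_mult)
    hence "int d * int e - 6 * i^2 = int N - 7 * i^2" by simp
    thus ?case by (simp add: a)
  qed (auto simp: quad_pairs_def)
  finally show ?thesis .
qed

lemma card_sqrt_ints:
  assumes "1 \<le> N"
  shows "int (card {i::int. i\<^sup>2 = int N}) = (if \<exists>m. N = m^2 then 2 else 0)"
proof (cases "\<exists>m. N = m^2")
  case True
  then obtain m where m: "N = m^2" by blast
  have "{i::int. i\<^sup>2 = int N} = {int m, - int m}" by (auto simp: m power2_eq_iff)
  moreover have "m \<noteq> 0" using assms unfolding m by (cases "m = 0") auto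
  ultimately show ?thesis using True by simp
next
  case False
  have "{i::int. i\<^sup>2 = int N} = {}"
  proof (rule ccontr)
    assume "{i::int. i\<^sup>2 = int N} \<noteq> {}"
    then obtain y :: int where "y^2 = int N" by auto
    hence "int ((nat \<bar>y\<bar>)^2) = int N" by simp
    hence "N = (nat \<bar>y\<bar>)^2" by (simp only: of_nat_eq_iff)
    thus False using False by blast
  qed
  thus ?thesis using False by simp
qed

text \<open>Exchanging \<open>d\<close> and \<open>e\<close> in the part with \<open>chi d\<close>
  merges both parts of \<open>six_coeff\<close> into four times Liouville's sum. If \<open>N\<close>
  is a square, its value \<open>12 * N\<close> is cancelled by the two terms \<open>i^2 = N\<close>,
  each \<open>- 6 * N\<close>, where the coefficient of index 0 is set to 1.\<close>

lemma six_coeff_recursion: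
  assumes "1 \<le> N"
  shows "(\<Sum>i\<in>sq_ints N. (int N - 7 * i^2) * (if i\<^sup>2 = int N then 1 else six_coeff (N - nat (i^2)))) = 0"
proof -
  have un: "sq_ints N = {i. i\<^sup>2 < int N} \<union> {i. i\<^sup>2 = int N}" by (auto simp: sq_ints_def)
  have fin: "finite {i::int. i\<^sup>2 < int N}" "finite {i::int. i\<^sup>2 = int N}"
    using finite_sq_ints[of N] unfolding un by auto
  have "(\<Sum>i\<in>sq_ints N. (int N - 7 * i^2) * (if i\<^sup>2 = int N then 1 else six_coeff (N - nat (i^2))))
     = (\<Sum>i\<in>{i. i\<^sup>2 < int N}. (int N - 7 * i^2) * (if i\<^sup>2 = int N then 1 else six_coeff (N - nat (i^2))))
     + (\<Sum>i\<in>{i. i\<^sup>2 = int N}. (int N - 7 * i^2) * (if i\<^sup>2 = int N then 1 else six_coeff (N - nat (i^2))))"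
    unfolding un by (rule sum.union_disjoint) (use fin in auto)
  also have "(\<Sum>i\<in>{i. i\<^sup>2 < int N}. (int N - 7 * i^2) * (if i\<^sup>2 = int N then 1 else six_coeff (N - nat (i^2))))
     = (\<Sum>i\<in>{i. i\<^sup>2 < int N}. (int N - 7 * i^2) * six_coeff (N - nat (i^2)))"
    by (intro sum.cong) auto
  also have "\<dots> = (\<Sum>(i, d, e)\<in>quad_pairs N. (d * e - 6 * i^2) * ((16 * chi e - 4 * chi d) * d^2))"
    by (rule sum_quad_pairs_fibre[OF assms])
  also have "\<dots> = (\<Sum>(i, d, e)\<in>quad_pairs N. (d * e - 6 * i^2) * (16 * chi e * d^2))
     - (\<Sum>(i, d, e)\<in>quad_pairs N. (d * e - 6 * i^2) * (4 * chi d * d^2))"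
    by (simp add: sum_subtractf[symmetric] case_prod_unfold algebra_simps)
  also have "(\<Sum>(i, d, e)\<in>quad_pairs N. (d * e - 6 * i^2) * (4 * chi d * d^2))
     = (\<Sum>(i, d, e)\<in>quad_pairs N. (d * e - 6 * i^2) * (4 * chi e * e^2))"
    by (rule sum.reindex_bij_witness[of _ "\<lambda>(i, d, e). (i, e, d)" "\<lambda>(i, d, e). (i, e, d)"])
      (auto simp: quad_pairs_def mult.commute)
  also have "(\<Sum>(i, d, e)\<in>quad_pairs N. (d * e - 6 * i^2) * (16 * chi e * d^2))
      - (\<Sum>(i, d, e)\<in>quad_pairs N. (d * e - 6 * i^2) * (4 * chi e * e^2))
     = (\<Sum>(i, d, e)\<in>quad_pairs N. 4 * (chi e * ((d * e - 6 * i^2) * (4 * d^2 - e\<^sup>2))))"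
    by (simp add: sum_subtractf[symmetric] case_prod_unfold algebra_simps)
  also have "\<dots> = 4 * (\<Sum>(i, d, e)\<in>quad_pairs N. chi e * ((d * e - 6 * i^2) * (4 * d^2 - e\<^sup>2)))"
    by (simp add: sum_distrib_left case_prod_unfold)
  also have "\<dots> = 4 * (if \<exists>m. N = m^2 then 3 * int N else 0)"
    by (simp only: liouville_six_squares[OF assms])
  also have "(\<Sum>i\<in>{i. i\<^sup>2 = int N}. (int N - 7 * i^2) * (if i\<^sup>2 = int N then 1 else six_coeff (N - nat (i^2))))
     = int (card {i::int. i\<^sup>2 = int N}) * (- 6 * int N)" by simp
  also have "4 * (if \<exists>m. N = m^2 then 3 * int N else 0) + int (card {i::int. i\<^sup>2 = int N}) * (- 6 * int N) = 0"
    using card_sqrt_ints[OF assms] by simp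
  finally show ?thesis .
qed

lemma fps_nth_theta_0 [simp]: "fps_nth theta 0 = 1"
proof -
  have "{i::int. i\<^sup>2 = int 0} = {0}" by auto
  thus ?thesis by (simp add: theta_def)
qed

lemma fps_nth_theta_power_0 [simp]: "sq_reps k 0 = 1"
  by (induction k) auto

text \<open>Both sides satisfy the same recursion and agree at 0. Its term \<open>i = 0\<close> has
  the factor \<open>N\<close>, which is not zero, so induction determines the coefficient.\<close>

theorem six_squares:
  assumes "1 \<le> m"
  shows "sq_reps 6 m = real_of_int (six_coeff m)"
  using assms
proof (induction m rule: less_induct)
  case (less N)
  let ?f = "\<lambda>i. if i\<^sup>2 = int N then 1 else real_of_int (six_coeff (N - nat (i^2)))"
  have split: "sq_ints N = insert 0 (sq_ints N - {0})" by (auto simp: sq_ints_def)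
  have "(\<Sum>i\<in>sq_ints N. (real N - 7 * real_of_int (i^2)) * sq_reps 6 (N - nat (i^2))) = 0"
    using theta_power_recursion[of N 6] by simp
  hence 1: "real N * sq_reps 6 N
      + (\<Sum>i\<in>sq_ints N - {0}. (real N - 7 * real_of_int (i^2)) * sq_reps 6 (N - nat (i^2))) = 0"
    by (subst (asm) split, subst (asm) sum.insert) auto
  have "real_of_int (\<Sum>i\<in>sq_ints N. (int N - 7 * i^2) * (if i\<^sup>2 = int N then 1 else six_coeff (N - nat (i^2)))) = 0"
    using six_coeff_recursion[OF less.prems] by simp
  moreover have "(\<Sum>i\<in>sq_ints N. (real N - 7 * real_of_int (i^2)) * ?f i)
    = real_of_int (\<Sum>i\<in>sq_ints N. (int N - 7 * i^2) * (if i\<^sup>2 = int N then 1 else six_coeff (N - nat (i^2))))"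
    unfolding of_int_sum by (intro sum.cong) auto
  ultimately have "(\<Sum>i\<in>sq_ints N. (real N - 7 * real_of_int (i^2)) * ?f i) = 0" by simp
  hence 2: "real N * real_of_int (six_coeff N) + (\<Sum>i\<in>sq_ints N - {0}. (real N - 7 * real_of_int (i^2)) * ?f i) = 0"
    using less.prems by (subst (asm) split, subst (asm) sum.insert) auto
  have "(\<Sum>i\<in>sq_ints N - {0}. (real N - 7 * real_of_int (i^2)) * sq_reps 6 (N - nat (i^2)))
     = (\<Sum>i\<in>sq_ints N - {0}. (real N - 7 * real_of_int (i^2)) * ?f i)"
  proof (intro sum.cong refl arg_cong2[where f = "(*)"])
    fix i assume i: "i \<in> sq_ints N - {0}"
    show "sq_reps 6 (N - nat (i^2)) = ?f i"
    proof (cases "i^2 = int N")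
      case True thus ?thesis by simp
    next
      case False
      have "nat (i^2) < N" "0 < nat (i^2)" using i False by (auto simp: sq_ints_def nat_less_iff)
      hence "N - nat (i^2) < N" "1 \<le> N - nat (i^2)" by auto
      thus ?thesis using less.IH False by simp
    qed
  qed
  hence "real N * sq_reps 6 N = real N * real_of_int (six_coeff N)" using 1 2 by linarith
  thus ?case using less.prems by simp
qed

section \<open>Sawtooth sums weighted by representation numbers\<close>

lemma sum_divisor_pairs:
  fixes F :: "nat \<Rightarrow> nat \<Rightarrow> 'a::comm_monoid_add"
  shows "(\<Sum>m=1..N. \<Sum>(d, e)\<in>{(d, e). d * e = m}. F d e) = (\<Sum>e=1..N. \<Sum>d=1..N div e. F d e)"
proof -
  have "(\<Sum>m=1..N. \<Sum>(d, e)\<in>{(d, e). d * e = m}. F d e) = (\<Sum>(d, e)\<in>(\<Union>m\<in>{1..N}. {(d, e). d * e = m}). F d e)"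
    by (rule sum.UNION_disjoint[symmetric]) (auto intro: finite_divisor_pairs)
  also have "\<dots> = (\<Sum>(e, d)\<in>Sigma {1..N} (\<lambda>e. {1..N div e}). F d e)"
  proof (rule sum.reindex_bij_witness[of _ "\<lambda>(e, d). (d, e)" "\<lambda>(e, d). (d, e)"])
    fix p assume "p \<in> (\<Union>m\<in>{1..N}. {(d, e). d * e = m})"
    then obtain d e where p: "p = (d, e)" "1 \<le> d * e" "d * e \<le> N" by auto
    have de: "1 \<le> d" "1 \<le> e" using p(2) by (cases d; cases e; simp)+
    have "1 * e \<le> d * e" by (rule mult_right_mono) (use de in auto)
    hence "e \<le> N" using p(3) by linarith
    moreover have "d \<le> N div e" using p(3) de by (simp add: less_eq_div_iff_mult_less_eq)
    ultimately show "(case p of (e, d) \<Rightarrow> (d, e)) \<in> Sigma {1..N} (\<lambda>e. {1..N div e})" using p de by auto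
  next
    fix p assume "p \<in> Sigma {1..N} (\<lambda>e. {1..N div e})"
    then obtain d e where p: "p = (e, d)" "1 \<le> e" "1 \<le> d" "d \<le> N div e" by auto
    have "d * e \<le> N" using p by (simp add: less_eq_div_iff_mult_less_eq)
    moreover have "1 * 1 \<le> d * e" using p by (intro mult_mono) auto
    ultimately show "(case p of (e, d) \<Rightarrow> (d, e)) \<in> (\<Union>m\<in>{1..N}. {(d, e). d * e = m})" using p by auto
  qed auto
  also have "\<dots> = (\<Sum>e=1..N. \<Sum>d=1..N div e. F d e)" by (rule sum.Sigma[symmetric]) auto
  finally show ?thesis .
qed

lemma six_coeff_sum:
  fixes g :: "nat \<Rightarrow> real"
  shows "(\<Sum>m=1..N. six_coeff m * g m)
    = 16 * (\<Sum>e=1..N. chi (int e) * (\<Sum>d=1..N div e. (real d)^2 * g (d * e)))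
      - 4 * (\<Sum>e=1..N. \<Sum>d=1..N div e. chi (int d) * ((real d)^2 * g (d * e)))"
proof -
  have "(\<Sum>m=1..N. six_coeff m * g m) = (\<Sum>m=1..N. \<Sum>(d, e)\<in>{(d, e). d * e = m}. ((16 * chi (int e) - 4 * chi (int d)) * (real d)^2) * g (d * e))"
    unfolding six_coeff_def of_int_sum sum_distrib_right by (intro sum.cong refl) auto
  also have "\<dots> = (\<Sum>e=1..N. \<Sum>d=1..N div e. ((16 * chi (int e) - 4 * chi (int d)) * (real d)^2) * g (d * e))"
    by (rule sum_divisor_pairs)
  also have "\<dots> = 16 * (\<Sum>e=1..N. chi (int e) * (\<Sum>d=1..N div e. (real d)^2 * g (d * e)))
      - 4 * (\<Sum>e=1..N. \<Sum>d=1..N div e. chi (int d) * ((real d)^2 * g (d * e)))"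
    by (simp add: sum_distrib_left left_diff_distrib right_diff_distrib sum_subtractf mult_ac)
  finally show ?thesis .
qed

lemma abs_chi_le: "\<bar>chi n\<bar> \<le> 1" by (simp add: chi_def)

lemma weighted_sum_le_partial_sums:
  fixes w a :: "nat \<Rightarrow> real"
  assumes w: "\<And>n. w n \<le> w (Suc n)" "0 \<le> w 0" and B: "\<And>n. n \<le> X \<Longrightarrow> \<bar>\<Sum>k\<in>{0<..n}. a k\<bar> \<le> B"
  shows "\<bar>\<Sum>n\<in>{0<..X}. w n * a n\<bar> \<le> 2 * w X * B"
proof -
  define A where "A n = (\<Sum>k\<in>{0<..n}. a k)" for n
  have ivl: "{0<..Suc n} = insert (Suc n) {0<..n}" for n by auto
  have A_Suc: "A (Suc n) = A n + a (Suc n)" for n by (simp add: A_def ivl)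
  have "B \<ge> 0" using B[of 0] by simp
  have 1: "\<bar>(\<Sum>n\<in>{0<..Y}. w n * a n) - w Y * A Y\<bar> \<le> (w Y - w 0) * B" if "Y \<le> X" for Y
    using that
  proof (induction Y)
    case (Suc Y)
    have "(\<Sum>n\<in>{0<..Suc Y}. w n * a n) - w (Suc Y) * A (Suc Y) = ((\<Sum>n\<in>{0<..Y}. w n * a n) - w Y * A Y) - (w (Suc Y) - w Y) * A Y"
      by (simp add: ivl A_Suc algebra_simps)
    moreover have "\<bar>(w (Suc Y) - w Y) * A Y\<bar> \<le> (w (Suc Y) - w Y) * B"
      unfolding abs_mult using w(1)[of Y] B[of Y] Suc.prems by (intro mult_mono) (auto simp: A_def)
    moreover have "\<bar>(\<Sum>n\<in>{0<..Y}. w n * a n) - w Y * A Y\<bar> \<le> (w Y - w 0) * B" using Suc by simp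
    moreover have "(w Y - w 0) * B + (w (Suc Y) - w Y) * B = (w (Suc Y) - w 0) * B" by (simp add: algebra_simps)
    ultimately show ?case by linarith
  qed (simp add: A_def)
  have wX: "w 0 \<le> w X" using lift_Suc_mono_le[of w 0 X] w by simp
  have "\<bar>w X * A X\<bar> \<le> w X * B" unfolding abs_mult using wX w B[of X] by (intro mult_mono) (auto simp: A_def)
  moreover have "(w X - w 0) * B \<le> w X * B" using w \<open>B \<ge> 0\<close> by (intro mult_right_mono) auto
  ultimately show ?thesis using 1[of X] by simp
qed

lemma weighted_sum_le_partial_sums_0:
  fixes w a :: "nat \<Rightarrow> real"
  assumes w: "\<And>n. w n \<le> w (Suc n)" "0 \<le> w 0" and B: "\<And>n. n \<le> X \<Longrightarrow> \<bar>\<Sum>k\<in>{0<..n}. a k\<bar> \<le> B"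
  shows "\<bar>\<Sum>n\<le>X. w n * a n\<bar> \<le> 2 * w X * (\<bar>a 0\<bar> + B)"
proof -
  have "{..X} = insert 0 {0<..X}" by auto
  hence "(\<Sum>n\<le>X. w n * a n) = w 0 * a 0 + (\<Sum>n\<in>{0<..X}. w n * a n)" by simp
  moreover have "\<bar>w 0 * a 0\<bar> \<le> w X * \<bar>a 0\<bar>" unfolding abs_mult using lift_Suc_mono_le[of w 0 X] w by (intro mult_mono) auto
  moreover have "0 \<le> w X * \<bar>a 0\<bar>" using lift_Suc_mono_le[of w 0 X] w by (intro mult_nonneg_nonneg) auto
  ultimately show ?thesis using weighted_sum_le_partial_sums[of w X a B] w B by (simp add: distrib_left)
qed

lemma sum_chi:
  fixes g :: "nat \<Rightarrow> real"
  shows "(\<Sum>d=1..X. chi (int d) * g d) = (\<Sum>j | 4 * j + 1 \<le> X. g (4 * j + 1)) - (\<Sum>j | 4 * j + 3 \<le> X. g (4 * j + 3))"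
proof -
  have part: "(\<Sum>d\<in>{d\<in>{1..X}. d mod 4 = r}. g d) = (\<Sum>j | 4 * j + r \<le> X. g (4 * j + r))" if "r \<in> {1, 3}" for r
  proof (rule sum.reindex_bij_witness[of _ "\<lambda>j. 4 * j + r" "\<lambda>d. d div 4"])
    fix d assume d: "d \<in> {d\<in>{1..X}. d mod 4 = r}"
    hence "4 * (d div 4) + r = d" by (metis (mono_tags, lifting) mem_Collect_eq mult_div_mod_eq)
    thus "4 * (d div 4) + r = d" "d div 4 \<in> {j. 4 * j + r \<le> X}" "g (4 * (d div 4) + r) = g d" using d by auto
  qed (use that in auto)
  have "chi (int d) = (if d mod 4 = 1 then 1 else 0) - (if d mod 4 = 3 then 1 else 0)" for d
    unfolding chi_def by presburger
  hence "(\<Sum>d=1..X. chi (int d) * g d) = (\<Sum>d=1..X. (if d mod 4 = 1 then g d else 0) - (if d mod 4 = 3 then g d else 0))"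
    by (intro sum.cong) auto
  also have "\<dots> = (\<Sum>d\<in>{d\<in>{1..X}. d mod 4 = 1}. g d) - (\<Sum>d\<in>{d\<in>{1..X}. d mod 4 = 3}. g d)"
    by (simp only: sum_subtractf sum.inter_filter finite_atLeastAtMost)
  finally show ?thesis by (simp only: part insert_iff simp_thms)
qed

lemma progression_eq_atMost:
  fixes X r :: nat
  assumes "r \<le> X"
  shows "{j. 4 * j + r \<le> X} = {..(X - r) div 4}"
  using assms by (auto simp: less_eq_div_iff_mult_less_eq)

text \<open>The partial sums of \<open>arc_psi_sum\<close> start after the first point, so the first
  term of the progression is bounded separately by 1.\<close>

lemma abs_sum_progression_le:
  fixes a :: "nat \<Rightarrow> real" and X r :: nat
  assumes B: "\<And>n. 4 * n + r \<le> X \<Longrightarrow> \<bar>\<Sum>k\<in>{0<..n}. a (4 * k + r)\<bar> \<le> B" and "0 \<le> B" "\<bar>a r\<bar> \<le> 1"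
  shows "\<bar>\<Sum>j | 4 * j + r \<le> X. (real (4 * j + r))^2 * a (4 * j + r)\<bar> \<le> 2 * (real X)^2 * (1 + B)"
proof (cases "r \<le> X")
  case True
  define J where "J = (X - r) div 4"
  have J: "4 * J + r \<le> X" using True unfolding J_def by linarith
  have "\<bar>\<Sum>j\<le>J. (real (4 * j + r))^2 * a (4 * j + r)\<bar> \<le> 2 * (real (4 * J + r))^2 * (\<bar>a (4 * 0 + r)\<bar> + B)"
    by (rule weighted_sum_le_partial_sums_0) (use J in \<open>auto intro!: B power_mono\<close>)
  also have "\<dots> \<le> 2 * (real X)^2 * (1 + B)" using J assms
    by (intro mult_mono power_mono) auto
  finally show ?thesis using True by (simp add: progression_eq_atMost J_def)
next
  case False
  hence "{j. 4 * j + r \<le> X} = {}" by auto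
  thus ?thesis using assms by (simp only: sum.empty) simp
qed

text \<open>For fixed \<open>e\<close> the points \<open>m = d * e\<close> form a progression, and
  partial summation removes the weight \<open>d^2\<close> at the cost of \<open>(N / e)^2\<close>.
  With the loss \<open>e powr (1/20)\<close> of \<open>arc_psi_sum\<close> the exponent of
  \<open>e\<close> is \<open>- 39/20\<close>, so the sum over \<open>e\<close> converges. The shift
  \<open>s\<close> is kept for the squares still to be added.\<close>

theorem six_squares_psi_sum:
  "\<exists>C>0. \<forall>T s N. 1 \<le> T \<longrightarrow> 0 \<le> s \<longrightarrow> real N + s \<le> T \<longrightarrow>
     \<bar>\<Sum>m=1..N. six_coeff m * psi (sqrt (T^2 - (real m + s)^2))\<bar> \<le> C * T powr (2 + \<theta>)"
proof -
  obtain C where C: "0 < C" and arc: "\<And>T e s X. 1 \<le> T \<Longrightarrow> 1 \<le> e \<Longrightarrow> 0 \<le> s \<Longrightarrow> e * real X + s \<le> T \<Longrightarrow>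
     \<bar>\<Sum>n\<in>{0<..X}. psi (sqrt (T^2 - (e * real n + s)^2))\<bar> \<le> C * T powr \<theta> * e powr (1/20)"
    using arc_psi_sum by auto
  have sm: "summable (\<lambda>e. real e powr (- (39/20)))" by (simp add: summable_real_powr_iff)
  define Z where "Z = (\<Sum>e. real e powr (- (39/20)))"
  have Z0: "0 \<le> Z" unfolding Z_def by (intro suminf_nonneg sm) auto
  have "\<bar>\<Sum>m=1..N. six_coeff m * psi (sqrt (T^2 - (real m + s)^2))\<bar> \<le> (64 + 96 * C) * (1 + Z) * T powr (2 + \<theta>)"
    if T: "1 \<le> T" and s: "0 \<le> s" and N: "real N + s \<le> T" for T s and N :: nat
  proof -
    define g where "g m = psi (sqrt (T^2 - (real m + s)^2))" for m :: nat
    define W where "W = (\<Sum>e=1..N. (real N / real e)^2 * real e powr (1/20))"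
    have W: "W \<le> T powr 2 * Z"
    proof -
      have "W \<le> (\<Sum>e=1..N. T powr 2 * real e powr (- (39/20)))" unfolding W_def
      proof (rule sum_mono)
        fix e assume e: "e \<in> {1..N}"
        have "(real N / real e)^2 * real e powr (1/20) = (real N)^2 * (real e powr (1/20) / real e powr 2)"
          using e by (simp add: power_divide)
        also have "real e powr (1/20) / real e powr 2 = real e powr (- (39/20))" using e by (simp flip: powr_diff powr_numeral)
        also have "(real N)^2 * real e powr (- (39/20)) \<le> T powr 2 * real e powr (- (39/20))"
          using N s T by (intro mult_right_mono) (auto intro: power_mono)
        finally show "(real N / real e)^2 * real e powr (1/20) \<le> T powr 2 * real e powr (- (39/20))" .
      qed
      also have "\<dots> = T powr 2 * (\<Sum>e=1..N. real e powr (- (39/20)))" by (simp add: sum_distrib_left)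
      also have "\<dots> \<le> T powr 2 * Z" unfolding Z_def by (intro mult_left_mono sum_le_suminf sm) auto
      finally show ?thesis .
    qed
    define P where "P e = T powr \<theta> * real e powr (1/20)" for e :: nat
    have de: "real (N div e) \<le> real N / real e" for e by (rule of_nat_div_le_of_nat)
    have le: "real e * real n + s \<le> T" if "n \<le> N div e" "1 \<le> e" for n e :: nat
    proof -
      have "n * e \<le> N" using that by (simp add: less_eq_div_iff_mult_less_eq)
      hence "real n * real e \<le> real N" by (metis of_nat_le_iff of_nat_mult)
      thus ?thesis using N by (simp add: mult.commute)
    qed
    have P1: "1 \<le> P e" if "1 \<le> e" for e
      using mult_mono[of 1 "T powr \<theta>" 1 "real e powr (1/20)"] T that
      by (simp add: P_def ge_one_powr_ge_zero \<theta>_def)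
    have ivl1: "{1..n} = {0<..n}" for n :: nat by auto
    have in1: "\<bar>\<Sum>d=1..N div e. (real d)^2 * g (d * e)\<bar> \<le> 2 * C * T powr \<theta> * ((real N / real e)^2 * real e powr (1/20))" if e: "1 \<le> e" for e
    proof -
      have "\<bar>\<Sum>d\<in>{0<..N div e}. (real d)^2 * g (d * e)\<bar> \<le> 2 * (real (N div e))^2 * (C * P e)"
      proof (rule weighted_sum_le_partial_sums)
        fix n assume n: "n \<le> N div e"
        show "\<bar>\<Sum>k\<in>{0<..n}. g (k * e)\<bar> \<le> C * P e"
          using arc[OF T, of "real e" s n] le[OF n e] e s by (simp add: g_def P_def mult_ac)
      qed (auto intro: power_mono)
      also have "\<dots> \<le> 2 * (real N / real e)^2 * (C * P e)"
        using de[of e] C by (intro mult_mono power_mono) (auto simp: P_def)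
      finally show ?thesis unfolding ivl1 by (simp add: P_def mult_ac)
    qed
    have in2: "\<bar>\<Sum>d=1..N div e. chi (int d) * ((real d)^2 * g (d * e))\<bar> \<le> (4 + 16 * C) * T powr \<theta> * ((real N / real e)^2 * real e powr (1/20))" if e: "1 \<le> e" for e
    proof -
      have r: "\<bar>\<Sum>j | 4 * j + r \<le> N div e. (real (4 * j + r))^2 * g ((4 * j + r) * e)\<bar> \<le> 2 * (real (N div e))^2 * (1 + 4 * C * P e)" for r
      proof (rule abs_sum_progression_le[where a = "\<lambda>d. g (d * e)"])
        fix n assume n: "4 * n + r \<le> N div e"
        \<comment> \<open>The residue class \<open>r\<close> modulo 4, coming from
          \<open>chi d\<close>, makes the step \<open>4 * e\<close> and the shift
          \<open>r * e + s\<close>.\<close>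
        have "\<bar>\<Sum>k\<in>{0<..n}. psi (sqrt (T^2 - ((4 * real e) * real k + (real r * real e + s))^2))\<bar> \<le> C * T powr \<theta> * (4 * real e) powr (1/20)"
          by (rule arc) (use T s e le[OF n e] in \<open>auto simp: algebra_simps\<close>)
        also have "(\<Sum>k\<in>{0<..n}. psi (sqrt (T^2 - ((4 * real e) * real k + (real r * real e + s))^2))) = (\<Sum>k\<in>{0<..n}. g ((4 * k + r) * e))"
          by (simp add: g_def algebra_simps)
        also have "C * T powr \<theta> * (4 * real e) powr (1/20) \<le> C * T powr \<theta> * (4 * real e powr (1/20))"
        proof (rule mult_left_mono)
          have "(4::real) powr (1/20) \<le> 4 powr 1" by (intro powr_mono) auto
          thus "(4 * real e) powr (1/20) \<le> 4 * real e powr (1/20)" by (simp add: powr_mult mult_right_mono)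
        qed (use C in simp)
        finally show "\<bar>\<Sum>k\<in>{0<..n}. g ((4 * k + r) * e)\<bar> \<le> 4 * C * P e" by (simp add: P_def mult_ac)
      next
        show "\<bar>g (r * e)\<bar> \<le> 1" unfolding g_def by (rule order.trans[OF abs_psi_le]) simp
      qed (use C in \<open>auto simp: P_def\<close>)
      have "\<bar>\<Sum>d=1..N div e. chi (int d) * ((real d)^2 * g (d * e))\<bar> \<le> 4 * ((real (N div e))^2 * (1 + 4 * C * P e))"
        unfolding sum_chi using r[of 1] r[of 3] by linarith
      also have "\<dots> \<le> 4 * ((real N / real e)^2 * (P e + 4 * C * P e))"
        using de[of e] C P1[OF e] by (intro mult_left_mono mult_mono power_mono add_mono) auto
      finally show ?thesis by (simp add: P_def algebra_simps)
    qed
    have s1: "\<bar>\<Sum>e=1..N. chi (int e) * (\<Sum>d=1..N div e. (real d)^2 * g (d * e))\<bar> \<le> 2 * C * T powr \<theta> * W"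
    proof -
      have "\<bar>\<Sum>e=1..N. chi (int e) * (\<Sum>d=1..N div e. (real d)^2 * g (d * e))\<bar>
        \<le> (\<Sum>e=1..N. 2 * C * T powr \<theta> * ((real N / real e)^2 * real e powr (1/20)))"
      proof (rule order.trans[OF sum_abs sum_mono])
        fix e assume "e \<in> {1..N}"
        hence e: "1 \<le> e" by simp
        have c: "\<bar>real_of_int (chi (int e))\<bar> \<le> 1" using abs_chi_le[of "int e"] by linarith
        have "\<bar>chi (int e) * (\<Sum>d=1..N div e. (real d)^2 * g (d * e))\<bar> \<le> 1 * (2 * C * T powr \<theta> * ((real N / real e)^2 * real e powr (1/20)))"
          unfolding abs_mult by (rule mult_mono[OF c in1[OF e]]) auto
        thus "\<bar>chi (int e) * (\<Sum>d=1..N div e. (real d)^2 * g (d * e))\<bar> \<le> 2 * C * T powr \<theta> * ((real N / real e)^2 * real e powr (1/20))" by simp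
      qed
      thus ?thesis by (simp only: W_def sum_distrib_left)
    qed
    have s2: "\<bar>\<Sum>e=1..N. \<Sum>d=1..N div e. chi (int d) * ((real d)^2 * g (d * e))\<bar> \<le> (4 + 16 * C) * T powr \<theta> * W"
      unfolding W_def sum_distrib_left by (rule order.trans[OF sum_abs sum_mono]) (use in2 in auto)
    have "\<bar>\<Sum>m=1..N. six_coeff m * g m\<bar> \<le> 16 * (2 * C * T powr \<theta> * W) + 4 * ((4 + 16 * C) * T powr \<theta> * W)"
      unfolding six_coeff_sum using s1 s2 by linarith
    also have "\<dots> = (16 + 96 * C) * T powr \<theta> * W" by (simp add: algebra_simps)
    also have "\<dots> \<le> (64 + 96 * C) * T powr \<theta> * (T powr 2 * (1 + Z))"
    proof (rule mult_mono)
      show "W \<le> T powr 2 * (1 + Z)" by (rule order.trans[OF W]) (intro mult_left_mono, auto)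
      show "0 \<le> W" unfolding W_def by (intro sum_nonneg) auto
    qed (use C in \<open>auto intro!: mult_right_mono\<close>)
    also have "\<dots> = (64 + 96 * C) * (1 + Z) * T powr (2 + \<theta>)" by (simp add: powr_add)
    finally show ?thesis by (simp add: g_def)
  qed
  note main = this
  show ?thesis using C Z0 by (intro exI[of _ "(64 + 96 * C) * (1 + Z)"] conjI allI impI main) auto
qed

lemma fps_nth_theta_power_nonneg: "0 \<le> sq_reps n m"
proof (induction n arbitrary: m)
  case (Suc n)
  thus ?case by (auto simp: fps_nth_theta_mult intro: sum_nonneg)
qed simp

lemma sum_fps_mult:
  fixes A B :: "real fps"
  shows "(\<Sum>m\<le>N. fps_nth (A * B) m * g m) = (\<Sum>i\<le>N. fps_nth A i * (\<Sum>m\<le>N-i. fps_nth B m * g (m + i)))"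
proof -
  have "(\<Sum>m\<le>N. fps_nth (A * B) m * g m) = (\<Sum>m\<le>N. \<Sum>i\<le>m. fps_nth A i * (fps_nth B (m - i) * g ((m - i) + i)))"
    by (simp add: fps_mult_nth sum_distrib_right mult.assoc atLeast0AtMost)
  also have "\<dots> = (\<Sum>i\<le>N. \<Sum>m\<le>N-i. fps_nth A i * (fps_nth B m * g (m + i)))"
    unfolding sum.triangle_reindex_eq[of "\<lambda>i m. fps_nth A i * (fps_nth B m * g (m + i))", symmetric] sum.Sigma[OF finite_atMost ballI[OF finite_atMost]]
    by (rule sum.reindex_bij_witness[of _ id id]) auto
  finally show ?thesis by (simp add: sum_distrib_left)
qed

lemma card_sq_ints_le:
  assumes "1 \<le> T" "real N \<le> T"
  shows "real (card (sq_ints N)) \<le> 3 * sqrt T"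
proof -
  have "sq_ints N \<subseteq> {- \<lfloor>sqrt T\<rfloor>..\<lfloor>sqrt T\<rfloor>}"
  proof
    fix i assume "i \<in> sq_ints N"
    hence "real_of_int (i^2) \<le> T" using assms(2) unfolding sq_ints_def by (metis (mono_tags, lifting) mem_Collect_eq of_int_le_iff of_int_of_nat_eq order.trans)
    hence "\<bar>real_of_int i\<bar> \<le> sqrt T" by (metis of_int_power real_sqrt_abs real_sqrt_le_iff)
    thus "i \<in> {- \<lfloor>sqrt T\<rfloor>..\<lfloor>sqrt T\<rfloor>}" by (auto simp: le_floor_iff) linarith
  qed
  hence "card (sq_ints N) \<le> card {- \<lfloor>sqrt T\<rfloor>..\<lfloor>sqrt T\<rfloor>}" by (rule card_mono[rotated]) simp
  also have "\<dots> = nat (2 * \<lfloor>sqrt T\<rfloor> + 1)" by simp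
  finally have "real (card (sq_ints N)) \<le> real (nat (2 * \<lfloor>sqrt T\<rfloor> + 1))" by simp
  also have "\<dots> \<le> 2 * sqrt T + 1" using assms(1) of_int_floor_le[of "sqrt T"] by (simp add: of_nat_nat)
  finally show ?thesis using assms(1) real_sqrt_ge_one[of T] by linarith
qed

lemma sum_theta_power_le:
  assumes T: "1 \<le> T" and N: "real N \<le> T"
  shows "(\<Sum>m\<le>N. sq_reps n m) \<le> (3 * sqrt T) ^ n"
  using N
proof (induction n arbitrary: N)
  case 0
  have "(\<Sum>m\<le>N. fps_nth (1 :: real fps) m) = (\<Sum>m\<in>{0}. fps_nth 1 m)" by (rule sum.mono_neutral_right) auto
  thus ?case by simp
next
  case (Suc n)
  have "(\<Sum>m\<le>N. fps_nth (theta ^ Suc n) m) = (\<Sum>i\<le>N. fps_nth theta i * (\<Sum>m\<le>N-i. sq_reps n m))"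
    using sum_fps_mult[of theta "theta ^ n" "\<lambda>_. 1" N] by simp
  also have "\<dots> \<le> (\<Sum>i\<le>N. fps_nth theta i * (3 * sqrt T) ^ n)"
    using Suc by (intro sum_mono mult_left_mono Suc.IH) (auto simp: theta_def)
  also have "\<dots> = real (card (sq_ints N)) * (3 * sqrt T) ^ n"
    using theta_sum[where n = N and g = "\<lambda>_. (3 * sqrt T) ^ n"] by (simp add: atLeast0AtMost)
  also have "\<dots> \<le> 3 * sqrt T * (3 * sqrt T) ^ n"
    using card_sq_ints_le[OF T Suc.prems] T by (intro mult_right_mono) auto
  finally show ?case by simp
qed

lemma even_power_sqrt:
  assumes q: "3 \<le> q" and T: "1 \<le> T"
  shows "(3 * sqrt T) ^ (2 * (q - 3)) = 9 ^ (q - 3) * T powr (real q - 3)"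
proof -
  have "T powr (real q - 3) = T powr real (q - 3)" using q by simp
  also have "\<dots> = T ^ (q - 3)" using T by (simp add: powr_realpow)
  finally show ?thesis using T by (simp add: power_mult power_mult_distrib)
qed

text \<open>Of the other \<open>2 * q - 6\<close> squares only the total number of representations
  up to \<open>T\<close> enters, at most a constant times \<open>T powr (real q - 3)\<close>; their
  value \<open>i\<close> is the shift in the estimate for six squares.\<close>

theorem even_squares_psi_sum:
  assumes q: "3 \<le> q"
  shows "\<exists>C>0. \<forall>T N. 1 \<le> T \<longrightarrow> real N \<le> T \<longrightarrow>
     \<bar>\<Sum>m\<le>N. sq_reps (2 * q) m * psi (sqrt (T^2 - (real m)^2))\<bar> \<le> C * T powr (real q - 1 + \<theta>)"
proof -
  obtain C where C: "0 < C" and six: "\<And>T s N. 1 \<le> T \<Longrightarrow> 0 \<le> s \<Longrightarrow> real N + s \<le> T \<Longrightarrow>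
     \<bar>\<Sum>m=1..N. six_coeff m * psi (sqrt (T^2 - (real m + s)^2))\<bar> \<le> C * T powr (2 + \<theta>)"
    using six_squares_psi_sum by auto
  have "\<bar>\<Sum>m\<le>N. sq_reps (2 * q) m * psi (sqrt (T^2 - (real m)^2))\<bar> \<le> 9 ^ (q - 3) * (1 + C) * T powr (real q - 1 + \<theta>)"
    if T: "1 \<le> T" and N: "real N \<le> T" for T N
  proof -
    define g where "g m = psi (sqrt (T^2 - (real m)^2))" for m :: nat
    have inner: "\<bar>\<Sum>m\<le>N-i. sq_reps 6 m * g (m + i)\<bar> \<le> (1 + C) * T powr (2 + \<theta>)" if i: "i \<le> N" for i
    proof -
      \<comment> \<open>The divisor formula starts at \<open>m = 1\<close>; the term
        \<open>m = 0\<close> is at most \<open>1 / 2\<close>.\<close>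
      have "{..N-i} = insert 0 {1..N-i}" by auto
      hence "(\<Sum>m\<le>N-i. sq_reps 6 m * g (m + i)) = g i + (\<Sum>m=1..N-i. six_coeff m * psi (sqrt (T^2 - (real m + real i)^2)))"
        by (simp add: six_squares g_def)
      moreover have "\<bar>\<Sum>m=1..N-i. six_coeff m * psi (sqrt (T^2 - (real m + real i)^2))\<bar> \<le> C * T powr (2 + \<theta>)"
        using T N i by (intro six) auto
      moreover have "\<bar>g i\<bar> \<le> 1 / 2" unfolding g_def by (rule abs_psi_le)
      moreover have "1 \<le> T powr (2 + \<theta>)" using T by (intro ge_one_powr_ge_zero) (auto simp: \<theta>_def)
      ultimately show ?thesis by (simp add: distrib_right)
    qed
    have "2 * q = 2 * (q - 3) + 6" using q by simp
    hence "theta ^ (2 * q) = theta ^ (2 * (q - 3)) * theta ^ 6" by (metis power_add)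
    hence "(\<Sum>m\<le>N. sq_reps (2 * q) m * g m) = (\<Sum>i\<le>N. sq_reps (2 * (q - 3)) i * (\<Sum>m\<le>N-i. sq_reps 6 m * g (m + i)))"
      by (simp only: sum_fps_mult)
    also have "\<bar>\<dots>\<bar> \<le> (\<Sum>i\<le>N. sq_reps (2 * (q - 3)) i * ((1 + C) * T powr (2 + \<theta>)))"
    proof (rule order.trans[OF sum_abs sum_mono])
      fix i assume "i \<in> {..N}"
      thus "\<bar>sq_reps (2 * (q - 3)) i * (\<Sum>m\<le>N-i. sq_reps 6 m * g (m + i))\<bar>
         \<le> sq_reps (2 * (q - 3)) i * ((1 + C) * T powr (2 + \<theta>))"
        unfolding abs_mult abs_of_nonneg[OF fps_nth_theta_power_nonneg] by (intro mult_left_mono inner fps_nth_theta_power_nonneg) auto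
    qed
    also have "\<dots> \<le> (3 * sqrt T) ^ (2 * (q - 3)) * ((1 + C) * T powr (2 + \<theta>))"
      unfolding sum_distrib_right[symmetric] using C by (intro mult_right_mono sum_theta_power_le T N) auto
    also have "(3 * sqrt T) ^ (2 * (q - 3)) = 9 ^ (q - 3) * T powr (real q - 3)" using q T by (rule even_power_sqrt)
    also have "9 ^ (q - 3) * T powr (real q - 3) * ((1 + C) * T powr (2 + \<theta>)) = 9 ^ (q - 3) * (1 + C) * (T powr (real q - 3) * T powr (2 + \<theta>))"
      by simp
    also have "T powr (real q - 3) * T powr (2 + \<theta>) = T powr (real q - 1 + \<theta>)" by (simp add: algebra_simps flip: powr_add)
    finally show ?thesis by (simp add: g_def)
  qed
  note main = this
  show ?thesis using C by (intro exI[of _ "9 ^ (q - 3) * (1 + C)"] conjI allI impI main) auto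
qed

section \<open>Riesz means\<close>

text \<open>With \<open>Y = D + f\<close> the closed form of the sum agrees with
  \<open>Y ^ 4 / 12\<close> down to the cubic term, leaving an error of order \<open>Y^2\<close>. A
  sharp cutoff has the same error against a main term of only order \<open>Y^3\<close>.\<close>

lemma sum_squares_times_linear:
  fixes Y :: real
  assumes D: "real D \<le> Y" "Y \<le> real D + 1" and Y: "1 \<le> Y"
  shows "\<bar>(\<Sum>d=1..D. (real d)^2 * (Y - real d)) - Y ^ 4 / 12\<bar> \<le> 2 * Y^2"
proof -
  define f where "f = Y - real D"
  have f: "0 \<le> f" "f \<le> 1" using D by (auto simp: f_def)
  have closed: "(\<Sum>d=1..D. (real d)^2 * (Z - real d)) = Z * (2 * real D ^ 3 + 3 * (real D)^2 + real D) / 6 - (real D ^ 4 + 2 * real D ^ 3 + (real D)^2) / 4" for Z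
    by (induction D) (simp_all add: field_simps power2_eq_square power3_eq_cube power4_eq_xxxx)
  have Y_eq: "Y = real D + f" by (simp add: f_def)
  have "(\<Sum>d=1..D. (real d)^2 * (Y - real d)) - Y ^ 4 / 12
      = (f / 2 - f\<^sup>2 / 2 - 1 / 12) * (real D)^2 + (f / 6 - f ^ 3 / 3) * real D - f ^ 4 / 12"
    unfolding closed unfolding Y_eq by (simp add: field_simps power2_eq_square power3_eq_cube power4_eq_xxxx)
  also have "\<bar>\<dots>\<bar> \<le> 1 * Y^2 + 1 / 2 * Y^2 + 1 / 2 * Y^2"
  proof (intro order.trans[OF abs_triangle_ineq4 add_mono] order.trans[OF abs_triangle_ineq add_mono])
    have pw: "0 \<le> f^2" "f^2 \<le> 1" "0 \<le> f ^ 3" "f ^ 3 \<le> 1" "0 \<le> f ^ 4" "f ^ 4 \<le> 1"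
      using f by (auto intro: power_le_one)
    have "real D \<le> Y^2" using D Y by (simp add: power2_eq_square mult_le_cancel_right1 order.trans[of _ Y])
    have Y2: "1 \<le> Y^2" using Y by (simp add: one_le_power)
    have cf: "\<bar>f / 2 - f\<^sup>2 / 2 - 1 / 12\<bar> \<le> 1" "\<bar>f / 6 - f ^ 3 / 3\<bar> \<le> 1 / 2" using f pw by linarith+
    show "\<bar>(f / 2 - f\<^sup>2 / 2 - 1 / 12) * (real D)^2\<bar> \<le> 1 * Y^2"
      unfolding abs_mult using D by (intro mult_mono cf) (auto intro: power_mono)
    show "\<bar>(f / 6 - f ^ 3 / 3) * real D\<bar> \<le> 1 / 2 * Y^2"
      unfolding abs_mult using \<open>real D \<le> Y^2\<close> by (intro mult_mono cf) auto
    show "\<bar>f ^ 4 / 12\<bar> \<le> 1 / 2 * Y^2" using pw Y2 by simp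
  qed
  finally show ?thesis by simp
qed

text \<open>Complete blocks of four have a closed sum whose leading part contains the factor
  \<open>Y - 4 * j\<close>, at most 4 after the last block. At most three terms remain, and their
  weight \<open>Y - d\<close> is also at most 4.\<close>

lemma sum_chi_squares_times_linear:
  fixes Y :: real
  assumes D: "real D \<le> Y" "Y \<le> real D + 1" and Y: "1 \<le> Y"
  shows "\<bar>\<Sum>d=1..D. chi (int d) * ((real d)^2 * (Y - real d))\<bar> \<le> 20 * Y^2"
proof -
  define j where "j = D div 4"
  have j: "4 * j \<le> D" "D < 4 * j + 4" unfolding j_def by linarith+
  define t where "t d = chi (int d) * ((real d)^2 * (Y - real d))" for d :: nat
  have c: "chi (int (Suc (4 * i))) = 1" "chi (int (Suc (Suc (4 * i)))) = 0" "chi (int (Suc (Suc (Suc (4 * i))))) = -1"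
      "chi (int (Suc (Suc (Suc (Suc (4 * i)))))) = 0" for i :: nat
    unfolding chi_def by presburger+
  have full: "(\<Sum>d=1..4*j. t d) = - 8 * (real j)^2 * (Y - 4 * real j) - 6 * real j" for j
  proof (induction j)
    case (Suc j)
    have "(\<Sum>d=1..Suc (Suc (Suc (Suc k))). t d) = (\<Sum>d=1..k. t d) + (t (Suc k) + t (Suc (Suc k)) + t (Suc (Suc (Suc k))) + t (Suc (Suc (Suc (Suc k)))))" for k
      by (simp add: add.assoc)
    note this[of "4 * j"]
    moreover have "4 * Suc j = Suc (Suc (Suc (Suc (4 * j))))" by simp
    ultimately have "(\<Sum>d=1..4*Suc j. t d) = (\<Sum>d=1..4*j. t d) + (t (Suc (4 * j)) + t (Suc (Suc (4 * j))) + t (Suc (Suc (Suc (4 * j)))) + t (Suc (Suc (Suc (Suc (4 * j))))))"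
      by (simp only:)
    also have "\<dots> = - 8 * (real j)^2 * (Y - 4 * real j) - 6 * real j
       + ((4 * real j + 1)^2 * (Y - 4 * real j - 1) - (4 * real j + 3)^2 * (Y - 4 * real j - 3))"
    proof -
      have "t (Suc (4 * j)) = (4 * real j + 1)^2 * (Y - 4 * real j - 1)" "t (Suc (Suc (4 * j))) = 0"
        "t (Suc (Suc (Suc (4 * j)))) = - ((4 * real j + 3)^2 * (Y - 4 * real j - 3))" "t (Suc (Suc (Suc (Suc (4 * j))))) = 0"
        unfolding t_def c by (simp_all add: algebra_simps)
      thus ?thesis unfolding Suc by simp
    qed
    also have "\<dots> = - 8 * (real (Suc j))^2 * (Y - 4 * real (Suc j)) - 6 * real (Suc j)"
      by (simp add: algebra_simps power2_eq_square)
    finally show ?case .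
  qed simp
  have rest: "\<bar>\<Sum>d\<in>{4*j<..D}. t d\<bar> \<le> 12 * Y^2"
  proof -
    have "\<bar>\<Sum>d\<in>{4*j<..D}. t d\<bar> \<le> (\<Sum>d\<in>{4*j<..D}. 4 * Y^2)"
    proof (rule order.trans[OF sum_abs sum_mono])
      fix d assume d: "d \<in> {4*j<..D}"
      have c: "\<bar>real_of_int (chi (int d))\<bar> \<le> 1" using abs_chi_le[of "int d"] by linarith
      have dY: "real d \<le> Y" "Y - real d \<le> 4" using d D j by auto
      have "\<bar>t d\<bar> \<le> 1 * (Y^2 * 4)" unfolding t_def abs_mult
        using dY by (intro mult_mono c power_mono) (auto intro: power_mono)
      thus "\<bar>t d\<bar> \<le> 4 * Y^2" by simp
    qed
    also have "\<dots> = real (D - 4 * j) * (4 * Y^2)" by simp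
    also have "\<dots> \<le> 3 * (4 * Y^2)" using j by (intro mult_right_mono) auto
    finally show ?thesis by simp
  qed
  have "{1..D} = {1..4*j} \<union> {4*j<..D}" using j by auto
  hence split: "(\<Sum>d=1..D. t d) = (\<Sum>d=1..4*j. t d) + (\<Sum>d\<in>{4*j<..D}. t d)"
    by (simp add: sum.union_disjoint ivl_disj_int)
  have jY: "4 * real j \<le> Y" using j D by linarith
  have "\<bar>- 8 * (real j)^2 * (Y - 4 * real j) - 6 * real j\<bar> \<le> 8 * Y^2"
  proof -
    have "0 \<le> 8 * (real j)^2 * (Y - 4 * real j)" using jY by simp
    hence "\<bar>- 8 * (real j)^2 * (Y - 4 * real j) - 6 * real j\<bar> = 8 * (real j)^2 * (Y - 4 * real j) + 6 * real j"
      by simp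
    also have "\<dots> \<le> 8 * (Y / 4)^2 * 4 + 6 * Y"
      using jY j D by (intro add_mono mult_mono power_mono) auto
    also have "\<dots> = 2 * Y^2 + 6 * Y" by (simp add: power_divide)
    also have "\<dots> \<le> 8 * Y^2" using Y by (simp add: power2_eq_square)
    finally show ?thesis .
  qed
  thus ?thesis unfolding t_def[symmetric] split full using rest by linarith
qed

text \<open>Riesz mean of order one: the integral over \<open>[0, y]\<close> of the number of
  integer points in a ball, as a function of its squared radius.\<close>

definition riesz :: "nat \<Rightarrow> real \<Rightarrow> real" where
  "riesz n y = (\<Sum>m\<le>nat \<lfloor>y\<rfloor>. sq_reps n m * (y - real m))"

text \<open>For each \<open>e\<close> the inner sums have length \<open>y / e\<close>. The part with
  \<open>chi e\<close> gives the main term with the constant \<open>sum of chi(e) / e^3\<close>; the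
  part with \<open>chi d\<close> is only error. All errors are at most \<open>y^2\<close> times the
  harmonic sum, and \<open>T powr (1/10)\<close> absorbs the logarithm.\<close>

lemma riesz_six:
  "\<exists>V C. 0 \<le> C \<and> (\<forall>T y. 1 \<le> T \<longrightarrow> 0 \<le> y \<longrightarrow> y \<le> T \<longrightarrow> \<bar>riesz 6 y - V * y ^ 4\<bar> \<le> C * T powr (21 / 10))"
proof -
  define l where "l e = real_of_int (chi (int e)) / real e ^ 3" for e :: nat
  have sm3: "summable (\<lambda>e. 1 / real e ^ 3)" using inverse_power_summable[of 3] by (simp add: inverse_eq_divide)
  have cb: "\<bar>real_of_int (chi n)\<bar> \<le> 1" for n using abs_chi_le[of n] by linarith
  have l_le: "\<bar>l e\<bar> \<le> 1 / real e ^ 3" for e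
    unfolding l_def abs_divide using cb by (simp add: divide_right_mono)
  have sml: "summable l" by (rule summable_comparison_test'[OF sm3, of 0]) (simp add: l_le)
  define V where "V = 16 / 12 * suminf l"
  have tail: "\<bar>suminf l - (\<Sum>e=1..N. l e)\<bar> \<le> 1 / (real N)^2" if N: "1 \<le> N" for N
  proof -
    have l0: "l 0 = 0" by (simp add: l_def)
    have eq: "(\<Sum>e=1..N. l e) = sum l {..<Suc N}"
      by (rule sum.mono_neutral_left) (auto simp: l0 not_less_eq_eq)
    have fin: "\<bar>sum l {..<Suc M} - sum l {..<Suc N}\<bar> \<le> 1 / (real N)^2" if "N \<le> M" for M
    proof -
      have "\<bar>sum l {..<Suc M} - sum l {..<Suc N}\<bar> \<le> 1 / (real N)^2 - 1 / (real M)^2"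
        using that
      proof (induction M rule: dec_induct)
        case (step M)
        have M: "1 \<le> real M" using step N by simp
        have "1 / real (Suc M) ^ 3 \<le> 1 / (real M)^2 - 1 / (real (Suc M))^2"
        proof -
          define x where "x = real M"
          have x: "1 \<le> x" using M by (simp add: x_def)
          have "1 / (x + 1) \<le> (2 * x + 1) / x^2" using x by (simp add: field_simps power2_eq_square)
          hence "1 / (x + 1) / (x + 1)^2 \<le> (2 * x + 1) / x^2 / (x + 1)^2" by (rule divide_right_mono) simp
          also have "\<dots> = 1 / x^2 - 1 / (x + 1)^2"
          proof -
            have "1 / x^2 - 1 / (x + 1)^2 = ((x + 1)^2 - x\<^sup>2) / (x^2 * (x + 1)^2)" using x by (simp add: diff_frac_eq)
            also have "(x + 1)^2 - x\<^sup>2 = 2 * x + 1" by (simp add: power2_eq_square algebra_simps)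
            finally show ?thesis by simp
          qed
          also have "1 / (x + 1) / (x + 1)^2 = 1 / (x + 1) ^ 3" by (simp add: power2_eq_square power3_eq_cube)
          finally show ?thesis by (simp add: x_def add.commute)
        qed
        moreover have "sum l {..<Suc (Suc M)} = sum l {..<Suc M} + l (Suc M)" by simp
        ultimately show ?case using l_le[of "Suc M"] step.IH by linarith
      qed simp
      moreover have "0 \<le> 1 / (real M)^2" by simp
      ultimately show ?thesis by linarith
    qed
    have "(\<lambda>M. \<bar>sum l {..<Suc M} - sum l {..<Suc N}\<bar>) \<longlonglongrightarrow> \<bar>suminf l - sum l {..<Suc N}\<bar>"
      by (intro tendsto_intros) (use summable_LIMSEQ[OF sml] in \<open>rule LIMSEQ_Suc\<close>)
    thus ?thesis unfolding eq using fin by (intro LIMSEQ_le_const2) auto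
  qed
  have main: "\<bar>riesz 6 y - V * y ^ 4\<bar> \<le> (2000 + \<bar>V\<bar>) * T powr (21 / 10)" if T: "1 \<le> T" and y: "0 \<le> y" "y \<le> T" for T y
  proof (cases "y < 1")
    case True
    hence "riesz 6 y = y" using y by (simp add: riesz_def floor_less_one nat_eq_iff floor_eq_iff)
    moreover have "y ^ 4 \<le> 1" using True y by (intro power_le_one) auto
    hence "\<bar>V * y ^ 4\<bar> \<le> \<bar>V\<bar> * 1" unfolding abs_mult using y by (intro mult_left_mono) auto
    ultimately have "\<bar>riesz 6 y - V * y ^ 4\<bar> \<le> 2000 + \<bar>V\<bar>" using y True by linarith
    also have "\<dots> \<le> (2000 + \<bar>V\<bar>) * T powr (21 / 10)"
      using mult_left_mono[of 1 "T powr (21/10)" "2000 + \<bar>V\<bar>"] T by (simp add: ge_one_powr_ge_zero)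
    finally show ?thesis .
  next
    case False
    hence y1: "1 \<le> y" by simp
    define N where "N = nat \<lfloor>y\<rfloor>"
    have N: "1 \<le> N" "real N \<le> y" "y < real N + 1" unfolding N_def using y1 by linarith+
    have Ye: "real (N div e) \<le> y / e" "y / e \<le> real (N div e) + 1" "1 \<le> y / e" if e: "e \<in> {1..N}" for e
    proof -
      have "N div e * e \<le> N" by simp
      hence "real (N div e) * real e \<le> real N" by (metis of_nat_le_iff of_nat_mult)
      thus "real (N div e) \<le> y / e" using N e by (simp add: field_simps)
      have "N < (N div e + 1) * e" using e dividend_less_div_times[of e N] by (simp add: algebra_simps)
      hence "N + 1 \<le> (N div e + 1) * e" by simp
      hence "real N + 1 \<le> (real (N div e) + 1) * real e" by (metis of_nat_1 of_nat_add of_nat_le_iff of_nat_mult)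
      thus "y / e \<le> real (N div e) + 1" using N e by (simp add: field_simps)
      show "1 \<le> y / e" using N e by (simp add: field_simps)
    qed
    define H where "H = (\<Sum>e=1..N. 1 / real e)"
    define s1 where "s1 e = (\<Sum>d=1..N div e. (real d)^2 * (y - real (d * e)))" for e
    define s2 where "s2 e = (\<Sum>d=1..N div e. chi (int d) * ((real d)^2 * (y - real (d * e))))" for e
    have lin: "y - real (d * e) = real e * (y / real e - real d)" if "e \<in> {1..N}" for d e using that by (simp add: field_simps)
    have s1: "\<bar>s1 e - y ^ 4 / 12 * (1 / real e ^ 3)\<bar> \<le> 2 * y^2 * (1 / real e)" if e: "e \<in> {1..N}" for e
    proof -
      have "s1 e = real e * (\<Sum>d=1..N div e. (real d)^2 * (y / real e - real d))"
        unfolding s1_def lin[OF e] by (simp add: sum_distrib_left mult_ac)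
      moreover have "y ^ 4 / 12 * (1 / real e ^ 3) = real e * ((y / real e) ^ 4 / 12)"
        using e by (simp add: field_simps power3_eq_cube power4_eq_xxxx)
      ultimately have "\<bar>s1 e - y ^ 4 / 12 * (1 / real e ^ 3)\<bar> = real e * \<bar>(\<Sum>d=1..N div e. (real d)^2 * (y / real e - real d)) - (y / real e) ^ 4 / 12\<bar>"
        by (simp only: abs_mult abs_of_nat flip: right_diff_distrib)
      also have "\<dots> \<le> real e * (2 * (y / real e)^2)" by (intro mult_left_mono sum_squares_times_linear Ye e) simp
      also have "\<dots> = 2 * y^2 * (1 / real e)" using e by (simp add: field_simps power2_eq_square)
      finally show ?thesis .
    qed
    have s2: "\<bar>s2 e\<bar> \<le> 20 * y^2 * (1 / real e)" if e: "e \<in> {1..N}" for e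
    proof -
      have "s2 e = real e * (\<Sum>d=1..N div e. chi (int d) * ((real d)^2 * (y / real e - real d)))"
        unfolding s2_def lin[OF e] by (simp add: sum_distrib_left mult_ac)
      also have "\<bar>\<dots>\<bar> \<le> real e * (20 * (y / real e)^2)"
        unfolding abs_mult abs_of_nat by (intro mult_left_mono sum_chi_squares_times_linear Ye e) simp
      also have "\<dots> = 20 * y^2 * (1 / real e)" using e by (simp add: field_simps power2_eq_square)
      finally show ?thesis .
    qed
    have "{..N} = insert 0 {1..N}" by auto
    hence "riesz 6 y = y + (\<Sum>m=1..N. six_coeff m * (y - real m))" by (simp add: riesz_def N_def[symmetric] six_squares)
    hence r: "riesz 6 y = y + (16 * (\<Sum>e=1..N. chi (int e) * s1 e) - 4 * (\<Sum>e=1..N. s2 e))"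
      by (simp only: six_coeff_sum s1_def s2_def)
    have S1: "\<bar>(\<Sum>e=1..N. chi (int e) * s1 e) - y ^ 4 / 12 * (\<Sum>e=1..N. l e)\<bar> \<le> 2 * y^2 * H"
    proof -
      have "(\<Sum>e=1..N. chi (int e) * s1 e) - y ^ 4 / 12 * (\<Sum>e=1..N. l e) = (\<Sum>e=1..N. chi (int e) * (s1 e - y ^ 4 / 12 * (1 / real e ^ 3)))"
        by (simp add: l_def sum_distrib_left right_diff_distrib sum_subtractf mult_ac)
      also have "\<bar>\<dots>\<bar> \<le> (\<Sum>e=1..N. 2 * y^2 * (1 / real e))"
      proof (rule order.trans[OF sum_abs sum_mono])
        fix e assume e: "e \<in> {1..N}"
        have "\<bar>chi (int e) * (s1 e - y ^ 4 / 12 * (1 / real e ^ 3))\<bar> \<le> 1 * (2 * y^2 * (1 / real e))"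
          unfolding abs_mult[of "real_of_int (chi (int e))"] by (rule mult_mono[OF cb s1[OF e]]) auto
        thus "\<bar>chi (int e) * (s1 e - y ^ 4 / 12 * (1 / real e ^ 3))\<bar> \<le> 2 * y^2 * (1 / real e)" by simp
      qed
      finally show ?thesis by (simp only: H_def sum_distrib_left)
    qed
    have S2: "\<bar>\<Sum>e=1..N. s2 e\<bar> \<le> 20 * y^2 * H"
      unfolding H_def sum_distrib_left by (rule order.trans[OF sum_abs sum_mono]) (rule s2)
    have "\<bar>y ^ 4 / 12 * (\<Sum>e=1..N. l e) - y ^ 4 / 12 * suminf l\<bar> \<le> y^2"
    proof -
      have "\<bar>y ^ 4 / 12 * (\<Sum>e=1..N. l e) - y ^ 4 / 12 * suminf l\<bar> = y ^ 4 / 12 * \<bar>suminf l - (\<Sum>e=1..N. l e)\<bar>"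
        unfolding right_diff_distrib[symmetric] abs_mult using y by (simp add: abs_minus_commute)
      also have "\<dots> \<le> y ^ 4 / 12 * (1 / (real N)^2)" using y by (intro mult_left_mono tail N) auto
      also have "\<dots> \<le> y ^ 4 / 12 * (4 / y^2)"
      proof (rule mult_left_mono)
        have "y \<le> 2 * real N" using N by linarith
        hence "y^2 \<le> (2 * real N)^2" using y by (intro power_mono) auto
        thus "1 / (real N)^2 \<le> 4 / y^2" using N y1 by (simp add: field_simps)
      qed simp
      also have "\<dots> = y^2 / 3" using y1 by (simp add: field_simps power2_eq_square power4_eq_xxxx)
      finally show ?thesis using zero_le_power2[of y] by linarith
    qed
    hence "\<bar>riesz 6 y - V * y ^ 4\<bar> \<le> y + 16 * (2 * y^2 * H) + 16 * y^2 + 4 * (20 * y^2 * H)"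
      unfolding r V_def using S1 S2 y by (simp add: algebra_simps)
    also have "\<dots> \<le> 129 * (y^2 * H)"
    proof -
      have H1: "1 \<le> H" unfolding H_def using member_le_sum[of 1 "{1..N}" "\<lambda>e. 1 / real e"] N by simp
      have "y \<le> y^2" using y1 by (simp add: power2_eq_square)
      moreover have "y^2 * 1 \<le> y^2 * H" using H1 by (intro mult_left_mono) auto
      moreover have "y + 16 * (2 * y^2 * H) + 16 * y^2 + 4 * (20 * y^2 * H) = y + 16 * y^2 + 112 * (y^2 * H)"
        by simp
      ultimately show ?thesis by linarith
    qed
    also have "\<dots> \<le> 129 * (T powr 2 * (10 * T powr (1/10)))"
    proof (intro mult_left_mono mult_mono)
      show "y^2 \<le> T powr 2" using y T by (simp add: power_mono)
      have "H \<le> (\<Sum>e=1..N. real e powr (1/10 - 1))" unfolding H_def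
      proof (rule sum_mono)
        fix e assume e: "e \<in> {1..N}"
        have "1 / real e = real e powr (- 1)" using e by (simp add: powr_minus inverse_eq_divide)
        also have "\<dots> \<le> real e powr (1/10 - 1)" using e by (intro powr_mono) auto
        finally show "1 / real e \<le> real e powr (1/10 - 1)" .
      qed
      also have "\<dots> \<le> real N powr (1/10) / (1/10)" by (intro sum_powr_le) auto
      also have "\<dots> \<le> 10 * T powr (1/10)" using N y by (simp add: powr_mono2)
      finally show "H \<le> 10 * T powr (1/10)" .
    qed (auto simp: H_def intro: sum_nonneg)
    also have "\<dots> = 1290 * T powr (21 / 10)" by (simp flip: powr_add powr_numeral)
    also have "\<dots> \<le> (2000 + \<bar>V\<bar>) * T powr (21 / 10)" by (intro mult_right_mono) auto
    finally show ?thesis .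
  qed
  show ?thesis by (intro exI[of _ V] exI[of _ "2000 + \<bar>V\<bar>"] conjI allI impI main) auto
qed

section \<open>Adding one square by the corrected trapezoidal rule\<close>

text \<open>Regard the error on \<open>[a, a + t]\<close> as a function of \<open>t\<close>. It
  vanishes at 0 with its first two derivatives, and its third derivative is
  \<open>t^2 * f4 (a + t) / 12\<close>; Taylor's formula at \<open>t = 1\<close> divides by
  \<open>3! = 6\<close>. The open interval from \<open>c\<close> to \<open>d\<close> makes all
  derivatives two-sided.\<close>

lemma corrected_trapezoid_cell:
  fixes f f1 f2 f3 f4 :: "real \<Rightarrow> real"
  assumes c: "c < a" "a + 1 < d"
    and f: "\<And>x. c < x \<Longrightarrow> x < d \<Longrightarrow> (f has_real_derivative f1 x) (at x)"
    and f1: "\<And>x. c < x \<Longrightarrow> x < d \<Longrightarrow> (f1 has_real_derivative f2 x) (at x)"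
    and f2: "\<And>x. c < x \<Longrightarrow> x < d \<Longrightarrow> (f2 has_real_derivative f3 x) (at x)"
    and f3: "\<And>x. c < x \<Longrightarrow> x < d \<Longrightarrow> (f3 has_real_derivative f4 x) (at x)"
    and f4: "\<And>x. a \<le> x \<Longrightarrow> x \<le> a + 1 \<Longrightarrow> \<bar>f4 x\<bar> \<le> B"
  shows "\<bar>integral {a..a+1} f - (f a + f (a + 1)) / 2 + (f1 (a + 1) - f1 a) / 12\<bar> \<le> B / 72"
proof -
  define c' d' where "c' = (c + a) / 2" and "d' = (a + 1 + d) / 2"
  have cd: "c < c'" "c' < a" "a + 1 < d'" "d' < d" using c by (auto simp: c'_def d'_def)
  have cont: "continuous_on {c'..d'} f"
  proof (rule continuous_at_imp_continuous_on, rule ballI)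
    fix x assume "x \<in> {c'..d'}"
    thus "isCont f x" using cd f[of x] by (intro DERIV_isCont) auto
  qed
  define F where "F u = integral {c'..u} f" for u
  have F: "(F has_real_derivative f x) (at x)" if "c' < x" "x < d'" for x
  proof -
    have "(F has_real_derivative f x) (at x within {c'..d'})"
      unfolding F_def[abs_def] using that by (intro integral_has_real_derivative cont) auto
    thus ?thesis using at_within_Icc_at[of c' x d'] that by simp
  qed
  have sh: "((\<lambda>t. g (a + t)) has_real_derivative g') (at t)" if "(g has_real_derivative g') (at (a + t))" for g g' t
  proof -
    have "((\<lambda>t. a + t) has_real_derivative 1) (at t)" by (auto intro!: derivative_eq_intros)
    from DERIV_chain2[OF that this] show ?thesis by simp
  qed
  \<comment> \<open>\<open>D 0\<close> is the error with \<open>F\<close> as antiderivative of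
    \<open>f\<close>; the other cases are its successive derivatives after cancellation.\<close>
  define D where "D m t = (if m = 0 then F (a + t) - F a - t * (f a + f (a + t)) / 2 + t * t * (f1 (a + t) - f1 a) / 12
     else if m = 1 then (f (a + t) - f a) / 2 - t * f1 (a + t) / 3 - t * f1 a / 6 + t * t * f2 (a + t) / 12
     else if m = 2 then (f1 (a + t) - f1 a) / 6 - t * f2 (a + t) / 6 + t * t * f3 (a + t) / 12
     else t * t * f4 (a + t) / 12)" for m :: nat and t
  have "\<exists>t>0. t < 1 \<and> D 0 1 = (\<Sum>m<3. D m 0 / fact m * 1 ^ m) + D 3 t / fact 3 * 1 ^ 3"
  proof (rule Maclaurin)
    show "\<forall>m t. m < 3 \<and> 0 \<le> t \<and> t \<le> 1 \<longrightarrow> (D m has_real_derivative D (Suc m) t) (at t)"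
    proof (intro allI impI)
      fix m :: nat and t assume mt: "m < 3 \<and> 0 \<le> t \<and> (t::real) \<le> 1"
      have at: "c' < a + t" "a + t < d'" "c < a + t" "a + t < d" using mt cd by auto
      note d = sh[OF F[OF at(1,2)]] sh[OF f[OF at(3,4)]] sh[OF f1[OF at(3,4)]] sh[OF f2[OF at(3,4)]] sh[OF f3[OF at(3,4)]]
      have c: "((0::nat) = 0) = True" "((1::nat) = 0) = False" "((1::nat) = 1) = True" "((2::nat) = 0) = False" "((2::nat) = 1) = False" "((2::nat) = 2) = True"
        "(Suc 0 = 0) = False" "(Suc 0 = 1) = True" "(Suc 1 = 0) = False" "(Suc 1 = 1) = False" "(Suc 1 = 2) = True"
        "(Suc 2 = 0) = False" "(Suc 2 = 1) = False" "(Suc 2 = 2) = False" "\<And>x y :: real. (if True then x else y) = x" "\<And>x y :: real. (if False then x else y) = y" by auto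
      have "m = 0 \<or> m = 1 \<or> m = 2" using mt by auto
      thus "(D m has_real_derivative D (Suc m) t) (at t)"
      proof (elim disjE)
        assume m: "m = 0"
        show ?thesis unfolding m D_def[abs_def] c
          by (rule DERIV_cong, (rule d DERIV_const DERIV_ident DERIV_add DERIV_diff DERIV_cdivide DERIV_mult)+, simp add: field_simps)
      next
        assume m: "m = 1"
        show ?thesis unfolding m D_def[abs_def] c
          by (rule DERIV_cong, (rule d DERIV_const DERIV_ident DERIV_add DERIV_diff DERIV_cdivide DERIV_mult)+, simp add: field_simps)
      next
        assume m: "m = 2"
        show ?thesis unfolding m D_def[abs_def] c
          by (rule DERIV_cong, (rule d DERIV_const DERIV_ident DERIV_add DERIV_diff DERIV_cdivide DERIV_mult)+, simp add: field_simps)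
      qed
    qed
  qed auto
  then obtain t where t: "0 < t" "t < 1" "D 0 1 = (\<Sum>m<3. D m 0 / fact m * 1 ^ m) + D 3 t / fact 3 * 1 ^ 3" by blast
  have "(\<Sum>m<3. D m 0 / fact m * 1 ^ m) = 0" by (simp add: D_def numeral_3_eq_3)
  hence "D 0 1 = t^2 * f4 (a + t) / 72" using t(3) by (simp add: D_def fact_numeral power2_eq_square)
  moreover have "D 0 1 = integral {a..a+1} f - (f a + f (a + 1)) / 2 + (f1 (a + 1) - f1 a) / 12"
  proof -
    have "f integrable_on {c'..a+1}" using cont cd by (intro integrable_continuous_interval continuous_on_subset[OF cont]) auto
    hence "F a + integral {a..a+1} f = F (a + 1)" unfolding F_def using cd by (intro Henstock_Kurzweil_Integration.integral_combine) auto
    thus ?thesis by (simp add: D_def)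
  qed
  moreover have "\<bar>t\<^sup>2 * f4 (a + t) / 72\<bar> \<le> B / 72"
  proof -
    have "t^2 \<le> 1" using t by (intro power_le_one) auto
    hence "\<bar>t\<^sup>2 * f4 (a + t)\<bar> \<le> 1 * B" unfolding abs_mult using f4[of "a + t"] t by (intro mult_mono) auto
    thus ?thesis by simp
  qed
  ultimately show ?thesis by (simp only:)
qed

text \<open>Summing the main term of the Riesz mean over a new coordinate \<open>u\<close> leads to
  the profile \<open>(y - u^2) powr a\<close>. For \<open>a \<ge> 4\<close> its fourth derivative
  stays bounded up to the ends, where the profile has a zero of order \<open>a\<close>.\<close>

locale power_profile =
  fixes y a :: real
  assumes y: "4 \<le> y" and a: "4 \<le> a"
begin

definition P :: "real \<Rightarrow> real \<Rightarrow> real" where "P j u = (y - u\<^sup>2) powr (a - j)"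
definition h where "h u = P 0 u"
definition h1 where "h1 u = - 2 * a * u * P 1 u"
definition h2 where "h2 u = - 2 * a * P 1 u + 4 * a * (a - 1) * u^2 * P 2 u"
definition h3 where "h3 u = 12 * a * (a - 1) * u * P 2 u - 8 * a * (a - 1) * (a - 2) * u ^ 3 * P 3 u"
definition h4 where "h4 u = 12 * a * (a - 1) * P 2 u - 48 * a * (a - 1) * (a - 2) * u^2 * P 3 u
   + 16 * a * (a - 1) * (a - 2) * (a - 3) * u ^ 4 * P 4 u"

lemma inside: "- sqrt y < u \<Longrightarrow> u < sqrt y \<Longrightarrow> 0 < y - u\<^sup>2"
proof -
  assume "- sqrt y < u" "u < sqrt y"
  hence "\<bar>u\<bar> < sqrt y" by linarith
  hence "\<bar>u\<bar>\<^sup>2 < (sqrt y)^2" by (intro power_strict_mono) auto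
  thus ?thesis using y by simp
qed

lemma P_deriv:
  assumes "- sqrt y < u" "u < sqrt y" "k = j + 1"
  shows "(P j has_real_derivative - 2 * (a - j) * u * P k u) (at u)"
  unfolding P_def[abs_def] using inside[OF assms(1,2)] assms(3)
  by (auto intro!: derivative_eq_intros simp: diff_diff_eq algebra_simps)

lemma h_deriv: "- sqrt y < u \<Longrightarrow> u < sqrt y \<Longrightarrow> (h has_real_derivative h1 u) (at u)"
  unfolding h_def[abs_def] h1_def by (rule DERIV_cong[OF P_deriv[of _ 1]]) auto

lemma h1_deriv: "- sqrt y < u \<Longrightarrow> u < sqrt y \<Longrightarrow> (h1 has_real_derivative h2 u) (at u)"
  unfolding h1_def[abs_def] h2_def
  by (rule DERIV_cong, (rule P_deriv[OF _ _ refl] DERIV_const DERIV_ident DERIV_power DERIV_add DERIV_diff DERIV_mult | assumption)+)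
     (simp add: algebra_simps power2_eq_square power3_eq_cube power4_eq_xxxx)

lemma h2_deriv: "- sqrt y < u \<Longrightarrow> u < sqrt y \<Longrightarrow> (h2 has_real_derivative h3 u) (at u)"
  unfolding h2_def[abs_def] h3_def
  by (rule DERIV_cong, (rule P_deriv[OF _ _ refl] DERIV_const DERIV_ident DERIV_power DERIV_add DERIV_diff DERIV_mult | assumption)+)
     (simp add: algebra_simps power2_eq_square power3_eq_cube power4_eq_xxxx)

lemma h3_deriv: "- sqrt y < u \<Longrightarrow> u < sqrt y \<Longrightarrow> (h3 has_real_derivative h4 u) (at u)"
  unfolding h3_def[abs_def] h4_def
  by (rule DERIV_cong, (rule P_deriv[OF _ _ refl] DERIV_const DERIV_ident DERIV_power DERIV_add DERIV_diff DERIV_mult | assumption)+)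
     (simp add: algebra_simps power2_eq_square power3_eq_cube power4_eq_xxxx)

text \<open>Every factor \<open>u^2\<close> is at most \<open>y\<close> and makes up for one missing
  power of \<open>y - u^2\<close>, so each term has size \<open>y powr (a - 2)\<close>; the
  coefficients add to \<open>12 + 48 + 16 = 76\<close>.\<close>

lemma h4_bound:
  assumes u: "- sqrt y < u" "u < sqrt y"
  shows "\<bar>h4 u\<bar> \<le> 76 * a ^ 4 * y powr (a - 2)"
proof -
  have y0: "0 < y" using y by simp
  have d: "0 < y - u\<^sup>2" "y - u\<^sup>2 \<le> y" "u^2 \<le> y" using inside[OF u] by auto
  have Pb: "0 \<le> P j u" "P j u \<le> y powr (a - j)" if "j \<le> 4" for j
    unfolding P_def using d a that by (auto intro: powr_mono2)
  have p3: "u^2 * P 3 u \<le> y powr (a - 2)"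
  proof -
    have "u^2 * P 3 u \<le> y powr 1 * y powr (a - 3)" using d Pb y by (intro mult_mono) auto
    also have "\<dots> = y powr (a - 2)" by (subst powr_add[symmetric]) simp
    finally show ?thesis .
  qed
  have p4: "u ^ 4 * P 4 u \<le> y powr (a - 2)"
  proof -
    have "(u^2)^2 \<le> y^2" using d by (intro power_mono) auto
    hence "u ^ 4 \<le> y powr 2" using y by simp
    hence "u ^ 4 * P 4 u \<le> y powr 2 * y powr (a - 4)" using Pb by (intro mult_mono) auto
    thus ?thesis by (simp flip: powr_add del: powr_numeral)
  qed
  have a1: "1 \<le> a" using a by simp
  have aa: "a * (a - 1) \<le> a ^ 4" "a * (a - 1) * (a - 2) \<le> a ^ 4" "a * (a - 1) * (a - 2) * (a - 3) \<le> a ^ 4"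
  proof -
    have "a * (a - 1) \<le> a * a" "a * (a - 1) * (a - 2) \<le> a * a * a" "a * (a - 1) * (a - 2) * (a - 3) \<le> a * a * a * a"
      using a by (intro mult_mono; simp)+
    moreover have "a ^ 2 \<le> a ^ 4" "a ^ 3 \<le> a ^ 4" using a1 by (auto intro: power_increasing)
    ultimately show "a * (a - 1) \<le> a ^ 4" "a * (a - 1) * (a - 2) \<le> a ^ 4" "a * (a - 1) * (a - 2) * (a - 3) \<le> a ^ 4"
      by (simp_all add: power2_eq_square power3_eq_cube power4_eq_xxxx)
  qed
  have t1: "\<bar>a * (a - 1) * P 2 u\<bar> \<le> a ^ 4 * y powr (a - 2)"
    unfolding abs_mult using a Pb[of 2] aa by (intro mult_mono) auto
  have t2: "\<bar>a * (a - 1) * (a - 2) * (u^2 * P 3 u)\<bar> \<le> a ^ 4 * y powr (a - 2)"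
    unfolding abs_mult[of "a * (a - 1) * (a - 2)"] using a Pb[of 3] p3 aa by (intro mult_mono) auto
  have t3: "\<bar>a * (a - 1) * (a - 2) * (a - 3) * (u ^ 4 * P 4 u)\<bar> \<le> a ^ 4 * y powr (a - 2)"
    unfolding abs_mult[of "a * (a - 1) * (a - 2) * (a - 3)"] using a Pb[of 4] p4 aa by (intro mult_mono) auto
  have "h4 u = 12 * (a * (a - 1) * P 2 u) - 48 * (a * (a - 1) * (a - 2) * (u^2 * P 3 u)) + 16 * (a * (a - 1) * (a - 2) * (a - 3) * (u ^ 4 * P 4 u))"
    by (simp add: h4_def algebra_simps)
  thus ?thesis using t1 t2 t3 by linarith
qed

lemma integral_h: "(h has_integral y powr (a + 1/2) * integral {0..1} (\<lambda>v. (1 - v\<^sup>2) powr a)) {0..sqrt y}"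
proof -
  have ch: "continuous_on {0..sqrt y} h"
  proof -
    have "continuous_on {0..sqrt y} (\<lambda>u. (y - u\<^sup>2) powr a)"
    proof (rule continuous_on_powr')
      show "\<forall>x\<in>{0..sqrt y}. 0 \<le> y - x\<^sup>2 \<and> (y - x\<^sup>2 = 0 \<longrightarrow> 0 < a)"
      proof
        fix x assume "x \<in> {0..sqrt y}"
        hence "x^2 \<le> (sqrt y)^2" by (intro power_mono) auto
        thus "0 \<le> y - x\<^sup>2 \<and> (y - x\<^sup>2 = 0 \<longrightarrow> 0 < a)" using y a by simp
      qed
    qed (intro continuous_intros)+
    thus ?thesis by (simp add: h_def[abs_def] P_def)
  qed
  define I where "I = integral {0..sqrt y} h"
  have I: "(h has_integral I) {0..sqrt y}"
    unfolding I_def by (intro integrable_integral integrable_continuous_interval ch)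
  have sy: "0 < sqrt y" using y by simp
  have "((\<lambda>x. h (sqrt y * x)) has_integral (1 / \<bar>sqrt y\<bar>) * I) ((\<lambda>x. x / sqrt y) ` {0..sqrt y})"
    using has_integral_stretch_real[OF I, of "sqrt y"] sy by simp
  also have "(\<lambda>x. x / sqrt y) ` {0..sqrt y} = {0..1}"
  proof -
    have "x \<in> (\<lambda>x. x / sqrt y) ` {0..sqrt y}" if "x \<in> {0..1}" for x
      using that sy by (intro image_eqI[of _ _ "x * sqrt y"]) (auto simp: mult_le_cancel_right1)
    moreover have "x / sqrt y \<in> {0..1}" if "x \<in> {0..sqrt y}" for x using that sy by simp
    ultimately show ?thesis by blast
  qed
  finally have "((\<lambda>x. h (sqrt y * x)) has_integral I / sqrt y) {0..1}" using sy by simp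
  moreover have "h (sqrt y * x) = y powr a * (1 - x\<^sup>2) powr a" if "x \<in> {0..1}" for x
  proof -
    have "x^2 \<le> 1" using that by (intro power_le_one) auto
    moreover have "y - (sqrt y * x)^2 = y * (1 - x\<^sup>2)" using y by (simp add: power_mult_distrib algebra_simps)
    ultimately show ?thesis using y by (simp add: h_def P_def powr_mult)
  qed
  ultimately have "((\<lambda>x. y powr a * (1 - x\<^sup>2) powr a) has_integral I / sqrt y) {0..1}"
    by (rule has_integral_eq[rotated]) simp
  hence "I / sqrt y = y powr a * integral {0..1} (\<lambda>v. (1 - v\<^sup>2) powr a)"
    by (metis integral_unique integral_mult_right)
  hence "I = y powr a * sqrt y * integral {0..1} (\<lambda>v. (1 - v\<^sup>2) powr a)" using sy by (simp add: field_simps)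
  also have "y powr a * sqrt y = y powr (a + 1/2)" using y by (simp add: powr_half_sqrt powr_add)
  finally show ?thesis using I by simp
qed

text \<open>On whole cells inside the interval the derivative corrections telescope, and the one at
  0 vanishes because the profile is even. About \<open>sqrt y\<close> cells with error
  \<open>y powr (a - 2)\<close> give \<open>y powr (a - 3/2)\<close>. The stretch next to the end is
  estimated directly.\<close>

lemma lattice_sum:
  defines "K \<equiv> nat \<lfloor>sqrt y\<rfloor>"
  shows "\<bar>h 0 + 2 * (\<Sum>k=1..K. h (real k)) - 2 * y powr (a + 1/2) * integral {0..1} (\<lambda>v. (1 - v\<^sup>2) powr a)\<bar>
     \<le> (3 * a ^ 4 + (7 + a) * 4 powr a) * y powr (a - 3/2)"
proof -
  have sy: "2 \<le> sqrt y" using y by (simp add: real_le_rsqrt)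
  \<comment> \<open>One cell less than fits, so that every cell used lies strictly inside the
    interval of differentiability.\<close>
  define L where "L = K - 1"
  have K: "1 \<le> K" "real K \<le> sqrt y" "sqrt y < real K + 1" unfolding K_def using sy by linarith+
  have L: "K = Suc L" "real L \<le> sqrt y - 1" "sqrt y - 2 < real L" "real L < sqrt y" using K by (auto simp: L_def)
  define E where "E k = integral {real k..real k + 1} h - (h k + h (real k + 1)) / 2 + (h1 (real k + 1) - h1 k) / 12" for k :: nat
  have E: "\<bar>E k\<bar> \<le> 76 * a ^ 4 * y powr (a - 2) / 72" if k: "k < L" for k
    unfolding E_def
  proof (rule corrected_trapezoid_cell[where c = "- sqrt y" and d = "sqrt y"])
    have kL: "real k + 1 \<le> real L" using k by simp
    show "real k + 1 < sqrt y" using kL L by linarith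
    show "- sqrt y < real k" using sy by linarith
    show "\<bar>h4 x\<bar> \<le> 76 * a ^ 4 * y powr (a - 2)" if "real k \<le> x" "x \<le> real k + 1" for x
      using that kL L sy by (intro h4_bound) auto
  qed (auto intro: h_deriv h1_deriv h2_deriv h3_deriv)
  have ih: "h integrable_on {0..sqrt y}" using integral_h by (rule has_integral_integrable)
  have ih': "h integrable_on {p..q}" if "0 \<le> p" "q \<le> sqrt y" for p q
    by (rule integrable_on_subinterval[OF ih]) (use that in auto)
  have step: "(\<Sum>k=1..n. h (real k)) = integral {0..real n} h + (h n - h 0) / 2 + h1 n / 12 - (\<Sum>k<n. E k)" if "n \<le> L" for n
    using that
  proof (induction n)
    case 0
    show ?case by (simp add: h1_def)
  next
    case (Suc n)
    have "real (Suc n) \<le> sqrt y" using Suc.prems L by linarith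
    hence "integral {0..real n} h + integral {real n..real (Suc n)} h = integral {0..real (Suc n)} h"
      by (intro Henstock_Kurzweil_Integration.integral_combine ih') auto
    thus ?case using Suc by (simp add: E_def add.commute[of 1]) (simp add: field_simps)
  qed
  \<comment> \<open>Within distance 2 of the end \<open>y - u^2\<close> is at most
    \<open>4 * sqrt y\<close>, so the profile there is at most
    \<open>4 powr a * y powr (a / 2)\<close>, and \<open>a / 2 \<le> a - 3/2\<close>.\<close>
  define Q where "Q = 4 powr a * y powr (a - 3/2)"
  have hQ: "0 \<le> h u" "h u \<le> Q" "\<bar>h1 u\<bar> \<le> 2 * a * Q" if u: "real L \<le> u" "u \<le> sqrt y" for u
  proof -
    have u0: "0 \<le> u" using u by linarith
    have "(sqrt y - 2)^2 \<le> u^2" using u L sy by (intro power_mono) auto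
    moreover have "(sqrt y - 2)^2 = y - 4 * sqrt y + 4" using y by (simp add: power2_diff)
    ultimately have d: "y - u\<^sup>2 \<le> 4 * sqrt y" by linarith
    have "u^2 \<le> (sqrt y)^2" using u u0 by (intro power_mono) auto
    hence d0: "0 \<le> y - u\<^sup>2" using y by simp
    have Pj: "P j u \<le> 4 powr a * y powr ((a - j) / 2)" if "0 \<le> j" "j \<le> 1" for j
    proof -
      have "P j u \<le> (4 * sqrt y) powr (a - j)" unfolding P_def using d d0 a that by (intro powr_mono2) auto
      also have "\<dots> = 4 powr (a - j) * y powr ((a - j) / 2)" using y by (simp add: powr_mult powr_half_sqrt[symmetric] powr_powr)
      also have "\<dots> \<le> 4 powr a * y powr ((a - j) / 2)" using that by (intro mult_right_mono powr_mono) auto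
      finally show ?thesis .
    qed
    show "0 \<le> h u" by (simp add: h_def P_def)
    have "h u \<le> 4 powr a * y powr ((a - 0) / 2)" unfolding h_def by (rule Pj) auto
    also have "\<dots> \<le> Q" unfolding Q_def using a y by (intro mult_left_mono powr_mono) auto
    finally show "h u \<le> Q" .
    have P0: "0 \<le> P 1 u" by (simp add: P_def)
    have "u * P 1 u \<le> y powr (1/2) * (4 powr a * y powr ((a - 1) / 2))"
      using u u0 Pj[of 1] P0 y by (intro mult_mono) (auto simp: powr_half_sqrt)
    also have "\<dots> = 4 powr a * y powr (a / 2)" by (simp flip: powr_add add: field_simps)
    also have "\<dots> \<le> Q" unfolding Q_def using a y by (intro mult_left_mono powr_mono) auto
    finally have "u * P 1 u \<le> Q" .
    hence "2 * a * (u * P 1 u) \<le> 2 * a * Q" using a by (intro mult_left_mono) auto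
    thus "\<bar>h1 u\<bar> \<le> 2 * a * Q" using u0 a by (simp add: h1_def abs_mult P_def)
  qed
  have hL: "0 \<le> h L" "h L \<le> Q" "\<bar>h1 L\<bar> \<le> 2 * a * Q" using hQ[of "real L"] L by auto
  have hK: "0 \<le> h K" "h K \<le> Q" using hQ[of "real K"] K L by auto
  have sE: "\<bar>\<Sum>k<L. E k\<bar> \<le> (3/2) * a ^ 4 * y powr (a - 3/2)"
  proof -
    have "\<bar>\<Sum>k<L. E k\<bar> \<le> (\<Sum>k<L. 76 * a ^ 4 * y powr (a - 2) / 72)"
      using E by (intro order.trans[OF sum_abs sum_mono]) auto
    also have "\<dots> = real L * (76 * a ^ 4 * y powr (a - 2) / 72)" by simp
    also have "\<dots> \<le> y powr (1/2) * (76 * a ^ 4 * y powr (a - 2) / 72)"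
      using L a y by (intro mult_right_mono) (auto simp: powr_half_sqrt)
    also have "\<dots> = (76 / 72) * a ^ 4 * (y powr (1/2) * y powr (a - 2))" by simp
    also have "y powr (1/2) * y powr (a - 2) = y powr (a - 3/2)" by (simp flip: powr_add)
    also have "(76 / 72) * a ^ 4 * y powr (a - 3/2) \<le> (3/2) * a ^ 4 * y powr (a - 3/2)" by (intro mult_right_mono) auto
    finally show ?thesis .
  qed
  define J where "J = y powr (a + 1/2) * integral {0..1} (\<lambda>v. (1 - v\<^sup>2) powr a)"
  have J: "integral {0..real L} h + integral {real L..sqrt y} h = J"
    unfolding J_def integral_unique[OF integral_h, symmetric] using L
    by (intro Henstock_Kurzweil_Integration.integral_combine ih') auto
  have tail: "0 \<le> integral {real L..sqrt y} h" "integral {real L..sqrt y} h \<le> 2 * Q"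
  proof -
    show "0 \<le> integral {real L..sqrt y} h" using hQ by (intro integral_nonneg ih') auto
    have "integral {real L..sqrt y} h \<le> integral {real L..sqrt y} (\<lambda>_. Q)" using hQ by (intro integral_le ih') auto
    also have "\<dots> = (sqrt y - real L) * Q" using L by simp
    also have "\<dots> \<le> 2 * Q" using L by (intro mult_right_mono) (auto simp: Q_def)
    finally show "integral {real L..sqrt y} h \<le> 2 * Q" .
  qed
  have "h 0 + 2 * (\<Sum>k=1..K. h (real k)) - 2 * J = 2 * h K + h L + h1 L / 6 - 2 * (\<Sum>k<L. E k) - 2 * integral {real L..sqrt y} h"
  proof -
    have "(\<Sum>k=1..K. h (real k)) = (\<Sum>k=1..L. h (real k)) + h K" by (simp add: L(1))
    moreover have "h0 + 2 * S - 2 * J = 2 * hK + hL + d / 6 - 2 * e - 2 * i2"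
      if "S = S' + hK" "S' = i1 + (hL - h0) / 2 + d / 12 - e" "i1 + i2 = J" for S S' i1 i2 h0 hK hL d e J :: real
      using that by (simp add: field_simps)
    ultimately show ?thesis using step[OF order.refl] J by blast
  qed
  hence "\<bar>h 0 + 2 * (\<Sum>k=1..K. h (real k)) - 2 * J\<bar> \<le> 2 * Q + Q + 2 * a * Q / 6 + 3 * a ^ 4 * y powr (a - 3/2) + 4 * Q"
    using hL hK sE tail by linarith
  also have "\<dots> \<le> 3 * a ^ 4 * y powr (a - 3/2) + (7 + a) * Q"
  proof -
    have "0 \<le> Q * a" using a by (simp add: Q_def)
    thus ?thesis by (simp add: distrib_right mult.commute[of a])
  qed
  finally show ?thesis by (simp only: Q_def J_def mult.assoc distrib_right)
qed

end

lemma sq_ints_eq: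
  assumes "0 \<le> y"
  shows "sq_ints (nat \<lfloor>y\<rfloor>) = {- int (nat \<lfloor>sqrt y\<rfloor>)..int (nat \<lfloor>sqrt y\<rfloor>)}"
proof -
  have "i^2 \<le> \<lfloor>y\<rfloor> \<longleftrightarrow> \<bar>i\<bar> \<le> \<lfloor>sqrt y\<rfloor>" for i :: int
  proof -
    have "i^2 \<le> \<lfloor>y\<rfloor> \<longleftrightarrow> (real_of_int i)^2 \<le> y" by (simp add: le_floor_iff)
    also have "\<dots> \<longleftrightarrow> \<bar>real_of_int i\<bar> \<le> sqrt y" using assms real_sqrt_le_iff[of "(real_of_int i)^2" y] by simp
    finally show ?thesis by (simp add: le_floor_iff)
  qed
  hence "sq_ints (nat \<lfloor>y\<rfloor>) = {i. \<bar>i\<bar> \<le> \<lfloor>sqrt y\<rfloor>}" using assms by (simp add: sq_ints_def)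
  moreover have "int (nat \<lfloor>sqrt y\<rfloor>) = \<lfloor>sqrt y\<rfloor>" using assms by simp
  ultimately show ?thesis by (simp only: set_eq_iff mem_Collect_eq atLeastAtMost_iff abs_le_iff) linarith
qed

lemma sum_symmetric_ints:
  fixes g :: "int \<Rightarrow> real"
  assumes "\<And>i. g (- i) = g i"
  shows "(\<Sum>i\<in>{- int K..int K}. g i) = g 0 + 2 * (\<Sum>k=1..K. g (int k))"
proof (induction K)
  case (Suc K)
  have "{- int (Suc K)..int (Suc K)} = insert (- int (Suc K)) (insert (int (Suc K)) {- int K..int K})" by auto
  thus ?case using Suc assms[of "int (Suc K)"] by simp
qed simp

lemma sum_powr_sq_ints:
  assumes a: "4 \<le> a"
  shows "\<exists>\<beta> C. 0 \<le> C \<and> (\<forall>T y. 1 \<le> T \<longrightarrow> 0 \<le> y \<longrightarrow> y \<le> T \<longrightarrow>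
    \<bar>(\<Sum>i\<in>sq_ints (nat \<lfloor>y\<rfloor>). (y - (real_of_int i)^2) powr a) - \<beta> * y powr (a + 1/2)\<bar> \<le> C * T powr (a - 3/2))"
proof -
  let ?S = "\<lambda>y. \<Sum>i\<in>sq_ints (nat \<lfloor>y\<rfloor>). (y - (real_of_int i)^2) powr a"
  define I where "I = integral {0..1} (\<lambda>v. (1 - v\<^sup>2) powr a)"
  define C where "C = 6 * 4 powr a + \<bar>2 * I\<bar> * 4 powr (a + 1/2) + (3 * a ^ 4 + (7 + a) * 4 powr a)"
  have main: "\<bar>?S y - 2 * I * y powr (a + 1/2)\<bar> \<le> C * T powr (a - 3/2)"
    if T: "1 \<le> T" and yT: "0 \<le> y" "y \<le> T" for T y
  proof (cases "4 \<le> y")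
    case True
    then interpret power_profile y a using a by unfold_locales auto
    have "?S y = h 0 + 2 * (\<Sum>k=1..nat \<lfloor>sqrt y\<rfloor>. h (real k))"
      unfolding sq_ints_eq[OF yT(1)] by (subst sum_symmetric_ints) (simp_all add: h_def P_def)
    hence "\<bar>?S y - 2 * I * y powr (a + 1/2)\<bar>
      \<le> (3 * a ^ 4 + (7 + a) * 4 powr a) * y powr (a - 3/2)"
      using lattice_sum by (simp add: I_def mult_ac)
    also have "\<dots> \<le> C * T powr (a - 3/2)"
      using yT a by (intro mult_mono powr_mono2) (auto simp: C_def)
    finally show ?thesis .
  next
    case False
    have "0 \<le> ?S y" by (intro sum_nonneg) auto
    moreover have "?S y \<le> 6 * 4 powr a"
    proof -
      have "?S y \<le> (\<Sum>i\<in>sq_ints (nat \<lfloor>y\<rfloor>). 4 powr a)"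
      proof (rule sum_mono)
        fix i assume "i \<in> sq_ints (nat \<lfloor>y\<rfloor>)"
        hence "i^2 \<le> \<lfloor>y\<rfloor>" using yT by (simp add: sq_ints_def)
        hence "(real_of_int i)^2 \<le> y" by (simp add: le_floor_iff)
        thus "(y - (real_of_int i)^2) powr a \<le> 4 powr a" using False a zero_le_power2[of "real_of_int i"] by (intro powr_mono2) linarith+
      qed
      also have "\<dots> = real (card (sq_ints (nat \<lfloor>y\<rfloor>))) * 4 powr a" by simp
      also have "\<dots> \<le> (3 * sqrt 4) * 4 powr a"
      proof (rule mult_right_mono)
        show "real (card (sq_ints (nat \<lfloor>y\<rfloor>))) \<le> 3 * sqrt 4" by (rule card_sq_ints_le) (use yT False in linarith)+
      qed simp
      finally show ?thesis by simp
    qed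
    moreover have "\<bar>2 * I * y powr (a + 1/2)\<bar> \<le> \<bar>2 * I\<bar> * 4 powr (a + 1/2)"
      unfolding abs_mult using False yT a by (intro mult_left_mono) (auto intro: powr_mono2)
    ultimately have "\<bar>?S y - 2 * I * y powr (a + 1/2)\<bar> \<le> 6 * 4 powr a + \<bar>2 * I\<bar> * 4 powr (a + 1/2)"
      by linarith
    also have "\<dots> \<le> C * 1" using a by (simp add: C_def)
    also have "\<dots> \<le> C * T powr (a - 3/2)" using a T by (intro mult_left_mono ge_one_powr_ge_zero) (auto simp: C_def)
    finally show ?thesis .
  qed
  show ?thesis using a by (intro exI[of _ "2 * I"] exI[of _ C] conjI allI impI main) (auto simp: C_def)
qed

lemma riesz_Suc:
  assumes "0 \<le> y"
  shows "riesz (Suc n) y = (\<Sum>i\<in>sq_ints (nat \<lfloor>y\<rfloor>). riesz n (y - (real_of_int i)^2))"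
proof -
  define N where "N = nat \<lfloor>y\<rfloor>"
  have "riesz (Suc n) y = (\<Sum>j\<le>N. fps_nth theta j * (\<Sum>m\<le>N-j. sq_reps n m * (y - real (m + j))))"
    unfolding riesz_def N_def by (simp add: sum_fps_mult)
  also have "\<dots> = (\<Sum>i\<in>sq_ints N. \<Sum>m\<le>N - nat (i^2). sq_reps n m * (y - real (m + nat (i^2))))"
    unfolding atLeast0AtMost[symmetric] by (rule theta_sum)
  also have "\<dots> = (\<Sum>i\<in>sq_ints N. riesz n (y - (real_of_int i)^2))"
  proof (rule sum.cong)
    fix i assume "i \<in> sq_ints N"
    hence "i^2 \<le> \<lfloor>y\<rfloor>" using assms by (simp add: sq_ints_def N_def)
    have "\<lfloor>y - (real_of_int i)^2\<rfloor> = \<lfloor>y\<rfloor> - i\<^sup>2" by (metis floor_diff_of_int of_int_power)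
    hence "nat \<lfloor>y - (real_of_int i)^2\<rfloor> = N - nat (i^2)" using \<open>i\<^sup>2 \<le> \<lfloor>y\<rfloor>\<close> by (simp add: N_def nat_diff_distrib)
    moreover have "real (nat (i^2)) = (real_of_int i)^2" by (simp add: of_nat_nat)
    ultimately show "(\<Sum>m\<le>N - nat (i^2). sq_reps n m * (y - real (m + nat (i^2)))) = riesz n (y - (real_of_int i)^2)"
      unfolding riesz_def by (simp add: diff_diff_eq add.commute)
  qed simp
  finally show ?thesis by (simp only: N_def)
qed

text \<open>A further square sums the estimate over at most \<open>3 * sqrt T\<close> integers,
  which raises the exponent of the error by \<open>1/2\<close>; the new error from the main term,
  with exponent \<open>a - 3/2 = n/2 - 1/2\<close>, is smaller. The bound is stated in
  \<open>T\<close> rather than \<open>y\<close> so that it applies uniformly to the arguments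
  \<open>y - i^2\<close>.\<close>

theorem riesz_asymptotic:
  assumes "6 \<le> n"
  shows "\<exists>V C. 0 \<le> C \<and> (\<forall>T y. 1 \<le> T \<longrightarrow> 0 \<le> y \<longrightarrow> y \<le> T \<longrightarrow>
    \<bar>riesz n y - V * y powr (real n / 2 + 1)\<bar> \<le> C * T powr (real n / 2 - 9/10))"
  using assms
proof (induction n rule: dec_induct)
  case base
  obtain V C where C: "0 \<le> C" and b: "\<And>T y. 1 \<le> T \<Longrightarrow> 0 \<le> y \<Longrightarrow> y \<le> T \<Longrightarrow> \<bar>riesz 6 y - V * y ^ 4\<bar> \<le> C * T powr (21 / 10)"
    using riesz_six by auto
  show ?case
  proof (rule exI[of _ V], rule exI[of _ C], intro conjI allI impI C)
    fix T y :: real assume "1 \<le> T" "0 \<le> y" "y \<le> T"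
    from b[OF this] show "\<bar>riesz 6 y - V * y powr (real 6 / 2 + 1)\<bar> \<le> C * T powr (real 6 / 2 - 9/10)"
      using \<open>0 \<le> y\<close> by simp
  qed
next
  case (step n)
  define a where "a = real n / 2 + 1"
  have a: "4 \<le> a" using step by (simp add: a_def)
  obtain V C where C: "0 \<le> C" and IH: "\<And>T y. 1 \<le> T \<Longrightarrow> 0 \<le> y \<Longrightarrow> y \<le> T \<Longrightarrow> \<bar>riesz n y - V * y powr a\<bar> \<le> C * T powr (real n / 2 - 9/10)"
    using step.IH unfolding a_def by auto
  obtain \<beta> D where D: "0 \<le> D" and pw: "\<And>T y. 1 \<le> T \<Longrightarrow> 0 \<le> y \<Longrightarrow> y \<le> T \<Longrightarrow>
    \<bar>(\<Sum>i\<in>sq_ints (nat \<lfloor>y\<rfloor>). (y - (real_of_int i)^2) powr a) - \<beta> * y powr (a + 1/2)\<bar> \<le> D * T powr (a - 3/2)"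
    using sum_powr_sq_ints[OF a] by auto
  have main: "\<bar>riesz (Suc n) y - V * \<beta> * y powr (a + 1/2)\<bar> \<le> (3 * C + \<bar>V\<bar> * D) * T powr (real n / 2 - 4/10)"
    if T: "1 \<le> T" and y: "0 \<le> y" "y \<le> T" for T y
  proof -
    define S where "S = sq_ints (nat \<lfloor>y\<rfloor>)"
    define P where "P = (\<Sum>i\<in>S. (y - (real_of_int i)^2) powr a)"
    have "\<bar>riesz (Suc n) y - V * P\<bar> \<le> (\<Sum>i\<in>S. C * T powr (real n / 2 - 9/10))"
    proof -
      have "riesz (Suc n) y - V * P = (\<Sum>i\<in>S. riesz n (y - (real_of_int i)^2) - V * (y - (real_of_int i)^2) powr a)"
        by (simp add: riesz_Suc[OF y(1)] P_def S_def sum_subtractf sum_distrib_left)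
      also have "\<bar>\<dots>\<bar> \<le> (\<Sum>i\<in>S. C * T powr (real n / 2 - 9/10))"
      proof (rule order.trans[OF sum_abs sum_mono], rule IH[OF T])
        fix i assume "i \<in> S"
        hence "i^2 \<le> \<lfloor>y\<rfloor>" using y by (simp add: sq_ints_def S_def)
        hence "(real_of_int i)^2 \<le> y" by (simp add: le_floor_iff)
        thus "0 \<le> y - (real_of_int i)^2" "y - (real_of_int i)^2 \<le> T" using y zero_le_power2[of "real_of_int i"] by linarith+
      qed
      finally show ?thesis .
    qed
    also have "\<dots> = real (card S) * (C * T powr (real n / 2 - 9/10))" by simp
    also have "\<dots> \<le> (3 * sqrt T) * (C * T powr (real n / 2 - 9/10))"
    proof (rule mult_right_mono)
      show "real (card S) \<le> 3 * sqrt T" unfolding S_def by (rule card_sq_ints_le[OF T]) (use y in linarith)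
    qed (use C in simp)
    also have "\<dots> = 3 * C * (T powr (1/2) * T powr (real n / 2 - 9/10))" using T by (simp add: powr_half_sqrt)
    also have "T powr (1/2) * T powr (real n / 2 - 9/10) = T powr (real n / 2 - 4/10)" by (simp flip: powr_add)
    finally have 1: "\<bar>riesz (Suc n) y - V * P\<bar> \<le> 3 * C * T powr (real n / 2 - 4/10)" .
    have "\<bar>V * P - V * \<beta> * y powr (a + 1/2)\<bar> = \<bar>V\<bar> * \<bar>P - \<beta> * y powr (a + 1/2)\<bar>"
      unfolding mult.assoc right_diff_distrib[symmetric] abs_mult ..
    also have "\<dots> \<le> \<bar>V\<bar> * (D * T powr (a - 3/2))" unfolding P_def S_def by (intro mult_left_mono pw T y) auto
    also have "\<dots> \<le> \<bar>V\<bar> * (D * T powr (real n / 2 - 4/10))"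
      using T D by (intro mult_left_mono powr_mono) (auto simp: a_def)
    finally have "\<bar>V * P - V * \<beta> * y powr (a + 1/2)\<bar> \<le> \<bar>V\<bar> * D * T powr (real n / 2 - 4/10)" by simp
    with 1 show ?thesis unfolding distrib_right by linarith
  qed
  show ?case
  proof (rule exI[of _ "V * \<beta>"], rule exI[of _ "3 * C + \<bar>V\<bar> * D"], intro conjI allI impI)
    fix T y :: real assume "1 \<le> T" "0 \<le> y" "y \<le> T"
    note main[OF this]
    moreover have "a + 1/2 = real (Suc n) / 2 + 1" "real n / 2 - 4/10 = real (Suc n) / 2 - 9/10" by (simp_all add: a_def add_divide_distrib)
    ultimately show "\<bar>riesz (Suc n) y - V * \<beta> * y powr (real (Suc n) / 2 + 1)\<bar> \<le> (3 * C + \<bar>V\<bar> * D) * T powr (real (Suc n) / 2 - 9/10)"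
      by simp
  qed (use C D in simp)
qed

section \<open>Size of single representation numbers\<close>

lemma six_coeff_le: "\<bar>six_coeff m\<bar> \<le> 40 * (real m)^2" if m: "1 \<le> m"
proof -
  define S where "S = {(d, e). d * e = m}"
  have fin: "finite S" unfolding S_def by (rule finite_divisor_pairs[OF m])
  have "\<bar>real_of_int (six_coeff m)\<bar> \<le> (\<Sum>p\<in>S. 20 * (real m)^2 * (1 / (real (snd p))^2))"
    unfolding six_coeff_def S_def[symmetric] of_int_sum
  proof (rule order.trans[OF sum_abs sum_mono])
    fix p assume "p \<in> S"
    then obtain d e where p: "p = (d, e)" "d * e = m" by (auto simp: S_def)
    have e: "e \<noteq> 0" using p m by (intro notI) simp
    have "\<bar>16 * chi (int e) - 4 * chi (int d)\<bar> \<le> 20" using abs_chi_le[of "int e"] abs_chi_le[of "int d"] by linarith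
    hence "\<bar>real_of_int (16 * chi (int e) - 4 * chi (int d))\<bar> \<le> 20" by linarith
    hence "\<bar>real_of_int (16 * chi (int e) - 4 * chi (int d)) * (real d)^2\<bar> \<le> 20 * (real d)^2"
      unfolding abs_mult by (intro mult_mono) auto
    also have "20 * (real d)^2 = 20 * (real m)^2 * (1 / (real e)^2)" using e by (simp add: p(2)[symmetric] power_mult_distrib)
    finally show "\<bar>real_of_int (case p of (d, e) \<Rightarrow> (16 * chi (int e) - 4 * chi (int d)) * (int d)^2)\<bar> \<le> 20 * (real m)^2 * (1 / (real (snd p))^2)"
      by (simp add: p(1))
  qed
  also have "\<dots> = 20 * (real m)^2 * (\<Sum>e\<in>snd ` S. 1 / (real e)^2)"
  proof -
    have "inj_on snd S"
    proof (rule inj_onI)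
      fix p p' assume "p \<in> S" "p' \<in> S" "snd p = snd p'"
      moreover from this m have "snd p \<noteq> 0" by (auto simp: S_def)
      ultimately show "p = p'" by (auto simp: S_def)
    qed
    thus ?thesis by (simp add: sum.reindex sum_distrib_left)
  qed
  also have "\<dots> \<le> 20 * (real m)^2 * 2"
  proof (rule mult_left_mono)
    have "snd ` S \<subseteq> {1..m}"
    proof
      fix e assume "e \<in> snd ` S"
      then obtain d where "(d, e) \<in> S" by auto
      hence de: "d * e = m" by (simp add: S_def)
      hence "e dvd m" by auto
      thus "e \<in> {1..m}" using m de by (auto dest: dvd_imp_le intro: Suc_leI gr0I)
    qed
    hence "(\<Sum>e\<in>snd ` S. 1 / (real e)^2) \<le> (\<Sum>e\<in>{1..m}. 1 / (real e)^2)" by (intro sum_mono2) auto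
    also have "\<dots> = 1 + (\<Sum>e\<in>{1<..m}. 1 / (real e)^2)"
    proof -
      have "{1..m} = insert 1 {1<..m}" using m by auto
      thus ?thesis by simp
    qed
    also have "\<dots> \<le> 1 + 1 / real 1" by (intro add_left_mono sum_inverse_squares_tail) auto
    finally show "(\<Sum>e\<in>snd ` S. 1 / (real e)^2) \<le> 2" by simp
  qed simp
  finally show ?thesis by simp
qed

text \<open>Wanted for the one integer \<open>m\<close> in the unit interval below \<open>T\<close>,
  which the smoothing of the semicircle leaves out.\<close>

lemma theta_power_coeff_le:
  assumes q: "3 \<le> q" and T: "1 \<le> T" and N: "real N \<le> T"
  shows "sq_reps (2 * q) N \<le> 9 ^ (q - 3) * 40 * T powr (real q - 1)"
proof -
  have c6: "sq_reps 6 m \<le> 40 * T powr 2" if "m \<le> N" for m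
  proof (cases "m = 0")
    case True
    have "1 \<le> T powr 2" using T by (intro ge_one_powr_ge_zero) auto
    thus ?thesis using True by simp
  next
    case False
    have "(real m)^2 \<le> T^2" using that N by (intro power_mono) auto
    moreover have "\<bar>real_of_int (six_coeff m)\<bar> \<le> 40 * (real m)^2" using six_coeff_le[of m] False by simp
    ultimately have "real_of_int (six_coeff m) \<le> 40 * T^2" by linarith
    thus ?thesis using six_squares[of m] False T by simp
  qed
  have "2 * q = 2 * (q - 3) + 6" using q by simp
  hence "theta ^ (2 * q) = theta ^ (2 * (q - 3)) * theta ^ 6" by (metis power_add)
  hence "sq_reps (2 * q) N = (\<Sum>i\<le>N. sq_reps (2 * (q - 3)) i * sq_reps 6 (N - i))"
    by (simp add: fps_mult_nth atLeast0AtMost)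
  also have "\<dots> \<le> (\<Sum>i\<le>N. sq_reps (2 * (q - 3)) i * (40 * T powr 2))"
    by (intro sum_mono mult_left_mono c6 fps_nth_theta_power_nonneg) auto
  also have "\<dots> \<le> (3 * sqrt T) ^ (2 * (q - 3)) * (40 * T powr 2)"
    unfolding sum_distrib_right[symmetric] by (intro mult_right_mono sum_theta_power_le T N) auto
  also have "(3 * sqrt T) ^ (2 * (q - 3)) = 9 ^ (q - 3) * T powr (real q - 3)" using q T by (rule even_power_sqrt)
  also have "9 ^ (q - 3) * T powr (real q - 3) * (40 * T powr 2) = 9 ^ (q - 3) * 40 * (T powr (real q - 3) * T powr 2)" by simp
  also have "T powr (real q - 3) * T powr 2 = T powr (real q - 1)" by (subst powr_add[symmetric]) simp
  finally show ?thesis .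
qed

text \<open>The range of summation no longer depends on \<open>y\<close>, which shows continuity in
  \<open>y\<close> and lets sum and integral be exchanged.\<close>

lemma riesz_eq_sum_max:
  assumes "0 \<le> y" "y \<le> T"
  shows "riesz n y = (\<Sum>m\<le>nat \<lfloor>T\<rfloor>. sq_reps n m * max 0 (y - real m))"
proof -
  have "riesz n y = (\<Sum>m\<le>nat \<lfloor>y\<rfloor>. sq_reps n m * max 0 (y - real m))"
    unfolding riesz_def
  proof (rule sum.cong)
    fix m assume "m \<in> {..nat \<lfloor>y\<rfloor>}"
    hence "real m \<le> real (nat \<lfloor>y\<rfloor>)" by simp
    also have "\<dots> \<le> y" using assms by (intro of_nat_floor)
    finally have "real m \<le> y" .
    thus "sq_reps n m * (y - real m) = sq_reps n m * max 0 (y - real m)" by simp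
  qed simp
  also have "\<dots> = (\<Sum>m\<le>nat \<lfloor>T\<rfloor>. sq_reps n m * max 0 (y - real m))"
  proof (rule sum.mono_neutral_left)
    show "{..nat \<lfloor>y\<rfloor>} \<subseteq> {..nat \<lfloor>T\<rfloor>}" using assms by (auto intro: order.trans nat_mono floor_mono)
    show "\<forall>m\<in>{..nat \<lfloor>T\<rfloor>} - {..nat \<lfloor>y\<rfloor>}. sq_reps n m * max 0 (y - real m) = 0"
    proof
      fix m assume "m \<in> {..nat \<lfloor>T\<rfloor>} - {..nat \<lfloor>y\<rfloor>}"
      hence "nat \<lfloor>y\<rfloor> < m" by auto
      hence "y \<le> real m" by linarith
      thus "sq_reps n m * max 0 (y - real m) = 0" by simp
    qed
  qed simp
  finally show ?thesis .
qed

section \<open>From Riesz means to the semicircle weight\<close>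

locale semicircle =
  fixes T :: real
  assumes T: "2 \<le> T"
begin

text \<open>Cutoff one unit before the end: the second derivative of \<open>G\<close> is not
  integrable up to \<open>T\<close>, whereas up to \<open>b\<close> its integral is the slope there,
  at most \<open>sqrt T\<close>.\<close>

definition b where "b = T - 1"
definition d where "d y = T^2 - y\<^sup>2"
definition G where "G y = sqrt (d y)"
definition G1 where "G1 y = - y / sqrt (d y)"
definition G2 where "G2 y = - (T^2) / (d y * sqrt (d y))"

lemma d_pos: "0 \<le> y \<Longrightarrow> y \<le> b \<Longrightarrow> 0 < d y"
proof -
  assume "0 \<le> y" "y \<le> b"
  hence "y^2 \<le> b^2" by (intro power_mono) auto
  moreover have "b^2 < T\<^sup>2" using T by (intro power_strict_mono) (auto simp: b_def)
  ultimately show ?thesis by (simp add: d_def)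
qed

lemma d_deriv: "(d has_real_derivative - (2 * y)) (at y within A)"
  unfolding d_def[abs_def] by (auto intro!: derivative_eq_intros)

lemma sqrt_d_deriv:
  assumes "0 \<le> y" "y \<le> b"
  shows "((\<lambda>y. sqrt (d y)) has_real_derivative - y / sqrt (d y)) (at y within A)"
proof -
  have "((\<lambda>y. sqrt (d y)) has_real_derivative inverse (sqrt (d y)) / 2 * - (2 * y)) (at y within A)"
    by (rule DERIV_chain2[OF DERIV_real_sqrt[OF d_pos[OF assms]] d_deriv])
  moreover have "inverse (sqrt (d y)) / 2 * - (2 * y) = - y / sqrt (d y)"
    using d_pos[OF assms] by (simp add: field_simps)
  ultimately show ?thesis by (simp only:)
qed

lemma G_deriv: "0 \<le> y \<Longrightarrow> y \<le> b \<Longrightarrow> (G has_real_derivative G1 y) (at y within A)"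
  unfolding G_def[abs_def] G1_def by (rule sqrt_d_deriv)

lemma G1_deriv:
  assumes y: "0 \<le> y" "y \<le> b"
  shows "(G1 has_real_derivative G2 y) (at y within A)"
proof -
  define r where "r = sqrt (d y)"
  have r: "0 < r" "r * r = d y" "r^2 = T^2 - y\<^sup>2" using d_pos[OF y] by (auto simp: r_def d_def)
  have "((\<lambda>y. - y / sqrt (d y)) has_real_derivative ((- 1) * r - (- y) * (- y / r)) / (r * r)) (at y within A)"
    unfolding r_def by (rule DERIV_divide[OF DERIV_minus[OF DERIV_ident] sqrt_d_deriv[OF y]]) (use r in \<open>simp add: r_def\<close>)
  moreover have "((- 1) * r - (- y) * (- y / r)) / (r * r) = - (r^2 + y^2) / (r * r * r)"
    using r(1) by (simp add: field_simps power2_eq_square)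
  moreover have "G2 y = - (r^2 + y^2) / (r * r * r)"
  proof -
    have e: "sqrt (d y) = r" "d y = r * r" "T^2 = r^2 + y^2" using r by (auto simp: r_def)
    show ?thesis unfolding G2_def e(1) unfolding e(2,3) by simp
  qed
  ultimately show ?thesis unfolding G1_def[abs_def] by (simp only:)
qed

lemma continuous_G: "continuous_on {0..T} G"
  unfolding G_def[abs_def] d_def[abs_def] by (intro continuous_intros)

lemma continuous_G2: "continuous_on {0..b} G2"
  unfolding G2_def[abs_def] d_def[abs_def]
proof (intro continuous_intros ballI)
  fix x assume "x \<in> {0..b}"
  hence "0 < d x" using d_pos by auto
  thus "(T^2 - x\<^sup>2) * sqrt (T^2 - x\<^sup>2) \<noteq> 0" by (simp add: d_def)
qed

lemma G_bounds: "G b \<le> 2 * sqrt T" "0 \<le> G b" "\<bar>G1 b\<bar> \<le> sqrt T"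
proof -
  have db: "d b = 2 * T - 1" by (simp add: d_def b_def power2_eq_square algebra_simps)
  have "sqrt (d b) \<le> sqrt (4 * T)" unfolding db using T by (intro real_sqrt_le_mono) auto
  thus "G b \<le> 2 * sqrt T" by (simp add: G_def real_sqrt_mult)
  show "0 \<le> G b" using T db by (simp add: G_def)
  have 1: "sqrt T \<le> sqrt (d b)" unfolding db using T by (intro real_sqrt_le_mono) auto
  have "\<bar>G1 b\<bar> = b / sqrt (d b)" using T db by (simp add: G1_def abs_divide) (simp add: b_def)
  also have "\<dots> \<le> T / sqrt T" using 1 T by (intro frac_le) (auto simp: b_def)
  also have "\<dots> = sqrt T" using T by (intro real_div_sqrt) auto
  finally show "\<bar>G1 b\<bar> \<le> sqrt T" .
qed

lemma G_antimono: "0 \<le> x \<Longrightarrow> x \<le> y \<Longrightarrow> G y \<le> G x"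
  unfolding G_def d_def by (intro real_sqrt_le_mono) (simp add: power_mono)

text \<open>A superposition of the hat functions \<open>max 0 (y - m)\<close>, whose sums against
  \<open>sq_reps n\<close> are Riesz means. Below \<open>b\<close> it is Taylor's formula for
  \<open>G\<close> at \<open>b\<close> with integral remainder; the first two coefficients make it
  continue linearly from \<open>G b\<close> to 0 at \<open>T\<close>.\<close>

definition f :: "nat \<Rightarrow> real" where
  "f m = G b * max 0 (T - real m) + (- G b - G1 b) * max 0 (b - real m) + integral {0..b} (\<lambda>y. G2 y * max 0 (y - real m))"

lemma f_below:
  assumes "real m \<le> b"
  shows "f m = G m"
proof -
  have "((\<lambda>y. G2 y * max 0 (y - real m)) has_integral 0) {0..real m}"
    by (rule has_integral_is_0) auto
  moreover have "((\<lambda>y. G2 y * max 0 (y - real m)) has_integral (G1 b * (b - real m) - G b) - (G1 m * (m - real m) - G m)) {real m..b}"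
  proof (rule has_integral_eq)
    show "((\<lambda>y. G2 y * (y - real m)) has_integral (G1 b * (b - real m) - G b) - (G1 m * (m - real m) - G m)) {real m..b}"
    proof (rule fundamental_theorem_of_calculus)
      fix y assume y: "y \<in> {real m..b}"
      have "((\<lambda>y. G1 y * (y - real m) - G y) has_real_derivative (G2 y * (y - real m) + (1 - 0) * G1 y) - G1 y) (at y within {real m..b})"
        using y by (intro DERIV_diff DERIV_mult G1_deriv G_deriv DERIV_ident DERIV_const) auto
      thus "((\<lambda>y. G1 y * (y - real m) - G y) has_vector_derivative G2 y * (y - real m)) (at y within {real m..b})"
        by (simp add: has_real_derivative_iff_has_vector_derivative)
    qed (use assms in simp)
  qed auto
  ultimately have "((\<lambda>y. G2 y * max 0 (y - real m)) has_integral 0 + ((G1 b * (b - real m) - G b) - (G1 m * (m - real m) - G m))) {0..b}"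
    by (rule has_integral_combine[rotated 2]) (use assms in auto)
  hence "integral {0..b} (\<lambda>y. G2 y * max 0 (y - real m)) = G1 b * (b - real m) - G b + G m" by (simp add: integral_unique)
  thus ?thesis using assms by (simp add: f_def b_def algebra_simps)
qed

lemma f_above:
  assumes "b < real m" "real m \<le> T"
  shows "\<bar>G m - f m\<bar> \<le> G b"
proof -
  have "integral {0..b} (\<lambda>y. G2 y * max 0 (y - real m)) = 0"
    by (rule integral_unique, rule has_integral_is_0) (use assms in auto)
  hence "f m = G b * (T - real m)" using assms by (simp add: f_def)
  moreover have "G b * (T - real m) \<le> G b * 1" using assms G_bounds by (intro mult_left_mono) (auto simp: b_def)
  moreover have "0 \<le> G b * (T - real m)" using assms G_bounds by simp
  moreover have "G m \<le> G b" using assms T by (intro G_antimono) (auto simp: b_def)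
  moreover have "0 \<le> G m" unfolding G_def d_def using assms by (simp add: power_mono)
  ultimately show ?thesis by linarith
qed

lemma sum_f:
  "(\<Sum>m\<le>nat \<lfloor>T\<rfloor>. sq_reps n m * f m)
    = G b * riesz n T + (- G b - G1 b) * riesz n b + integral {0..b} (\<lambda>y. G2 y * riesz n y)"
proof -
  define N where "N = nat \<lfloor>T\<rfloor>"
  have b: "0 \<le> b" "b \<le> T" using T by (auto simp: b_def)
  have "integral {0..b} (\<lambda>y. G2 y * riesz n y) = integral {0..b} (\<lambda>y. \<Sum>m\<le>N. sq_reps n m * (G2 y * max 0 (y - real m)))"
    by (rule integral_cong) (use b in \<open>auto simp: riesz_eq_sum_max[of _ T] N_def sum_distrib_left mult_ac\<close>)
  also have "\<dots> = (\<Sum>m\<le>N. integral {0..b} (\<lambda>y. sq_reps n m * (G2 y * max 0 (y - real m))))"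
    by (intro integral_sum integrable_continuous_interval continuous_intros continuous_G2) auto
  also have "\<dots> = (\<Sum>m\<le>N. sq_reps n m * integral {0..b} (\<lambda>y. G2 y * max 0 (y - real m)))" by simp
  finally show ?thesis
    using b T by (simp add: f_def riesz_eq_sum_max[of _ T] N_def[symmetric] distrib_left sum.distrib sum_distrib_left mult_ac)
qed

lemma integral_G2: "((\<lambda>y. \<bar>G2 y\<bar>) has_integral \<bar>G1 b\<bar>) {0..b}"
proof -
  have b: "0 \<le> b" using T by (simp add: b_def)
  have "(G2 has_integral (G1 b - G1 0)) {0..b}"
    by (rule fundamental_theorem_of_calculus[OF b]) (auto intro: G1_deriv simp flip: has_real_derivative_iff_has_vector_derivative)
  hence "((\<lambda>y. - G2 y) has_integral - (G1 b - G1 0)) {0..b}" by (rule has_integral_neg)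
  moreover have "- (G1 b - G1 0) = \<bar>G1 b\<bar>" using b d_pos[OF b] by (simp add: G1_def)
  moreover have "- G2 y = \<bar>G2 y\<bar>" if "y \<in> {0..b}" for y using d_pos[of y] that by (simp add: G2_def)
  ultimately show ?thesis using has_integral_eq[of "{0..b}" "\<lambda>y. - G2 y" "\<lambda>y. \<bar>G2 y\<bar>"] by metis
qed

text \<open>The double integration by parts is undone with the power \<open>y ^ (q + 1)\<close> in
  place of the Riesz mean, which recovers the integral of \<open>G\<close> against its second
  derivative \<open>p2\<close>. What is left concerns only \<open>[b, T]\<close>: an integral over
  unit length and a second order Taylor remainder, each at most \<open>G b * p2 T\<close>.\<close>

lemma smoothed_main_term:
  fixes q :: nat
  assumes q: "1 \<le> q"
  defines "p2 \<equiv> \<lambda>y. real (q + 1) * real q * y ^ (q - 1)"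
  shows "\<bar>G b * T ^ (q + 1) + (- G b - G1 b) * b ^ (q + 1) + integral {0..b} (\<lambda>y. G2 y * y ^ (q + 1))
     - integral {0..T} (\<lambda>y. G y * p2 y)\<bar> \<le> 2 * G b * p2 T"
proof -
  have b: "0 \<le> b" "b \<le> T" using T by (auto simp: b_def)
  define p1 where "p1 y = real (q + 1) * y ^ q" for y :: real
  have pd: "((\<lambda>y. y ^ (q + 1)) has_real_derivative p1 y) (at y within A)" "(p1 has_real_derivative p2 y) (at y within A)" for y :: real and A
    unfolding p1_def[abs_def] p2_def
    by (rule DERIV_cong[OF DERIV_pow], simp) (rule DERIV_cong[OF DERIV_cmult[OF DERIV_pow]], simp)
  have cp2: "continuous_on A p2" for A unfolding p2_def by (intro continuous_intros)
  have "((\<lambda>y. G2 y * y ^ (q + 1) - G y * p2 y) has_integral (G1 b * b ^ (q + 1) - G b * p1 b) - (G1 0 * 0 ^ (q + 1) - G 0 * p1 0)) {0..b}"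
  proof (rule fundamental_theorem_of_calculus[OF b(1)])
    fix y assume y: "y \<in> {0..b}"
    have "((\<lambda>y. G1 y * y ^ (q + 1) - G y * p1 y) has_real_derivative (G2 y * y ^ (q + 1) + p1 y * G1 y) - (G1 y * p1 y + p2 y * G y)) (at y within {0..b})"
      using y by (intro DERIV_diff DERIV_mult pd G1_deriv G_deriv) auto
    thus "((\<lambda>y. G1 y * y ^ (q + 1) - G y * p1 y) has_vector_derivative G2 y * y ^ (q + 1) - G y * p2 y) (at y within {0..b})"
      by (simp add: has_real_derivative_iff_has_vector_derivative mult_ac)
  qed
  hence "integral {0..b} (\<lambda>y. G2 y * y ^ (q + 1) - G y * p2 y) = G1 b * b ^ (q + 1) - G b * p1 b"
    using q by (simp add: integral_unique p1_def)
  moreover have "integral {0..b} (\<lambda>y. G2 y * y ^ (q + 1) - G y * p2 y) = integral {0..b} (\<lambda>y. G2 y * y ^ (q + 1)) - integral {0..b} (\<lambda>y. G y * p2 y)"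
    by (intro integral_diff integrable_continuous_interval continuous_intros continuous_G2 cp2 continuous_on_subset[OF continuous_G]) (use b in auto)
  moreover have "integral {0..b} (\<lambda>y. G y * p2 y) + integral {b..T} (\<lambda>y. G y * p2 y) = integral {0..T} (\<lambda>y. G y * p2 y)"
    by (intro Henstock_Kurzweil_Integration.integral_combine b integrable_continuous_interval continuous_intros continuous_G cp2)
  ultimately have eq: "G b * T ^ (q + 1) + (- G b - G1 b) * b ^ (q + 1) + integral {0..b} (\<lambda>y. G2 y * y ^ (q + 1))
     - integral {0..T} (\<lambda>y. G y * p2 y) = G b * (T ^ (q + 1) - b ^ (q + 1) - p1 b) - integral {b..T} (\<lambda>y. G y * p2 y)"
    by (simp add: algebra_simps)
  have p2m: "p2 x \<le> p2 y" "0 \<le> p2 x" if "0 \<le> x" "x \<le> y" for x y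
    using that by (auto simp: p2_def intro!: mult_left_mono power_mono)
  have "0 \<le> integral {b..T} (\<lambda>y. G y * p2 y)"
    by (intro integral_nonneg integrable_continuous_interval continuous_intros cp2 continuous_on_subset[OF continuous_G])
       (use b p2m in \<open>auto intro!: mult_nonneg_nonneg simp: G_def d_def power_mono\<close>)
  moreover have "integral {b..T} (\<lambda>y. G y * p2 y) \<le> G b * p2 T"
  proof -
    have "integral {b..T} (\<lambda>y. G y * p2 y) \<le> integral {b..T} (\<lambda>y. G b * p2 T)"
    proof (intro integral_le integrable_continuous_interval continuous_intros cp2 continuous_on_subset[OF continuous_G])
      fix y assume "y \<in> {b..T}"
      thus "G y * p2 y \<le> G b * p2 T" using b G_bounds p2m[of y T] by (intro mult_mono G_antimono) auto
    qed (use b in auto)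
    thus ?thesis by (simp add: b_def)
  qed
  moreover have "0 \<le> T ^ (q + 1) - b ^ (q + 1) - p1 b \<and> T ^ (q + 1) - b ^ (q + 1) - p1 b \<le> p2 T"
  proof -
    have bT: "b < T" by (simp add: b_def)
    obtain z where z: "b < z" "z < T" "T ^ (q + 1) - b ^ (q + 1) = (T - b) * p1 z"
      using MVT2[OF bT, of "\<lambda>y. y ^ (q + 1)" p1] pd by auto
    obtain w where w: "b < w" "w < z" "p1 z - p1 b = (z - b) * p2 w"
      using MVT2[OF z(1), of p1 p2] pd by auto
    have "(z - b) * p2 w \<le> 1 * p2 T" using z w b p2m[of w T] by (intro mult_mono) (auto simp: b_def)
    moreover have "0 \<le> (z - b) * p2 w" using z w b p2m[of w w] by simp
    moreover have "T ^ (q + 1) - b ^ (q + 1) = p1 z" using z by (simp add: b_def)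
    ultimately show ?thesis using w by linarith
  qed
  hence "0 \<le> G b * (T ^ (q + 1) - b ^ (q + 1) - p1 b)" "G b * (T ^ (q + 1) - b ^ (q + 1) - p1 b) \<le> G b * p2 T"
    using G_bounds by (auto intro: mult_left_mono)
  ultimately show ?thesis unfolding eq by linarith
qed

lemma integral_scaling:
  fixes q :: nat
  assumes q: "1 \<le> q"
  shows "integral {0..T} (\<lambda>y. G y * (real (q + 1) * real q * y ^ (q - 1)))
    = T ^ (q + 1) * integral {0..1} (\<lambda>v. sqrt (1 - v\<^sup>2) * (real (q + 1) * real q * v ^ (q - 1)))"
proof -
  define h where "h y = G y * (real (q + 1) * real q * y ^ (q - 1))" for y
  have T0: "0 < T" using T by simp
  have "(h has_integral integral {0..T} h) {0..T}"
    unfolding h_def[abs_def] by (intro integrable_integral integrable_continuous_interval continuous_intros continuous_G)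
  from has_integral_stretch_real[OF this, of T]
  have "((\<lambda>x. h (T * x)) has_integral (1 / T) * integral {0..T} h) ((\<lambda>x. x / T) ` {0..T})" using T0 by simp
  also have "(\<lambda>x. x / T) ` {0..T} = {0..1}"
  proof -
    have "x \<in> (\<lambda>x. x / T) ` {0..T}" if "x \<in> {0..1}" for x
      using that T0 by (intro image_eqI[of _ _ "x * T"]) (auto simp: mult_le_cancel_right1)
    moreover have "x / T \<in> {0..1}" if "x \<in> {0..T}" for x using that T0 by simp
    ultimately show ?thesis by blast
  qed
  finally have 1: "((\<lambda>x. h (T * x)) has_integral (1 / T) * integral {0..T} h) {0..1}" .
  have "h (T * x) = T ^ q * (sqrt (1 - x\<^sup>2) * (real (q + 1) * real q * x ^ (q - 1)))" for x
  proof -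
    have "d (T * x) = T^2 * (1 - x\<^sup>2)" by (simp add: d_def power_mult_distrib algebra_simps)
    hence "G (T * x) = T * sqrt (1 - x\<^sup>2)" using T0 by (simp add: G_def real_sqrt_mult)
    moreover have "T ^ q = T * T ^ (q - 1)" using q by (simp flip: power_Suc)
    ultimately show ?thesis by (simp add: h_def power_mult_distrib mult_ac)
  qed
  hence "integral {0..1} (\<lambda>x. h (T * x)) = T ^ q * integral {0..1} (\<lambda>v. sqrt (1 - v\<^sup>2) * (real (q + 1) * real q * v ^ (q - 1)))"
    by (simp only: integral_mult_right)
  hence "(1 / T) * integral {0..T} h = T ^ q * integral {0..1} (\<lambda>v. sqrt (1 - v\<^sup>2) * (real (q + 1) * real q * v ^ (q - 1)))"
    using 1 by (simp add: integral_unique)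
  hence "integral {0..T} h = T ^ (q + 1) * integral {0..1} (\<lambda>v. sqrt (1 - v\<^sup>2) * (real (q + 1) * real q * v ^ (q - 1)))"
    using T0 by (simp add: field_simps)
  thus ?thesis by (simp add: h_def[abs_def])
qed

end

text \<open>The Riesz error \<open>T powr (q - 9/10)\<close> is multiplied by \<open>G b\<close>, by
  the slope at \<open>b\<close> and by the integral of the second derivative up to \<open>b\<close>,
  all of order \<open>sqrt T\<close>; hence the exponent \<open>q - 4/10\<close>. Replacing
  \<open>G\<close> by \<open>f\<close> changes only the term of the last integer
  \<open>m\<close>.\<close>

theorem even_squares_main_term:
  assumes q: "3 \<le> q"
  shows "\<exists>A C. 0 \<le> C \<and> (\<forall>T. 2 \<le> T \<longrightarrow>
     \<bar>(\<Sum>m\<le>nat \<lfloor>T\<rfloor>. sq_reps (2 * q) m * sqrt (T^2 - (real m)^2)) - A * T ^ (q + 1)\<bar> \<le> C * T powr (real q - 4/10))"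
proof -
  have "6 \<le> 2 * q" using q by simp
  from riesz_asymptotic[OF this] obtain V C where C: "0 \<le> C" and R0: "\<And>T y. 1 \<le> T \<Longrightarrow> 0 \<le> y \<Longrightarrow> y \<le> T \<Longrightarrow>
    \<bar>riesz (2 * q) y - V * y powr (real (2 * q) / 2 + 1)\<bar> \<le> C * T powr (real (2 * q) / 2 - 9/10)"
    by auto
  have R: "\<bar>riesz (2 * q) y - V * y ^ (q + 1)\<bar> \<le> C * T powr (real q - 9/10)" if "1 \<le> T" "0 \<le> y" "y \<le> T" for T y
  proof -
    have "y powr (real (2 * q) / 2 + 1) = y ^ (q + 1)"
    proof (cases "y = 0")
      case False
      have "real (2 * q) / 2 + 1 = real (q + 1)" by simp
      thus ?thesis using False that by (simp only: powr_realpow)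
    qed simp
    thus ?thesis using R0[OF that] by simp
  qed
  define I where "I = integral {0..1} (\<lambda>v. sqrt (1 - v\<^sup>2) * (real (q + 1) * real q * v ^ (q - 1)))"
  \<comment> \<open>The three summands belong to the last integer, to the Riesz errors, and to
    \<open>smoothed_main_term\<close>.\<close>
  define K where "K = 9 ^ (q - 3) * 80 + 6 * C + \<bar>V\<bar> * (4 * real (q + 1) * real q)"
  have main: "\<bar>(\<Sum>m\<le>nat \<lfloor>T\<rfloor>. sq_reps (2 * q) m * sqrt (T^2 - (real m)^2)) - V * I * T ^ (q + 1)\<bar> \<le> K * T powr (real q - 4/10)"
    if T2: "2 \<le> T" for T
  proof -
    interpret semicircle T using T2 by unfold_locales
    define r where "r m = sq_reps (2 * q) m" for m
    define N where "N = nat \<lfloor>T\<rfloor>"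
    define M where "M = riesz (2 * q)"
    define E where "E = C * T powr (real q - 9/10)"
    have T1: "1 \<le> T" and b: "0 \<le> b" "b \<le> T" using T2 by (auto simp: b_def)
    have N: "real N \<le> T" "b < real N" using T2 unfolding N_def b_def by linarith+
    have ME: "\<bar>M y - V * y ^ (q + 1)\<bar> \<le> E" if "0 \<le> y" "y \<le> T" for y unfolding M_def E_def by (rule R[OF T1 that])
    have r0: "0 \<le> r m" for m unfolding r_def by (rule fps_nth_theta_power_nonneg)
    have exps: "sqrt T * T powr (real q - 1) \<le> T powr (real q - 4/10)" "sqrt T * T powr (real q - 9/10) = T powr (real q - 4/10)"
      using T1 by (auto simp: powr_half_sqrt[symmetric] powr_add[symmetric] intro: powr_mono)
    have "\<bar>(\<Sum>m\<le>N. r m * G m) - (\<Sum>m\<le>N. r m * f m)\<bar> \<le> 9 ^ (q - 3) * 80 * T powr (real q - 4/10)"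
    proof -
      have "(\<Sum>m\<le>N. r m * G m) - (\<Sum>m\<le>N. r m * f m) = (\<Sum>m\<le>N. r m * (G m - f m))" by (simp add: right_diff_distrib sum_subtractf)
      also have "\<dots> = (\<Sum>m\<in>{N}. r m * (G m - f m))"
      proof (rule sum.mono_neutral_right)
        show "\<forall>m\<in>{..N} - {N}. r m * (G m - f m) = 0"
        proof
          fix m assume "m \<in> {..N} - {N}"
          hence "m + 1 \<le> N" by auto
          hence "real m \<le> b" using N by (simp add: b_def)
          thus "r m * (G m - f m) = 0" by (simp add: f_below)
        qed
      qed auto
      also have "\<bar>\<dots>\<bar> \<le> (9 ^ (q - 3) * 40 * T powr (real q - 1)) * (2 * sqrt T)"
      proof -
        have "r N \<le> 9 ^ (q - 3) * 40 * T powr (real q - 1)" unfolding r_def by (rule theta_power_coeff_le[OF q T1 N(1)])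
        moreover have "\<bar>G N - f N\<bar> \<le> 2 * sqrt T" using f_above[OF N(2,1)] G_bounds by linarith
        moreover have "(\<Sum>m\<in>{N}. r m * (G m - f m)) = r N * (G N - f N)" by simp
        ultimately show ?thesis unfolding abs_mult[of "r N"] using r0[of N]
          by (simp only: abs_mult abs_of_nonneg) (rule mult_mono, auto)
      qed
      also have "\<dots> = 9 ^ (q - 3) * 80 * (sqrt T * T powr (real q - 1))" by simp
      also have "\<dots> \<le> 9 ^ (q - 3) * 80 * T powr (real q - 4/10)" by (intro mult_left_mono exps) auto
      finally show ?thesis .
    qed
    moreover have "\<bar>(\<Sum>m\<le>N. r m * f m) - V * (G b * T ^ (q + 1) + (- G b - G1 b) * b ^ (q + 1) + integral {0..b} (\<lambda>y. G2 y * y ^ (q + 1)))\<bar> \<le> 6 * C * T powr (real q - 4/10)"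
    proof -
      have cM: "continuous_on {0..b} M"
      proof -
        have "continuous_on {0..b} (\<lambda>y. \<Sum>m\<le>N. r m * max 0 (y - real m))" by (intro continuous_intros)
        thus ?thesis by (rule continuous_on_eq) (use b in \<open>simp add: M_def r_def N_def riesz_eq_sum_max[of _ T]\<close>)
      qed
      have iM: "(\<lambda>y. G2 y * (M y - V * y ^ (q + 1))) integrable_on {0..b}"
        by (intro integrable_continuous_interval continuous_intros continuous_G2 cM)
      have "\<bar>integral {0..b} (\<lambda>y. G2 y * (M y - V * y ^ (q + 1)))\<bar> \<le> integral {0..b} (\<lambda>y. \<bar>G2 y\<bar> * E)"
        unfolding real_norm_def[symmetric]
      proof (rule integral_norm_bound_integral[OF iM])
        show "(\<lambda>y. norm (G2 y) * E) integrable_on {0..b}" by (intro integrable_continuous_interval continuous_intros continuous_G2)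
        fix y assume "y \<in> {0..b}"
        thus "norm (G2 y * (M y - V * y ^ (q + 1))) \<le> norm (G2 y) * E"
          unfolding norm_mult using ME[of y] b by (intro mult_left_mono) auto
      qed
      also have "\<dots> = \<bar>G1 b\<bar> * E" using integral_unique[OF integral_G2] by simp
      finally have i: "\<bar>integral {0..b} (\<lambda>y. G2 y * (M y - V * y ^ (q + 1)))\<bar> \<le> \<bar>G1 b\<bar> * E" .
      have "integral {0..b} (\<lambda>y. G2 y * (M y - V * y ^ (q + 1))) = integral {0..b} (\<lambda>y. G2 y * M y) - V * integral {0..b} (\<lambda>y. G2 y * y ^ (q + 1))"
      proof -
        have "integral {0..b} (\<lambda>y. G2 y * (M y - V * y ^ (q + 1))) = integral {0..b} (\<lambda>y. G2 y * M y - V * (G2 y * y ^ (q + 1)))"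
          by (simp add: algebra_simps)
        also have "\<dots> = integral {0..b} (\<lambda>y. G2 y * M y) - integral {0..b} (\<lambda>y. V * (G2 y * y ^ (q + 1)))"
          by (intro integral_diff integrable_continuous_interval continuous_intros continuous_G2 cM)
        finally show ?thesis by simp
      qed
      hence "(\<Sum>m\<le>N. r m * f m) - V * (G b * T ^ (q + 1) + (- G b - G1 b) * b ^ (q + 1) + integral {0..b} (\<lambda>y. G2 y * y ^ (q + 1)))
         = G b * (M T - V * T ^ (q + 1)) + (- G b - G1 b) * (M b - V * b ^ (q + 1)) + integral {0..b} (\<lambda>y. G2 y * (M y - V * y ^ (q + 1)))"
        using sum_f[of "2 * q"] by (simp add: r_def M_def N_def algebra_simps)
      also have "\<bar>\<dots>\<bar> \<le> G b * E + (G b + \<bar>G1 b\<bar>) * E + \<bar>G1 b\<bar> * E"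
      proof -
        have "\<bar>G b * (M T - V * T ^ (q + 1))\<bar> \<le> G b * E" unfolding abs_mult using ME[of T] T1 G_bounds by (intro mult_mono) auto
        moreover have "\<bar>(- G b - G1 b) * (M b - V * b ^ (q + 1))\<bar> \<le> (G b + \<bar>G1 b\<bar>) * E"
          unfolding abs_mult using ME[of b] b G_bounds by (intro mult_mono) auto
        ultimately show ?thesis using i by linarith
      qed
      also have "\<dots> = (2 * G b + 2 * \<bar>G1 b\<bar>) * E" by (simp add: algebra_simps)
      also have "\<dots> \<le> (6 * sqrt T) * E" using G_bounds C by (intro mult_right_mono) (auto simp: E_def)
      also have "\<dots> = 6 * C * (sqrt T * T powr (real q - 9/10))" by (simp add: E_def)
      finally show ?thesis unfolding exps .
    qed
    moreover have "\<bar>V * (G b * T ^ (q + 1) + (- G b - G1 b) * b ^ (q + 1) + integral {0..b} (\<lambda>y. G2 y * y ^ (q + 1))) - V * I * T ^ (q + 1)\<bar>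
       \<le> \<bar>V\<bar> * (4 * real (q + 1) * real q) * T powr (real q - 4/10)"
    proof -
      have q1: "1 \<le> q" using q by simp
      define Z where "Z = G b * T ^ (q + 1) + (- G b - G1 b) * b ^ (q + 1) + integral {0..b} (\<lambda>y. G2 y * y ^ (q + 1))"
      have "\<bar>Z - I * T ^ (q + 1)\<bar> \<le> 2 * G b * (real (q + 1) * real q * T ^ (q - 1))"
        using smoothed_main_term[OF q1] unfolding integral_scaling[OF q1] Z_def I_def by (simp only: mult.commute)
      also have "\<dots> \<le> 2 * (2 * sqrt T) * (real (q + 1) * real q * T ^ (q - 1))"
        using G_bounds T1 by (intro mult_right_mono mult_left_mono) auto
      also have "T ^ (q - 1) = T powr (real q - 1)"
      proof -
        have "T powr (real q - 1) = T powr real (q - 1)" using q by simp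
        thus ?thesis using T1 by (simp add: powr_realpow)
      qed
      also have "2 * (2 * sqrt T) * (real (q + 1) * real q * T powr (real q - 1)) = (4 * real (q + 1) * real q) * (sqrt T * T powr (real q - 1))"
        by simp
      also have "\<dots> \<le> (4 * real (q + 1) * real q) * T powr (real q - 4/10)" by (intro mult_left_mono exps) auto
      finally have 1: "\<bar>Z - I * T ^ (q + 1)\<bar> \<le> (4 * real (q + 1) * real q) * T powr (real q - 4/10)" .
      have "\<bar>V * Z - V * I * T ^ (q + 1)\<bar> = \<bar>V\<bar> * \<bar>Z - I * T ^ (q + 1)\<bar>"
        unfolding mult.assoc right_diff_distrib[symmetric] abs_mult ..
      also have "\<dots> \<le> \<bar>V\<bar> * ((4 * real (q + 1) * real q) * T powr (real q - 4/10))" by (intro mult_left_mono 1) auto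
      finally show ?thesis unfolding Z_def by (simp only: mult.assoc)
    qed
    ultimately have "\<bar>(\<Sum>m\<le>N. r m * G m) - V * I * T ^ (q + 1)\<bar> \<le> 9 ^ (q - 3) * 80 * T powr (real q - 4/10)
       + 6 * C * T powr (real q - 4/10) + \<bar>V\<bar> * (4 * real (q + 1) * real q) * T powr (real q - 4/10)" by linarith
    also have "\<dots> = K * T powr (real q - 4/10)" by (simp only: K_def distrib_right)
    finally show ?thesis by (simp only: r_def N_def G_def d_def)
  qed
  show ?thesis using C by (intro exI[of _ "V * I"] exI[of _ K] conjI allI impI main) (auto simp: K_def)
qed

section \<open>Lattice points and volume\<close>

abbreviation "lattice_ball q t \<equiv> heis_lattice q \<inter> ck_ball q t"

definition int_points :: "nat \<Rightarrow> nat \<Rightarrow> (nat \<Rightarrow> real) set" where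
  "int_points n N = {v \<in> {..<n} \<rightarrow>\<^sub>E \<int>. (\<Sum>i<n. (v i)^2) \<le> real N}"

lemma sum_int_points:
  "finite (int_points n N) \<and> (\<Sum>v\<in>int_points n N. g (\<Sum>i<n. (v i)^2)) = (\<Sum>m\<le>N. sq_reps n m * g (real m))"
  for g :: "real \<Rightarrow> real"
proof (induction n arbitrary: N g)
  case 0
  have "int_points 0 N = {\<lambda>_. undefined}" by (auto simp: int_points_def)
  moreover have "(\<Sum>m\<le>N. sq_reps 0 m * g (real m)) = (\<Sum>m\<in>{0}. sq_reps 0 m * g (real m))"
    by (rule sum.mono_neutral_right) auto
  ultimately show ?case by simp
next
  case (Suc n)
  define D where "D = Sigma (sq_ints N) (\<lambda>k. int_points n (N - nat (k^2)))"
  have bij: "bij_betw (\<lambda>(k, v). v(n := real_of_int k)) D (int_points (Suc n) N)"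
  \<comment> \<open>Removing the last coordinate resets it to \<open>undefined\<close>, the value
    that extensionality prescribes outside the smaller index set.\<close>
  proof (rule bij_betwI[where g = "\<lambda>v. (\<lfloor>v n\<rfloor>, v(n := undefined))"])
    show "(\<lambda>(k, v). v(n := real_of_int k)) \<in> D \<rightarrow> int_points (Suc n) N"
    proof
      fix p assume "p \<in> D"
      then obtain k v where p: "p = (k, v)" "k \<in> sq_ints N" "v \<in> int_points n (N - nat (k^2))" by (auto simp: D_def)
      have k: "(real_of_int k)^2 \<le> real N" using p(2) unfolding sq_ints_def by (metis mem_Collect_eq of_int_le_iff of_int_of_nat_eq of_int_power)
      have "nat (k^2) \<le> N" using p(2) by (simp add: sq_ints_def)
      hence "real (N - nat (k^2)) = real N - (real_of_int k)^2" by (simp add: of_nat_diff of_nat_nat)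
      moreover have "(\<Sum>i<n. ((v(n := real_of_int k)) i)^2) = (\<Sum>i<n. (v i)^2)" by (rule sum.cong) auto
      ultimately show "(case p of (k, v) \<Rightarrow> v(n := real_of_int k)) \<in> int_points (Suc n) N"
        using p k by (auto simp: int_points_def PiE_iff extensional_def less_Suc_eq)
    qed
    show "(\<lambda>v. (\<lfloor>v n\<rfloor>, v(n := undefined))) \<in> int_points (Suc n) N \<rightarrow> D"
    proof
      fix v assume v: "v \<in> int_points (Suc n) N"
      obtain k where k: "v n = real_of_int k" using v by (auto simp: int_points_def PiE_iff elim: Ints_cases)
      have s: "(\<Sum>i<n. (v i)^2) + (real_of_int k)^2 \<le> real N" using v k by (simp add: int_points_def)
      moreover have "0 \<le> (\<Sum>i<n. (v i)^2)" by (intro sum_nonneg) auto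
      ultimately have "(real_of_int k)^2 \<le> real N" by linarith
      hence k2: "k^2 \<le> int N" by (metis of_int_le_iff of_int_of_nat_eq of_int_power)
      hence "real (N - nat (k^2)) = real N - (real_of_int k)^2" by (simp add: of_nat_diff of_nat_nat nat_le_iff)
      moreover have "(\<Sum>i<n. ((v(n := undefined)) i)^2) = (\<Sum>i<n. (v i)^2)" by (rule sum.cong) auto
      ultimately show "(\<lfloor>v n\<rfloor>, v(n := undefined)) \<in> D"
        using v k k2 s by (auto simp: D_def int_points_def PiE_iff extensional_def sq_ints_def)
    qed
    show "(\<lambda>v. (\<lfloor>v n\<rfloor>, v(n := undefined))) ((\<lambda>(k, v). v(n := real_of_int k)) p) = p" if "p \<in> D" for p
      using that by (auto simp: D_def int_points_def PiE_iff extensional_def fun_eq_iff)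
    show "(\<lambda>(k, v). v(n := real_of_int k)) (\<lfloor>v n\<rfloor>, v(n := undefined)) = v" if "v \<in> int_points (Suc n) N" for v
      using that by (auto simp: int_points_def PiE_iff fun_eq_iff elim!: Ints_cases)
  qed
  have fin: "finite D" unfolding D_def using Suc.IH by (intro finite_SigmaI) auto
  have "(\<Sum>v\<in>int_points (Suc n) N. g (\<Sum>i<Suc n. (v i)^2)) = (\<Sum>(k, v)\<in>D. g ((\<Sum>i<n. (v i)^2) + (real_of_int k)^2))"
  proof (subst sum.reindex_bij_betw[OF bij, symmetric], rule sum.cong)
    fix p assume "p \<in> D"
    obtain k v where p: "p = (k, v)" by force
    have "(\<Sum>i<n. ((v(n := real_of_int k)) i)^2) = (\<Sum>i<n. (v i)^2)" by (rule sum.cong) auto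
    thus "g (\<Sum>i<Suc n. ((case p of (k, v) \<Rightarrow> v(n := real_of_int k)) i)^2) = (case p of (k, v) \<Rightarrow> g ((\<Sum>i<n. (v i)^2) + (real_of_int k)^2))"
      by (simp add: p)
  qed simp
  also have "\<dots> = (\<Sum>k\<in>sq_ints N. \<Sum>v\<in>int_points n (N - nat (k^2)). g ((\<Sum>i<n. (v i)^2) + (real_of_int k)^2))"
    unfolding D_def using Suc.IH by (subst sum.Sigma) auto
  also have "\<dots> = (\<Sum>k\<in>sq_ints N. \<Sum>m\<le>N - nat (k^2). sq_reps n m * g (real (m + nat (k^2))))"
    using Suc.IH[of _ "\<lambda>x. g (x + (real_of_int k)^2)" for k] by (intro sum.cong refl) (simp add: of_nat_nat)
  also have "\<dots> = (\<Sum>j\<le>N. fps_nth theta j * (\<Sum>m\<le>N-j. sq_reps n m * g (real (m + j))))"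
    unfolding atLeast0AtMost[symmetric] by (rule theta_sum[symmetric])
  also have "\<dots> = (\<Sum>m\<le>N. fps_nth (theta ^ Suc n) m * g (real m))" by (simp add: sum_fps_mult)
  finally show ?case using bij_betw_finite[OF bij] fin by simp
qed

lemma ck_norm_le_iff:
  assumes "0 \<le> s"
  shows "ck_norm q (v, w) \<le> s \<longleftrightarrow> (L2_set v {..<2 * q}) ^ 4 + w^2 \<le> s ^ 4"
proof -
  define z where "z = (L2_set v {..<2 * q}) ^ 4 + w^2"
  have z: "0 \<le> z" by (simp add: z_def)
  have 4: "(z powr (1/4)) ^ 4 = z" using z by (cases "z = 0") (auto simp: powr_power)
  have "z powr (1/4) \<le> s \<longleftrightarrow> (z powr (1/4)) ^ 4 \<le> s ^ 4"
    using assms power_mono_iff[of "z powr (1/4)" s 4] by simp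
  thus ?thesis unfolding 4 by (simp add: ck_norm_def z_def)
qed

lemma L2_set_power4: "(L2_set v I) ^ 4 = (\<Sum>i\<in>I. (v i)^2)^2"
proof -
  have "(L2_set v I) ^ 4 = ((L2_set v I)^2)^2" by simp
  thus ?thesis by (simp add: L2_set_def sum_nonneg del: power2_eq_iff)
qed

text \<open>The count \<open>2 * \<lfloor>g\<rfloor> + 1\<close> equals
  \<open>2 * (g - psi g)\<close>; the centred sawtooth absorbs the 1, so no further main term
  appears.\<close>

lemma card_Ints_abs_le:
  assumes "0 \<le> g"
  shows "finite {w \<in> \<int>. \<bar>w\<bar> \<le> (g::real)}" "real (card {w \<in> \<int>. \<bar>w\<bar> \<le> g}) = 2 * (g - psi g)"
proof -
  have eq: "{w \<in> \<int>. \<bar>w\<bar> \<le> g} = real_of_int ` {- \<lfloor>g\<rfloor>..\<lfloor>g\<rfloor>}"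
  proof (intro equalityI subsetI)
    fix w assume "w \<in> {w \<in> \<int>. \<bar>w\<bar> \<le> g}"
    then obtain k where k: "w = real_of_int k" "\<bar>real_of_int k\<bar> \<le> g" by (auto elim: Ints_cases)
    hence "k \<le> \<lfloor>g\<rfloor>" "- k \<le> \<lfloor>g\<rfloor>" unfolding le_floor_iff by auto
    thus "w \<in> real_of_int ` {- \<lfloor>g\<rfloor>..\<lfloor>g\<rfloor>}" using k by auto
  next
    fix w assume "w \<in> real_of_int ` {- \<lfloor>g\<rfloor>..\<lfloor>g\<rfloor>}"
    then obtain k where k: "w = real_of_int k" "k \<le> \<lfloor>g\<rfloor>" "- k \<le> \<lfloor>g\<rfloor>" by auto
    hence "real_of_int k \<le> g" "real_of_int (- k) \<le> g" unfolding le_floor_iff by auto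
    thus "w \<in> {w \<in> \<int>. \<bar>w\<bar> \<le> g}" using k by auto
  qed
  show "finite {w \<in> \<int>. \<bar>w\<bar> \<le> g}" unfolding eq by simp
  have "card {w \<in> \<int>. \<bar>w\<bar> \<le> g} = nat (2 * \<lfloor>g\<rfloor> + 1)" unfolding eq by (subst card_image) (auto simp: inj_on_def)
  moreover have "0 \<le> \<lfloor>g\<rfloor>" using assms by simp
  ultimately have "real (card {w \<in> \<int>. \<bar>w\<bar> \<le> g}) = 2 * real_of_int \<lfloor>g\<rfloor> + 1" by (simp add: of_nat_nat)
  thus "real (card {w \<in> \<int>. \<bar>w\<bar> \<le> g}) = 2 * (g - psi g)" by (simp add: psi_def frac_def)
qed

lemma lattice_count:
  assumes t: "0 < t"
  defines "T \<equiv> t\<^sup>2"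
  shows "finite (lattice_ball q t)"
    and "real (card (lattice_ball q t)) = (\<Sum>m\<le>nat \<lfloor>T\<rfloor>. sq_reps (2 * q) m * (2 * (sqrt (T^2 - (real m)^2) - psi (sqrt (T^2 - (real m)^2)))))"
proof -
  define N where "N = nat \<lfloor>T\<rfloor>"
  define G where "G x = sqrt (T^2 - x\<^sup>2)" for x :: real
  define W where "W v = {w \<in> \<int>. \<bar>w\<bar> \<le> G (\<Sum>i<2*q. (v i)^2)}" for v :: "nat \<Rightarrow> real"
  have T: "0 < T" using t by (simp add: T_def)
  have NT: "real N \<le> T" unfolding N_def using T by linarith
  have eq: "lattice_ball q t = Sigma (int_points (2 * q) N) W"
  proof -
    have "(v, w) \<in> lattice_ball q t \<longleftrightarrow> (v, w) \<in> Sigma (int_points (2 * q) N) W" for v w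
    proof (cases "v \<in> {..<2*q} \<rightarrow>\<^sub>E \<int> \<and> w \<in> \<int>")
      case True
      define x where "x = (\<Sum>i<2*q. (v i)^2)"
      have x0: "0 \<le> x" unfolding x_def by (intro sum_nonneg) auto
      have xZ: "x \<in> \<int>" unfolding x_def using True by (intro Ints_sum Ints_power) (auto simp: PiE_iff)
      have "(v, w) \<in> lattice_ball q t \<longleftrightarrow> x\<^sup>2 + w^2 \<le> T^2"
      proof -
        have "v \<in> {..<2*q} \<rightarrow>\<^sub>E UNIV" using True by auto
        thus ?thesis using True t
          by (simp add: heis_lattice_def ck_ball_def heis_space_def ck_norm_le_iff L2_set_power4 x_def T_def flip: power_mult)
      qed
      also have "\<dots> \<longleftrightarrow> x \<le> real N \<and> \<bar>w\<bar> \<le> G x"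
      proof
        assume a: "x^2 + w^2 \<le> T^2"
        hence "x^2 \<le> T^2" using zero_le_power2[of w] by linarith
        hence "x \<le> T" using T by (simp add: power2_le_iff_abs_le)
        obtain k where k: "x = real_of_int k" using xZ by (auto elim: Ints_cases)
        have "k \<le> \<lfloor>T\<rfloor>" using \<open>x \<le> T\<close> k by (simp add: le_floor_iff)
        hence "x \<le> real N" using x0 k unfolding N_def by (simp add: of_nat_nat)
        moreover have "\<bar>w\<bar> \<le> G x" unfolding G_def using a by (intro real_le_rsqrt) (simp add: power2_abs)
        ultimately show "x \<le> real N \<and> \<bar>w\<bar> \<le> G x" by blast
      next
        assume a: "x \<le> real N \<and> \<bar>w\<bar> \<le> G x"
        hence "x \<le> T" using NT by linarith
        hence "x^2 \<le> T^2" using x0 by (intro power_mono) auto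
        moreover have "\<bar>w\<bar>\<^sup>2 \<le> (G x)^2" using a by (intro power_mono) auto
        ultimately show "x^2 + w^2 \<le> T^2" by (simp add: G_def)
      qed
      also have "\<dots> \<longleftrightarrow> (v, w) \<in> Sigma (int_points (2 * q) N) W" using True by (simp add: int_points_def W_def x_def)
      finally show ?thesis .
    next
      case False
      thus ?thesis by (auto simp: heis_lattice_def int_points_def W_def)
    qed
    hence "p \<in> lattice_ball q t \<longleftrightarrow> p \<in> Sigma (int_points (2 * q) N) W" for p by (cases p) (simp only:)
    thus ?thesis by (intro set_eqI)
  qed
  have fin: "finite (int_points (2 * q) N)" using sum_int_points by blast
  have WG: "finite (W v)" "real (card (W v)) = 2 * (G (\<Sum>i<2*q. (v i)^2) - psi (G (\<Sum>i<2*q. (v i)^2)))"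
    if "v \<in> int_points (2 * q) N" for v
  proof -
    have "(\<Sum>i<2*q. (v i)^2) \<le> T" using that NT by (simp add: int_points_def)
    moreover have "0 \<le> (\<Sum>i<2*q. (v i)^2)" by (intro sum_nonneg) auto
    ultimately have "0 \<le> G (\<Sum>i<2*q. (v i)^2)" unfolding G_def by (simp add: power_mono)
    from card_Ints_abs_le[OF this] show "finite (W v)" "real (card (W v)) = 2 * (G (\<Sum>i<2*q. (v i)^2) - psi (G (\<Sum>i<2*q. (v i)^2)))"
      by (simp_all only: W_def)
  qed
  show "finite (lattice_ball q t)" unfolding eq using fin WG by (intro finite_SigmaI)
  have "real (card (lattice_ball q t)) = (\<Sum>v\<in>int_points (2 * q) N. real (card (W v)))"
    unfolding eq using fin WG by (subst card_SigmaI) auto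
  also have "\<dots> = (\<Sum>v\<in>int_points (2 * q) N. 2 * (G (\<Sum>i<2*q. (v i)^2) - psi (G (\<Sum>i<2*q. (v i)^2))))"
    by (intro sum.cong refl WG)
  also have "\<dots> = (\<Sum>m\<le>N. sq_reps (2 * q) m * (2 * (G (real m) - psi (G (real m)))))"
    using sum_int_points[of "2 * q" N "\<lambda>x. 2 * (G x - psi (G x))"] by blast
  finally show "real (card (lattice_ball q t)) = (\<Sum>m\<le>nat \<lfloor>T\<rfloor>. sq_reps (2 * q) m * (2 * (sqrt (T^2 - (real m)^2) - psi (sqrt (T^2 - (real m)^2)))))"
    by (simp only: G_def N_def)
qed

text \<open>With \<open>T = t^2\<close> the sawtooth part has exponent
  \<open>q - 1 + \<theta>\<close>, and the smooth part fits because \<open>\<theta> > 6/10\<close>.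
  The constant \<open>A\<close> is not yet known to be the volume.\<close>

lemma lattice_count_asymptotic:
  assumes q: "3 \<le> q"
  shows "\<exists>A C. 0 \<le> C \<and> (\<forall>t\<ge>2. \<bar>real (card (lattice_ball q t)) - A * t ^ (2 * q + 2)\<bar> \<le> C * t powr (2 * real q - 2 + 994 / 753))"
proof -
  obtain C1 where C1: "0 < C1" and ps: "\<And>T N. 1 \<le> T \<Longrightarrow> real N \<le> T \<Longrightarrow>
     \<bar>\<Sum>m\<le>N. sq_reps (2 * q) m * psi (sqrt (T^2 - (real m)^2))\<bar> \<le> C1 * T powr (real q - 1 + \<theta>)"
    using even_squares_psi_sum[OF q] by auto
  obtain A C2 where C2: "0 \<le> C2" and ms: "\<And>T. 2 \<le> T \<Longrightarrow>
     \<bar>(\<Sum>m\<le>nat \<lfloor>T\<rfloor>. sq_reps (2 * q) m * sqrt (T^2 - (real m)^2)) - A * T ^ (q + 1)\<bar> \<le> C2 * T powr (real q - 4/10)"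
    using even_squares_main_term[OF q] by auto
  have main: "\<bar>real (card (lattice_ball q t)) - 2 * A * t ^ (2 * q + 2)\<bar> \<le> (2 * C1 + 2 * C2) * t powr (2 * real q - 2 + 994 / 753)"
    if t: "2 \<le> t" for t
  proof -
    define T where "T = t^2"
    define S1 where "S1 = (\<Sum>m\<le>nat \<lfloor>T\<rfloor>. sq_reps (2 * q) m * sqrt (T^2 - (real m)^2))"
    define S2 where "S2 = (\<Sum>m\<le>nat \<lfloor>T\<rfloor>. sq_reps (2 * q) m * psi (sqrt (T^2 - (real m)^2)))"
    have "2 * 2 \<le> t * t" using t by (intro mult_mono) auto
    hence T: "4 \<le> T" by (simp add: T_def power2_eq_square)
    have "real (card (lattice_ball q t)) = 2 * S1 - 2 * S2"
      using lattice_count(2)[of t q] t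
      by (simp add: T_def[symmetric] S1_def S2_def right_diff_distrib sum_subtractf sum_distrib_left mult_ac)
    moreover have "\<bar>S2\<bar> \<le> C1 * T powr (real q - 1 + \<theta>)" unfolding S2_def using T by (intro ps) auto
    moreover have "\<bar>S1 - A * T ^ (q + 1)\<bar> \<le> C2 * T powr (real q - 1 + \<theta>)"
    proof -
      have "\<bar>S1 - A * T ^ (q + 1)\<bar> \<le> C2 * T powr (real q - 4/10)" unfolding S1_def using T by (intro ms) auto
      also have "\<dots> \<le> C2 * T powr (real q - 1 + \<theta>)" using C2 T by (intro mult_left_mono powr_mono) (auto simp: \<theta>_def)
      finally show ?thesis .
    qed
    moreover have "T ^ (q + 1) = t ^ (2 * q + 2)" by (simp add: T_def power_mult[symmetric] del: power_Suc)
    ultimately have "\<bar>real (card (lattice_ball q t)) - 2 * A * t ^ (2 * q + 2)\<bar> \<le> (2 * C1 + 2 * C2) * T powr (real q - 1 + \<theta>)"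
      unfolding distrib_right by (simp only: mult.assoc)
    also have "T powr (real q - 1 + \<theta>) = t powr (2 * real q - 2 + 994 / 753)"
    proof -
      have "T = t powr 2" using t by (simp add: T_def)
      hence "T powr (real q - 1 + \<theta>) = t powr (2 * (real q - 1 + \<theta>))" by (simp only: powr_powr)
      thus ?thesis by (simp add: \<theta>_def algebra_simps)
    qed
    finally show ?thesis .
  qed
  show ?thesis using C1 C2 by (intro exI[of _ "2 * A"] exI[of _ "2 * C1 + 2 * C2"] conjI allI impI main) auto
qed

text \<open>A change of at most 1 in each coordinate moves \<open>|v|\<close> by at most
  \<open>c = sqrt (2 * q)\<close>, hence \<open>|v|^2\<close> by at most
  \<open>D = 2 * c * s + c^2\<close>. The triangle inequality in the plane of
  \<open>(|v|^2, w)\<close> bounds the new squared norm by \<open>s^2 + D + 1\<close>, which is at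
  most \<open>(s + c + 1)^2\<close>. So the norm changes by a constant, whatever the size of the
  ball.\<close>

lemma ck_norm_perturb:
  assumes s: "0 \<le> s" "ck_norm q (v, w) \<le> s"
    and v: "\<And>i. i < 2 * q \<Longrightarrow> \<bar>v' i - v i\<bar> \<le> 1" and w: "\<bar>w' - w\<bar> \<le> 1"
  shows "ck_norm q (v', w') \<le> s + (sqrt (2 * real q) + 1)"
proof -
  define c x x' where "c = sqrt (2 * real q)" and "x = L2_set v {..<2 * q}" and "x' = L2_set v' {..<2 * q}"
  have c0: "0 \<le> c" by (simp add: c_def)
  have x0: "0 \<le> x" "0 \<le> x'" by (simp_all add: x_def x'_def)
  have xs: "x ^ 4 + w^2 \<le> s ^ 4" using s by (simp add: ck_norm_le_iff x_def)
  have s4: "(s^2)^2 = s ^ 4" "(x^2)^2 = x ^ 4" by simp_all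
  hence "x ^ 4 \<le> s ^ 4" using xs zero_le_power2[of w] by linarith
  hence x_le: "x \<le> s" using x0 s power_mono_iff[of x s 4] by simp
  have "x' \<le> x + c"
  proof -
    have "x' = L2_set (\<lambda>i. v i + (v' i - v i)) {..<2 * q}" by (simp add: x'_def)
    also have "\<dots> \<le> x + L2_set (\<lambda>i. v' i - v i) {..<2 * q}" unfolding x_def by (rule L2_set_triangle_ineq)
    also have "L2_set (\<lambda>i. v' i - v i) {..<2 * q} \<le> c"
    proof -
      have "(\<Sum>i<2*q. (v' i - v i)^2) \<le> (\<Sum>i<2*q. 1)" using v by (intro sum_mono) (auto simp: abs_square_le_1)
      thus ?thesis unfolding L2_set_def c_def by (intro real_sqrt_le_mono) simp
    qed
    finally show ?thesis by simp
  qed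
  hence "x'^2 \<le> (x + c)^2" using x0 by (intro power_mono) auto
  also have "\<dots> = x^2 + (2 * (c * x) + c^2)" by (simp add: power2_sum)
  also have "\<dots> \<le> x^2 + (2 * (c * s) + c^2)" using x_le c0 by (simp add: mult_left_mono)
  finally have x2: "x'^2 \<le> x^2 + (2 * (c * s) + c^2)" .
  define D where "D = 2 * (c * s) + c^2"
  have D0: "0 \<le> D" using c0 s by (simp add: D_def)
  have "sqrt ((x'^2)^2 + w'^2) \<le> sqrt ((x^2 + D)^2 + (\<bar>w\<bar> + 1)^2)"
  proof (intro real_sqrt_le_mono add_mono)
    show "(x'^2)^2 \<le> (x^2 + D)^2" using x2 by (intro power_mono) (auto simp: D_def)
    have "\<bar>w'\<bar> \<le> \<bar>w\<bar> + 1" using w by linarith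
    hence "\<bar>w'\<bar>\<^sup>2 \<le> (\<bar>w\<bar> + 1)^2" by (intro power_mono) auto
    thus "w'^2 \<le> (\<bar>w\<bar> + 1)^2" by simp
  qed
  also have "\<dots> \<le> sqrt ((x^2)^2 + \<bar>w\<bar>\<^sup>2) + sqrt (D^2 + 1\<^sup>2)" by (rule real_sqrt_sum_squares_triangle_ineq)
  also have "sqrt ((x^2)^2 + \<bar>w\<bar>\<^sup>2) \<le> s^2"
    using xs by (intro real_le_lsqrt) (simp_all flip: power_mult)
  also have "sqrt (D^2 + 1\<^sup>2) \<le> D + 1" using D0 by (intro sqrt_sum_squares_le_sum) auto
  also have "s^2 + (D + 1) \<le> (s + (c + 1))^2" using s c0 by (simp add: D_def power2_eq_square algebra_simps)
  finally have "sqrt ((x'^2)^2 + w'^2) \<le> (s + (c + 1))^2" by simp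
  hence "(x'^2)^2 + w'^2 \<le> ((s + (c + 1))^2)^2" by (rule sqrt_le_D)
  hence "x' ^ 4 + w'^2 \<le> (s + (c + 1)) ^ 4" by (simp flip: power_mult)
  moreover have "0 \<le> s + (c + 1)" using s c0 by simp
  ultimately show ?thesis by (simp only: ck_norm_le_iff c_def[symmetric] x'_def)
qed

section \<open>The volume as a density of lattice points\<close>

text \<open>The unit box at a lattice point, shrunk by the dilation with factor
  \<open>1 / t\<close>. Half-open sides make the boxes a partition, found again by taking
  floors.\<close>

definition cell :: "nat \<Rightarrow> real \<Rightarrow> (nat \<Rightarrow> real) \<times> real \<Rightarrow> ((nat \<Rightarrow> real) \<times> real) set" where
  "cell q t = (\<lambda>(v, w). (\<Pi>\<^sub>E i\<in>{..<2 * q}. {v i / t..<(v i + 1) / t}) \<times> {w / t^2..<(w + 1) / t^2})"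

lemma sets_cell [measurable]: "cell q t p \<in> sets (heis_vol q)"
  unfolding cell_def heis_vol_def by (auto split: prod.split intro!: pair_measureI sets_PiM_I_finite)

lemma emeasure_cell:
  assumes t: "0 < t"
  shows "emeasure (heis_vol q) (cell q t p) = ennreal (1 / t ^ (2 * q + 2))"
proof -
  obtain v w where p: "p = (v, w)" by force
  interpret product_sigma_finite "\<lambda>_::nat. lborel :: real measure" by unfold_locales
  have "emeasure (heis_vol q) (cell q t p)
    = emeasure (\<Pi>\<^sub>M i\<in>{..<2 * q}. lborel) (\<Pi>\<^sub>E i\<in>{..<2 * q}. {v i / t..<(v i + 1) / t}) * emeasure lborel {w / t^2..<(w + 1) / t^2}"
    unfolding heis_vol_def cell_def p prod.case
    by (rule lborel.emeasure_pair_measure_Times) (auto intro!: sets_PiM_I_finite)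
  also have "emeasure (\<Pi>\<^sub>M i\<in>{..<2 * q}. lborel) (\<Pi>\<^sub>E i\<in>{..<2 * q}. {v i / t..<(v i + 1) / t})
     = (\<Prod>i<2 * q. emeasure lborel {v i / t..<(v i + 1) / t})"
    by (rule emeasure_PiM) auto
  also have "\<dots> = (\<Prod>i<2 * q. ennreal (1 / t))"
    using t by (intro prod.cong refl) (simp add: divide_right_mono flip: diff_divide_distrib)
  also have "emeasure lborel {w / t^2..<(w + 1) / t^2} = ennreal (1 / t^2)"
    using t by (simp add: divide_right_mono flip: diff_divide_distrib)
  also have "(\<Prod>i<2 * q. ennreal (1 / t)) * ennreal (1 / t^2) = ennreal (1 / t ^ (2 * q + 2))"
    using t by (simp add: ennreal_power ennreal_mult[symmetric] power_add power_divide power2_eq_square)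
  finally show ?thesis .
qed

lemma mem_cell_iff:
  assumes t: "0 < t" and p: "(v, w) \<in> heis_lattice q" and x: "(x, z) \<in> heis_space q"
  shows "(x, z) \<in> cell q t (v, w) \<longleftrightarrow> (\<forall>i<2 * q. v i = real_of_int \<lfloor>t * x i\<rfloor>) \<and> w = real_of_int \<lfloor>t\<^sup>2 * z\<rfloor>"
proof -
  have int: "a / s \<le> y \<and> y < (a + 1) / s \<longleftrightarrow> a = real_of_int \<lfloor>s * y\<rfloor>" if s: "0 < s" and a: "a \<in> \<int>" for a s y :: real
  proof -
    obtain k where k: "a = real_of_int k" using a by (auto elim: Ints_cases)
    have "a / s \<le> y \<and> y < (a + 1) / s \<longleftrightarrow> real_of_int k \<le> s * y \<and> s * y < real_of_int k + 1"
      using s by (simp add: k field_simps)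
    also have "\<dots> \<longleftrightarrow> \<lfloor>s * y\<rfloor> = k" by (simp add: floor_eq_iff)
    finally show ?thesis by (auto simp: k)
  qed
  have v: "v i \<in> \<int>" if "i < 2 * q" for i using p that by (auto simp: heis_lattice_def)
  have w: "w \<in> \<int>" using p by (auto simp: heis_lattice_def)
  have e: "x \<in> extensional {..<2 * q}" using x by (auto simp: heis_space_def PiE_iff)
  show ?thesis
    using int[OF t v] int[of "t^2", OF _ w] t e by (auto simp: cell_def PiE_iff)
qed

lemma emeasure_cells:
  assumes t: "0 < t" and F: "F \<subseteq> heis_lattice q" "finite F"
  shows "emeasure (heis_vol q) (\<Union>p\<in>F. cell q t p) = ennreal (real (card F) / t ^ (2 * q + 2))"
proof -
  have "disjoint_family_on (cell q t) F"
    unfolding disjoint_family_on_def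
  proof (intro ballI impI, rule ccontr)
    fix p p' assume pp: "p \<in> F" "p' \<in> F" "p \<noteq> p'" "cell q t p \<inter> cell q t p' \<noteq> {}"
    then obtain x z where xz: "(x, z) \<in> cell q t p" "(x, z) \<in> cell q t p'" by auto
    obtain v w v' w' where e: "p = (v, w)" "p' = (v', w')" by force
    have hs: "(x, z) \<in> heis_space q" using xz(1) by (auto simp: e cell_def heis_space_def PiE_iff)
    have L: "(v, w) \<in> heis_lattice q" "(v', w') \<in> heis_lattice q" using F pp e by auto
    have eq: "v i = v' i" if "i < 2 * q" for i
      using xz that mem_cell_iff[OF t L(1) hs] mem_cell_iff[OF t L(2) hs] by (simp add: e)
    have "v = v'"
      using L eq by (intro PiE_ext[of _ "{..<2 * q}" "\<lambda>_. \<int>"]) (auto simp: heis_lattice_def)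
    moreover have "w = w'" using xz mem_cell_iff[OF t L(1) hs] mem_cell_iff[OF t L(2) hs] by (simp add: e)
    ultimately show False using pp e by simp
  qed
  hence "emeasure (heis_vol q) (\<Union>p\<in>F. cell q t p) = (\<Sum>p\<in>F. emeasure (heis_vol q) (cell q t p))"
    using F by (intro sum_emeasure[symmetric]) auto
  also have "\<dots> = ennreal (real (card F) / t ^ (2 * q + 2))"
    using t by (simp add: emeasure_cell ennreal_of_nat_eq_real_of_nat ennreal_mult[symmetric])
  finally show ?thesis .
qed

lemma sets_ck_ball [measurable]: "ck_ball q r \<in> sets (heis_vol q)"
proof -
  have "(\<lambda>p. ck_norm q p) \<in> borel_measurable (heis_vol q)"
    unfolding ck_norm_def heis_vol_def L2_set_def case_prod_beta' by measurable
  hence "{p \<in> space (heis_vol q). ck_norm q p \<le> r} \<in> sets (heis_vol q)" by measurable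
  thus ?thesis by (simp add: ck_ball_def space_heis_vol)
qed

lemma ck_ball_subset_cells:
  assumes t: "0 < t" and r: "0 \<le> r"
  shows "ck_ball q r \<subseteq> (\<Union>p\<in>lattice_ball q (t * r + (sqrt (2 * real q) + 1)). cell q t p)"
proof
  fix p assume p: "p \<in> ck_ball q r"
  obtain x z where xz: "p = (x, z)" by force
  have hs: "(x, z) \<in> heis_space q" using p by (simp add: xz ck_ball_def)
  define v where "v = (\<lambda>i\<in>{..<2 * q}. real_of_int \<lfloor>t * x i\<rfloor>)"
  define w where "w = real_of_int \<lfloor>t\<^sup>2 * z\<rfloor>"
  have L: "(v, w) \<in> heis_lattice q" by (auto simp: heis_lattice_def v_def w_def)
  have "ck_norm q (heis_dilation q t (x, z)) \<le> t * r" using p t by (simp add: ck_norm_dilation xz ck_ball_def)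
  hence "ck_norm q ((\<lambda>i\<in>{..<2 * q}. t * x i), t\<^sup>2 * z) \<le> t * r" by (simp add: heis_dilation_def)
  hence "ck_norm q (v, w) \<le> t * r + (sqrt (2 * real q) + 1)"
    using t r by (intro ck_norm_perturb[where v = "\<lambda>i\<in>{..<2 * q}. t * x i" and w = "t^2 * z"]) (auto simp: v_def w_def abs_le_iff; linarith)+
  moreover have "(v, w) \<in> heis_space q" by (auto simp: heis_space_def v_def)
  moreover have "p \<in> cell q t (v, w)" unfolding xz mem_cell_iff[OF t L hs] by (simp add: v_def w_def)
  ultimately show "p \<in> (\<Union>p\<in>lattice_ball q (t * r + (sqrt (2 * real q) + 1)). cell q t p)"
    using L by (auto simp: ck_ball_def)
qed

lemma cells_subset_ck_ball:
  assumes t: "0 < t"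
  shows "(\<Union>p\<in>lattice_ball q t. cell q t p) \<subseteq> ck_ball q (1 + (sqrt (2 * real q) + 1) / t)"
proof
  fix p assume "p \<in> (\<Union>p\<in>lattice_ball q t. cell q t p)"
  then obtain a where a: "a \<in> heis_lattice q" "a \<in> ck_ball q t" "p \<in> cell q t a" by blast
  obtain v w x z where vx: "a = (v, w)" "p = (x, z)" by force
  have p: "p = (x, z)" "(v, w) \<in> heis_lattice q" "(v, w) \<in> ck_ball q t" "(x, z) \<in> cell q t (v, w)" using a vx by simp_all
  have hs: "(x, z) \<in> heis_space q" using p(4) by (auto simp: cell_def heis_space_def PiE_iff)
  have fl: "v i = real_of_int \<lfloor>t * x i\<rfloor>" if "i < 2 * q" for i using p(4) that unfolding mem_cell_iff[OF t p(2) hs] by blast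
  have flw: "w = real_of_int \<lfloor>t\<^sup>2 * z\<rfloor>" using p(4) unfolding mem_cell_iff[OF t p(2) hs] by blast
  have "t * ck_norm q (x, z) = ck_norm q ((\<lambda>i\<in>{..<2 * q}. t * x i), t\<^sup>2 * z)"
    using ck_norm_dilation[OF t, of q "(x, z)"] by (simp add: heis_dilation_def)
  also have "\<dots> \<le> t + (sqrt (2 * real q) + 1)"
  proof (rule ck_norm_perturb)
    show "ck_norm q (v, w) \<le> t" using p by (simp add: ck_ball_def)
    show "\<bar>(\<lambda>i\<in>{..<2 * q}. t * x i) i - v i\<bar> \<le> 1" if "i < 2 * q" for i
      using that fl[OF that] by (simp add: abs_le_iff) linarith
    show "\<bar>t\<^sup>2 * z - w\<bar> \<le> 1" unfolding flw by linarith
  qed (use t in simp)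
  finally have "ck_norm q (x, z) \<le> 1 + (sqrt (2 * real q) + 1) / t" using t by (simp add: field_simps)
  thus "p \<in> ck_ball q (1 + (sqrt (2 * real q) + 1) / t)" using hs p by (simp add: ck_ball_def)
qed

lemma emeasure_ck_ball_finite: "0 \<le> r \<Longrightarrow> emeasure (heis_vol q) (ck_ball q r) < \<infinity>"
proof -
  assume r: "0 \<le> r"
  define F where "F = lattice_ball q (1 * r + (sqrt (2 * real q) + 1))"
  have F: "finite F" "F \<subseteq> heis_lattice q" unfolding F_def using r by (auto intro!: lattice_count add_nonneg_pos)
  have "emeasure (heis_vol q) (ck_ball q r) \<le> emeasure (heis_vol q) (\<Union>p\<in>F. cell q 1 p)"
    using ck_ball_subset_cells[of 1 r q] r F by (intro emeasure_mono) (auto simp: F_def intro!: sets.finite_UN)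
  also have "\<dots> < \<infinity>" using F by (subst emeasure_cells) auto
  finally show ?thesis .
qed

text \<open>The boxes at lattice points of norm at most \<open>t + c\<close> cover the unit ball,
  and those of norm at most \<open>t\<close> lie in the ball of radius \<open>1 + c / t\<close>. The
  first gives the upper bound in the limit; for the lower one, the closed balls of radius
  \<open>1 + c / n\<close> decrease to the unit ball, and continuity of the measure from above takes
  care of the boundary.\<close>

lemma volume_eq_lattice_density:
  assumes lim: "((\<lambda>t. real (card (lattice_ball q t)) / t ^ (2 * q + 2)) \<longlongrightarrow> A) at_top"
  shows "measure (heis_vol q) (ck_ball q 1) = A"
proof (rule antisym)
  define c where "c = sqrt (2 * real q) + 1"
  have c: "0 < c" by (simp add: c_def add_nonneg_pos)
  define N where "N t = real (card (lattice_ball q t))" for t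
  have fin: "finite (lattice_ball q t)" if "0 < t" for t by (rule lattice_count[OF that])
  have meas: "measure (heis_vol q) (\<Union>p\<in>lattice_ball q s. cell q t p) = N s / t ^ (2 * q + 2)" if "0 < s" "0 < t" for s t
    unfolding measure_def N_def using that fin by (subst emeasure_cells) auto
  show "measure (heis_vol q) (ck_ball q 1) \<le> A"
  proof (rule tendsto_lowerbound)
    have "((\<lambda>t. N (t + c) / (t + c) ^ (2 * q + 2) * ((t + c) / t) ^ (2 * q + 2)) \<longlongrightarrow> A * 1 ^ (2 * q + 2)) at_top"
    proof (intro tendsto_mult tendsto_power)
      show "((\<lambda>t. N (t + c) / (t + c) ^ (2 * q + 2)) \<longlongrightarrow> A) at_top"
        unfolding N_def by (rule filterlim_compose[OF lim]) (rule filterlim_at_top_mono[OF filterlim_ident], use c in \<open>auto simp: eventually_at_top_linorder\<close>)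
      have "((\<lambda>t. 1 + c / t) \<longlongrightarrow> 1 + 0) at_top" by (intro tendsto_intros tendsto_divide_0[OF tendsto_const] filterlim_at_top_imp_at_infinity filterlim_ident)
      moreover have "eventually (\<lambda>t. 1 + c / t = (t + c) / t) at_top" using eventually_gt_at_top[of 0] by eventually_elim (simp add: field_simps)
      ultimately show "((\<lambda>t. (t + c) / t) \<longlongrightarrow> 1) at_top" by (simp add: filterlim_cong)
    qed
    thus "((\<lambda>t. N (t + c) / (t + c) ^ (2 * q + 2) * ((t + c) / t) ^ (2 * q + 2)) \<longlongrightarrow> A) at_top" by simp
    show "eventually (\<lambda>t. measure (heis_vol q) (ck_ball q 1) \<le> N (t + c) / (t + c) ^ (2 * q + 2) * ((t + c) / t) ^ (2 * q + 2)) at_top"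
      using eventually_gt_at_top[of 0]
    proof eventually_elim
      case (elim t)
      have "measure (heis_vol q) (ck_ball q 1) \<le> measure (heis_vol q) (\<Union>p\<in>lattice_ball q (t + c). cell q t p)"
      proof (rule measure_mono_fmeasurable)
        show "ck_ball q 1 \<subseteq> (\<Union>p\<in>lattice_ball q (t + c). cell q t p)"
          using ck_ball_subset_cells[of t 1 q] elim by (simp add: c_def)
        show "(\<Union>p\<in>lattice_ball q (t + c). cell q t p) \<in> fmeasurable (heis_vol q)"
          using elim c fin[of "t + c"] by (intro fmeasurableI) (auto simp: emeasure_cells intro!: sets.finite_UN)
      qed simp
      also have "\<dots> = N (t + c) / t ^ (2 * q + 2)" using elim c by (intro meas) auto
      also have "\<dots> = N (t + c) / (t + c) ^ (2 * q + 2) * ((t + c) / t) ^ (2 * q + 2)"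
        using elim c by (simp add: power_divide del: power_Suc)
      finally show ?case .
    qed
  qed simp
  show "A \<le> measure (heis_vol q) (ck_ball q 1)"
  proof (rule tendsto_le)
    have fs: "filterlim (\<lambda>n. real (Suc n)) at_top sequentially"
      by (rule filterlim_compose[OF filterlim_real_sequentially filterlim_Suc])
    show "(\<lambda>n. N (real (Suc n)) / real (Suc n) ^ (2 * q + 2)) \<longlonglongrightarrow> A"
      unfolding N_def by (rule filterlim_compose[OF lim fs])
    have "(\<lambda>n. measure (heis_vol q) (ck_ball q (1 + c / real (Suc n)))) \<longlonglongrightarrow> measure (heis_vol q) (\<Inter>n. ck_ball q (1 + c / real (Suc n)))"
    proof (rule Lim_measure_decseq)
      show "range (\<lambda>n. ck_ball q (1 + c / real (Suc n))) \<subseteq> sets (heis_vol q)" by auto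
      show "decseq (\<lambda>n. ck_ball q (1 + c / real (Suc n)))"
      proof (rule decseq_SucI, rule subsetI)
        fix n p assume "p \<in> ck_ball q (1 + c / real (Suc (Suc n)))"
        moreover have "c / real (Suc (Suc n)) \<le> c / real (Suc n)" using c by (intro divide_left_mono) auto
        ultimately show "p \<in> ck_ball q (1 + c / real (Suc n))" by (simp add: ck_ball_def)
      qed
      show "emeasure (heis_vol q) (ck_ball q (1 + c / real (Suc n))) \<noteq> \<infinity>" for n
        using emeasure_ck_ball_finite[of "1 + c / real (Suc n)" q] c by simp
    qed
    moreover have "(\<Inter>n. ck_ball q (1 + c / real (Suc n))) = ck_ball q 1"
    proof (intro equalityI subsetI)
      fix p assume p: "p \<in> (\<Inter>n. ck_ball q (1 + c / real (Suc n)))"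
      have "(\<lambda>n. 1 + c / real (Suc n)) \<longlonglongrightarrow> 1 + 0"
        by (intro tendsto_intros tendsto_divide_0[OF tendsto_const] filterlim_at_top_imp_at_infinity fs)
      hence "ck_norm q p \<le> 1 + 0" by (rule LIMSEQ_le_const) (use p in \<open>auto simp: ck_ball_def\<close>)
      moreover have "p \<in> heis_space q" using p by (auto simp: ck_ball_def)
      ultimately show "p \<in> ck_ball q 1" by (simp add: ck_ball_def)
    next
      fix p assume "p \<in> ck_ball q 1"
      moreover have "0 \<le> c / real (Suc n)" for n using c by simp
      ultimately show "p \<in> (\<Inter>n. ck_ball q (1 + c / real (Suc n)))" by (auto simp: ck_ball_def intro: order.trans)
    qed
    ultimately show "(\<lambda>n. measure (heis_vol q) (ck_ball q (1 + c / real (Suc n)))) \<longlonglongrightarrow> measure (heis_vol q) (ck_ball q 1)" by simp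
    show "eventually (\<lambda>n. N (real (Suc n)) / real (Suc n) ^ (2 * q + 2) \<le> measure (heis_vol q) (ck_ball q (1 + c / real (Suc n)))) sequentially"
    proof (intro always_eventually allI)
      fix n
      have "N (real (Suc n)) / real (Suc n) ^ (2 * q + 2) = measure (heis_vol q) (\<Union>p\<in>lattice_ball q (real (Suc n)). cell q (real (Suc n)) p)"
        by (rule meas[symmetric]) auto
      also have "\<dots> \<le> measure (heis_vol q) (ck_ball q (1 + c / real (Suc n)))"
      proof (rule measure_mono_fmeasurable)
        show "(\<Union>p\<in>lattice_ball q (real (Suc n)). cell q (real (Suc n)) p) \<subseteq> ck_ball q (1 + c / real (Suc n))"
          unfolding c_def by (rule cells_subset_ck_ball) simp
        show "(\<Union>p\<in>lattice_ball q (real (Suc n)). cell q (real (Suc n)) p) \<in> sets (heis_vol q)"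
          using fin[of "real (Suc n)"] by (intro sets.finite_UN) auto
        show "ck_ball q (1 + c / real (Suc n)) \<in> fmeasurable (heis_vol q)"
          using c by (intro fmeasurableI emeasure_ck_ball_finite) auto
      qed
      finally show "N (real (Suc n)) / real (Suc n) ^ (2 * q + 2) \<le> measure (heis_vol q) (ck_ball q (1 + c / real (Suc n)))" .
    qed
  qed simp
qed

theorem theorem1p2:
  fixes q :: nat
  assumes "q \<ge> 3"
  shows "\<exists>C::real. C > 0 \<and> (\<forall>t::real. t \<ge> 10 \<longrightarrow>
           \<bar>ck_error q t\<bar> \<le>
             C * (if q \<ge> 4 then t powr (2 * real q - 2 + 994 / 753)
                  else t powr (16 / 3) * ln t))"
proof -
  define e where "e = 2 * real q - 2 + 994 / 753"
  obtain A C where C: "0 \<le> C" and count: "\<And>t. 2 \<le> t \<Longrightarrow> \<bar>real (card (lattice_ball q t)) - A * t ^ (2 * q + 2)\<bar> \<le> C * t powr e"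
    using lattice_count_asymptotic[OF assms] unfolding e_def by auto
  \<comment> \<open>The error exponent is smaller than \<open>2 * q + 2\<close> by
    \<open>4 - 994/753 > 0\<close>, so the count has density \<open>A\<close>; this identifies
    \<open>A\<close> with the volume.\<close>
  have "((\<lambda>t. real (card (lattice_ball q t)) / t ^ (2 * q + 2)) \<longlongrightarrow> A) at_top"
  proof (rule Lim_transform2)
    show "((\<lambda>t. A) \<longlongrightarrow> A) (at_top :: real filter)" by simp
    show "((\<lambda>t. A - real (card (lattice_ball q t)) / t ^ (2 * q + 2)) \<longlongrightarrow> 0) at_top"
    proof (rule Lim_null_comparison)
      show "((\<lambda>t. C * t powr - (4 - 994 / 753)) \<longlongrightarrow> 0) at_top"
        by (intro tendsto_mult_right_zero tendsto_neg_powr filterlim_ident) auto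
      show "eventually (\<lambda>t. norm (A - real (card (lattice_ball q t)) / t ^ (2 * q + 2)) \<le> C * t powr - (4 - 994 / 753)) at_top"
        using eventually_ge_at_top[of 2]
      proof eventually_elim
        case (elim t)
        define P where "P = t ^ (2 * q + 2)"
        have P: "0 < P" "P = t powr (2 * real q + 2)" using elim by (auto simp: P_def powr_realpow[symmetric] add.commute simp del: power_Suc)
        have "norm (A - real (card (lattice_ball q t)) / P) = \<bar>real (card (lattice_ball q t)) - A * P\<bar> / P"
        proof -
          have "A - real (card (lattice_ball q t)) / P = - ((real (card (lattice_ball q t)) - A * P) / P)"
            using P(1) by (simp add: diff_divide_distrib)
          thus ?thesis using P(1) by (simp only: real_norm_def abs_minus_cancel abs_divide abs_of_pos)
        qed
        also have "\<dots> \<le> C * t powr e / P" using count[OF elim] P(1) by (intro divide_right_mono) (auto simp: P_def)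
        also have "\<dots> = C * t powr - (4 - 994 / 753)"
        proof -
          have "t powr e / P = t powr (e - (2 * real q + 2))" unfolding P(2) by (rule powr_diff[symmetric])
          also have "e - (2 * real q + 2) = - (4 - 994 / 753)" by (simp add: e_def)
          finally show ?thesis by (simp only: times_divide_eq_right[symmetric])
        qed
        finally show ?case by (simp only: P_def)
      qed
    qed
  qed
  hence vol: "measure (heis_vol q) (ck_ball q 1) = A" by (rule volume_eq_lattice_density)
  have main: "\<bar>ck_error q t\<bar> \<le> (C + 1) * (if q \<ge> 4 then t powr (2 * real q - 2 + 994 / 753) else t powr (16 / 3) * ln t)"
    if t: "10 \<le> t" for t
  proof -
    have "\<bar>ck_error q t\<bar> \<le> C * t powr e" unfolding ck_error_def vol using t by (intro count) auto
    also have "\<dots> \<le> (C + 1) * t powr e" by (intro mult_right_mono) auto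
    also have "\<dots> \<le> (C + 1) * (if q \<ge> 4 then t powr (2 * real q - 2 + 994 / 753) else t powr (16 / 3) * ln t)"
    proof (intro mult_left_mono)
      show "t powr e \<le> (if q \<ge> 4 then t powr (2 * real q - 2 + 994 / 753) else t powr (16 / 3) * ln t)"
      proof (cases "4 \<le> q")
        case False
        hence "q = 3" using assms by simp
        \<comment> \<open>For \<open>q = 3\<close> the exponent \<open>4 + 994/753\<close> is below
          \<open>16/3\<close>, and \<open>t \<ge> 10\<close> makes the logarithm at least 1, so the
          general bound suffices.\<close>
        have "exp 1 \<le> t" using exp_le t by linarith
        hence "1 \<le> ln t" using t by (simp add: ln_ge_iff)
        have "t powr e \<le> t powr (16 / 3) * 1" using t by (simp add: e_def \<open>q = 3\<close> powr_mono)
        also have "\<dots> \<le> t powr (16 / 3) * ln t" using \<open>1 \<le> ln t\<close> by (intro mult_left_mono) auto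
        finally show ?thesis using False by simp
      qed (simp add: e_def)
    qed (use C in simp)
    finally show ?thesis .
  qed
  show ?thesis using C by (intro exI[of _ "C + 1"] conjI allI impI main) auto
qed

end
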